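(* Let $n\ge 2$ be an integer, let $f,g\in H^{\odot n}$, and put $F=I_n(f)$, $G=I_n(g)$. Let $\Lambda^{(s)}$ denote the $s$th iterated Malliavin matrix of $(F,G)$ and let $C$ be the covariance matrix of $(F,G)$. Then $$\sum_{s=2}^{\left[\frac{n-1}{2}\right]}\frac{n(n-2s)}{(s!)^2}\,E\det\Lambda^{(s)}+(n-1)^2\,E\det\Lambda^{(1)}\ \ge\ n^2\det C,$$ where $[x]$ is the integer part of $x$ and the sum is empty (equal to $0$) if $\left[\frac{n-1}{2}\right]<2$.
   Context: $H$ is a real separable Hilbert space and $W=(W(h),h\in H)$ is an isonormal Gaussian process over $H$ on a probability space $(\Omega,\mathcal F,P)$ with $\mathcal F$ generated by $W$: a centered Gaussian family with $E[W(h)W(g)]=\langle h,g\rangle_H$. $H^{\odot n}$ is the $n$th symmetric tensor product of $H$. $I_n(f)$, for $f\in H^{\odot n}$, is the multiple Wiener–Itô integral of order $n$ with respect to $W$, normalized so that $I_n(h^{\otimes n})=H_n(W(h))$ for $\|h\|_H=1$ (with $H_n$ the monic Hermite polynomial) and $E[I_n(f)^2]=n!\,\|f\|^2_{H^{\otimes n}}$. $D^{(k)}$ is the $k$th iterated Malliavin derivative with respect to $W$, so $D^{(k)}F$ is an $H^{\odot k}$-valued random element. The $k$th iterated Malliavin matrix of $(F,G)$, $k\ge1$, is $$\Lambda^{(k)}=\begin{pmatrix}\|D^{(k)}F\|^2_{H^{\otimes k}}&\langle D^{(k)}F,D^{(k)}G\rangle_{H^{\otimes k}}\\ \langle D^{(k)}F,D^{(k)}G\rangle_{H^{\otimes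 k}}&\|D^{(k)}G\|^2_{H^{\otimes k}}\end{pmatrix}.$$ For $F=I_n(f)$, $G=I_n(g)$ one has $\det C=(n!)^2\left(\|f\|^2\|g\|^2-\langle f,g\rangle^2\right)$. *)

theory Defs
  imports "HOL-Probability.Probability"
begin

section \<open>Orthonormal bases of a separable Hilbert space\<close>

definition orthonormal_basis :: "'h::real_inner set \<Rightarrow> bool" where
  "orthonormal_basis B \<longleftrightarrow>
     pairwise orthogonal B \<and> (\<forall>b\<in>B. norm b = 1) \<and> closure (span B) = UNIV"

lemma finite_orthonormal_extend:
  fixes B :: "'h::real_inner set"
  assumes "finite B" "pairwise orthogonal B" "\<forall>b\<in>B. norm b = 1"
  shows "\<exists>C. finite C \<and> pairwise orthogonal C \<and> (\<forall>b\<in>C. norm b = 1) \<and> B \<subseteq> C \<and> d \<in> span C"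
proof -
  define r where "r = d - (\<Sum>b\<in>B. (b \<bullet> d) *\<^sub>R b)"
  have d: "d = r + (\<Sum>b\<in>B. (b \<bullet> d) *\<^sub>R b)" by (simp add: r_def)
  have orth: "b \<bullet> r = 0" if "b \<in> B" for b
  proof -
    have "b \<bullet> (\<Sum>c\<in>B. (c \<bullet> d) *\<^sub>R c) = (\<Sum>c\<in>B. (c \<bullet> d) * (b \<bullet> c))"
      by (simp add: inner_sum_right)
    also have "\<dots> = (\<Sum>c\<in>B. if c = b then b \<bullet> d else 0)"
      using that assms
      by (intro sum.cong) (auto simp: pairwise_def orthogonal_def norm_eq_1)
    also have "\<dots> = b \<bullet> d" using that assms(1) by simp
    finally show ?thesis by (simp add: r_def inner_diff_right)
  qed
  have inB: "(\<Sum>b\<in>B. (b \<bullet> d) *\<^sub>R b) \<in> span B"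
    by (intro span_sum span_scale span_base)
  show ?thesis
  proof (cases "r = 0")
    case True
    then show ?thesis using assms inB d by (intro exI[of _ B]) auto
  next
    case False
    define e where "e = (1 / norm r) *\<^sub>R r"
    have "norm e = 1" using False by (simp add: e_def)
    have "b \<bullet> e = 0" if "b \<in> B" for b using orth[OF that] by (simp add: e_def)
    then have "pairwise orthogonal (insert e B)"
      using assms(2) by (auto simp: pairwise_insert orthogonal_def inner_commute)
    moreover have "d \<in> span (insert e B)"
    proof -
      have "r = norm r *\<^sub>R e" using False by (simp add: e_def)
      then have "r \<in> span (insert e B)"
        by (metis span_scale span_base insertI1)
      moreover have "(\<Sum>b\<in>B. (b \<bullet> d) *\<^sub>R b) \<in> span (insert e B)"
        using inB span_mono[of B "insert e B"] by auto
      ultimately show ?thesis using d span_add by metis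
    qed
    ultimately show ?thesis using assms \<open>norm e = 1\<close>
      by (intro exI[of _ "insert e B"]) auto
  qed
qed

lemma orthonormal_basis_exists:
  "\<exists>B :: 'h::{real_inner, second_countable_topology} set. countable B \<and> orthonormal_basis B"
proof -
  obtain D :: "'h set" where D: "countable D" "\<And>X. open X \<Longrightarrow> X \<noteq> {} \<Longrightarrow> \<exists>d\<in>D. d \<in> X"
    using countable_dense_exists[where ?'a = 'h] by auto
  have "D \<noteq> {}" using D(2)[of UNIV] by auto
  define d where "d = from_nat_into D"
  have ran: "range d = D" using D(1) \<open>D \<noteq> {}\<close> by (simp add: d_def)
  define P where "P C \<longleftrightarrow> finite C \<and> pairwise orthogonal C \<and> (\<forall>b\<in>C. norm b = 1)"
    for C :: "'h set"
  have step: "\<exists>C'. P C' \<and> C \<subseteq> C' \<and> d n \<in> span C'" if "P C" for C n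
    using finite_orthonormal_extend[of C "d n"] that by (auto simp: P_def)
  have "\<exists>B. \<forall>n. P (B n) \<and> (B n \<subseteq> B (Suc n) \<and> d n \<in> span (B (Suc n)))"
    using step by (intro dependent_nat_choice) (auto simp: P_def intro: exI[of _ "{}"])
  then obtain B where B: "\<And>n. P (B n)" "\<And>n. B n \<subseteq> B (Suc n)" "\<And>n. d n \<in> span (B (Suc n))"
    by blast
  have mono: "B m \<subseteq> B n" if "m \<le> n" for m n using B(2) that by (rule lift_Suc_mono_le)
  define U where "U = (\<Union>n. B n)"
  have "countable U" using B(1) by (auto simp: U_def P_def intro: countable_finite)
  moreover have "pairwise orthogonal U"
  proof (rule pairwiseI)
    fix x y assume "x \<in> U" "y \<in> U" "x \<noteq> y"
    then obtain m n where "x \<in> B m" "y \<in> B n" by (auto simp: U_def)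
    then have "x \<in> B (max m n)" "y \<in> B (max m n)"
      using mono[of m "max m n"] mono[of n "max m n"] by auto
    then show "orthogonal x y" using B(1)[of "max m n"] \<open>x \<noteq> y\<close>
      by (auto simp: P_def pairwise_def)
  qed
  moreover have "\<forall>b\<in>U. norm b = 1" using B(1) by (auto simp: U_def P_def)
  moreover have "closure (span U) = UNIV"
  proof -
    have "d n \<in> span U" for n
      using B(3)[of n] span_mono[of "B (Suc n)" U] by (auto simp: U_def)
    then have "D \<subseteq> span U" using ran by auto
    moreover have "closure D = UNIV"
    proof -
      have "x \<in> closure D" for x
        unfolding closure_iff_nhds_not_empty using D(2) by (metis disjoint_iff subsetD empty_iff)
      then show ?thesis by auto
    qed
    ultimately show ?thesis using closure_mono by blast
  qed
  ultimately show ?thesis unfolding orthonormal_basis_def by blast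
qed

definition hbasis :: "'h::{real_inner, polish_space} set" where
  "hbasis = (SOME B. orthonormal_basis B)"

lemma orthonormal_basis_hbasis: "orthonormal_basis hbasis"
  unfolding hbasis_def using orthonormal_basis_exists by (metis someI_ex)


section \<open>Hilbert tensor powers\<close>

text \<open>
  The Hilbert space tensor power of order \<open>k\<close> is realised as the space of bounded \<open>k\<close>-linear
  forms of Hilbert--Schmidt type, the elementary tensor of \<open>h\<^sub>1, \<dots>, h\<^sub>k\<close> being the form
  that maps \<open>u\<^sub>1, \<dots>, u\<^sub>k\<close> to the product of the \<open>h\<^sub>i \<bullet> u\<^sub>i\<close>. A form takes its
  arguments as a list of length \<open>k\<close> and vanishes, by convention, on lists of any other length.
  Neither the Hilbert--Schmidt condition nor the inner product depends on the orthonormal basis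
  used to write them down.
\<close>

type_synonym 'h tensor = "'h list \<Rightarrow> real"

definition basis_lists :: "nat \<Rightarrow> 'h::{real_inner, polish_space} list set" where
  "basis_lists k = {es. length es = k \<and> set es \<subseteq> hbasis}"

definition tensor_power :: "nat \<Rightarrow> 'h::{real_inner, polish_space} tensor set" where
  "tensor_power k = {f.
     (\<forall>us. length us \<noteq> k \<longrightarrow> f us = 0) \<and>
     (\<forall>us i. length us = k \<and> i < k \<longrightarrow> bounded_linear (\<lambda>u. f (us[i := u]))) \<and>
     (\<lambda>es. (f es)\<^sup>2) summable_on basis_lists k}"

definition sym_tensor_power :: "nat \<Rightarrow> 'h::{real_inner, polish_space} tensor set" where
  "sym_tensor_power k =
     {f \<in> tensor_power k. \<forall>us vs. mset us = mset vs \<longrightarrow> f us = f vs}"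

definition tensor_inner ::
    "nat \<Rightarrow> 'h::{real_inner, polish_space} tensor \<Rightarrow> 'h tensor \<Rightarrow> real" where
  "tensor_inner k f g = (\<Sum>\<^sub>\<infinity>es\<in>basis_lists k. f es * g es)"

definition tensor_norm :: "nat \<Rightarrow> 'h::{real_inner, polish_space} tensor \<Rightarrow> real" where
  "tensor_norm k f = sqrt (tensor_inner k f f)"

definition elem_tensor :: "'h::real_inner list \<Rightarrow> 'h tensor" where
  "elem_tensor hs us =
     (if length us = length hs then \<Prod>i<length hs. (hs ! i) \<bullet> (us ! i) else 0)"


section \<open>Isonormal Gaussian processes\<close>

text \<open>The degenerate Gaussian variable of variance zero is included.\<close>

definition centered_gaussian :: "'w measure \<Rightarrow> ('w \<Rightarrow> real) \<Rightarrow> bool" where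
  "centered_gaussian M X \<longleftrightarrow> X \<in> borel_measurable M \<and>
     ((AE \<omega> in M. X \<omega> = 0) \<or> (\<exists>\<sigma>>0. distributed M lborel X (normal_density 0 \<sigma>)))"

locale isonormal_gaussian_process = prob_space M
  for M :: "'w measure" and W :: "'h::{real_inner, polish_space} \<Rightarrow> 'w \<Rightarrow> real" +
  assumes gaussian_family:
      "\<And>S c. finite S \<Longrightarrow> centered_gaussian M (\<lambda>\<omega>. \<Sum>h\<in>S. c h * W h \<omega>)"
    and covariance: "\<And>h g. expectation (\<lambda>\<omega>. W h \<omega> * W g \<omega>) = h \<bullet> g"
    and generated:
      "sets M = sigma_sets (space M) {W h -` A \<inter> space M | h A. A \<in> sets borel}"


section \<open>Multiple Wiener--Ito integrals\<close>

fun hermite :: "nat \<Rightarrow> real \<Rightarrow> real" where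
  "hermite 0 x = 1"
| "hermite (Suc 0) x = x"
| "hermite (Suc (Suc n)) x = x * hermite (Suc n) x - real (Suc n) * hermite n x"

text \<open>
  The integral of order \<open>n\<close> is the continuous linear extension to all symmetric tensors, with
  values in the square integrable random variables, of the map sending the \<open>n\<close>-th tensor power
  of a unit vector \<open>h\<close> to the Hermite polynomial of \<open>W h\<close>. It is determined up to almost sure
  equality, and \<open>wiener_integral\<close> selects one version. Convergence is expressed with the
  nonnegative integral, so no integrability side conditions are needed.
\<close>

definition is_wiener_integral ::
    "'w measure \<Rightarrow> ('h::{real_inner, polish_space} \<Rightarrow> 'w \<Rightarrow> real) \<Rightarrow> nat \<Rightarrow> 'h tensor \<Rightarrow>
     ('w \<Rightarrow> real) \<Rightarrow> bool" where
  "is_wiener_integral M W n f X \<longleftrightarrow> X \<in> borel_measurable M \<and>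
     (\<exists>(S :: nat \<Rightarrow> 'h set) (c :: nat \<Rightarrow> 'h \<Rightarrow> real).
        (\<forall>j. finite (S j) \<and> (\<forall>h\<in>S j. norm h = 1)) \<and>
        (\<lambda>j. tensor_norm n
           (\<lambda>us. (\<Sum>h\<in>S j. c j h * elem_tensor (replicate n h) us) - f us)) \<longlonglongrightarrow> 0 \<and>
        (\<lambda>j. \<integral>\<^sup>+\<omega>. ennreal (((\<Sum>h\<in>S j. c j h * hermite n (W h \<omega>)) - X \<omega>)\<^sup>2) \<partial>M) \<longlonglongrightarrow> 0)"

definition wiener_integral ::
    "'w measure \<Rightarrow> ('h::{real_inner, polish_space} \<Rightarrow> 'w \<Rightarrow> real) \<Rightarrow> nat \<Rightarrow> 'h tensor \<Rightarrow>
     'w \<Rightarrow> real" where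
  "wiener_integral M W n f = (SOME X. is_wiener_integral M W n f X)"


section \<open>Iterated Malliavin derivatives\<close>

text \<open>
  A function of \<open>m\<close> real variables is represented as a function on real sequences that depends
  only on the coordinates below \<open>m\<close>.
\<close>

definition partial_deriv :: "nat \<Rightarrow> ((nat \<Rightarrow> real) \<Rightarrow> real) \<Rightarrow> (nat \<Rightarrow> real) \<Rightarrow> real" where
  "partial_deriv i \<phi> x = deriv (\<lambda>t. \<phi> (x(i := t))) (x i)"

definition iter_partial :: "nat list \<Rightarrow> ((nat \<Rightarrow> real) \<Rightarrow> real) \<Rightarrow> (nat \<Rightarrow> real) \<Rightarrow> real" where
  "iter_partial is \<phi> = foldr partial_deriv is \<phi>"

text \<open>Infinitely differentiable, with all partial derivatives of at most polynomial growth.\<close>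

definition smooth_poly_growth :: "nat \<Rightarrow> ((nat \<Rightarrow> real) \<Rightarrow> real) \<Rightarrow> bool" where
  "smooth_poly_growth m \<phi> \<longleftrightarrow>
     (\<forall>x y. (\<forall>i<m. x i = y i) \<longrightarrow> \<phi> x = \<phi> y) \<and>
     (\<forall>is. set is \<subseteq> {..<m} \<longrightarrow>
        continuous_on UNIV (iter_partial is \<phi>) \<and>
        (\<forall>x. \<forall>i<m. (\<lambda>t. iter_partial is \<phi> (x(i := t))) differentiable at (x i)) \<and>
        (\<exists>K N. \<forall>x. \<bar>iter_partial is \<phi> x\<bar> \<le> K * (1 + (\<Sum>i<m. \<bar>x i\<bar>)) ^ N))"

text \<open>
  The \<open>k\<close>-th derivative of the cylindrical variable \<open>\<phi> (W (h 0), \<dots>, W (h (m - 1)))\<close>; for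
  \<open>k = 0\<close> this is the variable itself, seen as a tensor of order zero.
\<close>

definition cylinder_deriv ::
    "('h::real_inner \<Rightarrow> 'w \<Rightarrow> real) \<Rightarrow> nat \<Rightarrow> nat \<Rightarrow> ((nat \<Rightarrow> real) \<Rightarrow> real) \<Rightarrow> (nat \<Rightarrow> 'h) \<Rightarrow>
     'w \<Rightarrow> 'h tensor" where
  "cylinder_deriv W k m \<phi> h \<omega> us =
     (\<Sum>is | length is = k \<and> set is \<subseteq> {..<m}.
        iter_partial is \<phi> (\<lambda>i. W (h i) \<omega>) * elem_tensor (map h is) us)"

text \<open>Measurability of tensor-valued maps is weak measurability; the target is separable.\<close>

definition tensor_random_element ::
    "'w measure \<Rightarrow> nat \<Rightarrow> ('w \<Rightarrow> 'h::{real_inner, polish_space} tensor) \<Rightarrow> bool" where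
  "tensor_random_element M k U \<longleftrightarrow>
     (\<forall>\<omega>\<in>space M. U \<omega> \<in> tensor_power k) \<and> (\<forall>us. (\<lambda>\<omega>. U \<omega> us) \<in> borel_measurable M)"

text \<open>
  The derivative is extended from cylindrical variables by closing it in the norm that controls
  the square integral of the variable and of its derivatives up to order \<open>k\<close>. The sequence \<open>V\<close>
  collects these derivatives, \<open>V 0\<close> being the variable itself.
\<close>

definition is_malliavin_deriv ::
    "'w measure \<Rightarrow> ('h::{real_inner, polish_space} \<Rightarrow> 'w \<Rightarrow> real) \<Rightarrow> nat \<Rightarrow> ('w \<Rightarrow> real) \<Rightarrow>
     ('w \<Rightarrow> 'h tensor) \<Rightarrow> bool" where
  "is_malliavin_deriv M W k F U \<longleftrightarrow>
     (\<exists>(m :: nat \<Rightarrow> nat) \<phi> (h :: nat \<Rightarrow> nat \<Rightarrow> 'h) V.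
        (\<forall>j. smooth_poly_growth (m j) (\<phi> j)) \<and>
        V 0 = (\<lambda>\<omega> us. if us = [] then F \<omega> else 0) \<and> V k = U \<and>
        (\<forall>i\<le>k. tensor_random_element M i (V i) \<and>
           (\<lambda>j. \<integral>\<^sup>+\<omega>. ennreal ((tensor_norm i
              (\<lambda>us. cylinder_deriv W i (m j) (\<phi> j) (h j) \<omega> us - V i \<omega> us))\<^sup>2) \<partial>M) \<longlonglongrightarrow> 0))"

definition malliavin_deriv ::
    "'w measure \<Rightarrow> ('h::{real_inner, polish_space} \<Rightarrow> 'w \<Rightarrow> real) \<Rightarrow> nat \<Rightarrow> ('w \<Rightarrow> real) \<Rightarrow>
     'w \<Rightarrow> 'h tensor" where
  "malliavin_deriv M W k F = (SOME U. is_malliavin_deriv M W k F U)"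

definition malliavin_matrix ::
    "'w measure \<Rightarrow> ('h::{real_inner, polish_space} \<Rightarrow> 'w \<Rightarrow> real) \<Rightarrow> nat \<Rightarrow> ('w \<Rightarrow> real) \<Rightarrow>
     ('w \<Rightarrow> real) \<Rightarrow> 'w \<Rightarrow> real^2^2" where
  "malliavin_matrix M W k F G \<omega> =
     (let DF = malliavin_deriv M W k F \<omega>; DG = malliavin_deriv M W k G \<omega> in
      vector [vector [(tensor_norm k DF)\<^sup>2, tensor_inner k DF DG],
              vector [tensor_inner k DF DG, (tensor_norm k DG)\<^sup>2]])"


section \<open>Covariance matrix\<close>

definition cov :: "'w measure \<Rightarrow> ('w \<Rightarrow> real) \<Rightarrow> ('w \<Rightarrow> real) \<Rightarrow> real" where
  "cov M X Y = (\<integral>\<omega>. (X \<omega> - (\<integral>\<omega>'. X \<omega>' \<partial>M)) * (Y \<omega> - (\<integral>\<omega>'. Y \<omega>' \<partial>M)) \<partial>M)"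

definition covariance_matrix :: "'w measure \<Rightarrow> ('w \<Rightarrow> real) \<Rightarrow> ('w \<Rightarrow> real) \<Rightarrow> real^2^2" where
  "covariance_matrix M X Y =
     vector [vector [cov M X X, cov M X Y], vector [cov M Y X, cov M Y Y]]"

end

theory Submission
  imports Defs "HOL-Computational_Algebra.Polynomial"
begin

text \<open>
  By approximation one may take \<open>f\<close> and \<open>g\<close> to be finite combinations of powers \<open>h^n\<close> of unit vectors
  with coefficients \<open>c h\<close> and \<open>d h\<close>. Put \<open>a (h, g) = c h * d g - c g * d h\<close>, and for pairs of vectors
  \<open>(h, g)\<close>, \<open>(h', g')\<close> let \<open>X = \<langle>h, h'\<rangle> * \<langle>g, g'\<rangle>\<close>, \<open>Y = \<langle>h, g'\<rangle> * \<langle>g, h'\<rangle>\<close>, \<open>Z = \<langle>h, g\<rangle> * \<langle>h', g'\<rangle>\<close>.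
  The expected determinant of the \<open>s\<close>-th Malliavin matrix is a quadratic form in \<open>a\<close>, with kernel \<open>X^s\<close>
  times the mean of a product of four Hermite polynomials of degree \<open>n - s\<close>. The chaos expansion of the product of
  two Hermite polynomials splits this kernel into positive semidefinite parts. Write
  \<open>(n - 1)^2 = 1 + n * (n - 2)\<close>: in one copy of the term \<open>s = 1\<close> keep only the part of the highest order,
  in the \<open>n * (n - 2)\<close> remaining copies and in the terms \<open>s \<ge> 2\<close> only the constant part, which is a multiple of
  \<open>T (n - s)\<close>, where \<open>T b \<ge> 0\<close> is half the form with kernel \<open>X^(n - b) * Z^b\<close>. Since \<open>a\<close> is alternating,
  half the form with kernel \<open>X^(n - b) * Y^b\<close> equals \<open>T b - T (n - b)\<close>, so the highest part for \<open>s = 1\<close> is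
  the sum over \<open>b < n / 2\<close> of \<open>(n!)^2 * n * (n - 2 * b) * (n choose b)^2 * (T b - T (n - b))\<close>. The form
  \<open>T 0 - T n\<close> gives \<open>n^2\<close> times the determinant of the covariance matrix, and every \<open>T (n - b)\<close>
  with \<open>b \<ge> 1\<close> is absorbed by the constant part for \<open>s = b\<close>.

  The determinants of the approximating elements converge because the same positivity bounds fourth moments of the derivatives by
  the norms in the tensor powers, and because the iterated derivatives are closable.
\<close>

subsection \<open>Fourier uniqueness and mean square completeness\<close>

text \<open>The weights are forced by the comparison. The form with kernel X^i * Y^(n - i) changes
  sign under i -> n - i, so in the highest part the factor i^2 may be replaced by (i^2 - (n - i)^2)
  / 2 = n * (2 * i - n) / 2; this is where n * (n - 2 * b) comes from. Dividing the constant part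
  for s = b by (b!)^2 turns its coefficient (n!)^4 / ((n - b)!)^2 into (n!)^2 * (n choose b)^2,
  exactly the coefficient of the term to be absorbed.

  Two obstacles shape the rest. Integral and derivative are choices among versions: a chosen
  integral brings its approximating sums along, but the chosen derivative may stem from unrelated
  cylindrical variables, so uniqueness of the limit has to be proved, which uses that W generates
  the sigma-algebra. And the determinants have degree four in the derivatives, so mean square
  convergence is not enough; fourth moments are controlled by comparing contractions instead of by
  hypercontractivity. All mixed Gaussian moments come from one source, integration by parts.\<close>

text \<open>Levy's uniqueness theorem after normalisation: the cosine hypothesis at t = 0 equates
  the total masses, and mass zero is treated apart because it cannot be normalised.\<close>

lemma finite_measure_eqI_cos_sin:
  fixes \<mu> \<nu> :: "real measure"
  assumes "finite_measure \<mu>" "finite_measure \<nu>" "sets \<mu> = sets borel" "sets \<nu> = sets borel"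
    and c: "\<And>t. (\<integral>x. cos (t * x) \<partial>\<mu>) = (\<integral>x. cos (t * x) \<partial>\<nu>)"
    and s: "\<And>t. (\<integral>x. sin (t * x) \<partial>\<mu>) = (\<integral>x. sin (t * x) \<partial>\<nu>)"
  shows "\<mu> = \<nu>"
proof -
  interpret \<mu>: finite_measure \<mu> by fact
  interpret \<nu>: finite_measure \<nu> by fact
  note [measurable_cong] = assms(3,4)
  have sp: "space \<mu> = UNIV" "space \<nu> = UNIV"
    using sets_eq_imp_space_eq[OF assms(3)] sets_eq_imp_space_eq[OF assms(4)] by simp_all
  define m where "m = measure \<mu> UNIV"
  have m: "measure \<nu> UNIV = m" using c[of 0] by (simp add: sp m_def)
  show ?thesis
  proof (cases "m = 0")
    case True
    have "emeasure \<mu> A = emeasure \<nu> A" for A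
    proof -
      have "emeasure \<mu> A \<le> emeasure \<mu> (space \<mu>)" by (rule emeasure_space)
      moreover have "emeasure \<nu> A \<le> emeasure \<nu> (space \<nu>)" by (rule emeasure_space)
      ultimately show ?thesis using True m
        by (simp add: sp \<mu>.emeasure_eq_measure \<nu>.emeasure_eq_measure m_def measure_le_0_iff)
    qed
    then show ?thesis using assms by (intro measure_eqI) auto
  next
    case False
    then have mpos: "m > 0" by (simp add: m_def less_le)
    define P where "P \<kappa> = density \<kappa> (\<lambda>_. ennreal (1/m))" for \<kappa> :: "real measure"
    have real: "real_distribution (P \<kappa>)" if "finite_measure \<kappa>" "sets \<kappa> = sets borel" "measure \<kappa> UNIV = m" for \<kappa>
    proof -
      interpret k: finite_measure \<kappa> by fact
      have "space \<kappa> = UNIV" using sets_eq_imp_space_eq[OF that(2)] by simp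
      then have "emeasure (P \<kappa>) (space (P \<kappa>)) = 1"
        using that mpos
        by (simp add: P_def emeasure_density k.emeasure_eq_measure ennreal_mult[symmetric])
      then show ?thesis
        using that(2) by (intro real_distribution.intro prob_spaceI)
          (auto simp: real_distribution_axioms_def P_def \<open>space \<kappa> = UNIV\<close>)
    qed
    have ch: "char (P \<kappa>) t = of_real (1/m) * (of_real (\<integral>x. cos (t * x) \<partial>\<kappa>) + \<i> * of_real (\<integral>x. sin (t * x) \<partial>\<kappa>))"
      if "finite_measure \<kappa>" "sets \<kappa> = sets borel" for \<kappa> t
    proof -
      interpret k: finite_measure \<kappa> by fact
      note [measurable_cong] = that(2)
      have ic: "integrable \<kappa> (\<lambda>x. cos (t * x))" "integrable \<kappa> (\<lambda>x. sin (t * x))"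
        by (auto intro!: k.integrable_const_bound[where B=1])
      have intc: "integrable \<kappa> (\<lambda>x. complex_of_real (cos (t * x)) + \<i> * complex_of_real (sin (t * x)))"
        using ic by (intro Bochner_Integration.integrable_add integrable_mult_right integrable_of_real)
      have iexp: "iexp y = of_real (cos y) + \<i> * of_real (sin y)" for y
        unfolding exp_Euler cos_of_real sin_of_real ..
      have "char (P \<kappa>) t = (\<integral>x. (1/m) *\<^sub>R iexp (t * x) \<partial>\<kappa>)"
        unfolding char_def P_def using mpos by (subst integral_density) auto
      also have "\<dots> = of_real (1/m) * (\<integral>x. of_real (cos (t * x)) + \<i> * of_real (sin (t*x)) \<partial>\<kappa>)"
        unfolding iexp using intc by (subst integral_scaleR_right) (auto simp: scaleR_conv_of_real)
      also have "(\<integral>x. of_real (cos (t * x)) + \<i> * of_real (sin (t*x)) \<partial>\<kappa>) =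
         of_real (\<integral>x. cos (t * x) \<partial>\<kappa>) + \<i> * of_real (\<integral>x. sin (t * x) \<partial>\<kappa>)"
        using ic by (subst Bochner_Integration.integral_add) auto
      finally show ?thesis .
    qed
    have "char (P \<mu>) = char (P \<nu>)"
      using ch[OF assms(1,3)] ch[OF assms(2,4)] c s by (intro ext) simp
    then have PP: "P \<mu> = P \<nu>"
      by (intro Levy_uniqueness real assms m m_def[symmetric])
    have "emeasure \<mu> A = emeasure \<nu> A" if [measurable]: "A \<in> sets borel" for A
    proof -
      have "emeasure (P \<kappa>) A = ennreal (1/m) * emeasure \<kappa> A" if "sets \<kappa> = sets borel" for \<kappa>
        using that \<open>A \<in> sets borel\<close> unfolding P_def by (subst emeasure_density) (auto simp: nn_integral_cmult)
      then have "ennreal (1/m) * emeasure \<mu> A = ennreal (1/m) * emeasure \<nu> A"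
        using PP assms(3,4) by metis
      then show ?thesis using mpos by (simp add: ennreal_mult_cancel_left)
    qed
    then show ?thesis using assms(3,4) by (intro measure_eqI) auto
  qed
qed

text \<open>The images under \<open>X\<close> of the measures with density \<open>w\<close> are
  determined by their trigonometric integrals. The weight is what lets further variables be carried
  along while one variable is localised.\<close>

lemma weighted_indicator_eq:
  fixes X :: "'a \<Rightarrow> real" and w :: "'a \<Rightarrow> real"
  assumes "finite_measure \<mu>" "finite_measure \<nu>" "sets \<mu> = sets N" "sets \<nu> = sets N"
    and [measurable]: "X \<in> borel_measurable N" "w \<in> borel_measurable N"
    and w: "\<And>x. 0 \<le> w x" "\<And>x. w x \<le> K"
    and c: "\<And>s. (\<integral>x. w x * cos (s * X x) \<partial>\<mu>) = (\<integral>x. w x * cos (s * X x) \<partial>\<nu>)"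
    and s: "\<And>s. (\<integral>x. w x * sin (s * X x) \<partial>\<mu>) = (\<integral>x. w x * sin (s * X x) \<partial>\<nu>)"
    and A[measurable]: "A \<in> sets borel"
  shows "(\<integral>x. w x * indicator A (X x) \<partial>\<mu>) = (\<integral>x. w x * indicator A (X x) \<partial>\<nu>)"
proof -
  define Q where "Q \<kappa> = distr (density \<kappa> (\<lambda>x. ennreal (w x))) borel X" for \<kappa>
  have fin: "finite_measure (Q \<kappa>)" if "finite_measure \<kappa>" "sets \<kappa> = sets N" for \<kappa>
  proof -
    interpret k: finite_measure \<kappa> by fact
    note [measurable_cong] = that(2)
    have "emeasure (density \<kappa> (\<lambda>x. ennreal (w x))) (space \<kappa>) = (\<integral>\<^sup>+x. ennreal (w x) \<partial>\<kappa>)"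
      by (subst emeasure_density) (auto intro!: nn_integral_cong)
    also have "\<dots> \<le> (\<integral>\<^sup>+x. ennreal K \<partial>\<kappa>)"
      by (intro nn_integral_mono ennreal_leI w)
    also have "\<dots> < \<infinity>" by (simp add: k.emeasure_eq_measure ennreal_mult_less_top)
    finally have "finite_measure (density \<kappa> (\<lambda>x. ennreal (w x)))"
      by (intro finite_measureI) auto
    then show ?thesis unfolding Q_def by (intro finite_measure.finite_measure_distr) auto
  qed
  have int: "(\<integral>x. h x \<partial>Q \<kappa>) = (\<integral>x. w x * h (X x) \<partial>\<kappa>)"
    if "sets \<kappa> = sets N" "h \<in> borel_measurable borel" for \<kappa> and h :: "real \<Rightarrow> real"
  proof -
    note [measurable_cong] = that(1) note [measurable] = that(2)
    show ?thesis unfolding Q_def by (subst integral_distr, (simp; fail), (simp; fail), subst integral_density) (auto simp: w)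
  qed
  have "Q \<mu> = Q \<nu>"
    using assms fin by (intro finite_measure_eqI_cos_sin) (auto simp: int, auto simp: Q_def)
  then show ?thesis
    using int[OF assms(3), of "indicator A"] int[OF assms(4), of "indicator A"] by auto
qed

text \<open>A Cramer-Wold theorem reduced to dimension one: each induction step localises one
  coordinate in its Borel set while the linear combinations of the others act as weights. The
  measures are arbitrary in the induction, since it is applied to their restrictions.\<close>

lemma emeasure_rect_eq_if_cos_sin_eq:
  fixes X :: "'i \<Rightarrow> 'a \<Rightarrow> real"
  assumes "finite S"
    and "finite_measure \<mu>" "finite_measure \<nu>" "sets \<mu> = sets N" "sets \<nu> = sets N"
    and "\<And>i. i \<in> S \<Longrightarrow> X i \<in> borel_measurable N"
    and "\<And>t. (\<integral>x. cos (\<Sum>i\<in>S. t i * X i x) \<partial>\<mu>) = (\<integral>x. cos (\<Sum>i\<in>S. t i * X i x) \<partial>\<nu>)"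
    and "\<And>t. (\<integral>x. sin (\<Sum>i\<in>S. t i * X i x) \<partial>\<mu>) = (\<integral>x. sin (\<Sum>i\<in>S. t i * X i x) \<partial>\<nu>)"
    and "\<And>i. i \<in> S \<Longrightarrow> A i \<in> sets borel"
  shows "emeasure \<mu> {x \<in> space N. \<forall>i\<in>S. X i x \<in> A i} = emeasure \<nu> {x \<in> space N. \<forall>i\<in>S. X i x \<in> A i}"
  using assms
proof (induction S arbitrary: \<mu> \<nu>)
  case empty
  interpret \<mu>: finite_measure \<mu> by fact
  interpret \<nu>: finite_measure \<nu> by fact
  have "space \<mu> = space N" "space \<nu> = space N"
    using empty.prems sets_eq_imp_space_eq by blast+
  then show ?case using empty.prems(6)
    by (simp add: \<mu>.emeasure_eq_measure \<nu>.emeasure_eq_measure)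
next
  case (insert j S)
  interpret \<mu>: finite_measure \<mu> by fact
  interpret \<nu>: finite_measure \<nu> by fact
  note sm[measurable_cong] = insert.prems(3,4)
  have sp: "space \<mu> = space N" "space \<nu> = space N"
    using insert.prems sets_eq_imp_space_eq by blast+
  have Xj[measurable]: "X j \<in> borel_measurable N" and X[measurable]: "\<And>i. i \<in> S \<Longrightarrow> X i \<in> borel_measurable N"
    and [measurable]: "A j \<in> sets borel"
    using insert.prems by auto
  have sum: "(\<Sum>i\<in>insert j S. (t(j := s)) i * X i x) = s * X j x + (\<Sum>i\<in>S. t i * X i x)" for t s x
  proof -
    have "(\<Sum>i\<in>S. (t(j := s)) i * X i x) = (\<Sum>i\<in>S. t i * X i x)"
      using insert.hyps by (intro sum.cong) auto
    then show ?thesis using insert.hyps by simp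
  qed
  define Y where "Y t x = (\<Sum>i\<in>S. t i * X i x)" for t x
  have Ym[measurable]: "Y t \<in> borel_measurable N" for t unfolding Y_def by measurable
  have C: "(\<integral>x. cos (s * X j x + Y t x) \<partial>\<mu>) = (\<integral>x. cos (s * X j x + Y t x) \<partial>\<nu>)"
    and Sn: "(\<integral>x. sin (s * X j x + Y t x) \<partial>\<mu>) = (\<integral>x. sin (s * X j x + Y t x) \<partial>\<nu>)" for s t
    using insert.prems(6)[of "t(j := s)"] insert.prems(7)[of "t(j := s)"]
    by (simp_all only: sum Y_def)
  have Yneg: "Y (\<lambda>i. - t i) x = - Y t x" for t x by (simp add: Y_def sum_negf)
  have C': "(\<integral>x. cos (s * X j x - Y t x) \<partial>\<mu>) = (\<integral>x. cos (s * X j x - Y t x) \<partial>\<nu>)"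
    and Sn': "(\<integral>x. sin (s * X j x - Y t x) \<partial>\<mu>) = (\<integral>x. sin (s * X j x - Y t x) \<partial>\<nu>)" for s t
    using C[of s "\<lambda>i. - t i"] Sn[of s "\<lambda>i. - t i"] by (simp_all add: Yneg)
  have C0: "(\<integral>x. cos (s * X j x) \<partial>\<mu>) = (\<integral>x. cos (s * X j x) \<partial>\<nu>)"
    and S0: "(\<integral>x. sin (s * X j x) \<partial>\<mu>) = (\<integral>x. sin (s * X j x) \<partial>\<nu>)" for s
    using C[of s "\<lambda>_. 0"] Sn[of s "\<lambda>_. 0"] by (simp_all add: Y_def)
  have bi: "integrable \<kappa> h" if "finite_measure \<kappa>" "sets \<kappa> = sets N" "h \<in> borel_measurable N" "\<And>x. \<bar>h x\<bar> \<le> 3"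
    for \<kappa> and h :: "'a \<Rightarrow> real"
    using that by (intro finite_measure.integrable_const_bound[where B=3]) (auto cong: measurable_cong_sets)
  \<comment> \<open>Adding 2 makes the weights cos \<open>Y\<close> and sin \<open>Y\<close>
    positive, as densities must be. The addition theorems reduce their products with cos (s * X j)
    and sin (s * X j) to trigonometric integrals of s * X j + Y t and s * X j - Y t, which agree for
    both measures by hypothesis.\<close>
  have four:
    "(\<integral>x. (2 + cos (Y t x)) * cos (s * X j x) \<partial>\<kappa>) = 2 * (\<integral>x. cos (s * X j x) \<partial>\<kappa>)
       + ((\<integral>x. cos (s * X j x + Y t x) \<partial>\<kappa>) + (\<integral>x. cos (s * X j x - Y t x) \<partial>\<kappa>)) / 2" 
    "(\<integral>x. (2 + cos (Y t x)) * sin (s * X j x) \<partial>\<kappa>) = 2 * (\<integral>x. sin (s * X j x) \<partial>\<kappa>)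
       + ((\<integral>x. sin (s * X j x + Y t x) \<partial>\<kappa>) + (\<integral>x. sin (s * X j x - Y t x) \<partial>\<kappa>)) / 2" 
    "(\<integral>x. (2 + sin (Y t x)) * cos (s * X j x) \<partial>\<kappa>) = 2 * (\<integral>x. cos (s * X j x) \<partial>\<kappa>)
       + ((\<integral>x. sin (s * X j x + Y t x) \<partial>\<kappa>) - (\<integral>x. sin (s * X j x - Y t x) \<partial>\<kappa>)) / 2" 
    "(\<integral>x. (2 + sin (Y t x)) * sin (s * X j x) \<partial>\<kappa>) = 2 * (\<integral>x. sin (s * X j x) \<partial>\<kappa>)
       + ((\<integral>x. cos (s * X j x - Y t x) \<partial>\<kappa>) - (\<integral>x. cos (s * X j x + Y t x) \<partial>\<kappa>)) / 2" 
    if k: "finite_measure \<kappa>" "sets \<kappa> = sets N" for \<kappa> s t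
  proof -
    have I: "integrable \<kappa> (\<lambda>x. cos (s * X j x))" "integrable \<kappa> (\<lambda>x. sin (s * X j x))"
      "integrable \<kappa> (\<lambda>x. cos (s * X j x + Y t x))" "integrable \<kappa> (\<lambda>x. sin (s * X j x + Y t x))"
      "integrable \<kappa> (\<lambda>x. cos (s * X j x - Y t x))" "integrable \<kappa> (\<lambda>x. sin (s * X j x - Y t x))"
      by (auto intro!: bi k order_trans[OF abs_cos_le_one] order_trans[OF abs_sin_le_one])
    have e: "(2 + cos (Y t x)) * cos (s * X j x) = 2 * cos (s * X j x) + (cos (s * X j x + Y t x) + cos (s * X j x - Y t x)) / 2"
      "(2 + cos (Y t x)) * sin (s * X j x) = 2 * sin (s * X j x) + (sin (s * X j x + Y t x) + sin (s * X j x - Y t x)) / 2"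
      "(2 + sin (Y t x)) * cos (s * X j x) = 2 * cos (s * X j x) + (sin (s * X j x + Y t x) - sin (s * X j x - Y t x)) / 2"
      "(2 + sin (Y t x)) * sin (s * X j x) = 2 * sin (s * X j x) + (cos (s * X j x - Y t x) - cos (s * X j x + Y t x)) / 2" for x
      by (simp_all add: cos_add sin_add cos_diff sin_diff field_simps)
    show "(\<integral>x. (2 + cos (Y t x)) * cos (s * X j x) \<partial>\<kappa>) = 2 * (\<integral>x. cos (s * X j x) \<partial>\<kappa>)
       + ((\<integral>x. cos (s * X j x + Y t x) \<partial>\<kappa>) + (\<integral>x. cos (s * X j x - Y t x) \<partial>\<kappa>)) / 2" 
    "(\<integral>x. (2 + cos (Y t x)) * sin (s * X j x) \<partial>\<kappa>) = 2 * (\<integral>x. sin (s * X j x) \<partial>\<kappa>)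
       + ((\<integral>x. sin (s * X j x + Y t x) \<partial>\<kappa>) + (\<integral>x. sin (s * X j x - Y t x) \<partial>\<kappa>)) / 2" 
    "(\<integral>x. (2 + sin (Y t x)) * cos (s * X j x) \<partial>\<kappa>) = 2 * (\<integral>x. cos (s * X j x) \<partial>\<kappa>)
       + ((\<integral>x. sin (s * X j x + Y t x) \<partial>\<kappa>) - (\<integral>x. sin (s * X j x - Y t x) \<partial>\<kappa>)) / 2" 
    "(\<integral>x. (2 + sin (Y t x)) * sin (s * X j x) \<partial>\<kappa>) = 2 * (\<integral>x. sin (s * X j x) \<partial>\<kappa>)
       + ((\<integral>x. cos (s * X j x - Y t x) \<partial>\<kappa>) - (\<integral>x. cos (s * X j x + Y t x) \<partial>\<kappa>)) / 2" 
      unfolding e using I by simp_all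
  qed
  have b: "0 \<le> 2 + cos y" "2 + cos y \<le> 3" "0 \<le> 2 + sin y" "2 + sin y \<le> 3" for y :: real
    using cos_ge_minus_one[of y] cos_le_one[of y] sin_ge_minus_one[of y] sin_le_one[of y] by linarith+
  have wc: "(\<integral>x. (2 + cos (Y t x)) * indicator (A j) (X j x) \<partial>\<mu>) = (\<integral>x. (2 + cos (Y t x)) * indicator (A j) (X j x) \<partial>\<nu>)" for t
    using insert.prems(1-4)
    by (intro weighted_indicator_eq[where N=N and K=3])
       (auto simp: four C Sn C' Sn' C0 S0 b)
  have ws: "(\<integral>x. (2 + sin (Y t x)) * indicator (A j) (X j x) \<partial>\<mu>) = (\<integral>x. (2 + sin (Y t x)) * indicator (A j) (X j x) \<partial>\<nu>)" for t
    using insert.prems(1-4)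
    by (intro weighted_indicator_eq[where N=N and K=3])
       (auto simp: four C Sn C' Sn' C0 S0 b)
  \<comment> \<open>Restriction to the event that \<open>X j\<close> lies in \<open>A j\<close>; the
    weighted identities say that the restrictions have equal trigonometric integrals in the
    remaining variables.\<close>
  define R where "R \<kappa> = density \<kappa> (\<lambda>x. indicator (A j) (X j x))" for \<kappa> :: "'a measure"
  have Rint: "(\<integral>x. h x \<partial>R \<kappa>) = (\<integral>x. h x * indicator (A j) (X j x) \<partial>\<kappa>)"
    if "finite_measure \<kappa>" "sets \<kappa> = sets N" "h \<in> borel_measurable N" for \<kappa> and h :: "'a \<Rightarrow> real"
  proof -
    note [measurable_cong] = that(2) note [measurable] = that(3)
    have R: "R \<kappa> = density \<kappa> (\<lambda>x. ennreal (indicator (A j) (X j x)))" 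
      by (simp add: R_def ennreal_indicator)
    then show ?thesis by (subst R, subst integral_density) (auto simp: mult.commute)
  qed
  have Rfin: "finite_measure (R \<kappa>)" if "finite_measure \<kappa>" "sets \<kappa> = sets N" for \<kappa>
  proof -
    interpret k: finite_measure \<kappa> by fact
    note [measurable_cong] = that(2)
    have "emeasure (R \<kappa>) (space \<kappa>) = (\<integral>\<^sup>+x. indicator (A j) (X j x) \<partial>\<kappa>)"
      unfolding R_def by (subst emeasure_density) (auto intro!: nn_integral_cong)
    also have "\<dots> \<le> (\<integral>\<^sup>+x. 1 \<partial>\<kappa>)"
      by (intro nn_integral_mono) (auto split: split_indicator)
    also have "\<dots> < \<infinity>" by (simp add: k.emeasure_eq_measure)
    finally show ?thesis by (intro finite_measureI) (auto simp: R_def)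
  qed
  have one: "(\<integral>x. indicator (A j) (X j x) \<partial>\<mu>) = (\<integral>x. indicator (A j) (X j x) \<partial>\<nu> :: real)"
    using wc[of "\<lambda>_. 0"] by (simp add: Y_def)
  have split: "(\<integral>x. (2 + h x) * indicator (A j) (X j x) \<partial>\<kappa>) = 2 * (\<integral>x. indicator (A j) (X j x) \<partial>\<kappa>) + (\<integral>x. h x * indicator (A j) (X j x) \<partial>\<kappa>)"
    if k: "finite_measure \<kappa>" "sets \<kappa> = sets N" "h \<in> borel_measurable N" "\<And>x. \<bar>h x\<bar> \<le> 1" for \<kappa> and h :: "'a \<Rightarrow> real"
  proof -
    note [measurable] = that(3)
    have "\<bar>h x * indicator (A j) (X j x)\<bar> \<le> 3" for x
      using k(4)[of x] by (auto split: split_indicator)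
    then have "integrable \<kappa> (\<lambda>x. h x * indicator (A j) (X j x))" "integrable \<kappa> (\<lambda>x. indicator (A j) (X j x) :: real)"
      by (auto intro!: bi k(1,2) split: split_indicator)
    then show ?thesis by (simp add: algebra_simps)
  qed
  have cosS: "(\<integral>x. cos (Y t x) * indicator (A j) (X j x) \<partial>\<mu>) = (\<integral>x. cos (Y t x) * indicator (A j) (X j x) \<partial>\<nu>)" for t
    using wc[of t] one split[OF insert.prems(1,3), of "\<lambda>x. cos (Y t x)"] split[OF insert.prems(2,4), of "\<lambda>x. cos (Y t x)"]
    by simp
  have sinS: "(\<integral>x. sin (Y t x) * indicator (A j) (X j x) \<partial>\<mu>) = (\<integral>x. sin (Y t x) * indicator (A j) (X j x) \<partial>\<nu>)" for t
    using ws[of t] one split[OF insert.prems(1,3), of "\<lambda>x. sin (Y t x)"] split[OF insert.prems(2,4), of "\<lambda>x. sin (Y t x)"]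
    by simp
  have IH: "emeasure (R \<mu>) {x \<in> space N. \<forall>i\<in>S. X i x \<in> A i} = emeasure (R \<nu>) {x \<in> space N. \<forall>i\<in>S. X i x \<in> A i}"
  proof (rule insert.IH)
    show "finite_measure (R \<mu>)" "finite_measure (R \<nu>)" using Rfin insert.prems by auto
    show "sets (R \<mu>) = sets N" "sets (R \<nu>) = sets N" using insert.prems by (auto simp: R_def)
    show "(\<integral>x. cos (\<Sum>i\<in>S. t i * X i x) \<partial>R \<mu>) = (\<integral>x. cos (\<Sum>i\<in>S. t i * X i x) \<partial>R \<nu>)" for t
      using cosS[of t] insert.prems(1-4) Ym[of t] unfolding Y_def[symmetric] by (simp add: Rint)
    show "(\<integral>x. sin (\<Sum>i\<in>S. t i * X i x) \<partial>R \<mu>) = (\<integral>x. sin (\<Sum>i\<in>S. t i * X i x) \<partial>R \<nu>)" for t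
      using sinS[of t] insert.prems(1-4) Ym[of t] unfolding Y_def[symmetric] by (simp add: Rint)
  qed (use insert.prems in auto)
  have meas: "{x \<in> space N. \<forall>i\<in>S. X i x \<in> A i} \<in> sets N"
    using insert.prems insert.hyps(1) by (intro sets.sets_Collect_finite_All) (auto intro: measurable_sets_Collect)
  have "emeasure (R \<kappa>) {x \<in> space N. \<forall>i\<in>S. X i x \<in> A i} = emeasure \<kappa> {x \<in> space N. \<forall>i\<in>insert j S. X i x \<in> A i}"
    if "finite_measure \<kappa>" "sets \<kappa> = sets N" for \<kappa>
  proof -
    note [measurable_cong] = that(2)
    have [simp]: "space \<kappa> = space N" using that(2) sets_eq_imp_space_eq by blast
    have m2: "{x \<in> space N. \<forall>i\<in>insert j S. X i x \<in> A i} \<in> sets N"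
      using insert.prems insert.hyps(1) by (intro sets.sets_Collect_finite_All) (auto intro: measurable_sets_Collect)
    have "emeasure (R \<kappa>) {x \<in> space N. \<forall>i\<in>S. X i x \<in> A i} = 
      (\<integral>\<^sup>+x. indicator (A j) (X j x) * indicator {x \<in> space N. \<forall>i\<in>S. X i x \<in> A i} x \<partial>\<kappa>)"
      unfolding R_def using meas that(2) by (subst emeasure_density) auto
    also have "\<dots> = (\<integral>\<^sup>+x. indicator {x \<in> space N. \<forall>i\<in>insert j S. X i x \<in> A i} x \<partial>\<kappa>)"
      by (intro nn_integral_cong) (auto split: split_indicator)
    finally show ?thesis using m2 that(2) by simp
  qed
  then show ?case using IH insert.prems by simp
qed

section \<open>Almost sure subsequences, Fatou's lemma and completeness\<close>

text \<open>Along a subsequence with integrals at most 2^-k the sum of the functions has finite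
  integral, so it is finite almost everywhere and its terms tend to 0.\<close>

lemma AE_subseq_if_nn_integral_tendsto_0:
  fixes f :: "nat \<Rightarrow> 'a \<Rightarrow> ennreal"
  assumes [measurable]: "\<And>n. f n \<in> borel_measurable M"
    and lim: "(\<lambda>n. \<integral>\<^sup>+x. f n x \<partial>M) \<longlonglongrightarrow> 0"
  shows "\<exists>r. strict_mono r \<and> (AE x in M. (\<lambda>k. f (r k) x) \<longlonglongrightarrow> 0)"
proof -
  have ev: "\<exists>n>m. (\<integral>\<^sup>+x. f n x \<partial>M) \<le> ennreal ((1/2)^k)" for m k
  proof -
    have "eventually (\<lambda>n. (\<integral>\<^sup>+x. f n x \<partial>M) < ennreal ((1/2)^k)) sequentially"
      using lim by (rule order_tendstoD) simp
    then have "eventually (\<lambda>n. (\<integral>\<^sup>+x. f n x \<partial>M) < ennreal ((1/2)^k) \<and> n > m) sequentially"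
      using eventually_gt_at_top[of m] by (rule eventually_conj)
    then show ?thesis
      using eventually_happens[of _ sequentially] by (auto intro: less_imp_le)
  qed
  obtain r where r: "\<And>k. (\<integral>\<^sup>+x. f (r k) x \<partial>M) \<le> ennreal ((1/2)^k)" "\<And>k. r k < r (Suc k)"
  proof -
    have "\<exists>r. \<forall>k. (\<integral>\<^sup>+x. f (r k) x \<partial>M) \<le> ennreal ((1/2)^k) \<and> r k < r (Suc k)"
    proof (rule dependent_nat_choice)
      show "\<exists>n. (\<integral>\<^sup>+x. f n x \<partial>M) \<le> ennreal ((1/2)^0)" using ev[of 0 0] by blast
      show "\<exists>y. (\<integral>\<^sup>+x. f y x \<partial>M) \<le> ennreal ((1/2)^Suc k) \<and> n < y" for n k
        using ev[of n "Suc k"] by blast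
    qed
    then show ?thesis using that by blast
  qed
  have "(\<integral>\<^sup>+x. (\<Sum>k. f (r k) x) \<partial>M) = (\<Sum>k. \<integral>\<^sup>+x. f (r k) x \<partial>M)"
    by (rule nn_integral_suminf) auto
  also have "\<dots> \<le> (\<Sum>k. ennreal ((1/2)^k))"
    by (intro suminf_le r) auto
  also have "\<dots> = ennreal (\<Sum>k. (1/2)^k)"
    by (intro suminf_ennreal2) (auto intro: summable_geometric)
  finally have "(\<integral>\<^sup>+x. (\<Sum>k. f (r k) x) \<partial>M) \<noteq> \<infinity>"
    by (auto simp: top_unique)
  then have "AE x in M. (\<Sum>k. f (r k) x) \<noteq> \<infinity>"
    by (intro nn_integral_PInf_AE) auto
  then have "AE x in M. (\<lambda>k. f (r k) x) \<longlonglongrightarrow> 0"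
  proof eventually_elim
    case (elim x)
    have fin: "f (r k) x \<noteq> top" for k
      using elim ennreal_suminf_lessD[of "\<lambda>k. f (r k) x" top k] by (auto simp: less_top)
    define g where "g k = enn2real (f (r k) x)" for k
    have fg: "f (r k) x = ennreal (g k)" for k
      using fin[of k] by (simp add: g_def less_top)
    have "summable g"
    proof (rule summable_suminf_not_top)
      show "0 \<le> g k" for k by (simp add: g_def)
      show "(\<Sum>k. ennreal (g k)) \<noteq> \<top>" using elim unfolding fg by simp
    qed
    then have "g \<longlonglongrightarrow> 0" by (rule summable_LIMSEQ_zero)
    then show ?case unfolding fg using tendsto_ennrealI by fastforce
  qed
  then show ?thesis using r(2) by (auto intro!: exI[of _ r] simp: strict_mono_Suc_iff)
qed

lemma nn_integral_le_of_AE_tendsto: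
  fixes f :: "nat \<Rightarrow> 'a \<Rightarrow> ennreal"
  assumes [measurable]: "\<And>n. f n \<in> borel_measurable M"
    and "AE x in M. (\<lambda>n. f n x) \<longlonglongrightarrow> g x"
    and "eventually (\<lambda>n. (\<integral>\<^sup>+x. f n x \<partial>M) \<le> c) sequentially"
  shows "(\<integral>\<^sup>+x. g x \<partial>M) \<le> c"
proof -
  have "(\<integral>\<^sup>+x. g x \<partial>M) = (\<integral>\<^sup>+x. liminf (\<lambda>n. f n x) \<partial>M)"
    using assms(2) by (intro nn_integral_cong_AE) (auto elim!: eventually_mono simp: lim_imp_Liminf)
  also have "\<dots> \<le> liminf (\<lambda>n. \<integral>\<^sup>+x. f n x \<partial>M)" by (rule nn_integral_liminf) auto
  also have "\<dots> \<le> liminf (\<lambda>n. c)" by (rule Liminf_mono) (rule assms(3))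
  finally show ?thesis by (simp add: Liminf_const)
qed

text \<open>Riesz-Fischer, for functions rather than classes: a fast subsequence converges almost
  everywhere, and Fatou's lemma moves the Cauchy bound to the limit.\<close>

lemma L2_complete:
  fixes u :: "nat \<Rightarrow> 'a \<Rightarrow> real"
  assumes [measurable]: "\<And>n. u n \<in> borel_measurable M"
    and cauchy: "\<And>e. e > 0 \<Longrightarrow> \<exists>n0. \<forall>m\<ge>n0. \<forall>n\<ge>n0. (\<integral>\<^sup>+x. ennreal ((u m x - u n x)\<^sup>2) \<partial>M) \<le> ennreal e"
  shows "\<exists>v\<in>borel_measurable M. (\<lambda>n. \<integral>\<^sup>+x. ennreal ((u n x - v x)\<^sup>2) \<partial>M) \<longlonglongrightarrow> 0"
proof -
  \<comment> \<open>The rate 8^-k leaves room for the weight 4^k: the weighted increments are still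
    summable in the mean, and boundedness of 4^k * d^2 gives \<bar>d\<bar> at most a constant times
    2^-k.\<close>
  have step: "\<exists>n1>n0. \<forall>m\<ge>n1. (\<integral>\<^sup>+x. ennreal ((u m x - u n1 x)\<^sup>2) \<partial>M) \<le> ennreal ((1/8)^k)" for n0 k
  proof -
    obtain n1 where "\<forall>m\<ge>n1. \<forall>n\<ge>n1. (\<integral>\<^sup>+x. ennreal ((u m x - u n x)\<^sup>2) \<partial>M) \<le> ennreal ((1/8)^k)"
      using cauchy[of "(1/8)^k"] by auto
    then show ?thesis by (intro exI[of _ "max n1 (Suc n0)"]) auto
  qed
  obtain r where r: "\<And>k. \<forall>m\<ge>r k. (\<integral>\<^sup>+x. ennreal ((u m x - u (r k) x)\<^sup>2) \<partial>M) \<le> ennreal ((1/8)^k)"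
    "\<And>k. r k < r (Suc k)"
  proof -
    have "\<exists>r. \<forall>k. (\<forall>m\<ge>r k. (\<integral>\<^sup>+x. ennreal ((u m x - u (r k) x)\<^sup>2) \<partial>M) \<le> ennreal ((1/8)^k)) \<and> r k < r (Suc k)"
    proof (rule dependent_nat_choice)
      show "\<exists>n. \<forall>m\<ge>n. (\<integral>\<^sup>+x. ennreal ((u m x - u n x)\<^sup>2) \<partial>M) \<le> ennreal ((1/8)^0)"
        using step[of 0 0] by blast
      show "\<exists>y. (\<forall>m\<ge>y. (\<integral>\<^sup>+x. ennreal ((u m x - u y x)\<^sup>2) \<partial>M) \<le> ennreal ((1/8)^Suc k)) \<and> n < y" for n k
        using step[of n "Suc k"] by blast
    qed
    then show ?thesis using that by blast
  qed
  define d where "d k x = u (r (Suc k)) x - u (r k) x" for k x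
  have "(\<integral>\<^sup>+x. (\<Sum>k. ennreal (4^k * (d k x)\<^sup>2)) \<partial>M) = (\<Sum>k. \<integral>\<^sup>+x. ennreal (4^k * (d k x)\<^sup>2) \<partial>M)"
    unfolding d_def by (rule nn_integral_suminf) auto
  also have "\<dots> \<le> (\<Sum>k. ennreal ((1/2)^k))"
  proof (intro suminf_le)
    fix k
    have "(\<integral>\<^sup>+x. ennreal (4^k * (d k x)\<^sup>2) \<partial>M) = ennreal (4^k) * (\<integral>\<^sup>+x. ennreal ((d k x)\<^sup>2) \<partial>M)"
      unfolding d_def by (subst nn_integral_cmult[symmetric]) (auto simp: ennreal_mult)
    also have "\<dots> \<le> ennreal (4^k) * ennreal ((1/8)^k)"
      using r(1)[of k] r(2)[of k] unfolding d_def by (intro mult_left_mono) auto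
    also have "\<dots> = ennreal ((1/2)^k)"
      by (simp add: ennreal_mult[symmetric] power_mult_distrib[symmetric])
    finally show "(\<integral>\<^sup>+x. ennreal (4^k * (d k x)\<^sup>2) \<partial>M) \<le> ennreal ((1/2)^k)" .
  qed auto
  also have "\<dots> = ennreal (\<Sum>k. (1/2)^k)"
    by (intro suminf_ennreal2) (auto intro: summable_geometric)
  finally have "(\<integral>\<^sup>+x. (\<Sum>k. ennreal (4^k * (d k x)\<^sup>2)) \<partial>M) \<noteq> \<infinity>"
    by (auto simp: top_unique)
  then have "AE x in M. (\<Sum>k. ennreal (4^k * (d k x)\<^sup>2)) \<noteq> \<infinity>"
    by (intro nn_integral_PInf_AE) (auto simp: d_def)
  then have conv: "AE x in M. convergent (\<lambda>k. u (r k) x)"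
  proof eventually_elim
    case (elim x)
    have "summable (\<lambda>k. 4^k * (d k x)\<^sup>2)"
      by (rule summable_suminf_not_top) (use elim in auto)
    then have "Bseq (\<lambda>k. 4^k * (d k x)\<^sup>2)"
      using summable_LIMSEQ_zero convergentI convergent_imp_Bseq by blast
    then obtain C where C: "C > 0" "\<And>k. \<bar>4^k * (d k x)\<^sup>2\<bar> \<le> C" by (auto simp: Bseq_def)
    have "\<bar>d k x\<bar> \<le> sqrt C * (1/2)^k" for k
    proof -
      have "(2^k * \<bar>d k x\<bar>)\<^sup>2 \<le> C"
        using C(2)[of k] by (simp add: power_mult_distrib power_mult[symmetric] mult.commute[of k 2] power_mult)
      then have "2^k * \<bar>d k x\<bar> \<le> sqrt C" by (rule real_le_rsqrt)
      then show ?thesis by (simp add: field_simps power_one_over)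
    qed
    moreover have "summable (\<lambda>k. sqrt C * (1/2)^k)"
      by (rule summable_mult, rule summable_geometric) simp
    ultimately have "summable (\<lambda>k. d k x)"
      unfolding real_norm_def[symmetric] by (blast intro: summable_comparison_test'[where N=0])
    then have "(\<lambda>n. \<Sum>k<n. d k x) \<longlonglongrightarrow> (\<Sum>k. d k x)" by (rule summable_LIMSEQ)
    then have "(\<lambda>n. u (r n) x - u (r 0) x) \<longlonglongrightarrow> (\<Sum>k. d k x)"
      unfolding d_def by (subst (asm) sum_lessThan_telescope)
    then have "(\<lambda>n. (u (r n) x - u (r 0) x) + u (r 0) x) \<longlonglongrightarrow> (\<Sum>k. d k x) + u (r 0) x"
      by (intro tendsto_add) auto
    then show ?case by (auto simp: convergent_def)
  qed
  \<comment> \<open>\<open>lim\<close> keeps \<open>v\<close> measurable; its value off the set of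
    convergence does not matter, as that complement is null.\<close>
  define v where "v x = lim (\<lambda>k. u (r k) x)" for x
  have [measurable]: "v \<in> borel_measurable M" unfolding v_def by measurable
  have "(\<lambda>n. \<integral>\<^sup>+x. ennreal ((u n x - v x)\<^sup>2) \<partial>M) \<longlonglongrightarrow> 0"
  proof (rule order_tendstoI)
    fix e :: ennreal assume "0 < e"
    then obtain e' :: real where e': "0 < e'" "ennreal e' < e"
    proof (cases e)
      case (real a)
      then show ?thesis using that[of "a/2"] \<open>0 < e\<close> by (auto simp: ennreal_lessI)
    next
      case top
      then show ?thesis using that[of 1] by simp
    qed
    obtain n0 where n0: "\<forall>m\<ge>n0. \<forall>n\<ge>n0. (\<integral>\<^sup>+x. ennreal ((u m x - u n x)\<^sup>2) \<partial>M) \<le> ennreal e'"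
      using cauchy[OF e'(1)] by auto
    have rk: "r k \<ge> k" for k using r(2) by (intro seq_suble) (simp add: strict_mono_Suc_iff)
    have "(\<integral>\<^sup>+x. ennreal ((u n x - v x)\<^sup>2) \<partial>M) \<le> ennreal e'" if "n \<ge> n0" for n
    proof (rule nn_integral_le_of_AE_tendsto[where f = "\<lambda>k x. ennreal ((u n x - u (r k) x)\<^sup>2)"])
      show "AE x in M. (\<lambda>k. ennreal ((u n x - u (r k) x)\<^sup>2)) \<longlonglongrightarrow> ennreal ((u n x - v x)\<^sup>2)"
        using conv by eventually_elim (auto simp: v_def convergent_LIMSEQ_iff intro!: tendsto_intros)
      show "\<forall>\<^sub>F k in sequentially. (\<integral>\<^sup>+ x. ennreal ((u n x - u (r k) x)\<^sup>2) \<partial>M) \<le> ennreal e'"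
        using eventually_ge_at_top[of n0] by eventually_elim (use n0 that rk order_trans in blast)
    qed auto
    then show "\<forall>\<^sub>F n in sequentially. (\<integral>\<^sup>+ x. ennreal ((u n x - v x)\<^sup>2) \<partial>M) < e"
      using e'(2) by (intro eventually_sequentiallyI[of n0]) (rule le_less_trans)
  qed auto
  then show ?thesis by (intro bexI[of _ v]) auto
qed

subsection \<open>Integration by parts for the normal law\<close>

lemma one_plus_abs_power_le_exp: "(1 + \<bar>x\<bar>) ^ N \<le> fact N * exp (1 + \<bar>x\<bar>)" for x :: real
proof -
  have "(\<lambda>n. (1 + \<bar>x\<bar>) ^ n /\<^sub>R fact n) sums exp (1 + \<bar>x\<bar>)" by (rule exp_converges)
  then have "(\<Sum>n\<in>{N}. (1 + \<bar>x\<bar>) ^ n /\<^sub>R fact n) \<le> exp (1 + \<bar>x\<bar>)"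
    unfolding sums_iff using sum_le_suminf[of "\<lambda>n. (1 + \<bar>x\<bar>) ^ n /\<^sub>R fact n" "{N}"] by auto
  then show ?thesis by (simp add: field_simps)
qed

lemma integrable_std_normal_abs_power: "integrable std_normal_distribution (\<lambda>x. (1 + \<bar>x\<bar>) ^ N)"
proof -
  have "integrable std_normal_distribution (\<lambda>x. \<bar>x\<bar> ^ k)" for k
    using integrable_abs[OF integrable_std_normal_distribution_moment[of k]] by (simp add: power_abs)
  then show ?thesis by (simp add: binomial_ring add.commute)
qed

lemma integrable_std_normal_poly_growth:
  fixes f :: "real \<Rightarrow> real"
  assumes [measurable]: "f \<in> borel_measurable borel" and "\<And>x. \<bar>f x\<bar> \<le> K * (1 + \<bar>x\<bar>) ^ N"
  shows "integrable std_normal_distribution f"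
proof (rule Bochner_Integration.integrable_bound)
  show "integrable std_normal_distribution (\<lambda>x. K * (1 + \<bar>x\<bar>) ^ N)"
    using integrable_std_normal_abs_power by (intro integrable_mult_right)
  show "AE x in std_normal_distribution. norm (f x) \<le> norm (K * (1 + \<bar>x\<bar>) ^ N)"
    using assms(2) by (intro AE_I2) (simp add: order_trans[OF _ abs_ge_self])
qed simp

text \<open>The derivative of \<open>\<psi>\<close> times the normal density is
  (\<open>\<psi>'\<close> - x * \<open>\<psi>\<close>) times the density, so the claim is the
  fundamental theorem of calculus on the whole line; polynomial growth makes the boundary terms
  vanish.\<close>

lemma gaussian_integration_by_parts:
  fixes \<psi> \<psi>' :: "real \<Rightarrow> real"
  assumes D: "\<And>x. (\<psi> has_real_derivative \<psi>' x) (at x)"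
    and cont: "continuous_on UNIV \<psi>'"
    and b: "\<And>x. \<bar>\<psi> x\<bar> \<le> K * (1 + \<bar>x\<bar>) ^ N" and b': "\<And>x. \<bar>\<psi>' x\<bar> \<le> K * (1 + \<bar>x\<bar>) ^ N"
  shows "(\<integral>x. x * \<psi> x \<partial>std_normal_distribution) = (\<integral>x. \<psi>' x \<partial>std_normal_distribution)"
proof -
  let ?d = std_normal_density
  have cp: "continuous_on UNIV \<psi>" by (rule DERIV_continuous_on, rule has_field_derivative_at_within[OF D])
  have [measurable]: "\<psi> \<in> borel_measurable borel" "\<psi>' \<in> borel_measurable borel"
    using cp cont by (auto intro: borel_measurable_continuous_onI)
  have i1: "integrable std_normal_distribution \<psi>'"
    by (rule integrable_std_normal_poly_growth[OF _ b']) simp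
  have i2: "integrable std_normal_distribution (\<lambda>x. x * \<psi> x)"
  proof (rule integrable_std_normal_poly_growth)
    fix x
    have "\<bar>x * \<psi> x\<bar> \<le> (1 + \<bar>x\<bar>) * (K * (1 + \<bar>x\<bar>) ^ N)"
      unfolding abs_mult by (intro mult_mono b) auto
    then show "\<bar>x * \<psi> x\<bar> \<le> K * (1 + \<bar>x\<bar>) ^ Suc N" by (simp add: algebra_simps)
  qed simp
  have dd: "(?d has_real_derivative - x * ?d x) (at x)" for x
    unfolding std_normal_density_def
    by (auto intro!: derivative_eq_intros simp: power2_eq_square field_simps)
  have dc: "continuous_on UNIV ?d"
    by (rule DERIV_continuous_on, rule has_field_derivative_at_within[OF dd])
  define G where "G x = \<psi> x * ?d x" for x
  define g where "g x = (\<psi>' x - x * \<psi> x) * ?d x" for x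
  have Gd: "(G has_vector_derivative g x) (at x)" for x
    unfolding has_real_derivative_iff_has_vector_derivative[symmetric] G_def g_def
    by (rule DERIV_cong[OF DERIV_mult[OF D dd]]) (simp add: algebra_simps)
  have gc: "isCont g x" for x
  proof -
    have "continuous_on UNIV g" unfolding g_def by (intro continuous_intros cont cp dc)
    then show ?thesis by (simp add: continuous_on_eq_continuous_at)
  qed
  have gi: "integrable lborel g"
    using Bochner_Integration.integrable_diff[OF i1 i2] unfolding g_def
    by (subst (asm) integrable_density) (auto simp: mult.commute)
  \<comment> \<open>A single term of the exponential series bounds the polynomial by N! * exp (1 +
    \<bar>x\<bar>), and (\<bar>x\<bar> - 2)^2 \<ge> 0 gives 1 + \<bar>x\<bar> - x^2 / 2 \<le> 3 -
    \<bar>x\<bar>, whence the constant exp 3.\<close>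
  have Gb: "\<bar>G x\<bar> \<le> K * fact N * (exp 3 * exp (- \<bar>x\<bar>))" for x
  proof -
    have "0 \<le> K" using b[of 0] by simp
    have "\<bar>G x\<bar> \<le> K * (1 + \<bar>x\<bar>) ^ N * ?d x"
      unfolding G_def abs_mult using b[of x] by (intro mult_mono) auto
    also have "\<dots> \<le> K * (fact N * exp (1 + \<bar>x\<bar>)) * exp (- x\<^sup>2 / 2)"
    proof (intro mult_mono mult_left_mono one_plus_abs_power_le_exp \<open>0 \<le> K\<close>)
      have "1 * 1 \<le> 2 * pi" using pi_ge_two by (intro mult_mono) auto
      then have "1 / sqrt (2 * pi) \<le> 1" by (simp add: real_le_rsqrt)
      then have "1 / sqrt (2 * pi) * exp (- x\<^sup>2 / 2) \<le> 1 * exp (- x\<^sup>2 / 2)"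
        by (rule mult_right_mono) simp
      then show "?d x \<le> exp (- x\<^sup>2 / 2)" by (simp add: std_normal_density_def)
    qed (use \<open>0 \<le> K\<close> in auto)
    also have "\<dots> = K * fact N * exp (1 + \<bar>x\<bar> - x\<^sup>2 / 2)"
      unfolding diff_conv_add_uminus exp_add by simp
    also have "\<dots> \<le> K * fact N * exp (3 - \<bar>x\<bar>)"
    proof (intro mult_left_mono)
      have "0 \<le> (\<bar>x\<bar> - 2)\<^sup>2" by simp
      then show "exp (1 + \<bar>x\<bar> - x\<^sup>2 / 2) \<le> exp (3 - \<bar>x\<bar>)"
        by (simp add: power2_diff)
    qed (use \<open>0 \<le> K\<close> in auto)
    finally show ?thesis by (simp add: exp_diff exp_minus divide_inverse)
  qed
  have Gl: "(G \<longlongrightarrow> 0) F" if "((\<lambda>x. exp (- \<bar>x\<bar>)) \<longlongrightarrow> 0) F" for F :: "real filter"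
  proof (rule Lim_null_comparison)
    show "((\<lambda>x. K * fact N * (exp 3 * exp (- \<bar>x\<bar>))) \<longlongrightarrow> 0) F"
      using that by (intro tendsto_mult_right_zero)
  qed (use Gb in auto)
  have top: "((\<lambda>x::real. exp (- \<bar>x\<bar>)) \<longlongrightarrow> 0) at_top"
  proof (rule Lim_transform_eventually)
    show "((\<lambda>x::real. exp (- x)) \<longlongrightarrow> 0) at_top"
      by (rule filterlim_compose[OF exp_at_bot filterlim_uminus_at_bot_at_top])
  qed (auto intro!: eventually_mono[OF eventually_ge_at_top[of 0]])
  have bot: "((\<lambda>x::real. exp (- \<bar>x\<bar>)) \<longlongrightarrow> 0) at_bot"
    by (rule Lim_transform_eventually[OF exp_at_bot])
       (auto intro!: eventually_mono[OF eventually_le_at_bot[of 0]])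
  have "(LBINT x=-\<infinity>..\<infinity>. g x) = 0 - 0"
    using gi Gd gc Gl[OF top] Gl[OF bot]
    by (intro interval_integral_FTC_integrable[where F=G])
       (auto simp: ereal_tendsto_simps set_integrable_def)
  then have "(\<integral>x. g x \<partial>lborel) = 0"
    by (simp add: interval_lebesgue_integral_def set_lebesgue_integral_def)
  also have "(\<integral>x. g x \<partial>lborel) = (\<integral>x. \<psi>' x - x * \<psi> x \<partial>std_normal_distribution)"
    unfolding g_def by (subst integral_density) (auto simp: mult.commute)
  finally show ?thesis using i1 i2 by simp
qed

subsection \<open>Square summable families\<close>

lemma l2_mult_summable:
  fixes f g :: "'b \<Rightarrow> real"
  assumes "(\<lambda>b. (f b)\<^sup>2) summable_on B" "(\<lambda>b. (g b)\<^sup>2) summable_on B"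
  shows "(\<lambda>b. f b * g b) summable_on B"
proof -
  have "(\<lambda>b. norm (f b * g b)) summable_on B"
  proof (rule Infinite_Sum.abs_summable_on_comparison_test)
    show "(\<lambda>b. norm ((f b)\<^sup>2 + (g b)\<^sup>2)) summable_on B"
      using summable_on_add[OF assms] by simp
    show "norm (f b * g b) \<le> norm ((f b)\<^sup>2 + (g b)\<^sup>2)" for b
      using sum_squares_bound[of "\<bar>f b\<bar>" "\<bar>g b\<bar>"] by (simp add: abs_mult mult.assoc) 
         (smt (verit) zero_le_mult_iff abs_ge_zero)
  qed
  then show ?thesis by (rule abs_summable_summable)
qed

lemma l2_add_summable:
  fixes f g :: "'b \<Rightarrow> real"
  assumes "(\<lambda>b. (f b)\<^sup>2) summable_on B" "(\<lambda>b. (g b)\<^sup>2) summable_on B"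
  shows "(\<lambda>b. (x * f b + y * g b)\<^sup>2) summable_on B"
proof -
  have "(\<lambda>b. x\<^sup>2 * (f b)\<^sup>2 + 2 * x * y * (f b * g b) + y\<^sup>2 * (g b)\<^sup>2) summable_on B"
    using assms l2_mult_summable[OF assms]
    by (intro summable_on_add summable_on_cmult_right)
  then show ?thesis by (simp add: power2_eq_square algebra_simps)
qed

text \<open>Tensors enter norms and determinants only through their values on basis lists, so the
  geometry is set up for real families over an arbitrary index set. \<open>ip\<close> is blind to
  values off \<open>B\<close>, hence only positive semidefinite on functions.\<close>

definition ip :: "'b set \<Rightarrow> ('b \<Rightarrow> real) \<Rightarrow> ('b \<Rightarrow> real) \<Rightarrow> real" where
  "ip B f g = (\<Sum>\<^sub>\<infinity>b\<in>B. f b * g b)"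

definition l2 :: "'b set \<Rightarrow> ('b \<Rightarrow> real) set" where
  "l2 B = {f. (\<lambda>b. (f b)\<^sup>2) summable_on B}"

lemma l2_lincomb: "f \<in> l2 B \<Longrightarrow> g \<in> l2 B \<Longrightarrow> (\<lambda>b. x * f b + y * g b) \<in> l2 B"
  unfolding l2_def mem_Collect_eq by (rule l2_add_summable)

lemma l2_diff: "f \<in> l2 B \<Longrightarrow> g \<in> l2 B \<Longrightarrow> (\<lambda>b. f b - g b) \<in> l2 B"
  using l2_lincomb[of f B g 1 "-1"] by simp

lemma ip_commute: "ip B f g = ip B g f" by (simp add: ip_def mult.commute)

lemma ip_nonneg: "0 \<le> ip B f f" by (auto simp: ip_def intro!: infsum_nonneg)

lemma ip_lincomb:
  assumes "f \<in> l2 B" "g \<in> l2 B" "h \<in> l2 B"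
  shows "ip B (\<lambda>b. x * f b + y * g b) h = x * ip B f h + y * ip B g h"
proof -
  have "(\<lambda>b. f b * h b) summable_on B" "(\<lambda>b. g b * h b) summable_on B"
    using assms unfolding l2_def mem_Collect_eq by (auto intro: l2_mult_summable)
  then have "(\<Sum>\<^sub>\<infinity>b\<in>B. x * (f b * h b) + y * (g b * h b)) = x * ip B f h + y * ip B g h"
    unfolding ip_def by (subst infsum_add) (auto intro: summable_on_cmult_right simp: infsum_cmult_right)
  then show ?thesis by (simp add: ip_def algebra_simps)
qed

lemma ip_expand:
  assumes "f \<in> l2 B" "g \<in> l2 B"
  shows "ip B (\<lambda>b. x * f b + y * g b) (\<lambda>b. x * f b + y * g b) = x\<^sup>2 * ip B f f + 2 * x * y * ip B f g + y\<^sup>2 * ip B g g"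
proof -
  have l: "(\<lambda>b. x * f b + y * g b) \<in> l2 B" using assms by (rule l2_lincomb)
  show ?thesis
    unfolding ip_lincomb[OF assms l] ip_commute[of B f "\<lambda>b. x * f b + y * g b"] ip_commute[of B g "\<lambda>b. x * f b + y * g b"]
      ip_lincomb[OF assms assms(1)] ip_lincomb[OF assms assms(2)]
    by (simp add: ip_commute[of B g f] power2_eq_square algebra_simps)
qed

lemma ip_Cauchy_Schwarz:
  assumes "f \<in> l2 B" "g \<in> l2 B"
  shows "(ip B f g)\<^sup>2 \<le> ip B f f * ip B g g"
proof (cases "ip B g g = 0")
  case True
  have "0 \<le> ip B f f + 2 * t * ip B f g" for t
    using ip_nonneg[of B "\<lambda>b. 1 * f b + t * g b"] ip_expand[OF assms, of 1 t] True by simp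
  \<comment> \<open>This \<open>t\<close> would make the nonnegative expression equal to -1.\<close>
  from this[of "- (ip B f f + 1) / (2 * ip B f g)"] have "ip B f g = 0"
    by (cases "ip B f g = 0") (auto simp: field_simps)
  then show ?thesis by (simp add: ip_nonneg)
next
  case False
  then have g: "ip B g g > 0" using ip_nonneg[of B g] by simp
  have "0 \<le> (ip B g g)\<^sup>2 * ip B f f + 2 * ip B g g * (- ip B f g) * ip B f g + (- ip B f g)\<^sup>2 * ip B g g"
    unfolding ip_expand[OF assms, symmetric] by (rule ip_nonneg)
  also have "\<dots> = ip B g g * (ip B f f * ip B g g - (ip B f g)\<^sup>2)"
    by (simp add: power2_eq_square algebra_simps)
  finally show ?thesis using g by (simp add: zero_le_mult_iff)
qed

definition nrm :: "'b set \<Rightarrow> ('b \<Rightarrow> real) \<Rightarrow> real" where "nrm B f = sqrt (ip B f f)"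

lemma nrm_nonneg[simp]: "0 \<le> nrm B f" by (simp add: nrm_def ip_nonneg)

lemma nrm_sq: "(nrm B f)\<^sup>2 = ip B f f" by (simp add: nrm_def ip_nonneg)

lemma abs_ip_le:
  assumes "f \<in> l2 B" "g \<in> l2 B"
  shows "\<bar>ip B f g\<bar> \<le> nrm B f * nrm B g"
proof (rule power2_le_imp_le)
  show "\<bar>ip B f g\<bar>\<^sup>2 \<le> (nrm B f * nrm B g)\<^sup>2"
    unfolding power_mult_distrib nrm_sq power2_abs by (rule ip_Cauchy_Schwarz[OF assms])
qed simp

lemma nrm_lincomb_le:
  assumes "f \<in> l2 B" "g \<in> l2 B"
  shows "nrm B (\<lambda>b. x * f b + y * g b) \<le> \<bar>x\<bar> * nrm B f + \<bar>y\<bar> * nrm B g"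
proof (rule power2_le_imp_le)
  have "x * y * ip B f g \<le> \<bar>x * y\<bar> * \<bar>ip B f g\<bar>"
    unfolding abs_mult[symmetric] by (rule abs_ge_self)
  also have "\<dots> \<le> \<bar>x * y\<bar> * (nrm B f * nrm B g)"
    by (intro mult_left_mono abs_ip_le assms) simp
  finally have "x * y * ip B f g \<le> \<bar>x * y\<bar> * (nrm B f * nrm B g)" .
  then show "(nrm B (\<lambda>b. x * f b + y * g b))\<^sup>2 \<le> (\<bar>x\<bar> * nrm B f + \<bar>y\<bar> * nrm B g)\<^sup>2"
    unfolding nrm_sq ip_expand[OF assms] power2_sum power_mult_distrib
    by (simp add: abs_mult algebra_simps)
qed simp

lemma nrm_triangle_diff:
  assumes "f \<in> l2 B" "g \<in> l2 B" "h \<in> l2 B"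
  shows "nrm B (\<lambda>b. f b - h b) \<le> nrm B (\<lambda>b. f b - g b) + nrm B (\<lambda>b. g b - h b)"
  using nrm_lincomb_le[OF l2_diff[OF assms(1,2)] l2_diff[OF assms(2,3)], of 1 1] by simp

lemma nrm_diff_commute: "nrm B (\<lambda>b. f b - g b) = nrm B (\<lambda>b. g b - f b)"
proof -
  have "(f b - g b) * (f b - g b) = (g b - f b) * (g b - f b)" for b by (simp add: algebra_simps)
  then show ?thesis unfolding nrm_def ip_def by (simp only:)
qed

lemma abs_nrm_diff_le:
  assumes "f \<in> l2 B" "g \<in> l2 B"
  shows "\<bar>nrm B f - nrm B g\<bar> \<le> nrm B (\<lambda>b. f b - g b)"
proof -
  have "nrm B (\<lambda>b. 1 * (f b - g b) + 1 * g b) \<le> nrm B (\<lambda>b. f b - g b) + nrm B g"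
    using nrm_lincomb_le[OF l2_diff[OF assms] assms(2), of 1 1] by simp
  moreover have "nrm B (\<lambda>b. 1 * f b + -1 * (f b - g b)) \<le> nrm B f + nrm B (\<lambda>b. f b - g b)"
    using nrm_lincomb_le[OF assms(1) l2_diff[OF assms], of 1 "-1"] by simp
  ultimately show ?thesis by simp
qed

lemma ip_diff_le:
  assumes "f \<in> l2 B" "g \<in> l2 B" "f' \<in> l2 B" "g' \<in> l2 B"
  shows "\<bar>ip B f g - ip B f' g'\<bar> \<le> nrm B (\<lambda>b. f b - f' b) * nrm B g + nrm B f' * nrm B (\<lambda>b. g b - g' b)"
proof -
  have "ip B (\<lambda>b. 1 * f b + -1 * f' b) g = ip B f g - ip B f' g"
    using ip_lincomb[OF assms(1,3,2), of 1 "-1"] by simp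
  moreover have "ip B (\<lambda>b. 1 * g b + -1 * g' b) f' = ip B f' g - ip B f' g'"
    using ip_lincomb[OF assms(2,4,3), of 1 "-1"] by (simp add: ip_commute)
  moreover have "\<bar>ip B (\<lambda>b. f b - f' b) g\<bar> \<le> nrm B (\<lambda>b. f b - f' b) * nrm B g"
    by (intro abs_ip_le l2_diff assms)
  moreover have "\<bar>ip B (\<lambda>b. g b - g' b) f'\<bar> \<le> nrm B (\<lambda>b. g b - g' b) * nrm B f'"
    by (intro abs_ip_le l2_diff assms)
  ultimately show ?thesis by (simp add: mult.commute)
qed

lemma abs_le_nrm:
  assumes "f \<in> l2 B" "b \<in> B"
  shows "\<bar>f b\<bar> \<le> nrm B f"
proof -
  have "(\<Sum>b\<in>{b}. (f b)\<^sup>2) \<le> (\<Sum>\<^sub>\<infinity>b\<in>B. (f b)\<^sup>2)"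
    using assms by (intro finite_sum_le_infsum) (auto simp: l2_def)
  then show ?thesis
    unfolding nrm_def ip_def by (intro real_le_rsqrt) (simp add: power2_eq_square)
qed

text \<open>The Gram determinant, which is the determinant of the Malliavin matrix when the families
  are the two derivatives.\<close>

definition gram :: "'b set \<Rightarrow> ('b \<Rightarrow> real) \<Rightarrow> ('b \<Rightarrow> real) \<Rightarrow> real" where
  "gram B f g = ip B f f * ip B g g - (ip B f g)\<^sup>2"

text \<open>Both summands of \<open>gram\<close> are squares of quantities x, y bounded by R^2 with
  \<bar>x - y\<bar> \<le> r * R, so each changes by at most (r * R) * (2 * R^2); two summands give
  the constant 4. The cubic factor shows that fourth moments suffice for a limit in the
  mean.\<close>

lemma gram_diff_le:
  assumes "f \<in> l2 B" "g \<in> l2 B" "f' \<in> l2 B" "g' \<in> l2 B"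
    and r: "r = nrm B (\<lambda>b. f b - f' b) + nrm B (\<lambda>b. g b - g' b)"
    and R: "R = r + nrm B f' + nrm B g'"
  shows "\<bar>gram B f g - gram B f' g'\<bar> \<le> 4 * r * R ^ 3"
proof -
  define u where "u = nrm B (\<lambda>b. f b - f' b)"
  define v where "v = nrm B (\<lambda>b. g b - g' b)"
  define a where "a = nrm B f" define b where "b = nrm B g"
  define a' where "a' = nrm B f'" define b' where "b' = nrm B g'"
  have n: "0 \<le> u" "0 \<le> v" "0 \<le> a" "0 \<le> b" "0 \<le> a'" "0 \<le> b'"
    by (simp_all add: u_def v_def a_def b_def a'_def b'_def)
  have d: "\<bar>a - a'\<bar> \<le> u" "\<bar>b - b'\<bar> \<le> v"
    unfolding a_def a'_def u_def b_def b'_def v_def by (intro abs_nrm_diff_le assms)+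
  have rR: "r = u + v" "R = u + v + a' + b'" by (simp_all add: r R u_def v_def a'_def b'_def)
  have le: "a \<le> R" "b \<le> R" "a' \<le> R" "b' \<le> R" "0 \<le> r" "0 \<le> R" using n d rR by auto
  have ab: "a * b \<le> R * R" "a' * b' \<le> R * R"
    using n le by (simp_all add: mult_mono)
  have diff: "\<bar>x\<^sup>2 - y\<^sup>2\<bar> \<le> 2 * r * R ^ 3" if "\<bar>x - y\<bar> \<le> u * b + a' * v" "\<bar>x\<bar> \<le> R * R" "\<bar>y\<bar> \<le> R * R" for x y
  proof -
    have "u * b + a' * v \<le> u * R + R * v" by (intro add_mono mult_mono) (use le n in auto)
    then have "\<bar>x - y\<bar> \<le> r * R" using that(1) rR by (simp add: algebra_simps)
    moreover have "\<bar>x + y\<bar> \<le> 2 * (R * R)" using that by linarith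
    ultimately have "\<bar>x - y\<bar> * \<bar>x + y\<bar> \<le> (r * R) * (2 * (R * R))"
      by (intro mult_mono) (use le in auto)
    then show ?thesis by (simp add: abs_mult[symmetric] power2_eq_square power3_eq_cube algebra_simps)
  qed
  have "\<bar>a * b - a' * b'\<bar> \<le> u * b + a' * v"
  proof -
    have "a * b - a' * b' = (a - a') * b + a' * (b - b')" by (simp add: algebra_simps)
    also have "\<bar>\<dots>\<bar> \<le> \<bar>a - a'\<bar> * b + a' * \<bar>b - b'\<bar>"
      using n by (intro order_trans[OF abs_triangle_ineq]) (simp add: abs_mult)
    also have "\<dots> \<le> u * b + a' * v" by (intro add_mono mult_mono) (use d n in auto)
    finally show ?thesis .
  qed
  then have 1: "\<bar>(a * b)\<^sup>2 - (a' * b')\<^sup>2\<bar> \<le> 2 * r * R ^ 3"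
    by (rule diff) (use ab n in \<open>simp_all add: abs_mult\<close>)
  have 2: "\<bar>(ip B f g)\<^sup>2 - (ip B f' g')\<^sup>2\<bar> \<le> 2 * r * R ^ 3"
  proof (rule diff)
    show "\<bar>ip B f g - ip B f' g'\<bar> \<le> u * b + a' * v"
      unfolding u_def b_def a'_def v_def by (intro ip_diff_le assms)
    from ab show "\<bar>ip B f g\<bar> \<le> R * R" "\<bar>ip B f' g'\<bar> \<le> R * R"
      using abs_ip_le[OF assms(1,2)] abs_ip_le[OF assms(3,4)]
      unfolding a_def b_def a'_def b'_def by linarith+
  qed
  have "gram B f g - gram B f' g' = ((a * b)\<^sup>2 - (a' * b')\<^sup>2) - ((ip B f g)\<^sup>2 - (ip B f' g')\<^sup>2)"
    unfolding gram_def power_mult_distrib a_def b_def a'_def b'_def nrm_sq by simp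
  then show ?thesis using 1 2 by simp
qed

subsection \<open>Gaussian laws\<close>

context isonormal_gaussian_process
begin

lemma W_centered_gaussian: "centered_gaussian M (W h)"
  using gaussian_family[of "{h}" "\<lambda>_. 1"] by simp

lemma W_measurable[measurable]: "W h \<in> borel_measurable M"
  using W_centered_gaussian by (simp add: centered_gaussian_def)

lemma W_distr_ex: "\<exists>\<sigma>\<ge>0. distr M borel (W h) = distr std_normal_distribution borel (\<lambda>x. \<sigma> * x)"
proof -
  consider "AE \<omega> in M. W h \<omega> = 0" | \<sigma> where "\<sigma> > 0" "distributed M lborel (W h) (normal_density 0 \<sigma>)"
    using W_centered_gaussian[of h] by (auto simp: centered_gaussian_def)
  then show ?thesis
  proof cases
    case 1
    interpret N: prob_space std_normal_distribution
      using real_dist_normal_dist by (simp add: real_distribution_def)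
    have "distr M borel (W h) = distr M borel (\<lambda>_. 0)"
      using 1 by (intro distr_cong_AE) auto
    also have "\<dots> = distr std_normal_distribution borel (\<lambda>x. 0 * x)"
      by (auto simp: distr_const N.distr_const)
    finally show ?thesis by (intro exI[of _ 0]) simp
  next
    case 2
    then have "distributed M lborel (\<lambda>x. (W h x - 0) / \<sigma>) std_normal_density"
      using normal_standard_normal_convert[of \<sigma> "W h" 0] by simp
    then have Z: "distr M borel (\<lambda>x. W h x / \<sigma>) = std_normal_distribution"
      by (simp add: distributed_def cong: distr_cong)
    have "distr M borel (W h) = distr (distr M borel (\<lambda>x. W h x / \<sigma>)) borel (\<lambda>x. \<sigma> * x)"
      using 2 by (subst distr_distr) (auto simp: comp_def intro!: distr_cong)
    then show ?thesis using Z 2(1) by (intro exI[of _ \<sigma>]) auto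
  qed
qed

text \<open>The assumption on Gaussian families leaves the standard deviation open; the second
  moment identifies it with the norm. Scaling the standard normal law also covers norm 0.\<close>

lemma W_distr: "distr M borel (W h) = distr std_normal_distribution borel (\<lambda>x. norm h * x)"
proof -
  obtain \<sigma> where s: "\<sigma> \<ge> 0" "distr M borel (W h) = distr std_normal_distribution borel (\<lambda>x. \<sigma> * x)"
    using W_distr_ex by blast
  have "(norm h)\<^sup>2 = (\<integral>\<omega>. W h \<omega> * W h \<omega> \<partial>M)"
    by (simp add: covariance power2_norm_eq_inner)
  also have "\<dots> = (\<integral>x. x\<^sup>2 \<partial>distr M borel (W h))"
    by (subst integral_distr) (auto simp: power2_eq_square)
  also have "\<dots> = (\<integral>x. \<sigma>\<^sup>2 * x\<^sup>2 \<partial>std_normal_distribution)"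
    unfolding s(2) by (subst integral_distr) (auto simp: power_mult_distrib)
  also have "\<dots> = \<sigma>\<^sup>2"
    using std_normal_distribution_even_moments[of 1] by simp
  finally have "norm h = \<sigma>" using s(1) by (simp add: power2_eq_iff_nonneg)
  then show ?thesis using s by simp
qed

lemma integral_W:
  fixes f :: "real \<Rightarrow> real"
  assumes [measurable]: "f \<in> borel_measurable borel"
  shows "(\<integral>\<omega>. f (W h \<omega>) \<partial>M) = (\<integral>x. f (norm h * x) \<partial>std_normal_distribution)"
proof -
  have "(\<integral>\<omega>. f (W h \<omega>) \<partial>M) = (\<integral>x. f x \<partial>distr M borel (W h))" by (subst integral_distr) auto
  also have "\<dots> = (\<integral>x. f (norm h * x) \<partial>std_normal_distribution)"
    unfolding W_distr by (subst integral_distr) auto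
  finally show ?thesis .
qed

lemma integrable_W:
  fixes f :: "real \<Rightarrow> real"
  assumes [measurable]: "f \<in> borel_measurable borel"
  shows "integrable M (\<lambda>\<omega>. f (W h \<omega>)) \<longleftrightarrow> integrable std_normal_distribution (\<lambda>x. f (norm h * x))"
proof -
  have "integrable M (\<lambda>\<omega>. f (W h \<omega>)) \<longleftrightarrow> integrable (distr M borel (W h)) f"
    by (subst integrable_distr_eq) auto
  also have "\<dots> \<longleftrightarrow> integrable std_normal_distribution (\<lambda>x. f (norm h * x))"
    unfolding W_distr by (subst integrable_distr_eq) auto
  finally show ?thesis .
qed

lemma integrable_W_power: "integrable M (\<lambda>\<omega>. (1 + \<bar>W h \<omega>\<bar>) ^ N)"
proof -
  have "\<bar>(1 + \<bar>norm h * x\<bar>) ^ N\<bar> \<le> (1 + norm h) ^ N * (1 + \<bar>x\<bar>) ^ N" for x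
  proof -
    have "1 + \<bar>norm h * x\<bar> \<le> (1 + norm h) * (1 + \<bar>x\<bar>)" by (simp add: abs_mult algebra_simps)
    then show ?thesis by (simp add: power_mult_distrib[symmetric] power_mono)
  qed
  then show ?thesis
    by (subst integrable_W) (auto intro!: integrable_std_normal_poly_growth)
qed

lemma integrable_W_mult: "integrable M (\<lambda>\<omega>. W h \<omega> * W g \<omega>)"
proof (rule Bochner_Integration.integrable_bound)
  show "integrable M (\<lambda>\<omega>. (1 + \<bar>W h \<omega>\<bar>) ^ 2 + (1 + \<bar>W g \<omega>\<bar>) ^ 2)"
    by (intro Bochner_Integration.integrable_add integrable_W_power)
  have "\<bar>a * b\<bar> \<le> (1 + \<bar>a\<bar>)\<^sup>2 + (1 + \<bar>b\<bar>)\<^sup>2" for a b :: real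
  proof -
    have "\<bar>a\<bar> * \<bar>b\<bar> * 2 \<le> \<bar>a\<bar>\<^sup>2 + \<bar>b\<bar>\<^sup>2" using sum_squares_bound[of "\<bar>a\<bar>" "\<bar>b\<bar>"] by (simp add: mult_ac)
    moreover have "0 \<le> \<bar>a\<bar> * \<bar>b\<bar>" by simp
    ultimately show ?thesis
      using abs_ge_zero[of a] abs_ge_zero[of b] unfolding abs_mult power2_sum one_power2 by linarith
  qed
  then show "AE \<omega> in M. norm (W h \<omega> * W g \<omega>) \<le> norm ((1 + \<bar>W h \<omega>\<bar>) ^ 2 + (1 + \<bar>W g \<omega>\<bar>) ^ 2)"
    by (intro AE_I2) simp
qed simp

text \<open>Linearity of the process is not assumed: it follows since, by the covariance, the defect
  has second moment 0. Hence it holds almost surely only, for each combination separately.\<close>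

lemma W_lincomb_AE: "AE \<omega> in M. W (a *\<^sub>R h + b *\<^sub>R g) \<omega> = a * W h \<omega> + b * W g \<omega>"
proof -
  let ?k = "a *\<^sub>R h + b *\<^sub>R g"
  let ?D = "\<lambda>\<omega>. W ?k \<omega> - a * W h \<omega> - b * W g \<omega>"
  have sq: "(?D \<omega>)\<^sup>2 = W ?k \<omega> * W ?k \<omega> + a\<^sup>2 * (W h \<omega> * W h \<omega>) + b\<^sup>2 * (W g \<omega> * W g \<omega>)
      - 2 * a * (W ?k \<omega> * W h \<omega>) - 2 * b * (W ?k \<omega> * W g \<omega>) + 2 * a * b * (W h \<omega> * W g \<omega>)" for \<omega>
    by (simp add: power2_eq_square algebra_simps)
  have int: "integrable M (\<lambda>\<omega>. (?D \<omega>)\<^sup>2)"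
    unfolding sq by (intro Bochner_Integration.integrable_add Bochner_Integration.integrable_diff
      integrable_mult_right integrable_W_mult)
  have "(\<integral>\<omega>. (?D \<omega>)\<^sup>2 \<partial>M) = ?k \<bullet> ?k + a\<^sup>2 * (h \<bullet> h) + b\<^sup>2 * (g \<bullet> g)
     - 2 * a * (?k \<bullet> h) - 2 * b * (?k \<bullet> g) + 2 * a * b * (h \<bullet> g)"
    unfolding sq by (simp add: covariance integrable_W_mult)
  also have "\<dots> = 0"
    by (simp add: inner_simps inner_commute power2_eq_square algebra_simps)
  finally have "AE \<omega> in M. (?D \<omega>)\<^sup>2 = 0"
    using int by (subst (asm) integral_nonneg_eq_0_iff_AE) auto
  then show ?thesis by eventually_elim (simp add: power2_eq_square)
qed

lemma W_zero_AE: "AE \<omega> in M. W 0 \<omega> = 0"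
  using W_lincomb_AE[of 0 0 0 0] by simp

lemma W_sum_AE:
  assumes "finite I"
  shows "AE \<omega> in M. W (\<Sum>i\<in>I. t i *\<^sub>R h i) \<omega> = (\<Sum>i\<in>I. t i * W (h i) \<omega>)"
  using assms
proof (induction I)
  case empty
  then show ?case using W_zero_AE by simp
next
  case (insert j I)
  show ?case
    using insert.IH W_lincomb_AE[of "t j" "h j" 1 "\<Sum>i\<in>I. t i *\<^sub>R h i"]
    by eventually_elim (use insert.hyps in simp)
qed

lemma cos_W: "(\<integral>\<omega>. cos (W h \<omega>) \<partial>M) = exp (- (norm h)\<^sup>2 / 2)"
  and sin_W: "(\<integral>\<omega>. sin (W h \<omega>) \<partial>M) = 0"
proof -
  interpret N: prob_space std_normal_distribution
    using real_dist_normal_dist by (simp add: real_distribution_def)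
  have int: "integrable std_normal_distribution (\<lambda>x. iexp (t * x))" for t
    by (intro N.integrable_iexp) auto
  have "char std_normal_distribution (norm h) = of_real (exp (- (norm h)\<^sup>2 / 2))"
    by (simp add: char_std_normal_distribution)
  then have c: "(CLINT x|std_normal_distribution. iexp (norm h * x)) = of_real (exp (- (norm h)\<^sup>2 / 2))"
    by (simp add: char_def)
  have "(\<integral>x. Re (iexp (norm h * x)) \<partial>std_normal_distribution) = exp (- (norm h)\<^sup>2 / 2)"
    using c int[of "norm h"] by (subst integral_Re) auto
  moreover have "(\<integral>x. Im (iexp (norm h * x)) \<partial>std_normal_distribution) = 0"
    using c int[of "norm h"] by (subst integral_Im) auto
  ultimately show "(\<integral>\<omega>. cos (W h \<omega>) \<partial>M) = exp (- (norm h)\<^sup>2 / 2)" "(\<integral>\<omega>. sin (W h \<omega>) \<partial>M) = 0"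
    by (simp_all add: integral_W Re_exp Im_exp)
qed

text \<open>Uncorrelated and jointly Gaussian means independent. Independence is expressed by
  reading coordinate 0 from a second copy of the probability space. On finitely many coordinates
  both laws have the same trigonometric integrals, because by Pythagoras exp (- norm^2 / 2)
  factorises.\<close>

lemma W_split_law:
  fixes k :: "nat \<Rightarrow> 'h"
  assumes orth: "\<And>i. k 0 \<bullet> k (Suc i) = 0"
  shows "distr M (\<Pi>\<^sub>M i\<in>UNIV. borel) (\<lambda>\<omega> i. W (k i) \<omega>) =
    distr (M \<Otimes>\<^sub>M M) (\<Pi>\<^sub>M i\<in>UNIV. borel) (\<lambda>z i. if i = 0 then W (k i) (snd z) else W (k i) (fst z))"
    (is "?\<mu> = ?\<nu>")
proof (rule measure_eqI_PiM_infinite)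
  interpret P: pair_prob_space M M ..
  let ?P = "\<Pi>\<^sub>M i\<in>(UNIV::nat set). (borel::real measure)"
  have m1[measurable]: "(\<lambda>\<omega> i. W (k i) \<omega>) \<in> measurable M ?P" by (intro measurable_PiM_single') auto
  have m2[measurable]: "(\<lambda>z i. if i = 0 then W (k i) (snd z) else W (k i) (fst z)) \<in> measurable (M \<Otimes>\<^sub>M M) ?P"
    by (intro measurable_PiM_single') auto
  show "finite_measure ?\<mu>"
    by (intro finite_measure.finite_measure_distr) (auto intro: finite_measure_axioms)
  show s: "sets ?\<mu> = sets ?P" "sets ?\<nu> = sets ?P" by simp_all
  fix J :: "nat set" and A :: "nat \<Rightarrow> real set" assume J: "finite J" "\<And>i. i \<in> J \<Longrightarrow> A i \<in> sets borel"
  define y where "y t = (\<Sum>i\<in>J - {0}. t i *\<^sub>R k i)" for t :: "nat \<Rightarrow> real"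
  \<comment> \<open>The finite index set may or may not contain the distinguished coordinate 0; the
    default value 0 treats both cases at once.\<close>
  define a where "a t = (if 0 \<in> J then t 0 else 0)" for t :: "nat \<Rightarrow> real"
  have split: "(\<Sum>i\<in>J. t i *\<^sub>R k i) = a t *\<^sub>R k 0 + y t" for t
    using J(1) by (simp add: a_def y_def sum.remove)
  have ort: "k 0 \<bullet> y t = 0" for t
  proof -
    have "k 0 \<bullet> k i = 0" if "i \<noteq> 0" for i using orth[of "i - 1"] that by simp
    then show ?thesis by (simp add: y_def inner_sum_right)
  qed
  have nrm: "(norm (a t *\<^sub>R k 0 + y t))\<^sup>2 = (norm (a t *\<^sub>R k 0))\<^sup>2 + (norm (y t))\<^sup>2" for t
    unfolding power2_norm_eq_inner by (simp add: inner_simps ort inner_commute[of "y t" "k 0"])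
  have AE1: "AE \<omega> in M. (\<Sum>i\<in>J. t i * W (k i) \<omega>) = W (a t *\<^sub>R k 0 + y t) \<omega>" for t
    using W_sum_AE[OF J(1), of t k] unfolding split by eventually_elim simp
  have AE2: "AE \<omega> in M. a t * W (k 0) \<omega> = W (a t *\<^sub>R k 0) \<omega>" for t
    using W_lincomb_AE[of "a t" "k 0" 0 0] by eventually_elim simp
  have AE3: "AE \<omega> in M. (\<Sum>i\<in>J-{0}. t i * W (k i) \<omega>) = W (y t) \<omega>" for t
    using W_sum_AE[of "J - {0}" t k] J(1) unfolding y_def by (auto elim!: eventually_mono)
  have split2: "(\<Sum>i\<in>J. t i * (if i = 0 then W (k i) \<omega>' else W (k i) \<omega>)) = a t * W (k 0) \<omega>' + (\<Sum>i\<in>J-{0}. t i * W (k i) \<omega>)" for t \<omega> \<omega>'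
  proof (cases "0 \<in> J")
    case True
    then show ?thesis using J(1) by (subst sum.remove[of _ 0]) (auto simp: a_def intro!: sum.cong)
  next
    case False
    then show ?thesis using J(1) by (auto simp: a_def intro!: sum.cong)
  qed
  have bnd: "integrable Q f" if "finite_measure Q" "f \<in> borel_measurable Q" "\<And>x. \<bar>f x\<bar> \<le> 2" for Q and f :: "'z \<Rightarrow> real"
    using that by (intro finite_measure.integrable_const_bound[where B=2]) auto
  have I1: "(\<integral>x. f (\<Sum>i\<in>J. t i * x i) \<partial>?\<mu>) = (\<integral>\<omega>. f (W (a t *\<^sub>R k 0 + y t) \<omega>) \<partial>M)"
    if [measurable]: "f \<in> borel_measurable borel" for f :: "real \<Rightarrow> real" and t
    using AE1[of t] by (subst integral_distr) (auto intro!: integral_cong_AE)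
  have I2: "(\<integral>x. f (\<Sum>i\<in>J. t i * x i) \<partial>?\<nu>) =
     (\<integral>\<omega>. (\<integral>\<omega>'. f (W (a t *\<^sub>R k 0) \<omega>' + W (y t) \<omega>) \<partial>M) \<partial>M)"
    if [measurable]: "f \<in> borel_measurable borel" and b: "\<And>x. \<bar>f x\<bar> \<le> 2" for f :: "real \<Rightarrow> real" and t
  proof -
    have "(\<integral>x. f (\<Sum>i\<in>J. t i * x i) \<partial>?\<nu>) = 
      (\<integral>z. f (a t * W (k 0) (snd z) + (\<Sum>i\<in>J-{0}. t i * W (k i) (fst z))) \<partial>(M \<Otimes>\<^sub>M M))"
      by (subst integral_distr) (auto simp: split2)
    also have "\<dots> = (\<integral>\<omega>. (\<integral>\<omega>'. f (a t * W (k 0) \<omega>' + (\<Sum>i\<in>J-{0}. t i * W (k i) \<omega>)) \<partial>M) \<partial>M)"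
      using b by (subst P.integral_fst'[symmetric]) (auto intro!: bnd P.finite_measure_axioms)
    also have "\<dots> = (\<integral>\<omega>. (\<integral>\<omega>'. f (W (a t *\<^sub>R k 0) \<omega>' + W (y t) \<omega>) \<partial>M) \<partial>M)"
    proof (intro integral_cong_AE)
      show "AE \<omega> in M. (\<integral>\<omega>'. f (a t * W (k 0) \<omega>' + (\<Sum>i\<in>J-{0}. t i * W (k i) \<omega>)) \<partial>M) = (\<integral>\<omega>'. f (W (a t *\<^sub>R k 0) \<omega>' + W (y t) \<omega>) \<partial>M)"
        using AE3[of t]
      proof eventually_elim
        case (elim \<omega>)
        show ?case unfolding elim using AE2[of t] by (intro integral_cong_AE) auto
      qed
    qed measurable
    finally show ?thesis .
  qed
  have c: "integrable M (\<lambda>\<omega>. cos (W h \<omega>))" "integrable M (\<lambda>\<omega>. sin (W h \<omega>))" for h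
    by (auto intro!: bnd finite_measure_axioms order_trans[OF abs_cos_le_one] order_trans[OF abs_sin_le_one])
  have E: "emeasure ?\<mu> {x \<in> space ?P. \<forall>i\<in>J. x i \<in> A i} = emeasure ?\<nu> {x \<in> space ?P. \<forall>i\<in>J. x i \<in> A i}"
  proof (rule emeasure_rect_eq_if_cos_sin_eq[where X = "\<lambda>i x. x i"])
    show "finite_measure ?\<mu>" "finite_measure ?\<nu>"
      by (intro finite_measure.finite_measure_distr finite_measure_axioms P.finite_measure_axioms m1 m2)+
    show "(\<integral>x. cos (\<Sum>i\<in>J. t i * x i) \<partial>?\<mu>) = (\<integral>x. cos (\<Sum>i\<in>J. t i * x i) \<partial>?\<nu>)" for t
    proof -
      have "(\<integral>x. cos (\<Sum>i\<in>J. t i * x i) \<partial>?\<nu>) = (\<integral>\<omega>. (\<integral>\<omega>'. cos (W (a t *\<^sub>R k 0) \<omega>' + W (y t) \<omega>) \<partial>M) \<partial>M)"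
        by (rule I2) (auto intro: order_trans[OF abs_cos_le_one])
      also have "\<dots> = exp (- (norm (a t *\<^sub>R k 0))\<^sup>2 / 2) * exp (- (norm (y t))\<^sup>2 / 2)"
        using c by (simp add: cos_add cos_W sin_W)
      also have "\<dots> = (\<integral>x. cos (\<Sum>i\<in>J. t i * x i) \<partial>?\<mu>)"
        by (simp add: I1 cos_W nrm exp_add[symmetric] add_divide_distrib diff_divide_distrib)
      finally show ?thesis ..
    qed
    show "(\<integral>x. sin (\<Sum>i\<in>J. t i * x i) \<partial>?\<mu>) = (\<integral>x. sin (\<Sum>i\<in>J. t i * x i) \<partial>?\<nu>)" for t
    proof -
      have "(\<integral>x. sin (\<Sum>i\<in>J. t i * x i) \<partial>?\<nu>) = (\<integral>\<omega>. (\<integral>\<omega>'. sin (W (a t *\<^sub>R k 0) \<omega>' + W (y t) \<omega>) \<partial>M) \<partial>M)"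
        by (rule I2) (auto intro: order_trans[OF abs_sin_le_one])
      also have "\<dots> = 0" using c by (simp add: sin_add cos_W sin_W)
      also have "\<dots> = (\<integral>x. sin (\<Sum>i\<in>J. t i * x i) \<partial>?\<mu>)"
        by (simp add: I1 sin_W)
      finally show ?thesis ..
    qed
  qed (use J in auto)
  have "prod_emb UNIV (\<lambda>_. borel) J (Pi\<^sub>E J A) = {x \<in> space ?P. \<forall>i\<in>J. x i \<in> A i}"
    by (auto simp: prod_emb_def space_PiM PiE_iff)
  then show "emeasure ?\<mu> (prod_emb UNIV (\<lambda>_. borel) J (Pi\<^sub>E J A)) = emeasure ?\<nu> (prod_emb UNIV (\<lambda>_. borel) J (Pi\<^sub>E J A))"
    using E by simp
qed

end

subsection \<open>Integration by parts for Gaussian families\<close>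

definition poly_growth :: "nat \<Rightarrow> ((nat \<Rightarrow> real) \<Rightarrow> real) \<Rightarrow> bool" where
  "poly_growth m f \<longleftrightarrow> continuous_on UNIV f \<and> (\<exists>K N. \<forall>x. \<bar>f x\<bar> \<le> K * (1 + (\<Sum>i<m. \<bar>x i\<bar>)) ^ N)"

lemma poly_growthE:
  assumes "poly_growth m f" "poly_growth m g"
  obtains K N where "K \<ge> 0" "\<And>x. \<bar>f x\<bar> \<le> K * (1 + (\<Sum>i<m. \<bar>x i\<bar>)) ^ N" "\<And>x. \<bar>g x\<bar> \<le> K * (1 + (\<Sum>i<m. \<bar>x i\<bar>)) ^ N"
proof -
  obtain K N K' N' where *: "\<And>x. \<bar>f x\<bar> \<le> K * (1 + (\<Sum>i<m. \<bar>x i\<bar>)) ^ N" "\<And>x. \<bar>g x\<bar> \<le> K' * (1 + (\<Sum>i<m. \<bar>x i\<bar>)) ^ N'"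
    using assms by (auto simp: poly_growth_def)
  define L where "L = max \<bar>K\<bar> \<bar>K'\<bar>"
  have 1: "1 \<le> 1 + (\<Sum>i<m. \<bar>x i\<bar>)" for x :: "nat \<Rightarrow> real" by (simp add: sum_nonneg)
  have "\<bar>f x\<bar> \<le> L * (1 + (\<Sum>i<m. \<bar>x i\<bar>)) ^ (max N N')" "\<bar>g x\<bar> \<le> L * (1 + (\<Sum>i<m. \<bar>x i\<bar>)) ^ (max N N')" for x
  proof -
    let ?s = "1 + (\<Sum>i<m. \<bar>x i\<bar>)"
    have p: "0 \<le> ?s ^ N" "0 \<le> ?s ^ N'" using 1[of x] by simp_all
    have "K * ?s ^ N \<le> L * ?s ^ max N N'"
      using 1[of x] p by (intro mult_mono power_increasing) (auto simp: L_def[abs_def])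
    then show "\<bar>f x\<bar> \<le> L * ?s ^ max N N'" using *(1)[of x] by linarith
    have "K' * ?s ^ N' \<le> L * ?s ^ max N N'"
      using 1[of x] p by (intro mult_mono power_increasing) (auto simp: L_def[abs_def])
    then show "\<bar>g x\<bar> \<le> L * ?s ^ max N N'" using *(2)[of x] by linarith
  qed
  then show ?thesis using that[of L "max N N'"] by (auto simp: L_def[abs_def])
qed

lemma poly_growth_const: "poly_growth m (\<lambda>_. c)"
  unfolding poly_growth_def by (auto intro!: exI[of _ "\<bar>c\<bar>"] exI[of _ "0::nat"])

lemma poly_growth_coord: "i < m \<Longrightarrow> poly_growth m (\<lambda>x. x i)"
  unfolding poly_growth_def
proof (intro conjI exI allI)
  fix x :: "nat \<Rightarrow> real" assume "i < m"
  then have "\<bar>x i\<bar> \<le> (\<Sum>i<m. \<bar>x i\<bar>)" by (intro member_le_sum[of i _ "\<lambda>i. \<bar>x i\<bar>"]) auto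
  then show "\<bar>x i\<bar> \<le> 1 * (1 + (\<Sum>i<m. \<bar>x i\<bar>)) ^ 1" by simp
qed (auto intro: continuous_intros)

lemma poly_growth_add:
  assumes "poly_growth m f" "poly_growth m g" shows "poly_growth m (\<lambda>x. f x + g x)"
proof -
  obtain K N where K: "\<And>x. \<bar>f x\<bar> \<le> K * (1 + (\<Sum>i<m. \<bar>x i\<bar>)) ^ N" "\<And>x. \<bar>g x\<bar> \<le> K * (1 + (\<Sum>i<m. \<bar>x i\<bar>)) ^ N"
    using poly_growthE[OF assms] by metis
  have "\<bar>f x + g x\<bar> \<le> (2 * K) * (1 + (\<Sum>i<m. \<bar>x i\<bar>)) ^ N" for x
    using K(1)[of x] K(2)[of x] by linarith
  then show ?thesis using assms unfolding poly_growth_def by (auto intro: continuous_intros)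
qed

lemma poly_growth_mult:
  assumes "poly_growth m f" "poly_growth m g" shows "poly_growth m (\<lambda>x. f x * g x)"
proof -
  obtain K N where K: "K \<ge> 0" "\<And>x. \<bar>f x\<bar> \<le> K * (1 + (\<Sum>i<m. \<bar>x i\<bar>)) ^ N" "\<And>x. \<bar>g x\<bar> \<le> K * (1 + (\<Sum>i<m. \<bar>x i\<bar>)) ^ N"
    using poly_growthE[OF assms] by metis
  have "\<bar>f x * g x\<bar> \<le> (K * K) * (1 + (\<Sum>i<m. \<bar>x i\<bar>)) ^ (N + N)" for x
  proof -
    have "\<bar>f x\<bar> * \<bar>g x\<bar> \<le> (K * (1 + (\<Sum>i<m. \<bar>x i\<bar>)) ^ N) * (K * (1 + (\<Sum>i<m. \<bar>x i\<bar>)) ^ N)"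
      using K by (intro mult_mono) (auto simp: sum_nonneg)
    then show ?thesis by (simp add: abs_mult power_add mult_ac)
  qed
  then show ?thesis using assms unfolding poly_growth_def by (auto intro: continuous_intros)
qed

lemma poly_growth_sum:
  "(\<And>i. i \<in> I \<Longrightarrow> poly_growth m (f i)) \<Longrightarrow> poly_growth m (\<lambda>x. \<Sum>i\<in>I. f i x)"
proof (induction I rule: infinite_finite_induct)
  case (insert i I)
  then show ?case by (auto intro!: poly_growth_add)
qed (auto intro: poly_growth_const)

lemma poly_growth_uminus: "poly_growth m f \<Longrightarrow> poly_growth m (\<lambda>x. - f x)"
  using poly_growth_mult[OF poly_growth_const[of m "-1"]] by simp

lemma poly_growth_cos: "poly_growth m f \<Longrightarrow> poly_growth m (\<lambda>x. cos (f x))"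
  and poly_growth_sin: "poly_growth m f \<Longrightarrow> poly_growth m (\<lambda>x. sin (f x))"
  unfolding poly_growth_def
  by (auto intro!: continuous_intros exI[of _ "1::real"] exI[of _ "0::nat"])

text \<open>With \<open>v i\<close> equal to the inner product of \<open>h i\<close> and
  \<open>u\<close> this is the Malliavin derivative in direction \<open>u\<close> of the cylindrical
  variable. The derivative is carried as a second function, so that closure rules compose without
  differentiability side conditions, and both functions stay integrable in the Gaussian
  variables.\<close>

definition dir_deriv :: "nat \<Rightarrow> (nat \<Rightarrow> real) \<Rightarrow> ((nat \<Rightarrow> real) \<Rightarrow> real) \<Rightarrow> ((nat \<Rightarrow> real) \<Rightarrow> real) \<Rightarrow> bool" where
  "dir_deriv m v f f' \<longleftrightarrow> poly_growth m f \<and> poly_growth m f' \<and>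
     (\<forall>x. ((\<lambda>t. f (\<lambda>i. x i + t * v i)) has_real_derivative f' x) (at 0))"

lemma dir_deriv_const: "dir_deriv m v (\<lambda>_. c) (\<lambda>_. 0)"
  unfolding dir_deriv_def by (auto intro: poly_growth_const)

lemma dir_deriv_coord: "i < m \<Longrightarrow> dir_deriv m v (\<lambda>x. x i) (\<lambda>_. v i)"
  unfolding dir_deriv_def
  by (auto intro!: poly_growth_const poly_growth_coord derivative_eq_intros)

lemma dir_deriv_add: "dir_deriv m v f f' \<Longrightarrow> dir_deriv m v g g' \<Longrightarrow> dir_deriv m v (\<lambda>x. f x + g x) (\<lambda>x. f' x + g' x)"
  unfolding dir_deriv_def by (auto intro!: poly_growth_add DERIV_add)

lemma dir_deriv_mult:
  assumes "dir_deriv m v f f'" "dir_deriv m v g g'"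
  shows "dir_deriv m v (\<lambda>x. f x * g x) (\<lambda>x. f' x * g x + f x * g' x)"
proof -
  have "((\<lambda>t. f (\<lambda>i. x i + t * v i) * g (\<lambda>i. x i + t * v i)) has_real_derivative f' x * g x + f x * g' x) (at 0)" for x
    using DERIV_mult[of "\<lambda>t. f (\<lambda>i. x i + t * v i)" "f' x" 0 UNIV "\<lambda>t. g (\<lambda>i. x i + t * v i)" "g' x"] assms
    by (simp add: dir_deriv_def mult.commute)
  then show ?thesis using assms unfolding dir_deriv_def
    by (auto intro!: poly_growth_add poly_growth_mult)
qed

lemma dir_deriv_cos:
  assumes "dir_deriv m v f f'"
  shows "dir_deriv m v (\<lambda>x. cos (f x)) (\<lambda>x. - sin (f x) * f' x)"
proof -
  have "((\<lambda>t. cos (f (\<lambda>i. x i + t * v i))) has_real_derivative - sin (f x) * f' x) (at 0)" for x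
  proof -
    have "((\<lambda>t. f (\<lambda>i. x i + t * v i)) has_real_derivative f' x) (at 0)"
      using assms by (simp add: dir_deriv_def)
    from DERIV_fun_cos[OF this] show ?thesis by simp
  qed
  then show ?thesis using assms unfolding dir_deriv_def
    by (auto intro!: poly_growth_mult poly_growth_uminus poly_growth_cos poly_growth_sin)
qed

lemma dir_deriv_sin:
  assumes "dir_deriv m v f f'"
  shows "dir_deriv m v (\<lambda>x. sin (f x)) (\<lambda>x. cos (f x) * f' x)"
proof -
  have "((\<lambda>t. sin (f (\<lambda>i. x i + t * v i))) has_real_derivative cos (f x) * f' x) (at 0)" for x
  proof -
    have "((\<lambda>t. f (\<lambda>i. x i + t * v i)) has_real_derivative f' x) (at 0)"
      using assms by (simp add: dir_deriv_def)
    from DERIV_fun_sin[OF this] show ?thesis by simp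
  qed
  then show ?thesis using assms unfolding dir_deriv_def
    by (auto intro!: poly_growth_mult poly_growth_cos poly_growth_sin)
qed

lemma dir_deriv_along:
  assumes "dir_deriv m v f f'"
  shows "((\<lambda>t. f (\<lambda>i. x i + t * v i)) has_real_derivative f' (\<lambda>i. x i + s * v i)) (at s)"
proof -
  have "((\<lambda>t. f (\<lambda>i. (x i + s * v i) + t * v i)) has_real_derivative f' (\<lambda>i. x i + s * v i)) (at 0)"
    using assms by (simp add: dir_deriv_def)
  then have "((\<lambda>t. f (\<lambda>i. x i + (t + s) * v i)) has_real_derivative f' (\<lambda>i. x i + s * v i)) (at 0)"
    by (simp add: algebra_simps)
  then show ?thesis using DERIV_shift[of "\<lambda>t. f (\<lambda>i. x i + t * v i)" _ 0 s] by simp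
qed

section \<open>Gaussian integration by parts in several variables\<close>

context isonormal_gaussian_process
begin

lemma integrable_poly_growth_power:
  fixes h :: "nat \<Rightarrow> 'h"
  shows "integrable M (\<lambda>\<omega>. (1 + (\<Sum>i<m. \<bar>W (h i) \<omega>\<bar>)) ^ N)"
proof (rule Bochner_Integration.integrable_bound)
  show "integrable M (\<lambda>\<omega>. (1 + real m) ^ N * (1 + (\<Sum>i<m. (1 + \<bar>W (h i) \<omega>\<bar>) ^ N)))"
    by (intro integrable_mult_right Bochner_Integration.integrable_add Bochner_Integration.integrable_sum integrable_W_power) auto
  have "(1 + (\<Sum>i<m. \<bar>x i\<bar>)) ^ N \<le> (1 + real m) ^ N * (1 + (\<Sum>i<m. (1 + \<bar>x i\<bar>) ^ N))" for x :: "nat \<Rightarrow> real"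
  proof -
    \<comment> \<open>With 0 inserted the maximum also exists for m = 0.\<close>
    define B where "B = Max (insert 0 ((\<lambda>i. \<bar>x i\<bar>) ` {..<m}))"
    have B: "0 \<le> B" "\<And>i. i < m \<Longrightarrow> \<bar>x i\<bar> \<le> B" unfolding B_def by auto
    have "(\<Sum>i<m. \<bar>x i\<bar>) \<le> (\<Sum>i<m. B)" by (intro sum_mono B) auto
    then have "1 + (\<Sum>i<m. \<bar>x i\<bar>) \<le> (1 + real m) * (1 + B)" using B(1) by (simp add: algebra_simps)
    then have "(1 + (\<Sum>i<m. \<bar>x i\<bar>)) ^ N \<le> ((1 + real m) * (1 + B)) ^ N"
      by (intro power_mono) (auto simp: sum_nonneg)
    also have "\<dots> = (1 + real m) ^ N * (1 + B) ^ N" by (simp add: power_mult_distrib)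
    also have "\<dots> \<le> (1 + real m) ^ N * (1 + (\<Sum>i<m. (1 + \<bar>x i\<bar>) ^ N))"
    proof (intro mult_left_mono)
      have "B \<in> insert 0 ((\<lambda>i. \<bar>x i\<bar>) ` {..<m})" unfolding B_def by (intro Max_in) auto
      then consider "B = 0" | i where "i < m" "B = \<bar>x i\<bar>" by auto
      then show "(1 + B) ^ N \<le> 1 + (\<Sum>i<m. (1 + \<bar>x i\<bar>) ^ N)"
      proof cases
        case 1 then show ?thesis by (simp add: sum_nonneg)
      next
        case 2
        then have "(1 + B) ^ N \<le> (\<Sum>i<m. (1 + \<bar>x i\<bar>) ^ N)"
          using member_le_sum[of i "{..<m}" "\<lambda>i. (1 + \<bar>x i\<bar>) ^ N"] by auto
        then show ?thesis by simp
      qed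
    qed auto
    finally show ?thesis .
  qed
  then show "AE \<omega> in M. norm ((1 + (\<Sum>i<m. \<bar>W (h i) \<omega>\<bar>)) ^ N) \<le> norm ((1 + real m) ^ N * (1 + (\<Sum>i<m. (1 + \<bar>W (h i) \<omega>\<bar>) ^ N)))"
    by (intro AE_I2) (auto simp: sum_nonneg)
qed measurable

lemma measurable_W_seq[measurable]:
  fixes h :: "nat \<Rightarrow> 'h"
  shows "(\<lambda>\<omega> i. W (h i) \<omega>) \<in> measurable M borel"
  by (subst measurable_cong_sets[OF refl sets_PiM_equal_borel[symmetric]]) (intro measurable_abs_UNIV W_measurable)

lemma poly_growth_measurable: "poly_growth m f \<Longrightarrow> f \<in> borel_measurable borel"
  unfolding poly_growth_def by (auto intro: borel_measurable_continuous_onI)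

lemma integrable_poly_growth:
  assumes "poly_growth m f"
  shows "integrable M (\<lambda>\<omega>. f (\<lambda>i. W (h i) \<omega>))"
proof -
  obtain K N where K: "\<And>x. \<bar>f x\<bar> \<le> K * (1 + (\<Sum>i<m. \<bar>x i\<bar>)) ^ N"
    using assms by (auto simp: poly_growth_def)
  note [measurable] = poly_growth_measurable[OF assms]
  show ?thesis
  proof (rule Bochner_Integration.integrable_bound)
    show "integrable M (\<lambda>\<omega>. K * (1 + (\<Sum>i<m. \<bar>W (h i) \<omega>\<bar>)) ^ N)"
      by (intro integrable_mult_right integrable_poly_growth_power)
    show "AE \<omega> in M. norm (f (\<lambda>i. W (h i) \<omega>)) \<le> norm (K * (1 + (\<Sum>i<m. \<bar>W (h i) \<omega>\<bar>)) ^ N)"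
      using K by (intro AE_I2) (simp add: order_trans[OF _ abs_ge_self])
  qed measurable
qed

text \<open>Conditioning on the part of the process orthogonal to \<open>u\<close> reduces the claim to dimension one.\<close>

lemma integration_by_parts_unit:
  assumes u: "norm u = 1" and d: "dir_deriv m (\<lambda>i. h i \<bullet> u) \<psi> \<psi>'"
  shows "expectation (\<lambda>\<omega>. W u \<omega> * \<psi> (\<lambda>i. W (h i) \<omega>)) = expectation (\<lambda>\<omega>. \<psi>' (\<lambda>i. W (h i) \<omega>))"
proof -
  interpret P: pair_prob_space M M ..
  define v where "v i = h i \<bullet> u" for i
  \<comment> \<open>Place 0 holds \<open>u\<close>, place i + 1 the component of \<open>h i\<close>
    orthogonal to \<open>u\<close>; \<open>W_split_law\<close> applies to this sequence.\<close>
  define k where "k i = (case i of 0 \<Rightarrow> u | Suc i \<Rightarrow> h i - v i *\<^sub>R u)" for i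
  let ?P = "\<Pi>\<^sub>M i\<in>(UNIV::nat set). (borel::real measure)"
  have pg: "poly_growth m \<psi>" "poly_growth m \<psi>'" using d by (auto simp: dir_deriv_def)
  note [measurable] = pg[THEN poly_growth_measurable]
  obtain K N where K: "K \<ge> 0" "\<And>x. \<bar>\<psi> x\<bar> \<le> K * (1 + (\<Sum>i<m. \<bar>x i\<bar>)) ^ N" "\<And>x. \<bar>\<psi>' x\<bar> \<le> K * (1 + (\<Sum>i<m. \<bar>x i\<bar>)) ^ N"
    using poly_growthE[OF pg] by metis
  have orth: "k 0 \<bullet> k (Suc i) = 0" for i
    using u by (simp add: k_def v_def inner_simps norm_eq_1 inner_commute)
  have AEk: "AE \<omega> in M. \<forall>i. W (h i) \<omega> = W u \<omega> * v i + W (k (Suc i)) \<omega>"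
  proof (subst AE_all_countable, rule allI)
    fix i
    have "h i = v i *\<^sub>R u + 1 *\<^sub>R k (Suc i)" by (simp add: k_def)
    then show "AE \<omega> in M. W (h i) \<omega> = W u \<omega> * v i + W (k (Suc i)) \<omega>"
      using W_lincomb_AE[of "v i" u 1 "k (Suc i)"] by (auto elim!: eventually_mono)
  qed
  define L where "L z i = z 0 * v i + z (Suc i)" for z :: "nat \<Rightarrow> real" and i
  have Lm[measurable]: "L \<in> measurable ?P borel"
    by (subst measurable_cong_sets[OF refl sets_PiM_equal_borel[symmetric]])
       (auto simp: L_def intro!: measurable_abs_UNIV)
  have coord[measurable]: "(\<lambda>z. z 0) \<in> borel_measurable ?P" by measurable
  have m1[measurable]: "(\<lambda>\<omega> i. W (k i) \<omega>) \<in> measurable M ?P" by (intro measurable_PiM_single') auto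
  have m2[measurable]: "(\<lambda>z i. if i = 0 then W (k i) (snd z) else W (k i) (fst z)) \<in> measurable (M \<Otimes>\<^sub>M M) ?P"
    by (intro measurable_PiM_single') auto
  \<comment> \<open>After passing to the product law, Fubini's theorem freezes the orthogonal
    components and leaves an inner integral over \<open>W u\<close>, which is standard normal
    because \<open>u\<close> is a unit vector.\<close>
  have red: "expectation (\<lambda>\<omega>. \<Phi> (W u \<omega>) (\<lambda>i. W (h i) \<omega>)) =
      (\<integral>\<omega>. (\<integral>x. \<Phi> x (\<lambda>i. x * v i + W (k (Suc i)) \<omega>) \<partial>std_normal_distribution) \<partial>M)"
    if int: "integrable M (\<lambda>\<omega>. \<Phi> (W u \<omega>) (\<lambda>i. W (h i) \<omega>))"
      and m: "(\<lambda>(x, y). \<Phi> x y) \<in> borel_measurable (borel \<Otimes>\<^sub>M borel)" for \<Phi> :: "real \<Rightarrow> (nat \<Rightarrow> real) \<Rightarrow> real"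
  proof -
    have meas[measurable]: "(\<lambda>z. \<Phi> (z 0) (L z)) \<in> borel_measurable ?P"
      using measurable_compose[OF measurable_Pair[OF coord Lm] m] by simp
    note meas2[measurable] = meas[unfolded L_def[abs_def]]
    have AE: "AE \<omega> in M. \<Phi> (W u \<omega>) (\<lambda>i. W (h i) \<omega>) = \<Phi> (W (k 0) \<omega>) (L (\<lambda>i. W (k i) \<omega>))"
      using AEk
    proof eventually_elim
      case (elim \<omega>)
      have "L (\<lambda>i. W (k i) \<omega>) = (\<lambda>i. W (h i) \<omega>)" using elim by (auto simp: L_def k_def)
      then show ?case by (simp add: k_def)
    qed
    have m3: "(\<lambda>\<omega>. \<Phi> (W u \<omega>) (\<lambda>i. W (h i) \<omega>)) \<in> borel_measurable M"
      using borel_measurable_integrable[OF int] .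
    have m4: "(\<lambda>\<omega>. \<Phi> (W (k 0) \<omega>) (L (\<lambda>i. W (k i) \<omega>))) \<in> borel_measurable M"
      using measurable_compose[OF m1 meas] .
    have "integrable M (\<lambda>\<omega>. \<Phi> (W (k 0) \<omega>) (L (\<lambda>i. W (k i) \<omega>)))"
      using int by (rule integrable_cong_AE_imp) (use AE m4 in \<open>auto elim!: eventually_mono\<close>)
    then have "integrable (distr M ?P (\<lambda>\<omega> i. W (k i) \<omega>)) (\<lambda>z. \<Phi> (z 0) (L z))"
      by (subst integrable_distr_eq) auto
    then have int2: "integrable (M \<Otimes>\<^sub>M M) (\<lambda>z. \<Phi> (W (k 0) (snd z)) (\<lambda>i. W (k 0) (snd z) * v i + W (k (Suc i)) (fst z)))"
      unfolding W_split_law[OF orth] by (subst (asm) integrable_distr_eq) (auto simp: L_def[abs_def])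
    have "expectation (\<lambda>\<omega>. \<Phi> (W u \<omega>) (\<lambda>i. W (h i) \<omega>)) = expectation (\<lambda>\<omega>. \<Phi> (W (k 0) \<omega>) (L (\<lambda>i. W (k i) \<omega>)))"
      using AE m3 m4 by (intro integral_cong_AE)
    also have "\<dots> = (\<integral>z. \<Phi> (z 0) (L z) \<partial>distr M ?P (\<lambda>\<omega> i. W (k i) \<omega>))"
      by (subst integral_distr) auto
    also have "\<dots> = (\<integral>z. \<Phi> (W (k 0) (snd z)) (\<lambda>i. W (k 0) (snd z) * v i + W (k (Suc i)) (fst z)) \<partial>(M \<Otimes>\<^sub>M M))"
      unfolding W_split_law[OF orth] by (subst integral_distr) (auto simp: L_def[abs_def])
    also have "\<dots> = (\<integral>\<omega>. (\<integral>\<omega>'. \<Phi> (W u \<omega>') (\<lambda>i. W u \<omega>' * v i + W (k (Suc i)) \<omega>) \<partial>M) \<partial>M)"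
      using int2 by (subst P.integral_fst'[symmetric]) (auto simp: k_def)
    also have "\<dots> = (\<integral>\<omega>. (\<integral>x. \<Phi> x (\<lambda>i. x * v i + W (k (Suc i)) \<omega>) \<partial>std_normal_distribution) \<partial>M)"
    proof (intro Bochner_Integration.integral_cong refl)
      fix \<omega>
      have "(\<lambda>x i. x * v i + W (k (Suc i)) \<omega>) \<in> measurable borel borel"
        by (subst measurable_cong_sets[OF refl sets_PiM_equal_borel[symmetric]]) (auto intro!: measurable_abs_UNIV)
      from measurable_compose[OF measurable_Pair[OF measurable_ident this] m]
      have "(\<lambda>x. \<Phi> x (\<lambda>i. x * v i + W (k (Suc i)) \<omega>)) \<in> borel_measurable borel" by simp
      from integral_W[OF this, of u]
      show "(\<integral>\<omega>'. \<Phi> (W u \<omega>') (\<lambda>i. W u \<omega>' * v i + W (k (Suc i)) \<omega>) \<partial>M) = (\<integral>x. \<Phi> x (\<lambda>i. x * v i + W (k (Suc i)) \<omega>) \<partial>std_normal_distribution)"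
        by (simp add: u)
    qed
    finally show ?thesis .
  qed
  have int1: "integrable M (\<lambda>\<omega>. W u \<omega> * \<psi> (\<lambda>i. W (h i) \<omega>))"
  proof -
    define h' where "h' i = (case i of 0 \<Rightarrow> u | Suc i \<Rightarrow> h i)" for i
    have "\<bar>W u \<omega> * \<psi> (\<lambda>i. W (h i) \<omega>)\<bar> \<le> K * (1 + (\<Sum>i<Suc m. \<bar>W (h' i) \<omega>\<bar>)) ^ Suc N" for \<omega>
    proof -
      let ?s = "1 + (\<Sum>i<Suc m. \<bar>W (h' i) \<omega>\<bar>)"
      have s: "?s = 1 + \<bar>W u \<omega>\<bar> + (\<Sum>i<m. \<bar>W (h i) \<omega>\<bar>)"
        by (simp only: sum.lessThan_Suc_shift) (simp add: h'_def)
      have "\<bar>W u \<omega>\<bar> * \<bar>\<psi> (\<lambda>i. W (h i) \<omega>)\<bar> \<le> ?s * (K * ?s ^ N)"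
      proof (intro mult_mono order_trans[OF K(2)] mult_left_mono power_mono)
        show "0 \<le> 1 + (\<Sum>i<m. \<bar>W (h i) \<omega>\<bar>)" by (simp add: sum_nonneg)
        show "\<bar>W u \<omega>\<bar> \<le> ?s" unfolding s by (simp add: sum_nonneg)
        show "1 + (\<Sum>i<m. \<bar>W (h i) \<omega>\<bar>) \<le> ?s" unfolding s by simp
      qed (use K(1) in \<open>auto simp: sum_nonneg add_nonneg_nonneg\<close>)
      then show ?thesis by (simp add: abs_mult mult_ac)
    qed
    then have "AE \<omega> in M. norm (W u \<omega> * \<psi> (\<lambda>i. W (h i) \<omega>)) \<le> norm (K * (1 + (\<Sum>i<Suc m. \<bar>W (h' i) \<omega>\<bar>)) ^ Suc N)"
      by (intro AE_I2) (metis abs_ge_self order_trans real_norm_def)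
    then show ?thesis
      by (intro Bochner_Integration.integrable_bound[OF integrable_mult_right[OF integrable_poly_growth_power[of h' "Suc m" "Suc N"], of K]])
         measurable
  qed
  have "expectation (\<lambda>\<omega>. W u \<omega> * \<psi> (\<lambda>i. W (h i) \<omega>)) = 
     (\<integral>\<omega>. (\<integral>x. x * \<psi> (\<lambda>i. x * v i + W (k (Suc i)) \<omega>) \<partial>std_normal_distribution) \<partial>M)"
    using int1 by (rule red[of "\<lambda>x y. x * \<psi> y"]) measurable
  also have "\<dots> = (\<integral>\<omega>. (\<integral>x. \<psi>' (\<lambda>i. x * v i + W (k (Suc i)) \<omega>) \<partial>std_normal_distribution) \<partial>M)"
  proof (rule Bochner_Integration.integral_cong[OF refl])
    fix \<omega>
    define y where "y i = W (k (Suc i)) \<omega>" for i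
    \<comment> \<open>For a frozen point the sum of the absolute values of \<open>y i\<close> + x *
      \<open>v i\<close> plus 1 is at most c * (1 + \<bar>x\<bar>), so the one-dimensional growth
      condition holds with constant K * c^N.\<close>
    define c where "c = 1 + (\<Sum>i<m. \<bar>v i\<bar>) + (\<Sum>i<m. \<bar>y i\<bar>)"
    have "(\<integral>x. x * \<psi> (\<lambda>i. y i + x * v i) \<partial>std_normal_distribution) = (\<integral>x. \<psi>' (\<lambda>i. y i + x * v i) \<partial>std_normal_distribution)"
    proof (rule gaussian_integration_by_parts[where K = "K * c ^ N" and N = N])
      show "((\<lambda>x. \<psi> (\<lambda>i. y i + x * v i)) has_real_derivative \<psi>' (\<lambda>i. y i + x * v i)) (at x)" for x
        using dir_deriv_along[OF d] by (simp add: v_def)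
      have "continuous_on UNIV (\<lambda>x i. y i + x * v i)"
        by (intro continuous_on_coordinatewise_then_product continuous_intros)
      from continuous_on_compose2[OF _ this, of UNIV \<psi>']
      show "continuous_on UNIV (\<lambda>x. \<psi>' (\<lambda>i. y i + x * v i))"
        using pg(2) by (simp add: poly_growth_def)
      have b: "1 + (\<Sum>i<m. \<bar>y i + x * v i\<bar>) \<le> c * (1 + \<bar>x\<bar>)" for x
      proof -
        have "(\<Sum>i<m. \<bar>y i + x * v i\<bar>) \<le> (\<Sum>i<m. \<bar>y i\<bar> + \<bar>x\<bar> * \<bar>v i\<bar>)"
          by (intro sum_mono order_trans[OF abs_triangle_ineq]) (simp add: abs_mult)
        also have "\<dots> = (\<Sum>i<m. \<bar>y i\<bar>) + \<bar>x\<bar> * (\<Sum>i<m. \<bar>v i\<bar>)" by (simp add: sum.distrib sum_distrib_left)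
        finally have "1 + (\<Sum>i<m. \<bar>y i + x * v i\<bar>) \<le> 1 + (\<Sum>i<m. \<bar>y i\<bar>) + (\<Sum>i<m. \<bar>v i\<bar>) * \<bar>x\<bar>"
          by (simp add: mult.commute)
        moreover have "0 \<le> (\<Sum>i<m. \<bar>v i\<bar>)" "0 \<le> 1 * \<bar>x\<bar> + (\<Sum>i<m. \<bar>y i\<bar>) * \<bar>x\<bar>"
          by (simp_all add: sum_nonneg add_nonneg_nonneg)
        ultimately show ?thesis
          unfolding c_def distrib_left distrib_right mult_1_right by linarith
      qed
      have b2: "K * (1 + (\<Sum>i<m. \<bar>y i + x * v i\<bar>)) ^ N \<le> K * c ^ N * (1 + \<bar>x\<bar>) ^ N" for x
        unfolding mult.assoc power_mult_distrib[symmetric]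
        by (intro mult_left_mono power_mono b K(1)) (simp add: sum_nonneg)
      show "\<bar>\<psi> (\<lambda>i. y i + x * v i)\<bar> \<le> K * c ^ N * (1 + \<bar>x\<bar>) ^ N" for x
        using K(2)[of "\<lambda>i. y i + x * v i"] b2[of x] by linarith
      show "\<bar>\<psi>' (\<lambda>i. y i + x * v i)\<bar> \<le> K * c ^ N * (1 + \<bar>x\<bar>) ^ N" for x
        using K(3)[of "\<lambda>i. y i + x * v i"] b2[of x] by linarith
    qed
    then show "(\<integral>x. x * \<psi> (\<lambda>i. x * v i + W (k (Suc i)) \<omega>) \<partial>std_normal_distribution) =
      (\<integral>x. \<psi>' (\<lambda>i. x * v i + W (k (Suc i)) \<omega>) \<partial>std_normal_distribution)"
      by (simp add: y_def add.commute)
  qed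
  also have "\<dots> = expectation (\<lambda>\<omega>. \<psi>' (\<lambda>i. W (h i) \<omega>))"
    by (rule red[of "\<lambda>x y. \<psi>' y", symmetric]) (auto intro: integrable_poly_growth pg)
  finally show ?thesis .
qed

text \<open>Both sides are linear in \<open>u\<close>, so rescaling reduces to unit vectors; for
  \<open>u\<close> = 0 the derivative is 0 and \<open>W u\<close> vanishes almost surely.\<close>

lemma integration_by_parts:
  assumes d: "dir_deriv m (\<lambda>i. h i \<bullet> u) \<psi> \<psi>'"
  shows "expectation (\<lambda>\<omega>. W u \<omega> * \<psi> (\<lambda>i. W (h i) \<omega>)) = expectation (\<lambda>\<omega>. \<psi>' (\<lambda>i. W (h i) \<omega>))"
proof (cases "u = 0")
  case True
  have "\<psi>' x = 0" for x
  proof -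
    have "((\<lambda>t. \<psi> x) has_real_derivative \<psi>' x) (at 0)" using d True by (simp add: dir_deriv_def)
    then show ?thesis using DERIV_const DERIV_unique by blast
  qed
  moreover have "expectation (\<lambda>\<omega>. W u \<omega> * \<psi> (\<lambda>i. W (h i) \<omega>)) = expectation (\<lambda>\<omega>. 0)"
    using W_zero_AE True d poly_growth_measurable[of m \<psi>] by (intro integral_cong_AE) (auto simp: dir_deriv_def)
  ultimately show ?thesis by simp
next
  case False
  define e where "e = (1 / norm u) *\<^sub>R u"
  have e: "norm e = 1" "u = norm u *\<^sub>R e" using False by (simp_all add: e_def)
  have "dir_deriv m (\<lambda>i. h i \<bullet> e) \<psi> (\<lambda>x. (1 / norm u) * \<psi>' x)"
  proof -
    have "((\<lambda>t. \<psi> (\<lambda>i. x i + t * (h i \<bullet> e))) has_real_derivative \<psi>' x * (1 / norm u)) (at 0)" for x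
    proof -
      have "((\<lambda>t. \<psi> (\<lambda>i. x i + t * (h i \<bullet> u))) has_real_derivative \<psi>' x) (at ((0::real) * (1 / norm u)))"
        using d by (simp add: dir_deriv_def)
      moreover have "((\<lambda>t. t * c) has_real_derivative c) (at 0)" for c :: real
        by (auto intro!: derivative_eq_intros)
      then have "((\<lambda>t. t * (1 / norm u)) has_real_derivative (1 / norm u)) (at 0)" .
      ultimately have "((\<lambda>t. \<psi> (\<lambda>i. x i + (t * (1 / norm u)) * (h i \<bullet> u))) has_real_derivative \<psi>' x * (1 / norm u)) (at 0)"
        by (rule DERIV_chain2)
      then show ?thesis by (simp add: e_def)
    qed
    moreover have "poly_growth m (\<lambda>x. (1 / norm u) * \<psi>' x)"
      using d by (intro poly_growth_mult poly_growth_const) (simp add: dir_deriv_def)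
    ultimately show ?thesis using d by (simp add: dir_deriv_def mult.commute)
  qed
  from integration_by_parts_unit[OF e(1) this]
  have *: "expectation (\<lambda>\<omega>. W e \<omega> * \<psi> (\<lambda>i. W (h i) \<omega>)) = (1 / norm u) * expectation (\<lambda>\<omega>. \<psi>' (\<lambda>i. W (h i) \<omega>))"
    by simp
  have "AE \<omega> in M. W u \<omega> = norm u * W e \<omega>"
    using W_lincomb_AE[of "norm u" e 0 0] e(2) by (auto elim!: eventually_mono)
  then have "expectation (\<lambda>\<omega>. W u \<omega> * \<psi> (\<lambda>i. W (h i) \<omega>)) = expectation (\<lambda>\<omega>. norm u * (W e \<omega> * \<psi> (\<lambda>i. W (h i) \<omega>)))"
    using d poly_growth_measurable[of m \<psi>] by (intro integral_cong_AE) (auto simp: dir_deriv_def)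
  then show ?thesis using * False by simp
qed

end

subsection \<open>The directional derivative of smooth cylindrical functions\<close>

lemma poly_growth_mono:
  assumes "poly_growth m f" "m \<le> m'" shows "poly_growth m' f"
proof -
  obtain K N where K: "K \<ge> 0" "\<And>x. \<bar>f x\<bar> \<le> K * (1 + (\<Sum>i<m. \<bar>x i\<bar>)) ^ N"
    using poly_growthE[OF assms(1,1)] by metis
  have "\<bar>f x\<bar> \<le> K * (1 + (\<Sum>i<m'. \<bar>x i\<bar>)) ^ N" for x
  proof -
    have "(\<Sum>i<m. \<bar>x i\<bar>) \<le> (\<Sum>i<m'. \<bar>x i\<bar>)" using assms(2) by (intro sum_mono2) auto
    then have "K * (1 + (\<Sum>i<m. \<bar>x i\<bar>)) ^ N \<le> K * (1 + (\<Sum>i<m'. \<bar>x i\<bar>)) ^ N"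
      using K(1) by (intro mult_left_mono power_mono) (auto simp: sum_nonneg)
    then show ?thesis using K(2)[of x] by linarith
  qed
  then show ?thesis using assms unfolding poly_growth_def by auto
qed

text \<open>Only existence and continuity of partial derivatives are available, not total
  differentiability. The base point \<open>y t\<close> moves with t, so the difference quotient is
  rewritten by the mean value theorem as the partial derivative at an intermediate point, which
  converges by continuity.\<close>

lemma chain_rule_coord:
  fixes f :: "(nat \<Rightarrow> real) \<Rightarrow> real"
  assumes p: "\<And>x. ((\<lambda>s. f (x(j := s))) has_real_derivative p x) (at (x j))"
    and cont: "continuous_on UNIV p"
    and y: "\<And>i. continuous_on UNIV (\<lambda>t. y t i)" "\<And>i. y 0 i = x i" "\<And>t. y t j = x j"
  shows "((\<lambda>t. f ((y t)(j := x j + t * v)) - f (y t)) has_real_derivative v * p x) (at 0)"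
proof -
  let ?z = "\<lambda>t \<tau>. (y t)(j := x j + \<tau> * v)"
  have mvt: "\<exists>\<tau>. \<bar>\<tau>\<bar> \<le> \<bar>t\<bar> \<and> f (?z t t) - f (y t) = t * (v * p (?z t \<tau>))" for t
  proof -
    have D: "((\<lambda>s. f (?z t (s * t))) has_real_derivative p (?z t (s * t)) * (t * v)) (at s)" for s
    proof -
      have "((\<lambda>u. f ((?z t (s * t))(j := u))) has_real_derivative p (?z t (s * t))) (at (x j + s * t * v))"
        using p[of "?z t (s * t)"] by simp
      moreover have "((\<lambda>s. x j + s * t * v) has_real_derivative t * v) (at s)"
        by (auto intro!: derivative_eq_intros)
      ultimately have "((\<lambda>s'. f ((?z t (s * t))(j := x j + s' * t * v))) has_real_derivative p (?z t (s * t)) * (t * v)) (at s)"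
        by (rule DERIV_chain2)
      then show ?thesis by simp
    qed
    obtain s where s: "0 < s" "s < 1" "f (?z t (1 * t)) - f (?z t (0 * t)) = (1 - 0) * (p (?z t (s * t)) * (t * v))"
      using MVT2[of 0 1 "\<lambda>s. f (?z t (s * t))" "\<lambda>s. p (?z t (s * t)) * (t * v)"] D by auto
    have "?z t (0 * t) = y t" using y(3)[of t] by auto
    then show ?thesis using s by (intro exI[of _ "s * t"]) (auto simp: abs_mult mult_left_le_one_le)
  qed
  then obtain \<tau> where \<tau>: "\<And>t. \<bar>\<tau> t\<bar> \<le> \<bar>t\<bar>" "\<And>t. f (?z t t) - f (y t) = t * (v * p (?z t (\<tau> t)))"
    by metis
  have "(\<tau> \<longlongrightarrow> 0) (at 0)"
    by (rule Lim_null_comparison[where g = "\<lambda>t. \<bar>t\<bar>"]) (auto simp: \<tau> intro!: tendsto_eq_intros)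
  then have lim: "((\<lambda>t. (t, \<tau> t)) \<longlongrightarrow> (0, 0)) (at 0)" by (intro tendsto_Pair tendsto_ident_at)
  have "continuous_on UNIV (\<lambda>q :: real \<times> real. ?z (fst q) (snd q))"
  proof (rule continuous_on_coordinatewise_then_product)
    fix i
    have "continuous_on UNIV (\<lambda>q :: real \<times> real. y (fst q) i)"
      by (rule continuous_on_compose2[OF y(1)]) (auto intro: continuous_intros)
    then show "continuous_on UNIV (\<lambda>q :: real \<times> real. (?z (fst q) (snd q)) i)"
      by (cases "i = j") (auto intro!: continuous_intros)
  qed
  from continuous_on_compose2[OF cont this]
  have "continuous_on UNIV (\<lambda>q :: real \<times> real. p (?z (fst q) (snd q)))" by simp
  then have "isCont (\<lambda>q :: real \<times> real. p (?z (fst q) (snd q))) (0, 0)"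
    by (simp add: continuous_on_eq_continuous_at)
  from isCont_tendsto_compose[OF this lim]
  have "((\<lambda>t. p (?z t (\<tau> t))) \<longlongrightarrow> p (?z 0 0)) (at 0)" by simp
  moreover have "?z 0 0 = x" using y(2) by auto
  ultimately have "((\<lambda>t. v * p (?z t (\<tau> t))) \<longlongrightarrow> v * p x) (at 0)" by (auto intro: tendsto_intros)
  then show ?thesis
    unfolding has_field_derivative_iff
  proof (rule Lim_transform_eventually)
    have "y 0 = x" using y(2) by auto
    then show "\<forall>\<^sub>F t in at 0. v * p (?z t (\<tau> t)) = (f (?z t t) - f (y t) - (f (?z 0 0) - f (y 0))) / (t - 0)"
      by (auto simp: eventually_at_filter \<tau>(2) \<open>?z 0 0 = x\<close>)
  qed
qed

text \<open>The coordinates below \<open>m\<close> are moved one after another; each move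
  contributes one summand by \<open>chain_rule_coord\<close>, applied at a base point in which the
  earlier coordinates have already moved.\<close>

lemma chain_rule_dir:
  fixes f :: "(nat \<Rightarrow> real) \<Rightarrow> real"
  assumes dep: "\<And>x y. (\<forall>i<m. x i = y i) \<Longrightarrow> f x = f y"
    and p: "\<And>x j. j < m \<Longrightarrow> ((\<lambda>s. f (x(j := s))) has_real_derivative p j x) (at (x j))"
    and cont: "\<And>j. j < m \<Longrightarrow> continuous_on UNIV (p j)"
  shows "((\<lambda>t. f (\<lambda>i. x i + t * v i)) has_real_derivative (\<Sum>j<m. v j * p j x)) (at 0)"
proof -
  define y where "y k t i = (if i < k then x i + t * v i else x i)" for k and t :: real and i :: nat
  have "((\<lambda>t. f (y k t)) has_real_derivative (\<Sum>j<k. v j * p j x)) (at 0)" if "k \<le> m" for k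
    using that
  proof (induction k)
    case 0
    have "y 0 = (\<lambda>t. x)" by (intro ext) (simp add: y_def)
    then show ?case by simp
  next
    case (Suc k)
    have "((\<lambda>t. f ((y k t)(k := x k + t * v k)) - f (y k t)) has_real_derivative v k * p k x) (at 0)"
    proof (rule chain_rule_coord)
      show "continuous_on UNIV (\<lambda>t. y k t i)" for i
        by (cases "i < k") (auto simp: y_def intro!: continuous_intros)
      have "k < m" using Suc by simp
      then show "((\<lambda>s. f (x(k := s))) has_real_derivative p k x) (at (x k))" "continuous_on UNIV (p k)" for x
        by (rule p, rule cont)
    qed (auto simp: y_def)
    moreover have "(y k t)(k := x k + t * v k) = y (Suc k) t" for t by (auto simp: y_def)
    ultimately have "((\<lambda>t. (f (y (Suc k) t) - f (y k t)) + f (y k t)) has_real_derivative v k * p k x + (\<Sum>j<k. v j * p j x)) (at 0)"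
      using Suc by (intro DERIV_add) auto
    then show ?case by (simp add: add.commute)
  qed
  from this[of m] have "((\<lambda>t. f (y m t)) has_real_derivative (\<Sum>j<m. v j * p j x)) (at 0)" by simp
  moreover have "f (y m t) = f (\<lambda>i. x i + t * v i)" for t by (rule dep) (auto simp: y_def)
  ultimately show ?thesis by simp
qed

lemma iter_partial_Cons: "iter_partial (j # is) \<phi> = partial_deriv j (iter_partial is \<phi>)"
  by (simp add: iter_partial_def)

lemma iter_partial_depends:
  assumes "\<And>x y. (\<forall>i<m. x i = y i) \<Longrightarrow> \<phi> x = \<phi> y" "set is \<subseteq> {..<m}" "\<forall>i<m. x i = y i"
  shows "iter_partial is \<phi> x = iter_partial is \<phi> y"
  using assms(2,3)
proof (induction "is" arbitrary: x y)
  case Nil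
  then show ?case using assms(1) by (simp add: iter_partial_def)
next
  case (Cons j "is")
  have "iter_partial is \<phi> (x(j := t)) = iter_partial is \<phi> (y(j := t))" for t
    using Cons by auto
  moreover have "x j = y j" using Cons by auto
  ultimately show ?case by (simp add: iter_partial_Cons partial_deriv_def)
qed

text \<open>The bound \<open>m'\<close> may exceed \<open>m\<close> so that further coordinates can
  be appended for test functions.\<close>

lemma smooth_poly_growth_dir_deriv:
  assumes s: "smooth_poly_growth m \<phi>" and idx: "set is \<subseteq> {..<m}" and m: "m \<le> m'"
  shows "dir_deriv m' v (iter_partial is \<phi>) (\<lambda>x. \<Sum>j<m. v j * iter_partial (j # is) \<phi> x)"
proof -
  have pg: "poly_growth m' (iter_partial is \<phi>)" if "set is \<subseteq> {..<m}" for "is"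
    by (rule poly_growth_mono[OF _ m])
       (use s that in \<open>unfold smooth_poly_growth_def poly_growth_def, blast\<close>)
  have dep: "iter_partial is \<phi> x = iter_partial is \<phi> y" if "\<forall>i<m. x i = y i" for x y
    using s idx that by (intro iter_partial_depends[of m]) (auto simp: smooth_poly_growth_def)
  have D: "((\<lambda>s. iter_partial is \<phi> (x(j := s))) has_real_derivative iter_partial (j # is) \<phi> x) (at (x j))" if "j < m" for j x
    using s idx that unfolding iter_partial_Cons partial_deriv_def DERIV_deriv_iff_real_differentiable
    by (auto simp: smooth_poly_growth_def)
  have c: "continuous_on UNIV (iter_partial (j # is) \<phi>)" if "j < m" for j
    using pg[of "j # is"] idx that by (auto simp: poly_growth_def)
  show ?thesis
    unfolding dir_deriv_def
  proof (intro conjI allI)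
    show "poly_growth m' (iter_partial is \<phi>)" using pg idx by blast
    show "poly_growth m' (\<lambda>x. \<Sum>j<m. v j * iter_partial (j # is) \<phi> x)"
      using idx by (intro poly_growth_sum poly_growth_mult poly_growth_const pg) auto
    show "((\<lambda>t. iter_partial is \<phi> (\<lambda>i. x i + t * v i)) has_real_derivative (\<Sum>j<m. v j * iter_partial (j # is) \<phi> x)) (at 0)" for x
      by (rule chain_rule_dir[OF dep D c])
  qed
qed

section \<open>Duality between cylindrical derivatives and the process\<close>

context isonormal_gaussian_process
begin

text \<open>The product rule for an iterated partial derivative times a test function
  \<open>T\<close> of \<open>W g\<close>, integrated against \<open>W u\<close>. The pair
  \<open>T\<close>, \<open>T'\<close> stands for cos and sin with their derivatives, so both are
  treated by one argument.\<close>

lemma cylinder_integration_by_parts: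
  fixes T T' :: "real \<Rightarrow> real"
  assumes s: "smooth_poly_growth m \<phi>" and idx: "set is \<subseteq> {..<m}"
    and T: "\<And>f f' v. dir_deriv (Suc m) v f f' \<Longrightarrow> dir_deriv (Suc m) v (\<lambda>x. T (f x)) (\<lambda>x. T' (f x) * f' x)"
  shows "expectation (\<lambda>\<omega>. (\<Sum>j<m. (h j \<bullet> u) * iter_partial (j # is) \<phi> (\<lambda>i. W (h i) \<omega>)) * T (W g \<omega>)) =
    expectation (\<lambda>\<omega>. iter_partial is \<phi> (\<lambda>i. W (h i) \<omega>) * (W u \<omega> * T (W g \<omega>) - (g \<bullet> u) * T' (W g \<omega>)))"
proof -
  \<comment> \<open>Place \<open>m\<close>, which \<open>\<phi>\<close> does not read, carries the
    test vector \<open>g\<close>.\<close>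
  define h' where "h' = h(m := g)"
  let ?v = "\<lambda>i. h' i \<bullet> u"
  have dep: "iter_partial is \<phi> x = iter_partial is \<phi> y" if "\<forall>i<m. x i = y i" "set is \<subseteq> {..<m}" for x y "is"
    using s that by (intro iter_partial_depends[of m]) (auto simp: smooth_poly_growth_def)
  have eq: "iter_partial is \<phi> (\<lambda>i. W (h' i) \<omega>) = iter_partial is \<phi> (\<lambda>i. W (h i) \<omega>)" if "set is \<subseteq> {..<m}" for "is" \<omega>
    using that by (intro dep) (auto simp: h'_def)
  have g: "h' m = g" by (simp add: h'_def)
  have dT: "dir_deriv (Suc m) ?v (\<lambda>x. T (x m)) (\<lambda>x. T' (x m) * (g \<bullet> u))"
    using T[OF dir_deriv_coord[of m "Suc m" ?v]] by (simp add: g)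
  have dI: "dir_deriv (Suc m) ?v (iter_partial is \<phi>) (\<lambda>x. \<Sum>j<m. ?v j * iter_partial (j # is) \<phi> x)"
    by (rule smooth_poly_growth_dir_deriv[OF s idx]) simp
  have d: "dir_deriv (Suc m) ?v (\<lambda>x. iter_partial is \<phi> x * T (x m))
     (\<lambda>x. (\<Sum>j<m. ?v j * iter_partial (j # is) \<phi> x) * T (x m) + iter_partial is \<phi> x * (T' (x m) * (g \<bullet> u)))"
    by (rule dir_deriv_mult[OF dI dT])
  have pgs: "poly_growth (Suc m) (\<lambda>x. (\<Sum>j<m. ?v j * iter_partial (j # is) \<phi> x) * T (x m))"
      "poly_growth (Suc m) (\<lambda>x. iter_partial is \<phi> x * (T' (x m) * (g \<bullet> u)))"
    using dT dI by (auto simp: dir_deriv_def intro!: poly_growth_mult)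
  have "expectation (\<lambda>\<omega>. W u \<omega> * (iter_partial is \<phi> (\<lambda>i. W (h' i) \<omega>) * T (W (h' m) \<omega>))) =
     expectation (\<lambda>\<omega>. (\<Sum>j<m. ?v j * iter_partial (j # is) \<phi> (\<lambda>i. W (h' i) \<omega>)) * T (W (h' m) \<omega>) + iter_partial is \<phi> (\<lambda>i. W (h' i) \<omega>) * (T' (W (h' m) \<omega>) * (g \<bullet> u)))"
    by (rule integration_by_parts[OF d])
  also have "\<dots> = expectation (\<lambda>\<omega>. (\<Sum>j<m. ?v j * iter_partial (j # is) \<phi> (\<lambda>i. W (h' i) \<omega>)) * T (W (h' m) \<omega>)) +
     expectation (\<lambda>\<omega>. iter_partial is \<phi> (\<lambda>i. W (h' i) \<omega>) * (T' (W (h' m) \<omega>) * (g \<bullet> u)))"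
    using integrable_poly_growth[OF pgs(1), of h'] integrable_poly_growth[OF pgs(2), of h'] by (intro Bochner_Integration.integral_add)
  finally have 1: "expectation (\<lambda>\<omega>. (\<Sum>j<m. ?v j * iter_partial (j # is) \<phi> (\<lambda>i. W (h' i) \<omega>)) * T (W (h' m) \<omega>)) =
    expectation (\<lambda>\<omega>. W u \<omega> * (iter_partial is \<phi> (\<lambda>i. W (h' i) \<omega>) * T (W (h' m) \<omega>))) -
    expectation (\<lambda>\<omega>. iter_partial is \<phi> (\<lambda>i. W (h' i) \<omega>) * (T' (W (h' m) \<omega>) * (g \<bullet> u)))" by simp
  have int: "integrable M (\<lambda>\<omega>. W u \<omega> * (iter_partial is \<phi> (\<lambda>i. W (h' i) \<omega>) * T (W (h' m) \<omega>)))"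
  proof -
    \<comment> \<open>A further place carries \<open>u\<close>, which makes the product with
      \<open>W u\<close> a function of polynomial growth.\<close>
    define h'' where "h'' = h'(Suc m := u)"
    have "poly_growth (Suc (Suc m)) (\<lambda>x. x (Suc m) * (iter_partial is \<phi> x * T (x m)))"
      by (intro poly_growth_mult[OF poly_growth_coord] poly_growth_mono[of "Suc m" _ "Suc (Suc m)"])
         (use d in \<open>auto simp: dir_deriv_def\<close>)
    from integrable_poly_growth[OF this, of h'']
    have "integrable M (\<lambda>\<omega>. W (h'' (Suc m)) \<omega> * (iter_partial is \<phi> (\<lambda>i. W (h'' i) \<omega>) * T (W (h'' m) \<omega>)))" .
    moreover have "iter_partial is \<phi> (\<lambda>i. W (h'' i) \<omega>) = iter_partial is \<phi> (\<lambda>i. W (h' i) \<omega>)" for \<omega>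
      using idx by (intro dep) (auto simp: h''_def)
    ultimately show ?thesis by (simp add: h''_def)
  qed
  have "expectation (\<lambda>\<omega>. (\<Sum>j<m. ?v j * iter_partial (j # is) \<phi> (\<lambda>i. W (h' i) \<omega>)) * T (W (h' m) \<omega>)) =
    expectation (\<lambda>\<omega>. W u \<omega> * (iter_partial is \<phi> (\<lambda>i. W (h' i) \<omega>) * T (W (h' m) \<omega>)) -
      iter_partial is \<phi> (\<lambda>i. W (h' i) \<omega>) * (T' (W (h' m) \<omega>) * (g \<bullet> u)))"
    unfolding 1 using int integrable_poly_growth[OF pgs(2), of h'] by (intro Bochner_Integration.integral_diff[symmetric])
  moreover have "(\<Sum>j<m. ?v j * iter_partial (j # is) \<phi> (\<lambda>i. W (h' i) \<omega>)) = (\<Sum>j<m. (h j \<bullet> u) * iter_partial (j # is) \<phi> (\<lambda>i. W (h i) \<omega>))" for \<omega>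
  proof (intro sum.cong refl)
    fix j assume "j \<in> {..<m}"
    then have "set (j # is) \<subseteq> {..<m}" "h' j = h j" using idx by (auto simp: h'_def)
    then show "?v j * iter_partial (j # is) \<phi> (\<lambda>i. W (h' i) \<omega>) = (h j \<bullet> u) * iter_partial (j # is) \<phi> (\<lambda>i. W (h i) \<omega>)"
      by (simp only: eq)
  qed
  ultimately show ?thesis
    by (simp add: g eq idx algebra_simps)
qed

lemma cylinder_deriv_Cons:
  "cylinder_deriv W (Suc k) m \<phi> h \<omega> (u # us) =
     (\<Sum>is | length is = k \<and> set is \<subseteq> {..<m}.
        (\<Sum>j<m. (h j \<bullet> u) * iter_partial (j # is) \<phi> (\<lambda>i. W (h i) \<omega>)) * elem_tensor (map h is) us)"
proof -
  let ?L = "{is. length is = k \<and> set is \<subseteq> {..<m}}"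
  have et: "elem_tensor (a # as) (u # us) = (a \<bullet> u) * elem_tensor as us" for a :: 'h and as
    by (simp only: elem_tensor_def length_Cons prod.lessThan_Suc_shift) simp
  have img: "{is. length is = Suc k \<and> set is \<subseteq> {..<m}} = (\<lambda>(is, j). j # is) ` (?L \<times> {..<m})"
  proof (intro set_eqI iffI)
    fix js assume "js \<in> {is. length is = Suc k \<and> set is \<subseteq> {..<m}}"
    then show "js \<in> (\<lambda>(is, j). j # is) ` (?L \<times> {..<m})" by (cases js) auto
  qed auto
  have "cylinder_deriv W (Suc k) m \<phi> h \<omega> (u # us) =
    (\<Sum>(is, j)\<in>?L \<times> {..<m}. iter_partial (j # is) \<phi> (\<lambda>i. W (h i) \<omega>) * elem_tensor (map h (j # is)) (u # us))"
    unfolding cylinder_deriv_def img by (subst sum.reindex) (auto simp: inj_on_def case_prod_beta)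
  also have "\<dots> = (\<Sum>is\<in>?L. \<Sum>j<m. iter_partial (j # is) \<phi> (\<lambda>i. W (h i) \<omega>) * elem_tensor (map h (j # is)) (u # us))"
    by (simp add: sum.cartesian_product)
  also have "\<dots> = (\<Sum>is\<in>?L. (\<Sum>j<m. (h j \<bullet> u) * iter_partial (j # is) \<phi> (\<lambda>i. W (h i) \<omega>)) * elem_tensor (map h is) us)"
    by (simp add: et sum_distrib_left mult_ac)
  finally show ?thesis .
qed

text \<open>Peels one argument off the derivative: order k + 1 tested by \<open>T\<close> becomes
  order k tested by a divergence. The right side involves the derivative of order k only, which is
  what makes the derivatives closable one order after another.\<close>

lemma cylinder_deriv_integration_by_parts:
  fixes T T' :: "real \<Rightarrow> real"
  assumes s: "smooth_poly_growth m \<phi>"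
    and T: "\<And>f f' v. dir_deriv (Suc m) v f f' \<Longrightarrow> dir_deriv (Suc m) v (\<lambda>x. T (f x)) (\<lambda>x. T' (f x) * f' x)"
    and b: "\<And>x. \<bar>T x\<bar> \<le> 1" "\<And>x. \<bar>T' x\<bar> \<le> 1" and [measurable]: "T \<in> borel_measurable borel" "T' \<in> borel_measurable borel"
  shows "expectation (\<lambda>\<omega>. cylinder_deriv W (Suc k) m \<phi> h \<omega> (u # us) * T (W g \<omega>)) =
    expectation (\<lambda>\<omega>. cylinder_deriv W k m \<phi> h \<omega> us * (W u \<omega> * T (W g \<omega>) - (g \<bullet> u) * T' (W g \<omega>)))"
proof -
  let ?L = "{is. length is = k \<and> set is \<subseteq> {..<m}}"
  have pg: "poly_growth m (iter_partial is \<phi>)" if "set is \<subseteq> {..<m}" for "is"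
    using smooth_poly_growth_dir_deriv[OF s that order_refl] by (auto simp: dir_deriv_def)
  have i1: "integrable M (\<lambda>\<omega>. (\<Sum>j<m. (h j \<bullet> u) * iter_partial (j # is) \<phi> (\<lambda>i. W (h i) \<omega>)) * T (W g \<omega>))" (is "integrable M (?A is)")
    if "is \<in> ?L" for "is"
  proof (rule Bochner_Integration.integrable_bound)
    show i: "integrable M (\<lambda>\<omega>. \<Sum>j<m. (h j \<bullet> u) * iter_partial (j # is) \<phi> (\<lambda>i. W (h i) \<omega>))"
      using that by (intro Bochner_Integration.integrable_sum integrable_mult_right integrable_poly_growth[OF pg]) auto
    show "AE \<omega> in M. norm (?A is \<omega>) \<le> norm (\<Sum>j<m. (h j \<bullet> u) * iter_partial (j # is) \<phi> (\<lambda>i. W (h i) \<omega>))"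
      using b by (auto simp: abs_mult mult_left_le)
    show "?A is \<in> borel_measurable M" using borel_measurable_integrable[OF i] by measurable
  qed
  have i2: "integrable M (\<lambda>\<omega>. iter_partial is \<phi> (\<lambda>i. W (h i) \<omega>) * (W u \<omega> * T (W g \<omega>) - (g \<bullet> u) * T' (W g \<omega>)))" (is "integrable M (?B is)")
    if idx: "is \<in> ?L" for "is"
  proof (rule Bochner_Integration.integrable_bound)
    define h' where "h' = h(m := u)"
    have "poly_growth (Suc m) (\<lambda>x. iter_partial is \<phi> x * x m)" "poly_growth (Suc m) (iter_partial is \<phi>)"
      using idx by (auto intro!: poly_growth_mult poly_growth_coord poly_growth_mono[of m "iter_partial is \<phi>" "Suc m"] pg)
    from this[THEN integrable_poly_growth, of h']
    have "integrable M (\<lambda>\<omega>. iter_partial is \<phi> (\<lambda>i. W (h' i) \<omega>) * W u \<omega>)" "integrable M (\<lambda>\<omega>. iter_partial is \<phi> (\<lambda>i. W (h' i) \<omega>))"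
      by (simp_all add: h'_def)
    moreover have "iter_partial is \<phi> (\<lambda>i. W (h' i) \<omega>) = iter_partial is \<phi> (\<lambda>i. W (h i) \<omega>)" for \<omega>
      using s idx by (intro iter_partial_depends[of m]) (auto simp: smooth_poly_growth_def h'_def)
    ultimately have i: "integrable M (\<lambda>\<omega>. iter_partial is \<phi> (\<lambda>i. W (h i) \<omega>) * W u \<omega>)" "integrable M (\<lambda>\<omega>. iter_partial is \<phi> (\<lambda>i. W (h i) \<omega>))"
      by simp_all
    then show "integrable M (\<lambda>\<omega>. \<bar>iter_partial is \<phi> (\<lambda>i. W (h i) \<omega>) * W u \<omega>\<bar> + \<bar>g \<bullet> u\<bar> * \<bar>iter_partial is \<phi> (\<lambda>i. W (h i) \<omega>)\<bar>)"
      by auto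
    show "?B is \<in> borel_measurable M" using borel_measurable_integrable[OF i(2)] by measurable
    have "\<bar>a * (w * T x - c * T' x)\<bar> \<le> \<bar>a * w\<bar> + \<bar>c\<bar> * \<bar>a\<bar>" for a w c x
    proof -
      have "\<bar>a * (w * T x - c * T' x)\<bar> \<le> \<bar>a * w\<bar> * \<bar>T x\<bar> + \<bar>c\<bar> * \<bar>a\<bar> * \<bar>T' x\<bar>"
        unfolding right_diff_distrib by (rule order_trans[OF abs_triangle_ineq4]) (simp add: abs_mult mult_ac)
      also have "\<dots> \<le> \<bar>a * w\<bar> * 1 + \<bar>c\<bar> * \<bar>a\<bar> * 1"
        by (intro add_mono mult_left_mono b) auto
      finally show ?thesis by simp
    qed
    then show "AE \<omega> in M. norm (?B is \<omega>) \<le> norm (\<bar>iter_partial is \<phi> (\<lambda>i. W (h i) \<omega>) * W u \<omega>\<bar> + \<bar>g \<bullet> u\<bar> * \<bar>iter_partial is \<phi> (\<lambda>i. W (h i) \<omega>)\<bar>)"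
      by (intro AE_I2) simp
  qed
  have "expectation (\<lambda>\<omega>. cylinder_deriv W (Suc k) m \<phi> h \<omega> (u # us) * T (W g \<omega>)) =
     expectation (\<lambda>\<omega>. \<Sum>is\<in>?L. elem_tensor (map h is) us * ?A is \<omega>)"
    unfolding cylinder_deriv_Cons by (simp add: sum_distrib_left sum_distrib_right mult_ac)
  also have "\<dots> = (\<Sum>is\<in>?L. elem_tensor (map h is) us * expectation (?A is))"
    using i1 by (subst Bochner_Integration.integral_sum) (auto intro!: integrable_mult_right)
  also have "\<dots> = (\<Sum>is\<in>?L. elem_tensor (map h is) us * expectation (?B is))"
    by (intro sum.cong refl arg_cong[where f = "(*) _"] cylinder_integration_by_parts[OF s _ T]) auto
  also have "\<dots> = expectation (\<lambda>\<omega>. \<Sum>is\<in>?L. elem_tensor (map h is) us * ?B is \<omega>)"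
    using i2 by (subst Bochner_Integration.integral_sum) (auto intro!: integrable_mult_right)
  also have "\<dots> = expectation (\<lambda>\<omega>. cylinder_deriv W k m \<phi> h \<omega> us * (W u \<omega> * T (W g \<omega>) - (g \<bullet> u) * T' (W g \<omega>)))"
    unfolding cylinder_deriv_def by (simp add: sum_distrib_right sum_distrib_left mult_ac)
  finally show ?thesis .
qed

text \<open>Positive and negative part of \<open>Z\<close> are densities of two finite measures with
  equal trigonometric integrals in every finite family of the process. They agree on
  finite-dimensional rectangles and hence on the sigma-algebra generated by the process, which is
  all of \<open>M\<close>.\<close>

lemma AE_zero_if_trig_orthogonal:
  assumes Z: "integrable M Z"
    and c: "\<And>g. expectation (\<lambda>\<omega>. Z \<omega> * cos (W g \<omega>)) = 0"
    and s: "\<And>g. expectation (\<lambda>\<omega>. Z \<omega> * sin (W g \<omega>)) = 0"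
  shows "AE \<omega> in M. Z \<omega> = 0"
proof -
  have [measurable]: "Z \<in> borel_measurable M" using Z by auto
  define p where "p \<omega> = max 0 (Z \<omega>)" for \<omega>
  define q where "q \<omega> = max 0 (- Z \<omega>)" for \<omega>
  have [measurable]: "p \<in> borel_measurable M" "q \<in> borel_measurable M" unfolding p_def q_def by measurable
  have nn: "0 \<le> p \<omega>" "0 \<le> q \<omega>" and Zpq: "Z \<omega> = p \<omega> - q \<omega>" for \<omega> by (auto simp: p_def q_def)
  have ip: "integrable M p" "integrable M q"
    by (rule Bochner_Integration.integrable_bound[OF Z]; auto simp: p_def q_def)+
  define \<mu> where "\<mu> = density M (\<lambda>\<omega>. ennreal (p \<omega>))"
  define \<nu> where "\<nu> = density M (\<lambda>\<omega>. ennreal (q \<omega>))"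
  have fin: "finite_measure (density M (\<lambda>\<omega>. ennreal (r \<omega>)))" if "integrable M r" "\<And>\<omega>. 0 \<le> r \<omega>" for r
    using that by (intro finite_measureI) (auto simp: emeasure_density nn_integral_eq_integral cong: nn_integral_cong)
  have f\<mu>: "finite_measure \<mu>" and f\<nu>: "finite_measure \<nu>" unfolding \<mu>_def \<nu>_def using fin ip nn by auto
  have bint: "integrable M (\<lambda>\<omega>. r \<omega> * t (W g \<omega>))"
    if "integrable M r" "t \<in> borel_measurable borel" "\<And>x. \<bar>t x\<bar> \<le> 1" for r g and t :: "real \<Rightarrow> real"
  proof (rule Bochner_Integration.integrable_bound[OF that(1)])
    note [measurable] = that(2) borel_measurable_integrable[OF that(1)]
    show "(\<lambda>\<omega>. r \<omega> * t (W g \<omega>)) \<in> borel_measurable M" by measurable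
    show "AE \<omega> in M. norm (r \<omega> * t (W g \<omega>)) \<le> norm (r \<omega>)"
      using that(3) by (auto simp: abs_mult mult_left_le)
  qed
  have trig: "expectation (\<lambda>\<omega>. p \<omega> * t (W g \<omega>)) = expectation (\<lambda>\<omega>. q \<omega> * t (W g \<omega>))"
    if "t \<in> borel_measurable borel" "\<And>x. \<bar>t x\<bar> \<le> 1" "expectation (\<lambda>\<omega>. Z \<omega> * t (W g \<omega>)) = 0" for t g
    using that(3) bint[OF ip(1) that(1,2), of g] bint[OF ip(2) that(1,2), of g]
    unfolding Zpq left_diff_distrib by simp
  have sum: "(\<integral>\<omega>. t (\<Sum>h\<in>S. c h * W h \<omega>) \<partial>\<mu>) = (\<integral>\<omega>. t (\<Sum>h\<in>S. c h * W h \<omega>) \<partial>\<nu>)"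
    if S: "finite S" and [measurable]: "t \<in> borel_measurable borel" and t: "\<And>x. \<bar>t x\<bar> \<le> 1" "\<And>g. expectation (\<lambda>\<omega>. Z \<omega> * t (W g \<omega>)) = 0"
    for S c and t :: "real \<Rightarrow> real"
  proof -
    have "(\<integral>\<omega>. t (\<Sum>h\<in>S. c h * W h \<omega>) \<partial>density M (\<lambda>\<omega>. ennreal (r \<omega>))) = expectation (\<lambda>\<omega>. r \<omega> * t (W (\<Sum>h\<in>S. c h *\<^sub>R h) \<omega>))"
      if [measurable]: "r \<in> borel_measurable M" and "\<And>\<omega>. 0 \<le> r \<omega>" for r
    proof -
      have "(\<integral>\<omega>. t (\<Sum>h\<in>S. c h * W h \<omega>) \<partial>density M (\<lambda>\<omega>. ennreal (r \<omega>))) = expectation (\<lambda>\<omega>. r \<omega> * t (\<Sum>h\<in>S. c h * W h \<omega>))"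
        using that(2) by (subst integral_density) auto
      also have "\<dots> = expectation (\<lambda>\<omega>. r \<omega> * t (W (\<Sum>h\<in>S. c h *\<^sub>R h) \<omega>))"
        using W_sum_AE[OF S, of c "\<lambda>h. h"] by (intro integral_cong_AE) (auto elim!: eventually_mono)
      finally show ?thesis .
    qed
    then show ?thesis unfolding \<mu>_def \<nu>_def using trig[OF \<open>t \<in> borel_measurable borel\<close> t] nn by simp
  qed
  have rect: "emeasure \<mu> {\<omega> \<in> space M. \<forall>h\<in>S. W h \<omega> \<in> A h} = emeasure \<nu> {\<omega> \<in> space M. \<forall>h\<in>S. W h \<omega> \<in> A h}"
    if "finite S" "\<And>h. h \<in> S \<Longrightarrow> A h \<in> sets borel" for S and A :: "'h \<Rightarrow> real set"
    using f\<mu> f\<nu> that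
    by (intro emeasure_rect_eq_if_cos_sin_eq sum c s) (auto simp: \<mu>_def \<nu>_def)
  \<comment> \<open>Finite-dimensional rectangles; stability under intersection comes from merging
    the two index sets and filling in the whole line where a set imposes no condition.\<close>
  define G where "G = {{\<omega> \<in> space M. \<forall>h\<in>S. W h \<omega> \<in> A h} | S A. finite S \<and> (\<forall>h. A h \<in> sets borel)}"
  have "\<mu> = \<nu>"
  proof (rule measure_eqI_generator_eq[where E = G and \<Omega> = "space M" and A = "\<lambda>_. space M"])
    show "Int_stable G"
    proof (rule Int_stableI)
      fix a b assume "a \<in> G" "b \<in> G"
      then obtain S A S' A' where *: "finite S" "finite S'" "\<And>h. A h \<in> sets borel" "\<And>h. A' h \<in> sets borel"
        "a = {\<omega> \<in> space M. \<forall>h\<in>S. W h \<omega> \<in> A h}" "b = {\<omega> \<in> space M. \<forall>h\<in>S'. W h \<omega> \<in> A' h}"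
        unfolding G_def by blast
      have "a \<inter> b = {\<omega> \<in> space M. \<forall>h\<in>S \<union> S'. W h \<omega> \<in> (if h \<in> S then A h else UNIV) \<inter> (if h \<in> S' then A' h else UNIV)}"
        unfolding *(5,6) by auto
      moreover have "(if h \<in> S then A h else UNIV) \<inter> (if h \<in> S' then A' h else UNIV) \<in> sets borel" for h
        using *(3,4) by auto
      ultimately show "a \<inter> b \<in> G" using *(1,2) unfolding G_def
        by (intro CollectI exI[of _ "S \<union> S'"] exI[of _ "\<lambda>h. (if h \<in> S then A h else UNIV) \<inter> (if h \<in> S' then A' h else UNIV)"]) auto
    qed
    show "G \<subseteq> Pow (space M)" by (auto simp: G_def)
    show "emeasure \<mu> X = emeasure \<nu> X" if "X \<in> G" for X
      using that rect by (auto simp: G_def)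
    have "sigma_sets (space M) G = sets M"
    proof
      show "sigma_sets (space M) G \<subseteq> sets M"
      proof (rule sets.sigma_sets_subset)
        show "G \<subseteq> sets M"
          unfolding G_def by (auto intro!: sets.sets_Collect_finite_All intro: measurable_sets_Collect)
      qed
      have "W h -` A \<inter> space M \<in> G" if "A \<in> sets borel" for h A
        unfolding G_def by (rule CollectI, rule exI[of _ "{h}"], rule exI[of _ "\<lambda>_. A"]) (use that in auto)
      then show "sets M \<subseteq> sigma_sets (space M) G"
        unfolding generated by (intro sigma_sets_mono') auto
    qed
    then show "sets \<mu> = sigma_sets (space M) G" "sets \<nu> = sigma_sets (space M) G"
      by (simp_all add: \<mu>_def \<nu>_def)
    show "range (\<lambda>_. space M) \<subseteq> G"
      unfolding G_def by (auto intro!: exI[of _ "{}"] exI[of _ "\<lambda>_. {}"])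
    show "emeasure \<mu> (space M) \<noteq> \<infinity>" for i :: nat
      using f\<mu> finite_measure.emeasure_finite by auto
  qed simp
  then have "AE \<omega> in M. ennreal (p \<omega>) = ennreal (q \<omega>)"
    unfolding \<mu>_def \<nu>_def by (subst (asm) density_unique_iff) auto
  then show ?thesis by eventually_elim (use nn Zpq in auto)
qed

end

subsection \<open>Hilbert tensors as square summable families\<close>

text \<open>Turns unordered sums into integrals over the counting measure, so that Tonelli's theorem
  may exchange them with expectations.\<close>

lemma nn_integral_count_space_has_sum:
  fixes f :: "'b \<Rightarrow> real"
  assumes "\<And>x. x \<in> A \<Longrightarrow> 0 \<le> f x" "f summable_on A"
  shows "(\<integral>\<^sup>+x. ennreal (f x) \<partial>count_space A) = ennreal (infsum f A)"
proof -
  have "Infinite_Set_Sum.abs_summable_on f A"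
    using assms summable_on_iff_abs_summable_on_real abs_summable_equivalent by blast
  then show ?thesis
    using nn_integral_conv_infsetsum[of f A] infsetsum_infsum[of f A] assms(1) by simp
qed

lemma summable_on_if_nn_integral_count_space:
  fixes f :: "'b \<Rightarrow> real"
  assumes "\<And>x. x \<in> A \<Longrightarrow> 0 \<le> f x" "(\<integral>\<^sup>+x. ennreal (f x) \<partial>count_space A) \<noteq> \<infinity>"
  shows "f summable_on A"
proof -
  have "integrable (count_space A) f"
    using assms by (intro integrableI_nonneg) (auto simp: AE_count_space less_top)
  then have "Infinite_Set_Sum.abs_summable_on f A" by (simp add: abs_summable_on_def)
  then show ?thesis
    using summable_on_iff_abs_summable_on_real abs_summable_equivalent by blast
qed

lemma nn_integral_l2:
  "f \<in> l2 B \<Longrightarrow> (\<integral>\<^sup>+b. ennreal ((f b)\<^sup>2) \<partial>count_space B) = ennreal ((nrm B f)\<^sup>2)"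
  unfolding l2_def nrm_sq ip_def power2_eq_square[symmetric]
  by (intro nn_integral_count_space_has_sum) auto

lemma l2_cong: "(\<And>b. b \<in> B \<Longrightarrow> f b = g b) \<Longrightarrow> f \<in> l2 B \<longleftrightarrow> g \<in> l2 B"
  unfolding l2_def mem_Collect_eq by (intro summable_on_cong) simp

lemma ip_cong: "(\<And>b. b \<in> B \<Longrightarrow> f b = f' b) \<Longrightarrow> (\<And>b. b \<in> B \<Longrightarrow> g b = g' b) \<Longrightarrow> ip B f g = ip B f' g'"
  unfolding ip_def by (intro infsum_cong) simp

lemma nrm_cong: "(\<And>b. b \<in> B \<Longrightarrow> f b = g b) \<Longrightarrow> nrm B f = nrm B g"
  unfolding nrm_def by (intro arg_cong[where f = sqrt] ip_cong)

lemma l2_zero: "(\<lambda>_. 0) \<in> l2 B" by (simp add: l2_def)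

lemma l2_sum: "(\<And>i. i \<in> I \<Longrightarrow> f i \<in> l2 B) \<Longrightarrow> (\<lambda>b. \<Sum>i\<in>I. c i * f i b) \<in> l2 B"
proof (induction I rule: infinite_finite_induct)
  case (insert i I)
  then show ?case using l2_lincomb[of "f i" B "\<lambda>b. \<Sum>i\<in>I. c i * f i b" "c i" 1] by simp
qed (auto simp: l2_zero)

lemma ip_sum_left:
  assumes "finite I" "\<And>i. i \<in> I \<Longrightarrow> f i \<in> l2 B" "g \<in> l2 B"
  shows "ip B (\<lambda>b. \<Sum>i\<in>I. c i * f i b) g = (\<Sum>i\<in>I. c i * ip B (f i) g)"
  using assms
proof (induction I)
  case empty then show ?case by (simp add: ip_def)
next
  case (insert i I)
  then show ?case
    using ip_lincomb[of "f i" B "\<lambda>b. \<Sum>i\<in>I. c i * f i b" g "c i" 1] by (simp add: l2_sum)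
qed

lemma ip_sum_sum:
  assumes "finite I" "finite J" "\<And>i. i \<in> I \<Longrightarrow> f i \<in> l2 B" "\<And>j. j \<in> J \<Longrightarrow> g j \<in> l2 B"
  shows "ip B (\<lambda>b. \<Sum>i\<in>I. c i * f i b) (\<lambda>b. \<Sum>j\<in>J. d j * g j b) = (\<Sum>i\<in>I. \<Sum>j\<in>J. c i * d j * ip B (f i) (g j))"
proof -
  have "ip B (f i) (\<lambda>b. \<Sum>j\<in>J. d j * g j b) = (\<Sum>j\<in>J. d j * ip B (f i) (g j))" if "i \<in> I" for i
    using ip_sum_left[of J g B "f i" d] assms that by (simp add: ip_commute)
  then show ?thesis
    using assms by (subst ip_sum_left) (auto simp: l2_sum sum_distrib_left mult.assoc)
qed

lemma inj_on_Cons_pair: "inj_on (\<lambda>(e, es). e # es) X"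
  by (auto simp: inj_on_def)

section \<open>Parseval's identity for an orthonormal basis\<close>

context
  fixes B :: "'h::real_inner set"
  assumes B: "orthonormal_basis B"
begin

lemma basis_inner: "e \<in> B \<Longrightarrow> e' \<in> B \<Longrightarrow> e \<bullet> e' = (if e = e' then 1 else 0)"
  using B by (auto simp: orthonormal_basis_def pairwise_def orthogonal_def norm_eq_1)

text \<open>Pythagoras with free coefficients: the Fourier coefficients give Bessel's inequality,
  and for any others the last sum is the excess error.\<close>

lemma basis_projection:
  assumes F: "finite F" "F \<subseteq> B"
  shows "(norm (h - (\<Sum>e\<in>F. c e *\<^sub>R e)))\<^sup>2 = (norm h)\<^sup>2 - (\<Sum>e\<in>F. (h \<bullet> e)\<^sup>2) + (\<Sum>e\<in>F. (c e - h \<bullet> e)\<^sup>2)"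
proof -
  have ss: "(\<Sum>e\<in>F. c e *\<^sub>R e) \<bullet> (\<Sum>e\<in>F. c e *\<^sub>R e) = (\<Sum>e\<in>F. (c e)\<^sup>2)"
  proof -
    have "(\<Sum>e\<in>F. c e *\<^sub>R e) \<bullet> (\<Sum>e\<in>F. c e *\<^sub>R e) = (\<Sum>e\<in>F. \<Sum>e'\<in>F. c e * (c e' * (e' \<bullet> e)))"
      by (simp add: inner_sum_left inner_sum_right sum_distrib_left)
    also have "\<dots> = (\<Sum>e\<in>F. \<Sum>e'\<in>F. if e' = e then (c e)\<^sup>2 else 0)"
      using F by (intro sum.cong refl) (auto simp: basis_inner[OF subsetD[OF F(2)] subsetD[OF F(2)]] power2_eq_square)
    also have "\<dots> = (\<Sum>e\<in>F. (c e)\<^sup>2)" using F by simp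
    finally show ?thesis .
  qed
  have "(norm (h - (\<Sum>e\<in>F. c e *\<^sub>R e)))\<^sup>2 = (norm h)\<^sup>2 - 2 * (\<Sum>e\<in>F. c e * (h \<bullet> e)) + (\<Sum>e\<in>F. (c e)\<^sup>2)"
  proof -
    have hs: "h \<bullet> (\<Sum>e\<in>F. c e *\<^sub>R e) = (\<Sum>e\<in>F. c e * (h \<bullet> e))" by (simp add: inner_sum_right)
    show ?thesis
      unfolding power2_norm_eq_inner inner_diff_left inner_diff_right ss inner_commute[of "\<Sum>e\<in>F. c e *\<^sub>R e" h] hs by simp
  qed
  also have "\<dots> = (norm h)\<^sup>2 - (\<Sum>e\<in>F. (h \<bullet> e)\<^sup>2) + (\<Sum>e\<in>F. (c e - h \<bullet> e)\<^sup>2)"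
    by (simp add: power2_diff sum.distrib sum_subtractf sum_distrib_left mult_ac)
  finally show ?thesis .
qed

text \<open>One inequality is Bessel's; for the other, an element of the span close to
  \<open>h\<close> cannot beat the Fourier coefficients on the same finite set.\<close>

lemma basis_square_sums: "((\<lambda>e. (h \<bullet> e)\<^sup>2) has_sum (norm h)\<^sup>2) B"
proof -
  let ?S = "{F. F \<subseteq> B \<and> finite F}"
  have le: "(\<Sum>e\<in>F. (h \<bullet> e)\<^sup>2) \<le> (norm h)\<^sup>2" if "F \<in> ?S" for F
    using basis_projection[of F h "\<lambda>e. h \<bullet> e"] that zero_le_power2[of "norm (h - (\<Sum>e\<in>F. (h \<bullet> e) *\<^sub>R e))"] by auto
  then have bdd: "bdd_above (sum (\<lambda>e. (h \<bullet> e)\<^sup>2) ` ?S)" by (intro bdd_aboveI2[of _ _ "(norm h)\<^sup>2"]) auto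
  have hs: "((\<lambda>e. (h \<bullet> e)\<^sup>2) has_sum (SUP F\<in>{F. finite F \<and> F \<subseteq> B}. \<Sum>e\<in>F. (h \<bullet> e)\<^sup>2)) B"
    using nonneg_bdd_above_has_sum[OF _ bdd] by simp
  have "(SUP F\<in>{F. finite F \<and> F \<subseteq> B}. \<Sum>e\<in>F. (h \<bullet> e)\<^sup>2) = (norm h)\<^sup>2"
  proof (rule antisym)
    show "(SUP F\<in>{F. finite F \<and> F \<subseteq> B}. \<Sum>e\<in>F. (h \<bullet> e)\<^sup>2) \<le> (norm h)\<^sup>2"
      using le by (intro cSUP_least) auto
    show "(norm h)\<^sup>2 \<le> (SUP F\<in>{F. finite F \<and> F \<subseteq> B}. \<Sum>e\<in>F. (h \<bullet> e)\<^sup>2)"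
    proof (rule field_le_epsilon)
      fix \<epsilon> :: real assume "\<epsilon> > 0"
      have "h \<in> closure (span B)" using B by (simp add: orthonormal_basis_def)
      then obtain s where s: "s \<in> span B" "dist s h < sqrt \<epsilon>"
        using \<open>\<epsilon> > 0\<close> unfolding closure_approachable by (meson real_sqrt_gt_zero)
      then obtain F c where F: "finite F" "F \<subseteq> B" "s = (\<Sum>e\<in>F. c e *\<^sub>R e)"
        unfolding span_explicit by blast
      have "(norm (h - s))\<^sup>2 < \<epsilon>"
      proof -
        have "norm (h - s) < sqrt \<epsilon>" using s(2) by (simp add: dist_norm norm_minus_commute)
        then have "(norm (h - s))\<^sup>2 < (sqrt \<epsilon>)\<^sup>2" by (intro power_strict_mono) auto
        then show ?thesis using \<open>\<epsilon> > 0\<close> by simp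
      qed
      then have "(norm h)\<^sup>2 \<le> (\<Sum>e\<in>F. (h \<bullet> e)\<^sup>2) + \<epsilon>"
        using basis_projection[OF F(1,2), of h c] sum_nonneg[of F "\<lambda>e. (c e - h \<bullet> e)\<^sup>2"] F(3) by auto
      also have "(\<Sum>e\<in>F. (h \<bullet> e)\<^sup>2) \<le> (SUP F\<in>{F. finite F \<and> F \<subseteq> B}. \<Sum>e\<in>F. (h \<bullet> e)\<^sup>2)"
        using F bdd by (intro cSUP_upper2[of _ _ F]) (auto simp: conj_commute)
      finally show "(norm h)\<^sup>2 \<le> (SUP F\<in>{F. finite F \<and> F \<subseteq> B}. \<Sum>e\<in>F. (h \<bullet> e)\<^sup>2) + \<epsilon>" by simp
    qed
  qed
  then show ?thesis using hs by simp
qed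

lemma basis_l2: "(\<lambda>e. h \<bullet> e) \<in> l2 B"
  using basis_square_sums unfolding l2_def summable_on_def by blast

lemma basis_parseval: "ip B (\<lambda>e. h \<bullet> e) (\<lambda>e. g \<bullet> e) = h \<bullet> g"
proof -
  have sq: "ip B (\<lambda>e. x \<bullet> e) (\<lambda>e. x \<bullet> e) = x \<bullet> x" for x
    using infsumI[OF basis_square_sums[of x]] by (simp add: ip_def power2_eq_square[symmetric] power2_norm_eq_inner)
  have "ip B (\<lambda>e. 1 * (h \<bullet> e) + 1 * (g \<bullet> e)) (\<lambda>e. 1 * (h \<bullet> e) + 1 * (g \<bullet> e)) = (h + g) \<bullet> (h + g)"
    using sq[of "h + g"] by (simp add: inner_add_left)
  then show ?thesis
    unfolding ip_expand[OF basis_l2 basis_l2] by (simp add: sq inner_add_left inner_add_right inner_commute[of g h])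
qed

end

text \<open>\<open>hbasis\<close> is an arbitrary choice among orthonormal bases, so countability
  must hold for each of them: distinct members are sqrt 2 apart, and a separable space has only
  countably many disjoint open balls.\<close>

lemma countable_orthonormal:
  fixes B :: "'h::{real_inner, second_countable_topology} set"
  assumes "orthonormal_basis B"
  shows "countable B"
proof -
  have d: "dist x y \<ge> 1" if "x \<in> B" "y \<in> B" "x \<noteq> y" for x y
  proof -
    have "(norm (x - y))\<^sup>2 = 2"
      using that basis_inner[OF assms] unfolding power2_norm_eq_inner by (simp add: inner_simps)
    then show ?thesis unfolding dist_norm by (simp add: power2_le_imp_le)
  qed
  have "disjoint ((\<lambda>x. ball x (1/2)) ` B)"
  proof (rule disjointI, elim imageE)
    fix a b x y assume *: "a \<noteq> b" "a = ball x (1/2)" "b = ball y (1/2)" "x \<in> B" "y \<in> B"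
    then have "dist x y \<ge> 1" using d by blast
    then show "a \<inter> b = {}" unfolding * by (auto) (smt (verit) dist_commute dist_triangle field_sum_of_halves)
  qed
  moreover have "\<And>S. S \<in> (\<lambda>x. ball x (1/2)) ` B \<Longrightarrow> open S" by auto
  ultimately have "countable ((\<lambda>x. ball x (1/2)) ` B)"
    by (intro countable_disjoint_open_subsets)
  moreover have "inj_on (\<lambda>x. ball x (1/2 :: real)) B"
  proof (rule inj_onI)
    fix x y assume *: "x \<in> B" "y \<in> B" "ball x (1/2) = ball y (1/2)"
    then have "dist x y < 1/2" using centre_in_ball[of y "1/2"] by auto
    then show "x = y" using d * by force
  qed
  ultimately show ?thesis by (rule countable_image_inj_on)
qed

section \<open>Elementary tensors and tensors with given coefficients\<close>

context
  notes [simp] = orthonormal_basis_hbasis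
begin

lemma basis_lists_0: "basis_lists 0 = {[]}" by (auto simp: basis_lists_def)

lemma basis_lists_Suc: "basis_lists (Suc k) = (\<lambda>(e, es). e # es) ` (hbasis \<times> basis_lists k)"
proof (intro set_eqI iffI)
  fix es :: "'a list" assume "es \<in> basis_lists (Suc k)"
  then show "es \<in> (\<lambda>(e, es). e # es) ` (hbasis \<times> basis_lists k)" by (cases es) (auto simp: basis_lists_def)
qed (auto simp: basis_lists_def)

lemma countable_basis_lists: "countable (basis_lists k)"
proof (rule countable_subset)
  show "basis_lists k \<subseteq> lists hbasis" by (auto simp: basis_lists_def lists_eq_set)
  show "countable (lists (hbasis :: 'a set))" by (intro countable_lists countable_orthonormal) simp
qed

lemma elem_tensor_Cons: "elem_tensor (a # as) (u # us) = (a \<bullet> u) * elem_tensor as us"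
  by (simp only: elem_tensor_def length_Cons prod.lessThan_Suc_shift) simp

lemma elem_tensor_replicate:
  assumes "length us = k"
  shows "elem_tensor (replicate k h) us = (\<Prod>i<k. h \<bullet> us ! i)"
  using assms by (auto simp: elem_tensor_def intro!: prod.cong)

lemma elem_tensor_replicate_self: "elem_tensor (replicate k h) (replicate k g) = (h \<bullet> g) ^ k"
  by (simp add: elem_tensor_replicate)

lemma elem_tensor_square_sums:
  "length hs = k \<Longrightarrow> ((\<lambda>es. (elem_tensor hs es)\<^sup>2) has_sum (\<Prod>i<k. (norm (hs ! i))\<^sup>2)) (basis_lists k)"
proof (induction k arbitrary: hs)
  case 0
  then show ?case using has_sum_finite[of "{[]}"  "\<lambda>es. (elem_tensor hs es)\<^sup>2"]
    by (simp add: basis_lists_0 elem_tensor_def)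
next
  case (Suc k)
  then obtain a as where hs: "hs = a # as" "length as = k" by (cases hs) auto
  let ?c = "\<Prod>i<k. (norm (as ! i))\<^sup>2"
  have "((\<lambda>(e, es). (elem_tensor hs (e # es))\<^sup>2) has_sum (norm a)\<^sup>2 * ?c) (hbasis \<times> basis_lists k)"
  proof (rule has_sum_SigmaI)
    show 1: "((\<lambda>es. (\<lambda>(e, es). (elem_tensor hs (e # es))\<^sup>2) (e, es)) has_sum (a \<bullet> e)\<^sup>2 * ?c) (basis_lists k)" for e
      using has_sum_cmult_right[OF Suc.IH[OF hs(2)], of "(a \<bullet> e)\<^sup>2"]
      by (simp add: hs(1) elem_tensor_Cons power_mult_distrib)
    show 2: "((\<lambda>e. (a \<bullet> e)\<^sup>2 * ?c) has_sum (norm a)\<^sup>2 * ?c) hbasis"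
      by (intro has_sum_cmult_left basis_square_sums) simp
    show "(\<lambda>(e, es). (elem_tensor hs (e # es))\<^sup>2) summable_on hbasis \<times> basis_lists k"
      using 1 2 by (intro summable_on_SigmaI) (auto simp: summable_on_def)
  qed
  moreover have "(norm a)\<^sup>2 * ?c = (\<Prod>i<Suc k. (norm (hs ! i))\<^sup>2)"
    by (simp only: prod.lessThan_Suc_shift hs(1)) simp
  ultimately show ?case
    unfolding basis_lists_Suc has_sum_reindex[OF inj_on_Cons_pair] by (simp add: o_def case_prod_unfold)
qed

lemma elem_tensor_l2: "length hs = k \<Longrightarrow> elem_tensor hs \<in> l2 (basis_lists k)"
  using elem_tensor_square_sums unfolding l2_def summable_on_def by blast

lemma nrm_elem_tensor: "length hs = k \<Longrightarrow> nrm (basis_lists k) (elem_tensor hs) = (\<Prod>i<k. norm (hs ! i))"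
  using infsumI[OF elem_tensor_square_sums[of hs k]]
  unfolding nrm_def ip_def power2_eq_square[symmetric] by (simp add: prod_power_distrib[symmetric] prod_nonneg)

lemma ip_elem_tensor:
  "length hs = k \<Longrightarrow> length gs = k \<Longrightarrow> ip (basis_lists k) (elem_tensor hs) (elem_tensor gs) = elem_tensor hs gs"
proof (induction k arbitrary: hs gs)
  case 0
  then show ?case by (simp add: ip_def basis_lists_0 elem_tensor_def)
next
  case (Suc k)
  then obtain a as b bs where hs: "hs = a # as" "length as = k" "gs = b # bs" "length bs = k"
    by (metis length_Suc_conv)
  have "(\<lambda>es. elem_tensor hs es * elem_tensor gs es) summable_on basis_lists (Suc k)"
    using elem_tensor_l2[OF Suc.prems(1)] elem_tensor_l2[OF Suc.prems(2)] unfolding l2_def mem_Collect_eq by (rule l2_mult_summable)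
  then have summ: "(\<lambda>(e, es). elem_tensor hs (e # es) * elem_tensor gs (e # es)) summable_on (hbasis \<times> basis_lists k)"
    unfolding basis_lists_Suc summable_on_reindex[OF inj_on_Cons_pair] by (simp add: o_def case_prod_unfold)
  have "ip (basis_lists (Suc k)) (elem_tensor hs) (elem_tensor gs) =
    infsum (\<lambda>(e, es). elem_tensor hs (e # es) * elem_tensor gs (e # es)) (hbasis \<times> basis_lists k)"
    unfolding basis_lists_Suc ip_def infsum_reindex[OF inj_on_Cons_pair] by (simp add: o_def case_prod_unfold)
  also have "\<dots> = (\<Sum>\<^sub>\<infinity>e\<in>hbasis. \<Sum>\<^sub>\<infinity>es\<in>basis_lists k. elem_tensor hs (e # es) * elem_tensor gs (e # es))"
    by (rule infsum_Sigma'_banach[OF summ, symmetric])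
  also have "\<dots> = (\<Sum>\<^sub>\<infinity>e\<in>hbasis. ((a \<bullet> e) * (b \<bullet> e)) * ip (basis_lists k) (elem_tensor as) (elem_tensor bs))"
    unfolding ip_def infsum_cmult_right'[symmetric] by (simp add: hs elem_tensor_Cons mult_ac)
  also have "\<dots> = ip hbasis (\<lambda>e. a \<bullet> e) (\<lambda>e. b \<bullet> e) * elem_tensor as bs"
    unfolding infsum_cmult_left' Suc.IH[OF hs(2,4)] by (simp add: ip_def)
  also have "\<dots> = elem_tensor hs gs" by (simp add: basis_parseval hs elem_tensor_Cons)
  finally show ?case .
qed

lemma elem_tensor_basis:
  assumes "es \<in> basis_lists k" "es' \<in> basis_lists k"
  shows "elem_tensor es es' = (if es = es' then 1 else 0)"
proof -
  have l: "length es = k" "length es' = k" "set es \<subseteq> hbasis" "set es' \<subseteq> hbasis"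
    using assms by (auto simp: basis_lists_def)
  have "elem_tensor es es' = (\<Prod>i<k. if es ! i = es' ! i then 1 else 0)"
    using l by (auto simp: elem_tensor_def subset_iff intro!: prod.cong basis_inner[OF orthonormal_basis_hbasis])
  also have "\<dots> = (if es = es' then 1 else 0)"
    using l by (auto simp: list_eq_iff_nth_eq)
  finally show ?thesis .
qed

lemma tensor_power_l2: "f \<in> tensor_power k \<Longrightarrow> f \<in> l2 (basis_lists k)"
  by (simp add: tensor_power_def l2_def)

lemma tensor_norm_nrm: "tensor_norm k f = nrm (basis_lists k) f"
  and tensor_inner_ip: "tensor_inner k f g = ip (basis_lists k) f g"
  by (simp_all add: tensor_norm_def tensor_inner_def nrm_def ip_def)

text \<open>The multilinear form with prescribed values \<open>a\<close> on basis lists. Limits are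
  first obtained as families of coefficients and then need this extension to all argument
  lists.\<close>

definition tensor_of :: "nat \<Rightarrow> ('h::{real_inner, polish_space} list \<Rightarrow> real) \<Rightarrow> 'h tensor" where
  "tensor_of k a us = ip (basis_lists k) a (elem_tensor us)"

lemma tensor_of_basis:
  assumes "us \<in> basis_lists k"
  shows "tensor_of k a us = a us"
proof -
  have "ip (basis_lists k) a (elem_tensor us) = (\<Sum>\<^sub>\<infinity>es\<in>basis_lists k. if es = us then a us else 0)"
    unfolding ip_def using assms by (intro infsum_cong) (auto simp: elem_tensor_basis)
  also have "\<dots> = (\<Sum>\<^sub>\<infinity>es\<in>{us}. a us)"
    using assms by (intro infsum_cong_neutral) auto
  finally show ?thesis by (simp add: tensor_of_def)
qed

text \<open>Linearity in each slot is inherited from the elementary tensor of the arguments, and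
  Cauchy-Schwarz with the product formula for its norm gives boundedness.\<close>

lemma tensor_of_in:
  assumes a: "a \<in> l2 (basis_lists k)"
  shows "tensor_of k a \<in> tensor_power k"
  unfolding tensor_power_def
proof (intro CollectI conjI allI impI)
  fix us :: "'a list" assume l: "length us \<noteq> k"
  have "ip (basis_lists k) a (elem_tensor us) = ip (basis_lists k) a (\<lambda>_. 0)"
    using l by (intro ip_cong) (auto simp: elem_tensor_def basis_lists_def)
  then show "tensor_of k a us = 0" by (simp add: tensor_of_def ip_def)
next
  fix us :: "'a list" and i assume *: "length us = k \<and> i < k"
  have et: "elem_tensor (us[i := u]) es = (u \<bullet> es ! i) * (\<Prod>j\<in>{..<k} - {i}. us ! j \<bullet> es ! j)" if "length es = k" for u es
  proof -
    have "elem_tensor (us[i := u]) es = (\<Prod>j<k. us[i := u] ! j \<bullet> es ! j)"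
      using that * by (simp add: elem_tensor_def)
    also have "\<dots> = (u \<bullet> es ! i) * (\<Prod>j\<in>{..<k} - {i}. us[i := u] ! j \<bullet> es ! j)"
      using * by (subst prod.remove[of _ i]) auto
    also have "(\<Prod>j\<in>{..<k} - {i}. us[i := u] ! j \<bullet> es ! j) = (\<Prod>j\<in>{..<k} - {i}. us ! j \<bullet> es ! j)"
      by (intro prod.cong) auto
    finally show ?thesis .
  qed
  have mem: "elem_tensor (us[i := u]) \<in> l2 (basis_lists k)" for u using * by (intro elem_tensor_l2) simp
  have lin: "tensor_of k a (us[i := x *\<^sub>R u + y *\<^sub>R v]) = x * tensor_of k a (us[i := u]) + y * tensor_of k a (us[i := v])" for x y u v
  proof -
    have "tensor_of k a (us[i := x *\<^sub>R u + y *\<^sub>R v]) = ip (basis_lists k) a (\<lambda>es. x * elem_tensor (us[i := u]) es + y * elem_tensor (us[i := v]) es)"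
      unfolding tensor_of_def by (intro ip_cong) (auto simp: et basis_lists_def inner_simps algebra_simps)
    also have "\<dots> = x * tensor_of k a (us[i := u]) + y * tensor_of k a (us[i := v])"
      unfolding tensor_of_def ip_commute[of _ a] by (rule ip_lincomb[OF mem mem a])
    finally show ?thesis .
  qed
  show "bounded_linear (\<lambda>u. tensor_of k a (us[i := u]))"
  proof (rule bounded_linear_intro)
    show "tensor_of k a (us[i := u + v]) = tensor_of k a (us[i := u]) + tensor_of k a (us[i := v])" for u v
      using lin[of 1 u 1 v] by simp
    show "tensor_of k a (us[i := r *\<^sub>R u]) = r *\<^sub>R tensor_of k a (us[i := u])" for r u
      using lin[of r u 0 0] by simp
    fix u
    have "norm (tensor_of k a (us[i := u])) \<le> nrm (basis_lists k) a * nrm (basis_lists k) (elem_tensor (us[i := u]))"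
      unfolding tensor_of_def real_norm_def by (intro abs_ip_le a mem)
    also have "nrm (basis_lists k) (elem_tensor (us[i := u])) = (\<Prod>j<k. norm (us[i := u] ! j))"
      using * by (intro nrm_elem_tensor) simp
    also have "\<dots> = norm u * (\<Prod>j\<in>{..<k} - {i}. norm (us[i := u] ! j))"
      using * by (subst prod.remove[of _ i]) auto
    also have "(\<Prod>j\<in>{..<k} - {i}. norm (us[i := u] ! j)) = (\<Prod>j\<in>{..<k} - {i}. norm (us ! j))"
      by (intro prod.cong) auto
    finally show "norm (tensor_of k a (us[i := u])) \<le> norm u * ((\<Prod>j\<in>{..<k} - {i}. norm (us ! j)) * nrm (basis_lists k) a)"
      by (simp add: mult_ac)
  qed
next
  show "(\<lambda>es. (tensor_of k a es)\<^sup>2) summable_on basis_lists k"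
    using a l2_cong[of "basis_lists k" "tensor_of k a" a] tensor_of_basis unfolding l2_def by auto
qed

end

subsection \<open>Powers of unit vectors span the symmetric tensors\<close>

text \<open>After complementation this is the expansion of the product of (-1) + 1 over
  \<open>D - T\<close>, which is empty only for \<open>T\<close> = \<open>D\<close>.\<close>

lemma alternating_subset_sum:
  assumes "finite D" "T \<subseteq> D"
  shows "(\<Sum>A | T \<subseteq> A \<and> A \<subseteq> D. (-1) ^ card (D - A)) = (if T = D then 1 else (0::real))"
proof -
  have bij: "bij_betw (\<lambda>A. D - A) {A. T \<subseteq> A \<and> A \<subseteq> D} (Pow (D - T))"
    by (rule bij_betwI[where g = "\<lambda>B. D - B"]) (use assms in auto)
  have "(\<Sum>A | T \<subseteq> A \<and> A \<subseteq> D. (-1) ^ card (D - A)) = (\<Sum>B\<in>Pow (D - T). (-1) ^ card B :: real)"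
    using sum.reindex_bij_betw[OF bij, of "\<lambda>B. (-1) ^ card B :: real"] by simp
  also have "\<dots> = (\<Prod>i\<in>D - T. (-1) + 1)"
    using assms(1) by (subst prod_add) auto
  also have "\<dots> = (if T = D then 1 else 0)"
    using assms by (auto simp: finite_subset)
  finally show ?thesis .
qed

text \<open>Ryser's formula for the permanent: expand each product over choice functions;
  inclusion-exclusion over the sets containing the range cancels every function that is not onto,
  and those onto are the permutations.\<close>

lemma ryser:
  fixes x :: "nat \<Rightarrow> nat \<Rightarrow> real"
  shows "(\<Sum>A\<in>Pow {..<n}. (-1) ^ card ({..<n} - A) * (\<Prod>j<n. \<Sum>i\<in>A. x i j)) = (\<Sum>p | p permutes {..<n}. \<Prod>j<n. x (p j) j)"
proof -
  let ?D = "{..<n}"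
  let ?P = "PiE ?D (\<lambda>_. ?D)"
  have "(\<Prod>j<n. \<Sum>i\<in>A. x i j) = (\<Sum>\<tau>\<in>?P. if \<tau> ` ?D \<subseteq> A then \<Prod>j<n. x (\<tau> j) j else 0)" if "A \<subseteq> ?D" for A
  proof -
    have "finite A" using that finite_subset by blast
    then have "(\<Prod>j<n. \<Sum>i\<in>A. x i j) = (\<Sum>\<tau>\<in>PiE ?D (\<lambda>_. A). \<Prod>j<n. x (\<tau> j) j)"
      by (intro prod_sum_PiE) auto
    also have "PiE ?D (\<lambda>_. A) = {\<tau> \<in> ?P. \<tau> ` ?D \<subseteq> A}" using that by (fastforce simp: PiE_iff extensional_def)
    finally show ?thesis by (simp add: sum.inter_filter finite_PiE)
  qed
  then have "(\<Sum>A\<in>Pow ?D. (-1) ^ card (?D - A) * (\<Prod>j<n. \<Sum>i\<in>A. x i j)) =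
    (\<Sum>A\<in>Pow ?D. \<Sum>\<tau>\<in>?P. (-1) ^ card (?D - A) * (if \<tau> ` ?D \<subseteq> A then \<Prod>j<n. x (\<tau> j) j else 0))"
    by (simp add: sum_distrib_left)
  also have "\<dots> = (\<Sum>\<tau>\<in>?P. \<Sum>A\<in>Pow ?D. if \<tau> ` ?D \<subseteq> A then (-1) ^ card (?D - A) * (\<Prod>j<n. x (\<tau> j) j) else 0)"
    by (subst sum.swap) (auto intro!: sum.cong)
  also have "\<dots> = (\<Sum>\<tau>\<in>?P. if \<tau> ` ?D = ?D then \<Prod>j<n. x (\<tau> j) j else 0)"
  proof (intro sum.cong refl)
    fix \<tau> assume "\<tau> \<in> ?P"
    then have im: "\<tau> ` ?D \<subseteq> ?D" by auto
    have "(\<Sum>A\<in>Pow ?D. if \<tau> ` ?D \<subseteq> A then (-1) ^ card (?D - A) * (\<Prod>j<n. x (\<tau> j) j) else 0) =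
      (\<Sum>A | \<tau> ` ?D \<subseteq> A \<and> A \<subseteq> ?D. (-1) ^ card (?D - A) * (\<Prod>j<n. x (\<tau> j) j))"
      by (subst sum.inter_filter[symmetric]) (auto intro!: sum.cong)
    also have "\<dots> = (if \<tau> ` ?D = ?D then 1 else 0) * (\<Prod>j<n. x (\<tau> j) j)"
      by (simp only: sum_distrib_right[symmetric] alternating_subset_sum[OF finite_lessThan im])
    finally show "(\<Sum>A\<in>Pow ?D. if \<tau> ` ?D \<subseteq> A then (-1) ^ card (?D - A) * (\<Prod>j<n. x (\<tau> j) j) else 0) = (if \<tau> ` ?D = ?D then \<Prod>j<n. x (\<tau> j) j else 0)"
      by simp
  qed
  also have "\<dots> = (\<Sum>\<tau> | \<tau> \<in> ?P \<and> \<tau> ` ?D = ?D. \<Prod>j<n. x (\<tau> j) j)"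
    by (subst sum.inter_filter[symmetric]) (auto simp: finite_PiE)
  also have "\<dots> = (\<Sum>p | p permutes ?D. \<Prod>j<n. x (p j) j)"
  proof (rule sum.reindex_bij_witness[of _ "\<lambda>p. restrict p ?D" "\<lambda>\<tau> j. if j < n then \<tau> j else j"])
    fix \<tau> assume t: "\<tau> \<in> {\<tau>. \<tau> \<in> ?P \<and> \<tau> ` ?D = ?D}"
    then show "restrict (\<lambda>j. if j < n then \<tau> j else j) ?D = \<tau>"
      by (auto simp: PiE_iff extensional_def restrict_def)
    have "bij_betw \<tau> ?D ?D" using t by (auto simp: bij_betw_def intro: eq_card_imp_inj_on)
    then have "bij_betw (\<lambda>j. if j < n then \<tau> j else j) ?D ?D" by (subst bij_betw_cong[of _ _ \<tau>]) auto
    then show "(\<lambda>j. if j < n then \<tau> j else j) \<in> {p. p permutes ?D}"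
      by (auto intro!: bij_imp_permutes split: if_splits)
  next
    fix p assume "p \<in> {p. p permutes ?D}"
    then have p: "p permutes ?D" by simp
    show "(\<lambda>j. if j < n then restrict p ?D j else j) = p"
      using permutes_not_in[OF p] by auto
    show "restrict p ?D \<in> {\<tau>. \<tau> \<in> ?P \<and> \<tau> ` ?D = ?D}"
      using permutes_image[OF p] permutes_in_image[OF p] by (auto simp: PiE_iff)
  qed (auto intro!: prod.cong)
  finally show ?thesis .
qed

text \<open>Polarisation: by \<open>ryser\<close> the alternating sum of powers is the
  symmetrisation of an elementary tensor, and symmetry of \<open>f\<close> together with invariance
  of \<open>L\<close> under reordering makes all n! rearrangements contribute equally.\<close>

lemma symmetric_basis_tensor_polarization:
  fixes f :: "'h::{real_inner, polish_space} tensor"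
  assumes sym: "\<And>us vs. mset us = mset vs \<Longrightarrow> f us = f vs"
    and L: "L = {es. length es = n \<and> set es \<subseteq> E}" and us: "length us = n"
  shows "fact n * (\<Sum>es\<in>L. f es * elem_tensor es us) =
    (\<Sum>es\<in>L. \<Sum>A\<in>Pow {..<n}. f es * (-1) ^ card ({..<n} - A) * elem_tensor (replicate n (\<Sum>i\<in>A. es ! i)) us)"
proof -
  have inner: "(\<Sum>A\<in>Pow {..<n}. (-1) ^ card ({..<n} - A) * elem_tensor (replicate n (\<Sum>i\<in>A. es ! i)) us) =
     (\<Sum>p | p permutes {..<n}. \<Prod>j<n. es ! p j \<bullet> us ! j)" for es
    unfolding elem_tensor_replicate[OF us] inner_sum_left by (rule ryser)
  have "(\<Sum>es\<in>L. \<Sum>A\<in>Pow {..<n}. f es * (-1) ^ card ({..<n} - A) * elem_tensor (replicate n (\<Sum>i\<in>A. es ! i)) us) =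
    (\<Sum>es\<in>L. f es * (\<Sum>A\<in>Pow {..<n}. (-1) ^ card ({..<n} - A) * elem_tensor (replicate n (\<Sum>i\<in>A. es ! i)) us))"
    by (simp add: sum_distrib_left mult.assoc)
  also have "\<dots> = (\<Sum>es\<in>L. \<Sum>p | p permutes {..<n}. f es * (\<Prod>j<n. es ! p j \<bullet> us ! j))"
    unfolding inner sum_distrib_left ..
  also have "\<dots> = (\<Sum>p | p permutes {..<n}. \<Sum>es\<in>L. f es * (\<Prod>j<n. es ! p j \<bullet> us ! j))"
    by (rule sum.swap)
  also have "\<dots> = (\<Sum>p | p permutes {..<n}. \<Sum>es\<in>L. f es * elem_tensor es us)"
  proof (rule sum.cong[OF refl])
    fix p assume "p \<in> {p. p permutes {..<n}}"
    then have p: "p permutes {..<n}" "inv p permutes {..<n}" by (auto simp: permutes_inv)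
    show "(\<Sum>es\<in>L. f es * (\<Prod>j<n. es ! p j \<bullet> us ! j)) = (\<Sum>es\<in>L. f es * elem_tensor es us)"
    proof (rule sum.reindex_bij_witness[of _ "permute_list (inv p)" "permute_list p"])
      fix es assume "es \<in> L"
      then have es: "length es = n" "set es \<subseteq> E" by (auto simp: L)
      have pl: "p permutes {..<length es}" "inv p permutes {..<length es}" using p es by auto
      show "permute_list (inv p) (permute_list p es) = es" "permute_list p (permute_list (inv p) es) = es"
        using pl permute_list_compose[of "inv p" es p] permute_list_compose[of p es "inv p"]
        by (simp_all add: permutes_inv_o[OF pl(1)])
      show "permute_list p es \<in> L" "permute_list (inv p) es \<in> L"
        using es set_permute_list[OF pl(1)] set_permute_list[OF pl(2)] by (auto simp: L)
      have "f (permute_list p es) = f es" by (intro sym) (simp add: pl)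
      moreover have "elem_tensor (permute_list p es) us = (\<Prod>j<n. es ! p j \<bullet> us ! j)"
        using us es pl by (auto simp: elem_tensor_def permute_list_nth intro!: prod.cong)
      ultimately show "f (permute_list p es) * elem_tensor (permute_list p es) us = f es * (\<Prod>j<n. es ! p j \<bullet> us ! j)"
        by simp
    qed
  qed
  also have "\<dots> = fact n * (\<Sum>es\<in>L. f es * elem_tensor es us)"
    by (simp add: card_permutations)
  finally show ?thesis ..
qed

text \<open>The integral is defined through unit vectors with coefficients indexed by the vectors
  themselves. Hence directions are normalised, the norms move into the coefficients, coinciding
  directions are merged, and zero vectors drop out because \<open>n\<close> > 0.\<close>

lemma power_tensor_normalize:
  fixes v :: "'k \<Rightarrow> 'h::{real_inner, polish_space}"
  assumes "finite K" "n > 0"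
  shows "\<exists>S c. finite S \<and> (\<forall>h\<in>S. norm h = 1) \<and>
    (\<forall>us. length us = n \<longrightarrow> (\<Sum>k\<in>K. a k * elem_tensor (replicate n (v k)) us) = (\<Sum>h\<in>S. c h * elem_tensor (replicate n h) us))"
proof -
  define K' where "K' = {k \<in> K. v k \<noteq> 0}"
  define w where "w k = (1 / norm (v k)) *\<^sub>R v k" for k
  define c where "c h = (\<Sum>k\<in>{k \<in> K'. w k = h}. a k * norm (v k) ^ n)" for h
  have fin: "finite K'" using assms by (simp add: K'_def)
  have "(\<Sum>k\<in>K. a k * elem_tensor (replicate n (v k)) us) = (\<Sum>h\<in>w ` K'. c h * elem_tensor (replicate n h) us)"
    if us: "length us = n" for us
  proof -
    have "(\<Sum>k\<in>K. a k * elem_tensor (replicate n (v k)) us) = (\<Sum>k\<in>K'. a k * elem_tensor (replicate n (v k)) us)"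
      using assms by (intro sum.mono_neutral_right) (auto simp: K'_def elem_tensor_replicate[OF us])
    also have "\<dots> = (\<Sum>k\<in>K'. a k * norm (v k) ^ n * elem_tensor (replicate n (w k)) us)"
    proof (intro sum.cong refl)
      fix k assume "k \<in> K'"
      then have "norm (v k) > 0" by (simp add: K'_def)
      then have "elem_tensor (replicate n (v k)) us = norm (v k) ^ n * elem_tensor (replicate n (w k)) us"
        unfolding elem_tensor_replicate[OF us] w_def
        by (simp add: prod_dividef power_divide)
      then show "a k * elem_tensor (replicate n (v k)) us = a k * norm (v k) ^ n * elem_tensor (replicate n (w k)) us" by simp
    qed
    also have "\<dots> = (\<Sum>h\<in>w ` K'. \<Sum>k\<in>{k \<in> K'. w k = h}. a k * norm (v k) ^ n * elem_tensor (replicate n (w k)) us)"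
      using fin by (intro sum.group[symmetric]) auto
    also have "\<dots> = (\<Sum>h\<in>w ` K'. c h * elem_tensor (replicate n h) us)"
      unfolding c_def sum_distrib_right by (intro sum.cong refl) auto
    finally show ?thesis .
  qed
  then show ?thesis using fin
    by (intro exI[of _ "w ` K'"] exI[of _ c]) (auto simp: w_def K'_def)
qed

text \<open>The defining approximation of the integral must exist for every symmetric tensor:
  truncate the coefficients to finitely many basis lists, then polarise the truncation.\<close>

lemma power_tensor_approx:
  fixes f :: "'h::{real_inner, polish_space} tensor"
  assumes f: "f \<in> sym_tensor_power n" and n: "n > 0" and \<epsilon>: "\<epsilon> > 0"
  shows "\<exists>S c. finite S \<and> (\<forall>h\<in>S. norm h = 1) \<and>
    tensor_norm n (\<lambda>us. (\<Sum>h\<in>S. c h * elem_tensor (replicate n h) us) - f us) \<le> \<epsilon>"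
proof -
  let ?B = "basis_lists n :: 'h list set"
  have ft: "f \<in> tensor_power n" and sym: "\<And>us vs. mset us = mset vs \<Longrightarrow> f us = f vs"
    using f unfolding sym_tensor_power_def by blast+
  have summ: "(\<lambda>es. (f es)\<^sup>2) summable_on ?B" using ft by (simp add: tensor_power_def)
  obtain K where K: "finite K" "K \<subseteq> ?B" "dist (\<Sum>es\<in>K. (f es)\<^sup>2) (\<Sum>\<^sub>\<infinity>es\<in>?B. (f es)\<^sup>2) \<le> \<epsilon>\<^sup>2"
    using infsum_finite_approximation[OF summ, of "\<epsilon>\<^sup>2"] \<epsilon> by auto
  \<comment> \<open>The finite set \<open>K\<close> need not be closed under reordering, so it is
    enlarged to all lists over the letters that occur in it; the tail only gets smaller.\<close>
  define E where "E = (\<Union>es\<in>K. set es)"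
  define L where "L = {es. length es = n \<and> set es \<subseteq> E}"
  have fE: "finite E" using K(1) by (auto simp: E_def)
  have fL: "finite L" unfolding L_def using finite_lists_length_eq[OF fE, of n] by (simp add: conj_commute)
  have LB: "L \<subseteq> ?B" using K(2) by (auto simp: L_def E_def basis_lists_def)
  have KL: "K \<subseteq> L" using K(2) by (auto simp: L_def E_def basis_lists_def)
  define g where "g us = (\<Sum>es\<in>L. f es * elem_tensor es us)" for us
  have gB: "g es = (if es \<in> L then f es else 0)" if "es \<in> ?B" for es
  proof -
    have "g es = (\<Sum>es'\<in>L. if es' = es then f es else 0)"
      unfolding g_def using that LB by (intro sum.cong refl) (auto simp: elem_tensor_basis subset_iff)
    then show ?thesis using fL by simp
  qed
  have tail: "(nrm ?B (\<lambda>es. g es - f es))\<^sup>2 \<le> \<epsilon>\<^sup>2"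
  proof -
    have "(nrm ?B (\<lambda>es. g es - f es))\<^sup>2 = (\<Sum>\<^sub>\<infinity>es\<in>?B. (g es - f es)\<^sup>2)"
      unfolding nrm_sq ip_def by (simp add: power2_eq_square)
    also have "\<dots> = (\<Sum>\<^sub>\<infinity>es\<in>?B - L. (f es)\<^sup>2)"
      by (intro infsum_cong_neutral) (auto simp: gB)
    also have "\<dots> = (\<Sum>\<^sub>\<infinity>es\<in>?B. (f es)\<^sup>2) - (\<Sum>es\<in>L. (f es)\<^sup>2)"
    proof -
      have "(\<Sum>\<^sub>\<infinity>es\<in>L \<union> (?B - L). (f es)\<^sup>2) = (\<Sum>\<^sub>\<infinity>es\<in>L. (f es)\<^sup>2) + (\<Sum>\<^sub>\<infinity>es\<in>?B - L. (f es)\<^sup>2)"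
        using summ fL by (intro infsum_Un_disjoint) (auto intro: summable_on_subset_banach)
      moreover have "L \<union> (?B - L) = ?B" using LB by auto
      ultimately show ?thesis using fL by simp
    qed
    also have "\<dots> \<le> (\<Sum>\<^sub>\<infinity>es\<in>?B. (f es)\<^sup>2) - (\<Sum>es\<in>K. (f es)\<^sup>2)"
      using KL fL by (simp add: sum_mono2)
    also have "\<dots> \<le> \<epsilon>\<^sup>2" using K(3) by (simp add: dist_real_def)
    finally show ?thesis .
  qed
  define Q where "Q = L \<times> Pow {..<n}"
  define v where "v q = (\<Sum>i\<in>snd q. fst q ! i)" for q :: "'h list \<times> nat set"
  define a where "a q = f (fst q) * (-1) ^ card ({..<n} - snd q) / fact n" for q :: "'h list \<times> nat set"
  obtain S c where S: "finite S" "\<forall>h\<in>S. norm h = 1"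
    "\<And>us. length us = n \<Longrightarrow> (\<Sum>q\<in>Q. a q * elem_tensor (replicate n (v q)) us) = (\<Sum>h\<in>S. c h * elem_tensor (replicate n h) us)"
    using power_tensor_normalize[of Q n a v] n fL unfolding Q_def by auto
  have "(\<Sum>h\<in>S. c h * elem_tensor (replicate n h) us) = g us" if us: "length us = n" for us
  proof -
    have "fact n * (\<Sum>q\<in>Q. a q * elem_tensor (replicate n (v q)) us) = (\<Sum>q\<in>Q. f (fst q) * (-1) ^ card ({..<n} - snd q) * elem_tensor (replicate n (v q)) us)"
      by (simp add: a_def sum_distrib_left)
    also have "\<dots> = (\<Sum>es\<in>L. \<Sum>A\<in>Pow {..<n}. f es * (-1) ^ card ({..<n} - A) * elem_tensor (replicate n (\<Sum>i\<in>A. es ! i)) us)"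
      unfolding Q_def v_def by (simp add: sum.cartesian_product case_prod_unfold)
    also have "\<dots> = fact n * g us"
      unfolding g_def by (rule symmetric_basis_tensor_polarization[symmetric, OF sym L_def us])
    finally show ?thesis using S(3)[OF us] by simp
  qed
  then have "nrm ?B (\<lambda>us. (\<Sum>h\<in>S. c h * elem_tensor (replicate n h) us) - f us) = nrm ?B (\<lambda>us. g us - f us)"
    by (intro nrm_cong) (auto simp: basis_lists_def)
  also have "\<dots> \<le> \<epsilon>" using tail \<epsilon> by (intro power2_le_imp_le[OF tail]) simp
  finally show ?thesis using S(1,2) unfolding tensor_norm_nrm by blast
qed

subsection \<open>Hermite and Wick polynomials\<close>

lemma hermite_Suc: "hermite (Suc n) x = x * hermite n x - real n * hermite (n - 1) x"
  by (cases n) auto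

text \<open>\<open>wick a b r (W h) (W g)\<close> is the Wick product of the powers \<open>W h ^ a\<close> and \<open>W g ^ b\<close>
  for unit vectors with \<open>h \<bullet> g = r\<close>.\<close>

fun wick :: "nat \<Rightarrow> nat \<Rightarrow> real \<Rightarrow> real \<Rightarrow> real \<Rightarrow> real" where
  "wick 0 b r x y = hermite b y"
| "wick (Suc 0) b r x y = x * hermite b y - real b * r * hermite (b - 1) y"
| "wick (Suc (Suc a)) b r x y = x * wick (Suc a) b r x y - real (Suc a) * wick a b r x y - real b * r * wick (Suc a) (b - 1) r x y"

lemma wick_Suc: "wick (Suc a) b r x y = x * wick a b r x y - real a * wick (a - 1) b r x y - real b * r * wick a (b - 1) r x y"
  by (cases a) auto

text \<open>A polynomial identity in x, y and r, proved by the three-term recursions. The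
  coefficient counts the partial matchings of size i between k and l points, each matched pair
  contributing a factor r.\<close>

lemma hermite_mult:
  "hermite k x * hermite l y =
     (\<Sum>i\<le>k. fact i * real (k choose i) * real (l choose i) * r ^ i * wick (k - i) (l - i) r x y)"
proof (induction k rule: less_induct)
  case (less k)
  define c where "c k i = fact i * real (k choose i) * real (l choose i)" for k i
  define w where "w a b = wick a b r x y" for a b
  have IH: "hermite j x * hermite l y = (\<Sum>i\<le>j. c j i * r ^ i * w (j - i) (l - i))" if "j < k" for j
    using less[OF that] by (simp add: c_def w_def)
  show ?case
  proof (cases k)
    case 0
    then show ?thesis by simp
  next
    case (Suc j)
    have xw: "x * w a b = w (Suc a) b + real a * w (a - 1) b + real b * r * w a (b - 1)" for a b
      by (simp add: w_def wick_Suc)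
    have prev: "real j * (hermite (j - 1) x * hermite l y) = (\<Sum>i\<le>j. c j i * r ^ i * (real (j - i) * w (j - i - 1) (l - i)))"
    proof (cases j)
      case 0
      then show ?thesis by simp
    next
      case (Suc j')
      have "c j i * real (j - i) = real j * c j' i" if "i \<le> j'" for i
      proof -
        have "(j - i) * (j choose i) = j * (j' choose i)"
          using Suc binomial_absorb_comp[of j i] by simp
        then have "real (j - i) * real (j choose i) = real j * real (j' choose i)"
          by (metis of_nat_mult)
        then show ?thesis by (simp add: c_def mult_ac)
      qed
      then have "(\<Sum>i\<le>j'. c j i * r ^ i * (real (j - i) * w (j - i - 1) (l - i))) = real j * (\<Sum>i\<le>j'. c j' i * r ^ i * w (j' - i) (l - i))"
        unfolding sum_distrib_left by (intro sum.cong refl) (use Suc in \<open>simp add: mult_ac\<close>)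
      then show ?thesis using IH[of j'] Suc \<open>k = Suc j\<close> by simp
    qed
    \<comment> \<open>Counting matchings with one point added: it stays free, or it is matched with
      one of the l - i points still free on the other side.\<close>
    have step: "c (Suc j) (Suc i) = c j (Suc i) + c j i * real (l - i)" for i
    proof -
      have "Suc i * (l choose Suc i) = (l - i) * (l choose i)"
      proof (cases "i < l")
        case True
        then show ?thesis using binomial_absorption[of i l] binomial_absorb_comp[of l i]
          by (metis Suc_pred binomial_absorption diff_Suc_1 gr_implies_not_zero not_gr_zero)
      next
        case False
        then show ?thesis by simp
      qed
      then have "real (Suc i) * real (l choose Suc i) = real (l - i) * real (l choose i)"
        by (metis of_nat_mult)
      then have "real (j choose i) * fact i * (real (Suc i) * real (l choose Suc i)) = real (j choose i) * fact i * (real (l - i) * real (l choose i))"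
        by simp
      then show ?thesis unfolding c_def binomial_Suc_Suc of_nat_add fact_Suc
        by (simp add: algebra_simps)
    qed
    have "hermite (Suc j) x * hermite l y = x * (hermite j x * hermite l y) - real j * (hermite (j - 1) x * hermite l y)"
      by (simp add: hermite_Suc algebra_simps)
    also have "x * (hermite j x * hermite l y) = (\<Sum>i\<le>j. c j i * r ^ i * (x * w (j - i) (l - i)))"
      using IH[of j] Suc by (simp add: sum_distrib_left mult_ac)
    also have "\<dots> = (\<Sum>i\<le>j. c j i * r ^ i * w (Suc (j - i)) (l - i)) + (\<Sum>i\<le>j. c j i * r ^ i * (real (j - i) * w (j - i - 1) (l - i)))
       + (\<Sum>i\<le>j. c j i * r ^ i * (real (l - i) * r * w (j - i) (l - i - 1)))"
      unfolding xw by (simp add: distrib_left sum.distrib)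
    also have "(\<Sum>i\<le>j. c j i * r ^ i * w (Suc (j - i)) (l - i)) = (\<Sum>i\<le>Suc j. c j i * r ^ i * w (Suc j - i) (l - i))"
      by (simp add: c_def Suc_diff_le)
    finally have "hermite (Suc j) x * hermite l y = (\<Sum>i\<le>Suc j. c j i * r ^ i * w (Suc j - i) (l - i))
       + (\<Sum>i\<le>j. c j i * r ^ i * (real (l - i) * r * w (j - i) (l - i - 1)))"
      unfolding prev by simp
    also have "\<dots> = (\<Sum>i\<le>Suc j. c (Suc j) i * r ^ i * w (Suc j - i) (l - i))"
    proof -
      have c0: "c i 0 = 1" for i by (simp add: c_def)
      show ?thesis unfolding sum.atMost_Suc_shift by (simp add: step c0 algebra_simps sum.distrib)
    qed
    finally show ?thesis unfolding c_def w_def Suc .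
  qed
qed

lemma dir_deriv_scale: "dir_deriv m v f f' \<Longrightarrow> dir_deriv m v (\<lambda>x. c * f x) (\<lambda>x. c * f' x)"
  using dir_deriv_mult[OF dir_deriv_const[of m v c]] by simp

lemma dir_deriv_diff: "dir_deriv m v f f' \<Longrightarrow> dir_deriv m v g g' \<Longrightarrow> dir_deriv m v (\<lambda>x. f x - g x) (\<lambda>x. f' x - g' x)"
  using dir_deriv_add[OF _ dir_deriv_scale[of m v g g' "-1"], of f f'] by simp

lemma dir_deriv_hermite:
  assumes "i < m"
  shows "dir_deriv m v (\<lambda>x. hermite n (x i)) (\<lambda>x. v i * real n * hermite (n - 1) (x i))"
proof (induction n rule: less_induct)
  case (less n)
  consider "n = 0" | "n = 1" | n' where "n = Suc (Suc n')" by (metis One_nat_def not0_implies_Suc)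
  then show ?case
  proof cases
    case 1
    then show ?thesis using dir_deriv_const[of m v 1] by simp
  next
    case 2
    then show ?thesis using dir_deriv_coord[OF assms, of v] by simp
  next
    case (3 n')
    have a: "dir_deriv m v (\<lambda>x. hermite (Suc n') (x i)) (\<lambda>x. v i * real (Suc n') * hermite n' (x i))"
      and b: "dir_deriv m v (\<lambda>x. hermite n' (x i)) (\<lambda>x. v i * real n' * hermite (n' - 1) (x i))"
      using less[of "Suc n'"] less[of n'] 3 by simp_all
    have "dir_deriv m v (\<lambda>x. x i * hermite (Suc n') (x i) - real (Suc n') * hermite n' (x i))
       (\<lambda>x. (v i * hermite (Suc n') (x i) + x i * (v i * real (Suc n') * hermite n' (x i))) - real (Suc n') * (v i * real n' * hermite (n' - 1) (x i)))"
      by (intro dir_deriv_diff dir_deriv_scale dir_deriv_mult dir_deriv_coord assms a b)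
    moreover have "(v i * hermite (Suc n') (x i) + x i * (v i * real (Suc n') * hermite n' (x i))) - real (Suc n') * (v i * real n' * hermite (n' - 1) (x i))
        = v i * real (Suc (Suc n')) * hermite (Suc n') (x i)" for x
      by (simp add: hermite_Suc[of n'] algebra_simps)
    ultimately show ?thesis using 3 by simp
  qed
qed

text \<open>Wick polynomials form an Appell family: differentiation in a variable lowers its degree
  by one with the same factor as for ordinary powers.\<close>

lemma dir_deriv_wick:
  assumes i: "i < m" and j: "j < m"
  shows "dir_deriv m v (\<lambda>x. wick a b r (x i) (x j))
    (\<lambda>x. v i * real a * wick (a - 1) b r (x i) (x j) + v j * real b * wick a (b - 1) r (x i) (x j))"
proof (induction a arbitrary: b rule: less_induct)
  case (less a)
  show ?case
  proof (cases a)
    case 0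
    then show ?thesis using dir_deriv_hermite[OF j, of v b] by simp
  next
    case (Suc a')
    let ?w = "\<lambda>a b x. wick a b r (x i) (x j)"
    let ?D = "\<lambda>a b x. v i * real a * ?w (a - 1) b x + v j * real b * ?w a (b - 1) x"
    have IH: "dir_deriv m v (?w a' b) (?D a' b)" for b using less Suc by simp
    have IH2: "dir_deriv m v (\<lambda>x. real a' * ?w (a' - 1) b x) (\<lambda>x. real a' * ?D (a' - 1) b x)" for b
    proof (cases a')
      case 0
      then show ?thesis using dir_deriv_const[of m v 0] by simp
    next
      case (Suc a'')
      then show ?thesis using less[of a''] \<open>a = Suc a'\<close> by (intro dir_deriv_scale) auto
    qed
    have "dir_deriv m v (\<lambda>x. x i * ?w a' b x - real a' * ?w (a' - 1) b x - real b * r * ?w a' (b - 1) x)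
      (\<lambda>x. (v i * ?w a' b x + x i * ?D a' b x) - real a' * ?D (a' - 1) b x - real b * r * ?D a' (b - 1) x)"
      by (intro dir_deriv_diff dir_deriv_mult dir_deriv_coord i IH IH2 dir_deriv_scale)
    moreover have "(v i * ?w a' b x + x i * ?D a' b x) - real a' * ?D (a' - 1) b x - real b * r * ?D a' (b - 1) x = ?D (Suc a') b x" for x
    proof -
      have 1: "real a' * ?w a' b x = real a' * (x i * ?w (a' - 1) b x - real (a' - 1) * ?w (a' - 1 - 1) b x - real b * r * ?w (a' - 1) (b - 1) x)"
        using wick_Suc[of "a' - 1" b r "x i" "x j"] by (cases a') auto
      have 2: "?w (Suc a') (b - 1) x = x i * ?w a' (b - 1) x - real a' * ?w (a' - 1) (b - 1) x - real (b - 1) * r * ?w a' (b - 1 - 1) x"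
        by (rule wick_Suc)
      have "?D (Suc a') b x = v i * ?w a' b x + v i * (real a' * ?w a' b x) + v j * real b * ?w (Suc a') (b - 1) x"
        by (simp add: algebra_simps)
      then show ?thesis unfolding 1 2 by (simp add: algebra_simps)
    qed
    ultimately show ?thesis unfolding Suc wick_Suc by simp
  qed
qed

section \<open>Moments of Wick products\<close>

context isonormal_gaussian_process
begin

text \<open>The lower terms of the Wick recursion are exactly the derivative of the Wick factor
  along \<open>k p\<close>. They cancel in the integration by parts, so one degree is removed and
  the derivative falls on \<open>\<Psi>\<close> alone.\<close>

lemma wick_integration_by_parts:
  fixes k :: "nat \<Rightarrow> 'h"
  assumes d: "dir_deriv m (\<lambda>i. k i \<bullet> k p) \<Psi> \<Psi>'" and p: "p < m" and q: "q < m" and n: "norm (k p) = 1"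
  shows "expectation (\<lambda>\<omega>. wick (Suc a) b (k p \<bullet> k q) (W (k p) \<omega>) (W (k q) \<omega>) * \<Psi> (\<lambda>i. W (k i) \<omega>)) =
     expectation (\<lambda>\<omega>. wick a b (k p \<bullet> k q) (W (k p) \<omega>) (W (k q) \<omega>) * \<Psi>' (\<lambda>i. W (k i) \<omega>))"
proof -
  let ?r = "k p \<bullet> k q"
  let ?w = "\<lambda>a b x. wick a b ?r (x p) (x q)"
  let ?X = "\<lambda>\<omega> i. W (k i) \<omega>"
  have kp: "k p \<bullet> k p = 1" using n by (simp add: norm_eq_1)
  have dw: "dir_deriv m (\<lambda>i. k i \<bullet> k p) (?w a b) (\<lambda>x. real a * ?w (a - 1) b x + ?r * real b * ?w a (b - 1) x)" for a b
    using dir_deriv_wick[OF p q, of "\<lambda>i. k i \<bullet> k p" a b ?r] by (simp add: kp inner_commute[of "k q"])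
  have pgw: "poly_growth m (?w a b)" for a b using dw by (simp add: dir_deriv_def)
  have pg: "poly_growth m \<Psi>" "poly_growth m \<Psi>'" using d by (auto simp: dir_deriv_def)
  define R where "R x = real a * ?w (a - 1) b x + ?r * real b * ?w a (b - 1) x" for x
  have pgR: "poly_growth m R" using dw[of a b] by (simp add: dir_deriv_def R_def[abs_def])
  have I: "integrable M (\<lambda>\<omega>. R (?X \<omega>) * \<Psi> (?X \<omega>))" "integrable M (\<lambda>\<omega>. ?w a b (?X \<omega>) * \<Psi>' (?X \<omega>))"
    "integrable M (\<lambda>\<omega>. W (k p) \<omega> * (?w a b (?X \<omega>) * \<Psi> (?X \<omega>)))"
    using integrable_poly_growth[OF poly_growth_mult[OF pgR pg(1)], of k]
      integrable_poly_growth[OF poly_growth_mult[OF pgw[of a b] pg(2)], of k]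
      integrable_poly_growth[OF poly_growth_mult[OF poly_growth_coord[OF p] poly_growth_mult[OF pgw[of a b] pg(1)]], of k] by auto
  have "expectation (\<lambda>\<omega>. ?w (Suc a) b (?X \<omega>) * \<Psi> (?X \<omega>)) =
    expectation (\<lambda>\<omega>. W (k p) \<omega> * (?w a b (?X \<omega>) * \<Psi> (?X \<omega>)) - R (?X \<omega>) * \<Psi> (?X \<omega>))"
    unfolding wick_Suc R_def by (simp add: algebra_simps)
  also have "\<dots> = expectation (\<lambda>\<omega>. W (k p) \<omega> * (?w a b (?X \<omega>) * \<Psi> (?X \<omega>))) - expectation (\<lambda>\<omega>. R (?X \<omega>) * \<Psi> (?X \<omega>))"
    using I by (intro Bochner_Integration.integral_diff)
  also have "expectation (\<lambda>\<omega>. W (k p) \<omega> * (?w a b (?X \<omega>) * \<Psi> (?X \<omega>))) = expectation (\<lambda>\<omega>. R (?X \<omega>) * \<Psi> (?X \<omega>) + ?w a b (?X \<omega>) * \<Psi>' (?X \<omega>))"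
    by (rule integration_by_parts) (use dir_deriv_mult[OF dw[of a b] d] in \<open>simp add: R_def[abs_def]\<close>)
  also have "\<dots> = expectation (\<lambda>\<omega>. R (?X \<omega>) * \<Psi> (?X \<omega>)) + expectation (\<lambda>\<omega>. ?w a b (?X \<omega>) * \<Psi>' (?X \<omega>))"
    using I by (intro Bochner_Integration.integral_add)
  finally show ?thesis by simp
qed

lemma hermite_integration_by_parts:
  fixes k :: "nat \<Rightarrow> 'h"
  assumes d: "dir_deriv m (\<lambda>i. k i \<bullet> k p) \<Psi> \<Psi>'" and p: "p < m" and n: "norm (k p) = 1"
  shows "expectation (\<lambda>\<omega>. hermite (Suc a) (W (k p) \<omega>) * \<Psi> (\<lambda>i. W (k i) \<omega>)) =
     expectation (\<lambda>\<omega>. hermite a (W (k p) \<omega>) * \<Psi>' (\<lambda>i. W (k i) \<omega>))"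
proof -
  \<comment> \<open>Degree 0 in the second variable leaves the Hermite polynomial, so the pair
    \<open>p\<close>, \<open>p\<close> may be used above.\<close>
  have "wick a 0 r x y = hermite a x" for a r x y
  proof (induction a rule: less_induct)
    case (less a)
    show ?case
    proof (cases a)
      case (Suc b)
      then show ?thesis using less[of b] less[of "b - 1"] by (cases b) (auto simp: wick_Suc hermite_Suc)
    qed simp
  qed
  then show ?thesis using wick_integration_by_parts[OF d p p n, where a = a and b = 0] by simp
qed

text \<open>Every factor on the left has to be paired with a factor on the right, since Wick
  products admit no pairing within. In the polynomial, whose variable is a bookkeeping device, the
  exponent counts the pairings with \<open>k 2\<close>, so the coefficient of order c collects those
  using \<open>k 2\<close> exactly c times.\<close>

lemma expectation_wick_wick:
  fixes k :: "nat \<Rightarrow> 'h"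
  assumes u: "\<And>i. i < 4 \<Longrightarrow> norm (k i) = 1"
  shows "expectation (\<lambda>\<omega>. wick a b (k 0 \<bullet> k 1) (W (k 0) \<omega>) (W (k 1) \<omega>) * wick c d (k 2 \<bullet> k 3) (W (k 2) \<omega>) (W (k 3) \<omega>)) =
    (if a + b = c + d then fact c * fact d * coeff ([:k 0 \<bullet> k 3, k 0 \<bullet> k 2:] ^ a * [:k 1 \<bullet> k 3, k 1 \<bullet> k 2:] ^ b) c else 0)"
    (is "?E a b c d = ?R a b c d")
proof -
  let ?w = "\<lambda>c d (x :: nat \<Rightarrow> real). wick c d (k 2 \<bullet> k 3) (x 2) (x 3)"
  have intw: "integrable M (\<lambda>\<omega>. wick a b (k 0 \<bullet> k 1) (W (k 0) \<omega>) (W (k 1) \<omega>) * ?w c d (\<lambda>i. W (k i) \<omega>))" for a b c d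
  proof -
    have "poly_growth 4 (\<lambda>x. wick a b (k 0 \<bullet> k 1) (x 0) (x 1))" "poly_growth 4 (?w c d)"
      using dir_deriv_wick[of 0 4 1 "\<lambda>_. 0" a b "k 0 \<bullet> k 1"] dir_deriv_wick[of 2 4 3 "\<lambda>_. 0" c d "k 2 \<bullet> k 3"]
      by (simp_all add: dir_deriv_def)
    from integrable_poly_growth[OF poly_growth_mult[OF this], of k] show ?thesis by simp
  qed
  have dd: "dir_deriv 4 (\<lambda>i. k i \<bullet> k p) (?w c d) (\<lambda>x. (k p \<bullet> k 2) * real c * ?w (c - 1) d x + (k p \<bullet> k 3) * real d * ?w c (d - 1) x)" for p c d
    using dir_deriv_wick[of 2 4 3 "\<lambda>i. k i \<bullet> k p" c d "k 2 \<bullet> k 3"] by (simp add: inner_commute[of "k p"])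
  have rec: "?E (Suc a) b c d = (k 0 \<bullet> k 2) * real c * ?E a b (c - 1) d + (k 0 \<bullet> k 3) * real d * ?E a b c (d - 1)" for a b c d
  proof -
    have "?E (Suc a) b c d = expectation (\<lambda>\<omega>. (k 0 \<bullet> k 2) * real c * (wick a b (k 0 \<bullet> k 1) (W (k 0) \<omega>) (W (k 1) \<omega>) * ?w (c - 1) d (\<lambda>i. W (k i) \<omega>))
      + (k 0 \<bullet> k 3) * real d * (wick a b (k 0 \<bullet> k 1) (W (k 0) \<omega>) (W (k 1) \<omega>) * ?w c (d - 1) (\<lambda>i. W (k i) \<omega>)))"
      using wick_integration_by_parts[OF dd[of 0 c d], where q = 1 and a = a and b = b] u by (simp add: algebra_simps)
    also have "\<dots> = (k 0 \<bullet> k 2) * real c * ?E a b (c - 1) d + (k 0 \<bullet> k 3) * real d * ?E a b c (d - 1)"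
      using intw by (subst Bochner_Integration.integral_add) auto
    finally show ?thesis .
  qed
  have rec0: "?E 0 (Suc b) c d = (k 1 \<bullet> k 2) * real c * ?E 0 b (c - 1) d + (k 1 \<bullet> k 3) * real d * ?E 0 b c (d - 1)" for b c d
  proof -
    have "?E 0 (Suc b) c d = expectation (\<lambda>\<omega>. (k 1 \<bullet> k 2) * real c * (wick 0 b (k 0 \<bullet> k 1) (W (k 0) \<omega>) (W (k 1) \<omega>) * ?w (c - 1) d (\<lambda>i. W (k i) \<omega>))
      + (k 1 \<bullet> k 3) * real d * (wick 0 b (k 0 \<bullet> k 1) (W (k 0) \<omega>) (W (k 1) \<omega>) * ?w c (d - 1) (\<lambda>i. W (k i) \<omega>)))"
      using hermite_integration_by_parts[OF dd[of 1 c d], where a = b] u by (simp add: algebra_simps)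
    also have "\<dots> = (k 1 \<bullet> k 2) * real c * ?E 0 b (c - 1) d + (k 1 \<bullet> k 3) * real d * ?E 0 b c (d - 1)"
      using intw[of 0 b "c - 1" d] intw[of 0 b c "d - 1"] by (subst Bochner_Integration.integral_add) auto
    finally show ?thesis .
  qed
  \<comment> \<open>Against the constant 1, whose derivative is 0, integration by parts kills every
    right side of positive degree.\<close>
  have base: "?E 0 0 c d = (if c = 0 \<and> d = 0 then 1 else 0)" for c d
  proof -
    have dc: "dir_deriv 4 v (\<lambda>_. 1) (\<lambda>_. 0)" for v by (rule dir_deriv_const)
    show ?thesis
    proof (cases c)
      case 0
      then show ?thesis
        using hermite_integration_by_parts[OF dc, where p = 3 and k = k and a = "d - 1"] u by (cases d) (auto simp: prob_space)
    next
      case (Suc c')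
      then show ?thesis
        using wick_integration_by_parts[OF dc, where p = 2 and q = 3 and k = k and a = c' and b = d] u by auto
    qed
  qed
  let ?p = "[:k 0 \<bullet> k 3, k 0 \<bullet> k 2:]" and ?q = "[:k 1 \<bullet> k 3, k 1 \<bullet> k 2:]"
  have deg: "degree (?p ^ a * ?q ^ b) \<le> a + b" for a b
  proof -
    have "degree ?p \<le> 1" "degree ?q \<le> 1" by (simp_all add: degree_pCons_le order_trans[OF degree_pCons_le])
    then have "degree (?p ^ a) \<le> 1 * a" "degree (?q ^ b) \<le> 1 * b"
      by (meson degree_power_le order_trans mult_le_mono1)+
    then show ?thesis using degree_mult_le[of "?p ^ a" "?q ^ b"] by linarith
  qed
  \<comment> \<open>The recursion obtained from integration by parts is multiplication by one more
    linear factor. The degree bound matters for d = 0, where the coefficient of order s + 1 has to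
    vanish.\<close>
  have alg: "x2 * real c * (if s = (c - 1) + d then fact (c - 1) * fact d * coeff R (c - 1) else 0) +
      x3 * real d * (if s = c + (d - 1) then fact c * fact (d - 1) * coeff R c else 0) =
     (if Suc s = c + d then fact c * fact d * coeff ([:x3, x2:] * R) c else 0)"
    if "degree R \<le> s" for x2 x3 :: real and s c d and R :: "real poly"
  proof -
    have f: "real j * fact (j - 1) = fact j" if "j > 0" for j :: nat
      using that by (cases j) auto
    have t1: "x2 * real c * (if s = (c - 1) + d then fact (c - 1) * fact d * coeff R (c - 1) else 0) =
      (if Suc s = c + d then fact c * fact d * (x2 * coeff (pCons 0 R) c) else 0)"
      by (cases c) (auto simp: algebra_simps)
    have t2: "x3 * real d * (if s = c + (d - 1) then fact c * fact (d - 1) * coeff R c else 0) =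
      (if Suc s = c + d then fact c * fact d * (x3 * coeff R c) else 0)"
      using that by (cases d) (auto simp: coeff_eq_0 algebra_simps)
    show ?thesis unfolding t1 t2 by (cases c) (auto simp: algebra_simps)
  qed
  have b0: "?E 0 b c d = ?R 0 b c d" for b c d
  proof (induction b arbitrary: c d)
    case 0
    show ?case unfolding base by auto
  next
    case (Suc b)
    have pw: "?p ^ 0 * ?q ^ Suc b = ?q * (?p ^ 0 * ?q ^ b)" by (simp only: power_Suc power_0 mult_1_left)
    show ?case unfolding rec0 Suc by (simp only: alg[OF deg[of 0 b]] pw add_Suc_right)
  qed
  show ?thesis
  proof (induction a arbitrary: c d)
    case 0
    show ?case by (rule b0)
  next
    case (Suc a)
    have pw: "?p ^ Suc a * ?q ^ b = ?p * (?p ^ a * ?q ^ b)" by (simp only: power_Suc mult.assoc)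
    show ?case unfolding rec Suc by (simp only: alg[OF deg[of a b]] pw add_Suc)
  qed
qed

text \<open>With all degrees equal, i counts the pairings of \<open>h1\<close> with
  \<open>h2\<close>. The remaining a - i copies of \<open>h1\<close> go to \<open>g2\<close>, which
  forces the pairings of \<open>g1\<close> and leaves a product of powers of two matchings.\<close>

lemma expectation_wick_diag:
  assumes u: "norm h1 = 1" "norm g1 = 1" "norm h2 = 1" "norm g2 = 1"
  shows "expectation (\<lambda>\<omega>. wick a a (h1 \<bullet> g1) (W h1 \<omega>) (W g1 \<omega>) * wick b b (h2 \<bullet> g2) (W h2 \<omega>) (W g2 \<omega>)) =
    (if a = b then (fact a)\<^sup>2 * (\<Sum>i\<le>a. (real (a choose i))\<^sup>2 * ((h1 \<bullet> h2) * (g1 \<bullet> g2)) ^ i * ((h1 \<bullet> g2) * (g1 \<bullet> h2)) ^ (a - i)) else 0)"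
proof -
  define k where "k i = (if i = 0 then h1 else if i = 1 then g1 else if i = 2 then h2 else g2)" for i :: nat
  have k: "k 0 = h1" "k 1 = g1" "k 2 = h2" "k 3 = g2" by (auto simp: k_def)
  have "coeff ([:h1 \<bullet> g2, h1 \<bullet> h2:] ^ a * [:g1 \<bullet> g2, g1 \<bullet> h2:] ^ a) a =
     (\<Sum>i\<le>a. (real (a choose i))\<^sup>2 * ((h1 \<bullet> h2) * (g1 \<bullet> g2)) ^ i * ((h1 \<bullet> g2) * (g1 \<bullet> h2)) ^ (a - i))"
    unfolding coeff_mult
    by (intro sum.cong refl) (simp add: coeff_linear_poly_power binomial_symmetric[symmetric] power2_eq_square power_mult_distrib mult_ac)
  then show ?thesis
    using expectation_wick_wick[of k a a b b] u unfolding k by (cases "a = b") (auto simp: k_def power2_eq_square)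
qed

lemma integrable_hermite_prod4:
  "integrable M (\<lambda>\<omega>. hermite a (W h1 \<omega>) * hermite b (W h2 \<omega>) * (hermite c (W h3 \<omega>) * hermite d (W h4 \<omega>)))"
proof -
  define k where "k i = (if i = 0 then h1 else if i = 1 then h2 else if i = 2 then h3 else h4)" for i :: nat
  have pg: "poly_growth 4 (\<lambda>x. hermite n (x i))" if "i < 4" for n i
    using dir_deriv_hermite[OF that, of "\<lambda>_. 0" n] by (simp add: dir_deriv_def)
  have "poly_growth 4 (\<lambda>x. hermite a (x 0) * hermite b (x 1) * (hermite c (x 2) * hermite d (x 3)))"
    by (intro poly_growth_mult pg) auto
  from integrable_poly_growth[OF this, of k] show ?thesis by (simp add: k_def)
qed

lemma integrable_hermite_prod2: "integrable M (\<lambda>\<omega>. hermite a (W h1 \<omega>) * hermite b (W h2 \<omega>))"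
  using integrable_hermite_prod4[of a h1 b h2 0 h1 0 h1] by simp

lemma expectation_hermite_hermite:
  assumes "norm h = 1" "norm g = 1"
  shows "expectation (\<lambda>\<omega>. hermite a (W h \<omega>) * hermite b (W g \<omega>)) = (if a = b then fact b * (h \<bullet> g) ^ b else 0)"
proof -
  define k where "k i = (if i = 1 then h else g)" for i :: nat
  have "coeff ([:h \<bullet> g, h \<bullet> g:] ^ b) 0 = (h \<bullet> g) ^ b" by (simp add: coeff_linear_poly_power)
  then show ?thesis
    using expectation_wick_wick[of k 0 a 0 b] assms by (simp add: k_def)
qed

text \<open>Both pairs are expanded by \<open>hermite_mult\<close>; Wick products of different
  orders are orthogonal, so only equal contraction numbers r survive and the weight becomes a
  square.\<close>

lemma expectation_hermite4:
  assumes u: "norm h1 = 1" "norm g1 = 1" "norm h2 = 1" "norm g2 = 1"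
  shows "expectation (\<lambda>\<omega>. hermite m (W h1 \<omega>) * hermite m (W g1 \<omega>) * (hermite m (W h2 \<omega>) * hermite m (W g2 \<omega>))) =
    (\<Sum>r\<le>m. (fact r * (real (m choose r))\<^sup>2)\<^sup>2 * ((h1 \<bullet> g1) * (h2 \<bullet> g2)) ^ r *
      expectation (\<lambda>\<omega>. wick (m - r) (m - r) (h1 \<bullet> g1) (W h1 \<omega>) (W g1 \<omega>) * wick (m - r) (m - r) (h2 \<bullet> g2) (W h2 \<omega>) (W g2 \<omega>)))"
proof -
  let ?w = "\<lambda>h g r \<omega>. wick (m - r) (m - r) (h \<bullet> g) (W h \<omega>) (W g \<omega>)"
  let ?c = "\<lambda>r. fact r * (real (m choose r))\<^sup>2 :: real"
  have prod: "hermite m (W h \<omega>) * hermite m (W g \<omega>) = (\<Sum>r\<le>m. ?c r * (h \<bullet> g) ^ r * ?w h g r \<omega>)" for h g \<omega>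
    unfolding hermite_mult[of m _ m _ "h \<bullet> g"] by (simp add: power2_eq_square mult_ac)
  have int: "integrable M (\<lambda>\<omega>. ?w h1 g1 r \<omega> * ?w h2 g2 r' \<omega>)" for r r'
  proof -
    define k where "k i = (if i = 0 then h1 else if i = 1 then g1 else if i = 2 then h2 else g2)" for i :: nat
    have "poly_growth 4 (\<lambda>x. wick (m - r) (m - r) (h1 \<bullet> g1) (x 0) (x 1))" "poly_growth 4 (\<lambda>x. wick (m - r') (m - r') (h2 \<bullet> g2) (x 2) (x 3))"
      using dir_deriv_wick[of 0 4 1 "\<lambda>_. 0" "m-r" "m-r" "h1 \<bullet> g1"] dir_deriv_wick[of 2 4 3 "\<lambda>_. 0" "m-r'" "m-r'" "h2 \<bullet> g2"]
      by (simp_all add: dir_deriv_def)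
    from integrable_poly_growth[OF poly_growth_mult[OF this], of k] show ?thesis by (simp add: k_def)
  qed
  have "expectation (\<lambda>\<omega>. hermite m (W h1 \<omega>) * hermite m (W g1 \<omega>) * (hermite m (W h2 \<omega>) * hermite m (W g2 \<omega>))) =
    expectation (\<lambda>\<omega>. \<Sum>r\<le>m. \<Sum>r'\<le>m. ?c r * (h1 \<bullet> g1) ^ r * (?c r' * (h2 \<bullet> g2) ^ r') * (?w h1 g1 r \<omega> * ?w h2 g2 r' \<omega>))"
    unfolding prod by (simp add: sum_product mult_ac)
  also have "\<dots> = (\<Sum>r\<le>m. \<Sum>r'\<le>m. ?c r * (h1 \<bullet> g1) ^ r * (?c r' * (h2 \<bullet> g2) ^ r') * expectation (\<lambda>\<omega>. ?w h1 g1 r \<omega> * ?w h2 g2 r' \<omega>))"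
    using int by (subst Bochner_Integration.integral_sum, simp)+ simp
  also have "\<dots> = (\<Sum>r\<le>m. \<Sum>r'\<le>m. if r' = r then (?c r)\<^sup>2 * ((h1 \<bullet> g1) * (h2 \<bullet> g2)) ^ r * expectation (\<lambda>\<omega>. ?w h1 g1 r \<omega> * ?w h2 g2 r \<omega>) else 0)"
  proof (intro sum.cong refl, goal_cases)
    case (1 r r')
    show ?case
    proof (cases "r' = r")
      case True
      then show ?thesis by (simp add: power2_eq_square power_mult_distrib mult_ac)
    next
      case False
      then have "m - r \<noteq> m - r'" using 1 by auto
      then show ?thesis using False expectation_wick_diag[OF u, of "m - r" "m - r'"] by simp
    qed
  qed
  finally show ?thesis by simp
qed

end

subsection \<open>Positive semidefinite kernels\<close>

definition psd :: "('i \<Rightarrow> 'i \<Rightarrow> real) \<Rightarrow> bool" where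
  "psd K \<longleftrightarrow> (\<forall>I a. finite I \<longrightarrow> 0 \<le> (\<Sum>p\<in>I. \<Sum>q\<in>I. a p * a q * K p q))"

lemma psdD: "psd K \<Longrightarrow> finite I \<Longrightarrow> 0 \<le> (\<Sum>p\<in>I. \<Sum>q\<in>I. a p * a q * K p q)"
  by (simp add: psd_def)

lemma psd_one: "psd (\<lambda>p q. 1)"
  unfolding psd_def
proof (intro allI impI)
  fix I :: "'a set" and a :: "'a \<Rightarrow> real"
  have "(\<Sum>p\<in>I. \<Sum>q\<in>I. a p * a q * 1) = (\<Sum>p\<in>I. a p)\<^sup>2"
    by (simp add: power2_eq_square sum_product)
  then show "0 \<le> (\<Sum>p\<in>I. \<Sum>q\<in>I. a p * a q * 1)" by simp
qed

text \<open>The Cauchy-Binet (Lagrange) identity. The alternating coefficients are the 2 x 2 minors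
  of u and v, and the factor 1/2 compensates for counting each pair of vectors in both
  orders.\<close>

lemma sum_pairs_gram:
  fixes x :: "'h \<Rightarrow> 'h \<Rightarrow> real"
  assumes sym: "\<And>h k. x h k = x k h"
  shows "(\<Sum>h\<in>S. \<Sum>k\<in>S. u h * u k * x h k) * (\<Sum>h\<in>S. \<Sum>k\<in>S. v h * v k * x h k) - (\<Sum>h\<in>S. \<Sum>k\<in>S. u h * v k * x h k)\<^sup>2
   = (\<Sum>p\<in>S\<times>S. \<Sum>q\<in>S\<times>S. (u (fst p) * v (snd p) - v (fst p) * u (snd p)) * (u (fst q) * v (snd q) - v (fst q) * u (snd q))
       * (x (fst p) (fst q) * x (snd p) (snd q))) / 2"
proof -
  define B where "B u v = (\<Sum>h\<in>S. \<Sum>k\<in>S. u h * v k * x h k)" for u v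
  have prod: "(\<Sum>p\<in>S\<times>S. \<Sum>q\<in>S\<times>S. u1 (fst p) * v1 (snd p) * (u2 (fst q) * v2 (snd q)) * (x (fst p) (fst q) * x (snd p) (snd q))) = B u1 u2 * B v1 v2" for u1 v1 u2 v2
  proof -
    have "B u1 u2 * B v1 v2 = (\<Sum>h\<in>S. \<Sum>g\<in>S. (\<Sum>k\<in>S. u1 h * u2 k * x h k) * (\<Sum>l\<in>S. v1 g * v2 l * x g l))"
      unfolding B_def sum_product ..
    also have "\<dots> = (\<Sum>h\<in>S. \<Sum>g\<in>S. \<Sum>k\<in>S. \<Sum>l\<in>S. (u1 h * u2 k * x h k) * (v1 g * v2 l * x g l))"
      by (simp add: sum_product)
    finally show ?thesis by (simp add: sum.cartesian_product' mult_ac)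
  qed
  have comm: "B v u = B u v"
    unfolding B_def by (subst sum.swap) (simp add: sym mult_ac)
  have "(\<Sum>p\<in>S\<times>S. \<Sum>q\<in>S\<times>S. (u (fst p) * v (snd p) - v (fst p) * u (snd p)) * (u (fst q) * v (snd q) - v (fst q) * u (snd q))
       * (x (fst p) (fst q) * x (snd p) (snd q))) = B u u * B v v - B u v * B v u - B v u * B u v + B v v * B u u"
    unfolding prod[symmetric] by (simp add: left_diff_distrib right_diff_distrib sum_subtractf sum.distrib)
  then show ?thesis unfolding comm B_def[symmetric] by (simp add: power2_eq_square)
qed

section \<open>Schur products with inner product kernels\<close>

context isonormal_gaussian_process
begin

lemma psd_expectation:
  fixes f :: "'i \<Rightarrow> 'w \<Rightarrow> real"
  assumes "\<And>p q. integrable M (\<lambda>\<omega>. f p \<omega> * f q \<omega>)"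
  shows "psd (\<lambda>p q. expectation (\<lambda>\<omega>. f p \<omega> * f q \<omega>))"
  unfolding psd_def
proof (intro allI impI)
  fix I :: "'i set" and a assume "finite I"
  have "(\<Sum>p\<in>I. \<Sum>q\<in>I. a p * a q * expectation (\<lambda>\<omega>. f p \<omega> * f q \<omega>)) = expectation (\<lambda>\<omega>. \<Sum>p\<in>I. \<Sum>q\<in>I. a p * a q * (f p \<omega> * f q \<omega>))"
    using assms by simp
  also have "\<dots> = expectation (\<lambda>\<omega>. (\<Sum>p\<in>I. a p * f p \<omega>)\<^sup>2)"
    by (simp add: power2_eq_square sum_product mult_ac)
  also have "\<dots> \<ge> 0" by simp
  finally show "0 \<le> (\<Sum>p\<in>I. \<Sum>q\<in>I. a p * a q * expectation (\<lambda>\<omega>. f p \<omega> * f q \<omega>))" .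
qed

text \<open>An instance of Schur's product theorem: the inner product is the covariance of the process.\<close>

lemma psd_mult_inner:
  fixes f :: "'i \<Rightarrow> 'h"
  assumes "psd K"
  shows "psd (\<lambda>p q. K p q * (f p \<bullet> f q))"
  unfolding psd_def
proof (intro allI impI)
  fix I :: "'i set" and a assume I: "finite I"
  have "(\<Sum>p\<in>I. \<Sum>q\<in>I. a p * a q * (K p q * (f p \<bullet> f q))) = (\<Sum>p\<in>I. \<Sum>q\<in>I. a p * a q * K p q * expectation (\<lambda>\<omega>. W (f p) \<omega> * W (f q) \<omega>))"
    by (simp add: covariance mult_ac)
  also have "\<dots> = expectation (\<lambda>\<omega>. \<Sum>p\<in>I. \<Sum>q\<in>I. a p * a q * K p q * (W (f p) \<omega> * W (f q) \<omega>))"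
    by (simp add: integrable_W_mult)
  also have "\<dots> = expectation (\<lambda>\<omega>. \<Sum>p\<in>I. \<Sum>q\<in>I. (a p * W (f p) \<omega>) * (a q * W (f q) \<omega>) * K p q)"
    by (simp add: mult_ac)
  also have "\<dots> \<ge> 0" by (intro integral_nonneg_AE AE_I2 psdD assms I)
  finally show "0 \<le> (\<Sum>p\<in>I. \<Sum>q\<in>I. a p * a q * (K p q * (f p \<bullet> f q)))" .
qed

lemma psd_mult_inner_power:
  fixes f :: "'i \<Rightarrow> 'h"
  shows "psd K \<Longrightarrow> psd (\<lambda>p q. K p q * (f p \<bullet> f q) ^ i)"
proof (induction i)
  case (Suc i)
  then show ?case using psd_mult_inner[of "\<lambda>p q. K p q * (f p \<bullet> f q) ^ i" f] by (simp add: mult_ac)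
qed simp

end

subsection \<open>Quadrilinear contractions of finite combinations of powers\<close>

definition KX :: "'h::real_inner \<times> 'h \<Rightarrow> 'h \<times> 'h \<Rightarrow> real" where "KX p q = (fst p \<bullet> fst q) * (snd p \<bullet> snd q)"
definition KY :: "'h::real_inner \<times> 'h \<Rightarrow> 'h \<times> 'h \<Rightarrow> real" where "KY p q = (fst p \<bullet> snd q) * (snd p \<bullet> fst q)"
definition KZ :: "'h::real_inner \<times> 'h \<Rightarrow> 'h \<times> 'h \<Rightarrow> real" where "KZ p q = (fst p \<bullet> snd p) * (fst q \<bullet> snd q)"

definition alt_coeff :: "('h \<Rightarrow> real) \<Rightarrow> ('h \<Rightarrow> real) \<Rightarrow> 'h \<times> 'h \<Rightarrow> real" where
  "alt_coeff c d p = c (fst p) * d (snd p) - d (fst p) * c (snd p)"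

text \<open>In the notation of the overview, \<open>T b\<close> is one half of
  \<open>quad S (alt_coeff c d) (n - b) 0 b\<close>.\<close>

definition quad :: "'h::real_inner set \<Rightarrow> ('h \<times> 'h \<Rightarrow> real) \<Rightarrow> nat \<Rightarrow> nat \<Rightarrow> nat \<Rightarrow> real" where
  "quad S a i j k = (\<Sum>p\<in>S\<times>S. \<Sum>q\<in>S\<times>S. a p * a q * (KX p q ^ i * KY p q ^ j * KZ p q ^ k))"

lemma sum_pair_swap: "(\<Sum>p\<in>S\<times>S. f p) = (\<Sum>p\<in>S\<times>S. f (snd p, fst p))"
  by (rule sum.reindex_bij_witness[of _ "\<lambda>p. (snd p, fst p)" "\<lambda>p. (snd p, fst p)"]) auto

text \<open>Interchanging the two vectors of \<open>q\<close> changes the sign of the alternating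
  coefficient, exchanges \<open>KX\<close> with \<open>KY\<close> and fixes
  \<open>KZ\<close>.\<close>

lemma quad_alt_swap: "quad S (alt_coeff c d) i j k = - quad S (alt_coeff c d) j i k"
proof -
  have "quad S (alt_coeff c d) i j k = (\<Sum>p\<in>S\<times>S. \<Sum>q\<in>S\<times>S. - (alt_coeff c d p * alt_coeff c d q * (KX p q ^ j * KY p q ^ i * KZ p q ^ k)))"
    unfolding quad_def
  proof (rule sum.cong[OF refl])
    fix p
    show "(\<Sum>q\<in>S\<times>S. alt_coeff c d p * alt_coeff c d q * (KX p q ^ i * KY p q ^ j * KZ p q ^ k)) =
      (\<Sum>q\<in>S\<times>S. - (alt_coeff c d p * alt_coeff c d q * (KX p q ^ j * KY p q ^ i * KZ p q ^ k)))"
      by (subst sum_pair_swap, rule sum.cong[OF refl])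
         (simp add: alt_coeff_def KX_def KY_def KZ_def inner_commute algebra_simps)
  qed
  then show ?thesis by (simp add: quad_def sum_negf)
qed

text \<open>\<open>mixed S c d i j k\<close> contracts \<open>f, f, g, g\<close> along the edges of the complete graph: \<open>i\<close> edges
  for \<open>f f\<close> and \<open>g g\<close>, and \<open>j\<close> respectively \<open>k\<close> for the two matchings of the \<open>f\<close>'s with the \<open>g\<close>'s.\<close>

definition mixed :: "'h::real_inner set \<Rightarrow> ('h \<Rightarrow> real) \<Rightarrow> ('h \<Rightarrow> real) \<Rightarrow> nat \<Rightarrow> nat \<Rightarrow> nat \<Rightarrow> real" where
  "mixed S c d i j k = (\<Sum>(h, g, h', g')\<in>S\<times>S\<times>S\<times>S. c h * d g * c h' * d g' *
     (((h \<bullet> h') * (g \<bullet> g')) ^ i * ((h \<bullet> g) * (h' \<bullet> g')) ^ j * ((h \<bullet> g') * (h' \<bullet> g)) ^ k))"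

lemma mixed_swap: "mixed S c d i j k = mixed S c d i k j"
  unfolding mixed_def
  by (rule sum.reindex_bij_witness[of _ "\<lambda>(h, g, h', g'). (h, g', h', g)" "\<lambda>(h, g, h', g'). (h, g', h', g)"])
     (auto simp: inner_commute mult_ac)

text \<open>Of the four products of coefficients two have equal and two have opposite orientation.
  Relabelling identifies each kind with one contraction of f, f, g, g.\<close>

lemma quad_alt_eq_mixed: "quad S (alt_coeff c d) i j k = 2 * (mixed S c d i k j - mixed S c d j k i)"
proof -
  let ?T = "S\<times>S\<times>S\<times>S"
  let ?m = "\<lambda>h g h' g'. ((h \<bullet> h') * (g \<bullet> g')) ^ i * ((h \<bullet> g') * (g \<bullet> h')) ^ j * ((h \<bullet> g) * (h' \<bullet> g')) ^ k"
  have "quad S (alt_coeff c d) i j k = (\<Sum>(h, g, h', g')\<in>?T. alt_coeff c d (h, g) * alt_coeff c d (h', g') * ?m h g h' g')"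
    unfolding quad_def by (simp add: sum.cartesian_product' KX_def KY_def KZ_def)
  also have "\<dots> = (\<Sum>(h, g, h', g')\<in>?T. c h * d g * c h' * d g' * ?m h g h' g') + (\<Sum>(h, g, h', g')\<in>?T. d h * c g * d h' * c g' * ?m h g h' g')
     - (\<Sum>(h, g, h', g')\<in>?T. c h * d g * d h' * c g' * ?m h g h' g') - (\<Sum>(h, g, h', g')\<in>?T. d h * c g * c h' * d g' * ?m h g h' g')"
    unfolding sum.distrib[symmetric] sum_subtractf[symmetric]
    by (intro sum.cong refl) (auto simp: alt_coeff_def algebra_simps)
  also have "(\<Sum>(h, g, h', g')\<in>?T. c h * d g * c h' * d g' * ?m h g h' g') = mixed S c d i k j"
    unfolding mixed_def by (intro sum.cong refl) (auto simp: inner_commute mult_ac)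
  also have "(\<Sum>(h, g, h', g')\<in>?T. d h * c g * d h' * c g' * ?m h g h' g') = mixed S c d i k j"
    unfolding mixed_def
    by (rule sum.reindex_bij_witness[of _ "\<lambda>(h, g, h', g'). (g, h, g', h')" "\<lambda>(h, g, h', g'). (g, h, g', h')"])
       (auto simp: inner_commute mult_ac)
  also have "(\<Sum>(h, g, h', g')\<in>?T. c h * d g * d h' * c g' * ?m h g h' g') = mixed S c d j k i"
    unfolding mixed_def
    by (rule sum.reindex_bij_witness[of _ "\<lambda>(h, g, h', g'). (h, g, g', h')" "\<lambda>(h, g, h', g'). (h, g, g', h')"])
       (auto simp: inner_commute mult_ac)
  also have "(\<Sum>(h, g, h', g')\<in>?T. d h * c g * c h' * d g' * ?m h g h' g') = mixed S c d j k i"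
    unfolding mixed_def
    by (rule sum.reindex_bij_witness[of _ "\<lambda>(h, g, h', g'). (g, h, h', g')" "\<lambda>(h, g, h', g'). (g, h, h', g')"])
       (auto simp: inner_commute mult_ac)
  finally show ?thesis by simp
qed

text \<open>Expressed through \<open>mixed\<close>, the two forms on the right share a contraction
  with no edge joining the two f's; by symmetry in the two matchings across it cancels.\<close>

lemma quad_alt_relation:
  "quad S (alt_coeff c d) i j 0 = quad S (alt_coeff c d) i 0 j - quad S (alt_coeff c d) j 0 i"
  unfolding quad_alt_eq_mixed by (simp add: mixed_swap[of S c d _ 0] mixed_swap[of S c d 0 j i])

section \<open>Positivity and comparison of contractions\<close>

context isonormal_gaussian_process
begin

lemma psd_KX_power:
  fixes K :: "'h \<times> 'h \<Rightarrow> 'h \<times> 'h \<Rightarrow> real"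
  shows "psd K \<Longrightarrow> psd (\<lambda>p q. K p q * KX p q ^ i)"
  using psd_mult_inner_power[OF psd_mult_inner_power, of K fst i snd i]
  by (simp add: KX_def power_mult_distrib mult_ac)

text \<open>\<open>KZ\<close> is a function of p times the same function of q, so its powers are
  absorbed into the coefficients; powers of \<open>KX\<close> are Schur products and keep
  positivity.\<close>

lemma quad_sum_nonneg:
  fixes S :: "'h set"
  assumes "finite S" "psd K"
  shows "0 \<le> (\<Sum>p\<in>S\<times>S. \<Sum>q\<in>S\<times>S. a p * a q * (KX p q ^ i * K p q * KZ p q ^ k))"
proof -
  have "0 \<le> (\<Sum>p\<in>S\<times>S. \<Sum>q\<in>S\<times>S. (a p * (fst p \<bullet> snd p) ^ k) * (a q * (fst q \<bullet> snd q) ^ k) * (K p q * KX p q ^ i))"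
    using assms by (intro psdD psd_KX_power) auto
  then show ?thesis by (simp add: KZ_def power_mult_distrib mult_ac)
qed

lemma quad_X_nonneg:
  fixes S :: "'h set"
  shows "finite S \<Longrightarrow> 0 \<le> quad S a i 0 k"
  using quad_sum_nonneg[OF _ psd_one, of S a i k] by (simp add: quad_def)

text \<open>Cauchy--Schwarz for the tensor \<open>\<Sum>p. a p *\<^sub>R (fst p)\<^sup>i \<otimes> (snd p)\<^sup>i \<otimes> (fst p)\<^sup>j \<otimes> (snd p)\<^sup>j\<close> and its
  image under exchanging the last two factors.\<close>

lemma quad_XY_le:
  fixes S :: "'h set"
  assumes S: "finite S"
  shows "quad S a i j k \<le> quad S a (i + j) 0 k"
proof -
  let ?P = "S \<times> S"
  \<comment> \<open>The Boolean doubles the index set: true gives the tensor, false, with sign -1,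
    its image under the exchange. Nonnegativity of the squared norm of the difference is the claim,
    as the exchange is an isometry.\<close>
  define f where "f z = (if snd z then fst (fst z) else snd (fst z))" for z :: "('h \<times> 'h) \<times> bool"
  define g where "g z = (if snd z then snd (fst z) else fst (fst z))" for z :: "('h \<times> 'h) \<times> bool"
  define b where "b z = (if snd z then 1 else -1) * (a (fst z) * (fst (fst z) \<bullet> snd (fst z)) ^ k)" for z :: "('h \<times> 'h) \<times> bool"
  define K where "K z y = 1 * (fst (fst z) \<bullet> fst (fst y)) ^ i * (snd (fst z) \<bullet> snd (fst y)) ^ i * (f z \<bullet> f y) ^ j * (g z \<bullet> g y) ^ j" for z y
  have "psd K" unfolding K_def by (intro psd_mult_inner_power psd_one)
  then have "0 \<le> (\<Sum>z\<in>?P\<times>UNIV. \<Sum>y\<in>?P\<times>UNIV. b z * b y * K z y)"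
    using S by (intro psdD) auto
  also have "\<dots> = (\<Sum>p\<in>?P. \<Sum>q\<in>?P. 2 * (a p * a q * (KX p q ^ (i + j) * KY p q ^ 0 * KZ p q ^ k)) - 2 * (a p * a q * (KX p q ^ i * KY p q ^ j * KZ p q ^ k)))"
  proof -
    have "(\<Sum>z\<in>?P\<times>UNIV. \<Sum>y\<in>?P\<times>UNIV. b z * b y * K z y) =
      (\<Sum>p\<in>?P. \<Sum>\<epsilon>\<in>UNIV. \<Sum>q\<in>?P. \<Sum>\<delta>\<in>UNIV. b (p, \<epsilon>) * b (q, \<delta>) * K (p, \<epsilon>) (q, \<delta>))"
      by (simp add: sum.cartesian_product')
    also have "\<dots> = (\<Sum>p\<in>?P. \<Sum>q\<in>?P. \<Sum>\<epsilon>\<in>UNIV. \<Sum>\<delta>\<in>UNIV. b (p, \<epsilon>) * b (q, \<delta>) * K (p, \<epsilon>) (q, \<delta>))"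
      by (subst sum.swap[of _ UNIV]) simp
    also have "\<dots> = (\<Sum>p\<in>?P. \<Sum>q\<in>?P. 2 * (a p * a q * (KX p q ^ (i + j) * KY p q ^ 0 * KZ p q ^ k)) - 2 * (a p * a q * (KX p q ^ i * KY p q ^ j * KZ p q ^ k)))"
      by (intro sum.cong refl)
         (simp add: UNIV_bool b_def K_def f_def g_def KX_def KY_def KZ_def power_add power_mult_distrib algebra_simps)
    finally show ?thesis .
  qed
  finally show ?thesis by (simp add: quad_def sum_subtractf sum_distrib_left[symmetric])
qed

text \<open>The coefficient is symmetric in all four vectors, so \<open>KZ\<close> can be traded for
  \<open>KY\<close>. Two applications of \<open>quad_XY_le\<close>, before and after the trade, move
  all exponents to \<open>KX\<close>. This comparison is what bounds fourth moments by
  norms.\<close>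

lemma quad_square_le:
  fixes S :: "'h set"
  assumes S: "finite S"
  shows "quad S (\<lambda>p. c (fst p) * c (snd p)) i j k \<le> quad S (\<lambda>p. c (fst p) * c (snd p)) (i + j + k) 0 0"
proof -
  let ?a = "\<lambda>p. c (fst p) * c (snd p)"
  have "quad S ?a (i + j) 0 k = quad S ?a (i + j) k 0"
  proof -
    have "quad S ?a i 0 k = (\<Sum>(h, g, h', g')\<in>S\<times>S\<times>S\<times>S. c h * c g * (c h' * c g') * (((h \<bullet> h') * (g \<bullet> g')) ^ i * ((h \<bullet> g) * (h' \<bullet> g')) ^ k))" for i
      unfolding quad_def by (simp add: sum.cartesian_product' KX_def KY_def KZ_def)
    moreover have "quad S ?a i k 0 = (\<Sum>(h, g, h', g')\<in>S\<times>S\<times>S\<times>S. c h * c g * (c h' * c g') * (((h \<bullet> h') * (g \<bullet> g')) ^ i * ((h \<bullet> g') * (g \<bullet> h')) ^ k))" for i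
      unfolding quad_def by (simp add: sum.cartesian_product' KX_def KY_def KZ_def)
    moreover have "(\<Sum>(h, g, h', g')\<in>S\<times>S\<times>S\<times>S. c h * c g * (c h' * c g') * (((h \<bullet> h') * (g \<bullet> g')) ^ i * ((h \<bullet> g) * (h' \<bullet> g')) ^ k)) =
      (\<Sum>(h, g, h', g')\<in>S\<times>S\<times>S\<times>S. c h * c g * (c h' * c g') * (((h \<bullet> h') * (g \<bullet> g')) ^ i * ((h \<bullet> g') * (g \<bullet> h')) ^ k))" for i
      by (rule sum.reindex_bij_witness[of _ "\<lambda>(h, g, h', g'). (h, g', h', g)" "\<lambda>(h, g, h', g'). (h, g', h', g)"])
         (auto simp: inner_commute mult_ac)
    ultimately show ?thesis by simp
  qed
  then show ?thesis using quad_XY_le[OF S, of ?a i j k] quad_XY_le[OF S, of ?a "i + j" k 0] by simp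
qed

end

definition unit_set :: "'h::real_inner set \<Rightarrow> bool" where
  "unit_set S \<longleftrightarrow> finite S \<and> (\<forall>h\<in>S. norm h = 1)"

text \<open>The inner product of the tensors with coefficients \<open>c\<close> and \<open>d\<close>
  on the n-th powers of the vectors in \<open>S\<close>, written without tensors.\<close>

definition pow_ip :: "nat \<Rightarrow> 'h::real_inner set \<Rightarrow> ('h \<Rightarrow> real) \<Rightarrow> ('h \<Rightarrow> real) \<Rightarrow> real" where
  "pow_ip n S c d = (\<Sum>h\<in>S. \<Sum>k\<in>S. c h * d k * (h \<bullet> k) ^ n)"

lemma quad_alt_top: "quad S (alt_coeff c d) n 0 0 = 2 * (pow_ip n S c c * pow_ip n S d d - (pow_ip n S c d)\<^sup>2)"
  unfolding pow_ip_def
  by (subst sum_pairs_gram) (auto simp: inner_commute quad_def alt_coeff_def KX_def power_mult_distrib)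

lemma quad_square_top: "quad S (\<lambda>p. c (fst p) * c (snd p)) n 0 0 = (pow_ip n S c c)\<^sup>2"
proof -
  have "(pow_ip n S c c)\<^sup>2 = (\<Sum>h\<in>S. \<Sum>g\<in>S. (\<Sum>k\<in>S. c h * c k * (h \<bullet> k) ^ n) * (\<Sum>l\<in>S. c g * c l * (g \<bullet> l) ^ n))"
    unfolding pow_ip_def power2_eq_square sum_product ..
  also have "\<dots> = (\<Sum>h\<in>S. \<Sum>g\<in>S. \<Sum>k\<in>S. \<Sum>l\<in>S. (c h * c k * (h \<bullet> k) ^ n) * (c g * c l * (g \<bullet> l) ^ n))"
    by (simp add: sum_product)
  finally show ?thesis
    by (simp add: quad_def KX_def sum.cartesian_product' power_mult_distrib mult_ac)
qed

text \<open>The \<open>s\<close>-th Malliavin derivative of \<open>\<Sum>h\<in>S. c h * hermite n (W h)\<close>.\<close>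

definition chaos_deriv :: "('h::real_inner \<Rightarrow> 'w \<Rightarrow> real) \<Rightarrow> nat \<Rightarrow> nat \<Rightarrow> 'h set \<Rightarrow> ('h \<Rightarrow> real) \<Rightarrow> 'w \<Rightarrow> 'h tensor" where
  "chaos_deriv W n s S c \<omega> us =
     (\<Sum>h\<in>S. fact n / fact (n - s) * c h * hermite (n - s) (W h \<omega>) * elem_tensor (replicate s h) us)"

lemma chaos_deriv_l2: "finite S \<Longrightarrow> chaos_deriv W n s S c \<omega> \<in> l2 (basis_lists s)"
  unfolding chaos_deriv_def[abs_def] by (intro l2_sum elem_tensor_l2) simp

lemma ip_chaos_deriv:
  assumes "finite S"
  shows "ip (basis_lists s) (chaos_deriv W n s S c \<omega>) (chaos_deriv W n s S d \<omega>) =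
    (fact n / fact (n - s))\<^sup>2 * (\<Sum>h\<in>S. \<Sum>k\<in>S. (c h * hermite (n - s) (W h \<omega>)) * (d k * hermite (n - s) (W k \<omega>)) * (h \<bullet> k) ^ s)"
  unfolding chaos_deriv_def[abs_def] using assms
  by (subst ip_sum_sum)
     (auto simp: elem_tensor_l2 ip_elem_tensor elem_tensor_replicate_self sum_distrib_left power2_eq_square mult_ac)

definition hermite_pair :: "('h::real_inner \<Rightarrow> 'w \<Rightarrow> real) \<Rightarrow> nat \<Rightarrow> 'h \<times> 'h \<Rightarrow> 'w \<Rightarrow> real" where
  "hermite_pair W m p \<omega> = hermite m (W (fst p) \<omega>) * hermite m (W (snd p) \<omega>)"

definition wick_pair :: "('h::real_inner \<Rightarrow> 'w \<Rightarrow> real) \<Rightarrow> nat \<Rightarrow> 'h \<times> 'h \<Rightarrow> 'w \<Rightarrow> real" where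
  "wick_pair W m p \<omega> = wick m m (fst p \<bullet> snd p) (W (fst p) \<omega>) (W (snd p) \<omega>)"

lemma gram_chaos_deriv:
  assumes "finite S"
  shows "gram (basis_lists s) (chaos_deriv W n s S c \<omega>) (chaos_deriv W n s S d \<omega>) =
    (fact n / fact (n - s)) ^ 4 / 2 * (\<Sum>p\<in>S\<times>S. \<Sum>q\<in>S\<times>S. alt_coeff c d p * alt_coeff c d q *
      (KX p q ^ s * (hermite_pair W (n - s) p \<omega> * hermite_pair W (n - s) q \<omega>)))"
proof -
  let ?H = "\<lambda>h. hermite (n - s) (W h \<omega>)"
  let ?N = "fact n / fact (n - s) :: real"
  define A where "A = (\<Sum>h\<in>S. \<Sum>k\<in>S. (c h * ?H h) * (c k * ?H k) * (h \<bullet> k) ^ s)"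
  define B where "B = (\<Sum>h\<in>S. \<Sum>k\<in>S. (d h * ?H h) * (d k * ?H k) * (h \<bullet> k) ^ s)"
  define C where "C = (\<Sum>h\<in>S. \<Sum>k\<in>S. (c h * ?H h) * (d k * ?H k) * (h \<bullet> k) ^ s)"
  have "gram (basis_lists s) (chaos_deriv W n s S c \<omega>) (chaos_deriv W n s S d \<omega>) = ?N ^ 4 * (A * B - C\<^sup>2)"
    unfolding gram_def ip_chaos_deriv[OF assms] A_def B_def C_def by (simp add: power4_eq_xxxx power2_eq_square algebra_simps)
  also have "A * B - C\<^sup>2 = (\<Sum>p\<in>S\<times>S. \<Sum>q\<in>S\<times>S. alt_coeff c d p * alt_coeff c d q *
      (KX p q ^ s * (hermite_pair W (n - s) p \<omega> * hermite_pair W (n - s) q \<omega>))) / 2"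
    unfolding A_def B_def C_def
    by (subst sum_pairs_gram)
       (auto simp: inner_commute alt_coeff_def KX_def power_mult_distrib hermite_pair_def algebra_simps intro!: sum.cong)
  finally show ?thesis by simp
qed

text \<open>Squaring pairs the vectors differently from the determinant: the s contractions now join
  the two vectors inside each pair, giving powers of \<open>KZ\<close> instead of
  \<open>KX\<close>.\<close>

lemma ip_square_chaos_deriv:
  assumes "finite S"
  shows "(ip (basis_lists s) (chaos_deriv W n s S c \<omega>) (chaos_deriv W n s S c \<omega>))\<^sup>2 =
    (fact n / fact (n - s)) ^ 4 * (\<Sum>p\<in>S\<times>S. \<Sum>q\<in>S\<times>S. (c (fst p) * c (snd p)) * (c (fst q) * c (snd q)) *
      (KZ p q ^ s * (hermite_pair W (n - s) p \<omega> * hermite_pair W (n - s) q \<omega>)))"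
proof -
  have "(\<Sum>p\<in>S\<times>S. \<Sum>q\<in>S\<times>S. (c (fst p) * c (snd p)) * (c (fst q) * c (snd q)) *
      (KZ p q ^ s * (hermite_pair W (n - s) p \<omega> * hermite_pair W (n - s) q \<omega>))) =
    (\<Sum>p\<in>S\<times>S. c (fst p) * c (snd p) * (fst p \<bullet> snd p) ^ s * hermite_pair W (n - s) p \<omega>)\<^sup>2"
    unfolding power2_eq_square sum_product by (simp add: KZ_def power_mult_distrib mult_ac)
  also have "(\<Sum>p\<in>S\<times>S. c (fst p) * c (snd p) * (fst p \<bullet> snd p) ^ s * hermite_pair W (n - s) p \<omega>) =
    (\<Sum>h\<in>S. \<Sum>k\<in>S. (c h * hermite (n - s) (W h \<omega>)) * (c k * hermite (n - s) (W k \<omega>)) * (h \<bullet> k) ^ s)"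
    by (simp add: sum.cartesian_product' hermite_pair_def mult_ac)
  finally show ?thesis
    unfolding ip_chaos_deriv[OF assms] by (simp add: power_mult_distrib)
qed

section \<open>Chaos expansion of determinants and fourth moments\<close>

context isonormal_gaussian_process
begin

lemma integrable_hermite_pair: "integrable M (\<lambda>\<omega>. hermite_pair W m p \<omega> * hermite_pair W m q \<omega>)"
  unfolding hermite_pair_def by (rule integrable_hermite_prod4)

lemma integrable_wick_pair: "integrable M (\<lambda>\<omega>. wick_pair W m p \<omega> * wick_pair W m q \<omega>)"
proof -
  define k where "k i = (if i = 0 then fst p else if i = 1 then snd p else if i = 2 then fst q else snd q)" for i :: nat
  have "poly_growth 4 (\<lambda>x. wick m m (fst p \<bullet> snd p) (x 0) (x 1))" "poly_growth 4 (\<lambda>x. wick m m (fst q \<bullet> snd q) (x 2) (x 3))"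
    using dir_deriv_wick[of 0 4 1 "\<lambda>_. 0" m m "fst p \<bullet> snd p"] dir_deriv_wick[of 2 4 3 "\<lambda>_. 0" m m "fst q \<bullet> snd q"]
    by (simp_all add: dir_deriv_def)
  from integrable_poly_growth[OF poly_growth_mult[OF this], of k] show ?thesis by (simp add: k_def wick_pair_def)
qed

lemma integrable_gram_chaos_deriv:
  "finite S \<Longrightarrow> integrable M (\<lambda>\<omega>. gram (basis_lists s) (chaos_deriv W n s S c \<omega>) (chaos_deriv W n s S d \<omega>))"
  by (simp add: gram_chaos_deriv integrable_hermite_pair)

definition wick_kernel :: "nat \<Rightarrow> 'h \<times> 'h \<Rightarrow> 'h \<times> 'h \<Rightarrow> real" where
  "wick_kernel m p q = expectation (\<lambda>\<omega>. wick_pair W m p \<omega> * wick_pair W m q \<omega>)"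

lemma psd_wick_kernel: "psd (wick_kernel m)"
  unfolding wick_kernel_def[abs_def] by (rule psd_expectation[OF integrable_wick_pair])

lemma wick_kernel_0: "wick_kernel 0 p q = 1"
  by (simp add: wick_kernel_def wick_pair_def prob_space)

lemma wick_kernel_eq:
  assumes "unit_set S" "p \<in> S \<times> S" "q \<in> S \<times> S"
  shows "wick_kernel m p q = (fact m)\<^sup>2 * (\<Sum>i\<le>m. (real (m choose i))\<^sup>2 * (KX p q ^ i * KY p q ^ (m - i)))"
proof -
  have "norm (fst p) = 1" "norm (snd p) = 1" "norm (fst q) = 1" "norm (snd q) = 1"
    using assms by (auto simp: unit_set_def)
  from expectation_wick_diag[OF this, of m m] show ?thesis
    by (simp add: wick_kernel_def wick_pair_def KX_def KY_def mult.assoc)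
qed

text \<open>The square of the coefficient of the r-fold contraction in \<open>hermite_mult\<close>
  for two equal degrees m; it is squared because both pairs contribute one.\<close>

definition hermite_weight :: "nat \<Rightarrow> nat \<Rightarrow> real" where
  "hermite_weight m r = (fact r * (real (m choose r))\<^sup>2)\<^sup>2"

lemma expectation_hermite_pair:
  assumes "unit_set S" "p \<in> S \<times> S" "q \<in> S \<times> S"
  shows "expectation (\<lambda>\<omega>. hermite_pair W m p \<omega> * hermite_pair W m q \<omega>) =
    (\<Sum>r\<le>m. hermite_weight m r * (KZ p q ^ r * wick_kernel (m - r) p q))"
proof -
  have "norm (fst p) = 1" "norm (snd p) = 1" "norm (fst q) = 1" "norm (snd q) = 1"
    using assms by (auto simp: unit_set_def)
  from expectation_hermite4[OF this, of m] show ?thesis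
    by (simp add: wick_kernel_def wick_pair_def hermite_pair_def hermite_weight_def KZ_def mult.assoc)
qed

lemma expectation_quad_hermite:
  assumes S: "unit_set S"
  shows "(\<Sum>p\<in>S\<times>S. \<Sum>q\<in>S\<times>S. a p * a q * (KX p q ^ s * KZ p q ^ t * expectation (\<lambda>\<omega>. hermite_pair W m p \<omega> * hermite_pair W m q \<omega>))) =
    (\<Sum>r\<le>m. hermite_weight m r * (\<Sum>p\<in>S\<times>S. \<Sum>q\<in>S\<times>S. a p * a q * (KX p q ^ s * wick_kernel (m - r) p q * KZ p q ^ (r + t))))"
proof -
  have "(\<Sum>p\<in>S\<times>S. \<Sum>q\<in>S\<times>S. a p * a q * (KX p q ^ s * KZ p q ^ t * expectation (\<lambda>\<omega>. hermite_pair W m p \<omega> * hermite_pair W m q \<omega>))) =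
    (\<Sum>p\<in>S\<times>S. \<Sum>q\<in>S\<times>S. \<Sum>r\<le>m. hermite_weight m r * (a p * a q * (KX p q ^ s * wick_kernel (m - r) p q * KZ p q ^ (r + t))))"
    by (intro sum.cong refl)
       (simp add: expectation_hermite_pair[OF S] sum_distrib_left power_add mult_ac)
  also have "\<dots> = (\<Sum>p\<in>S\<times>S. \<Sum>r\<le>m. \<Sum>q\<in>S\<times>S. hermite_weight m r * (a p * a q * (KX p q ^ s * wick_kernel (m - r) p q * KZ p q ^ (r + t))))"
    by (intro sum.cong refl sum.swap)
  also have "\<dots> = (\<Sum>r\<le>m. \<Sum>p\<in>S\<times>S. \<Sum>q\<in>S\<times>S. hermite_weight m r * (a p * a q * (KX p q ^ s * wick_kernel (m - r) p q * KZ p q ^ (r + t))))"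
    by (rule sum.swap)
  finally show ?thesis by (simp add: sum_distrib_left)
qed

lemma expectation_gram_chaos_deriv:
  assumes S: "unit_set S"
  shows "expectation (\<lambda>\<omega>. gram (basis_lists s) (chaos_deriv W n s S c \<omega>) (chaos_deriv W n s S d \<omega>)) =
    (fact n / fact (n - s)) ^ 4 / 2 * (\<Sum>r\<le>n - s. hermite_weight (n - s) r *
      (\<Sum>p\<in>S\<times>S. \<Sum>q\<in>S\<times>S. alt_coeff c d p * alt_coeff c d q * (KX p q ^ s * wick_kernel (n - s - r) p q * KZ p q ^ r)))"
proof -
  have fin: "finite S" using S by (simp add: unit_set_def)
  show ?thesis
    unfolding gram_chaos_deriv[OF fin]
    using expectation_quad_hermite[OF S, of "alt_coeff c d" s 0 "n - s"]
    by (simp add: integrable_hermite_pair)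
qed

text \<open>Every chaos component of the determinant has a nonnegative share in the expectation, so
  any single one may be kept and the others dropped.\<close>

lemma gram_term_le:
  assumes S: "unit_set S" and r: "r \<le> n - s"
  shows "(fact n / fact (n - s)) ^ 4 / 2 * (hermite_weight (n - s) r *
      (\<Sum>p\<in>S\<times>S. \<Sum>q\<in>S\<times>S. alt_coeff c d p * alt_coeff c d q * (KX p q ^ s * wick_kernel (n - s - r) p q * KZ p q ^ r)))
    \<le> expectation (\<lambda>\<omega>. gram (basis_lists s) (chaos_deriv W n s S c \<omega>) (chaos_deriv W n s S d \<omega>))"
  unfolding expectation_gram_chaos_deriv[OF S]
proof (intro mult_left_mono member_le_sum)
  fix r'
  show "0 \<le> hermite_weight (n - s) r' *
      (\<Sum>p\<in>S\<times>S. \<Sum>q\<in>S\<times>S. alt_coeff c d p * alt_coeff c d q * (KX p q ^ s * wick_kernel (n - s - r') p q * KZ p q ^ r'))"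
    using S by (intro mult_nonneg_nonneg quad_sum_nonneg psd_wick_kernel) (auto simp: hermite_weight_def unit_set_def)
qed (use r in auto)

text \<open>The component of order zero of the chaos expansion of the minors of \<open>D\<^sup>s F, D\<^sup>s G\<close>.\<close>

lemma gram_ge_constant_part:
  assumes S: "unit_set S"
  shows "(fact n) ^ 4 / (fact (n - s))\<^sup>2 / 2 * quad S (alt_coeff c d) s 0 (n - s)
    \<le> expectation (\<lambda>\<omega>. gram (basis_lists s) (chaos_deriv W n s S c \<omega>) (chaos_deriv W n s S d \<omega>))"
proof -
  \<comment> \<open>For full contraction the weight is ((n - s)!)^2, which cancels two of the four
    factorials in the denominator.\<close>
  have "(fact n / fact (n - s)) ^ 4 / 2 * hermite_weight (n - s) (n - s) = (fact n) ^ 4 / (fact (n - s))\<^sup>2 / (2::real)"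
    by (simp add: hermite_weight_def power4_eq_xxxx power2_eq_square field_simps)
  then show ?thesis
    using gram_term_le[OF S order_refl, of n s c d]
    by (simp add: wick_kernel_0 quad_def mult.assoc[symmetric])
qed

text \<open>The component of the top order \<open>2 * (n - 1)\<close> for \<open>s = 1\<close>.\<close>

lemma gram_ge_top_part:
  assumes S: "unit_set S" and n: "n \<ge> 1"
  shows "(real n)\<^sup>2 * (fact n)\<^sup>2 / 2 * (\<Sum>i\<le>n - 1. (real ((n - 1) choose i))\<^sup>2 * quad S (alt_coeff c d) (Suc i) (n - 1 - i) 0)
    \<le> expectation (\<lambda>\<omega>. gram (basis_lists 1) (chaos_deriv W n 1 S c \<omega>) (chaos_deriv W n 1 S d \<omega>))"
proof -
  let ?a = "alt_coeff c d"
  have "(\<Sum>p\<in>S\<times>S. \<Sum>q\<in>S\<times>S. ?a p * ?a q * (KX p q ^ 1 * wick_kernel (n - 1 - 0) p q * KZ p q ^ 0)) =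
    (\<Sum>p\<in>S\<times>S. \<Sum>q\<in>S\<times>S. \<Sum>i\<le>n - 1. (fact (n - 1))\<^sup>2 * ((real ((n - 1) choose i))\<^sup>2 * (?a p * ?a q * (KX p q ^ Suc i * KY p q ^ (n - 1 - i) * KZ p q ^ 0))))"
    by (intro sum.cong refl) (simp add: wick_kernel_eq[OF S] sum_distrib_left mult_ac)
  also have "\<dots> = (\<Sum>p\<in>S\<times>S. \<Sum>i\<le>n - 1. \<Sum>q\<in>S\<times>S. (fact (n - 1))\<^sup>2 * ((real ((n - 1) choose i))\<^sup>2 * (?a p * ?a q * (KX p q ^ Suc i * KY p q ^ (n - 1 - i) * KZ p q ^ 0))))"
    by (intro sum.cong refl sum.swap)
  also have "\<dots> = (\<Sum>i\<le>n - 1. \<Sum>p\<in>S\<times>S. \<Sum>q\<in>S\<times>S. (fact (n - 1))\<^sup>2 * ((real ((n - 1) choose i))\<^sup>2 * (?a p * ?a q * (KX p q ^ Suc i * KY p q ^ (n - 1 - i) * KZ p q ^ 0))))"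
    by (rule sum.swap)
  also have "\<dots> = (fact (n - 1))\<^sup>2 * (\<Sum>i\<le>n - 1. (real ((n - 1) choose i))\<^sup>2 * quad S ?a (Suc i) (n - 1 - i) 0)"
    unfolding quad_def by (simp add: sum_distrib_left)
  finally have *: "(\<Sum>p\<in>S\<times>S. \<Sum>q\<in>S\<times>S. ?a p * ?a q * (KX p q ^ 1 * wick_kernel (n - 1 - 0) p q * KZ p q ^ 0)) =
    (fact (n - 1))\<^sup>2 * (\<Sum>i\<le>n - 1. (real ((n - 1) choose i))\<^sup>2 * quad S ?a (Suc i) (n - 1 - i) 0)" .
  have f: "fact n = real n * fact (n - 1)" using n by (cases n) auto
  \<comment> \<open>Without contraction the weight is 1, and n^4 * ((n - 1)!)^2 = n^2 *
    (n!)^2.\<close>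
  have eq: "(fact n / fact (n - 1)) ^ 4 / 2 * (hermite_weight (n - 1) 0 * ((fact (n - 1))\<^sup>2 * z)) = (real n)\<^sup>2 * (fact n)\<^sup>2 / 2 * z" for z :: real
    by (simp add: hermite_weight_def f power4_eq_xxxx power2_eq_square field_simps)
  show ?thesis
    using gram_term_le[OF S, of 0 n 1 c d, unfolded * eq] by simp
qed

text \<open>All kernels in the expansion have total degree n, so \<open>quad_square_le\<close>
  bounds each by the square of the tensor norm squared. The constant depends on n and s only, which
  is an equivalence of moments on a fixed chaos.\<close>

lemma expectation_ip_square_le:
  assumes S: "unit_set S" and s: "s \<le> n"
  shows "expectation (\<lambda>\<omega>. (ip (basis_lists s) (chaos_deriv W n s S c \<omega>) (chaos_deriv W n s S c \<omega>))\<^sup>2)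
    \<le> (fact n / fact (n - s)) ^ 4 * (\<Sum>r\<le>n - s. hermite_weight (n - s) r * ((fact (n - s - r))\<^sup>2 * (\<Sum>i\<le>n - s - r. (real ((n - s - r) choose i))\<^sup>2)))
      * (pow_ip n S c c)\<^sup>2"
proof -
  let ?b = "\<lambda>p. c (fst p) * c (snd p)"
  let ?m = "n - s"
  have fin: "finite S" using S by (simp add: unit_set_def)
  have t: "(\<Sum>p\<in>S\<times>S. \<Sum>q\<in>S\<times>S. ?b p * ?b q * (KX p q ^ 0 * wick_kernel (?m - r) p q * KZ p q ^ (r + s)))
     \<le> (fact (?m - r))\<^sup>2 * (\<Sum>i\<le>?m - r. (real ((?m - r) choose i))\<^sup>2) * (pow_ip n S c c)\<^sup>2" if r: "r \<le> ?m" for r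
  proof -
    let ?k = "?m - r"
    have "(\<Sum>p\<in>S\<times>S. \<Sum>q\<in>S\<times>S. ?b p * ?b q * (KX p q ^ 0 * wick_kernel ?k p q * KZ p q ^ (r + s))) =
      (\<Sum>p\<in>S\<times>S. \<Sum>q\<in>S\<times>S. \<Sum>i\<le>?k. (fact ?k)\<^sup>2 * ((real (?k choose i))\<^sup>2 * (?b p * ?b q * (KX p q ^ i * KY p q ^ (?k - i) * KZ p q ^ (r + s)))))"
      by (intro sum.cong refl) (simp add: wick_kernel_eq[OF S] sum_distrib_left sum_distrib_right mult_ac)
    also have "\<dots> = (\<Sum>p\<in>S\<times>S. \<Sum>i\<le>?k. \<Sum>q\<in>S\<times>S. (fact ?k)\<^sup>2 * ((real (?k choose i))\<^sup>2 * (?b p * ?b q * (KX p q ^ i * KY p q ^ (?k - i) * KZ p q ^ (r + s)))))"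
      by (intro sum.cong refl sum.swap)
    also have "\<dots> = (\<Sum>i\<le>?k. \<Sum>p\<in>S\<times>S. \<Sum>q\<in>S\<times>S. (fact ?k)\<^sup>2 * ((real (?k choose i))\<^sup>2 * (?b p * ?b q * (KX p q ^ i * KY p q ^ (?k - i) * KZ p q ^ (r + s)))))"
      by (rule sum.swap)
    also have "\<dots> = (fact ?k)\<^sup>2 * (\<Sum>i\<le>?k. (real (?k choose i))\<^sup>2 * quad S ?b i (?k - i) (r + s))"
      unfolding quad_def by (simp add: sum_distrib_left)
    also have "\<dots> \<le> (fact ?k)\<^sup>2 * (\<Sum>i\<le>?k. (real (?k choose i))\<^sup>2 * (pow_ip n S c c)\<^sup>2)"
    proof (intro mult_left_mono sum_mono)
      fix i assume "i \<in> {..?k}"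
      then have "i + (?k - i) + (r + s) = n" using r s by auto
      then show "quad S ?b i (?k - i) (r + s) \<le> (pow_ip n S c c)\<^sup>2"
        using quad_square_le[OF fin, of c i "?k - i" "r + s"] quad_square_top[of S c n] by simp
    qed auto
    finally show ?thesis by (simp add: sum_distrib_right mult.assoc)
  qed
  have "expectation (\<lambda>\<omega>. (ip (basis_lists s) (chaos_deriv W n s S c \<omega>) (chaos_deriv W n s S c \<omega>))\<^sup>2) =
    (fact n / fact ?m) ^ 4 * (\<Sum>p\<in>S\<times>S. \<Sum>q\<in>S\<times>S. ?b p * ?b q * (KX p q ^ 0 * KZ p q ^ s * expectation (\<lambda>\<omega>. hermite_pair W ?m p \<omega> * hermite_pair W ?m q \<omega>)))"
    unfolding ip_square_chaos_deriv[OF fin] by (simp add: integrable_hermite_pair)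
  also have "\<dots> = (fact n / fact ?m) ^ 4 * (\<Sum>r\<le>?m. hermite_weight ?m r * (\<Sum>p\<in>S\<times>S. \<Sum>q\<in>S\<times>S. ?b p * ?b q * (KX p q ^ 0 * wick_kernel (?m - r) p q * KZ p q ^ (r + s))))"
    unfolding expectation_quad_hermite[OF S] ..
  also have "\<dots> \<le> (fact n / fact ?m) ^ 4 * (\<Sum>r\<le>?m. hermite_weight ?m r * ((fact (?m - r))\<^sup>2 * (\<Sum>i\<le>?m - r. (real ((?m - r) choose i))\<^sup>2) * (pow_ip n S c c)\<^sup>2))"
    by (intro mult_left_mono sum_mono t) (auto simp: hermite_weight_def)
  finally show ?thesis by (simp add: sum_distrib_right mult.assoc)
qed

lemma integrable_ip_square:
  "finite S \<Longrightarrow> integrable M (\<lambda>\<omega>. (ip (basis_lists s) (chaos_deriv W n s S c \<omega>) (chaos_deriv W n s S c \<omega>))\<^sup>2)"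
  by (simp add: ip_square_chaos_deriv integrable_hermite_pair)

end

subsection \<open>The inequality for finite combinations\<close>

text \<open>Averaging the sum with its reversal replaces i^2 by (i^2 - (n - i)^2) / 2, which is
  linear in i. The resulting summand is symmetric under i -> n - i, so the sum folds to the indices
  below n / 2.\<close>

lemma binomial_antisymmetric_sum:
  fixes R :: "nat \<Rightarrow> real"
  assumes n: "n \<ge> 1" and anti: "\<And>i. i \<le> n \<Longrightarrow> R (n - i) = - R i"
  shows "(real n)\<^sup>2 * (\<Sum>i\<le>n - 1. (real ((n - 1) choose i))\<^sup>2 * R (Suc i)) =
    (\<Sum>b\<le>(n - 1) div 2. real n * (real n - 2 * real b) * (real (n choose b))\<^sup>2 * R (n - b))"
proof -
  define w where "w i = (real (n choose i))\<^sup>2" for i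
  have wsym: "w (n - i) = w i" if "i \<le> n" for i
    using that by (simp add: w_def binomial_symmetric[symmetric])
  define L where "L = (\<Sum>i\<le>n. (real i)\<^sup>2 * w i * R i)"
  \<comment> \<open>Absorption n * ((n - 1) choose i) = (i + 1) * (n choose (i + 1)) shifts the
    index; the new term i = 0 vanishes through its factor i^2.\<close>
  have lhs: "(real n)\<^sup>2 * (\<Sum>i\<le>n - 1. (real ((n - 1) choose i))\<^sup>2 * R (Suc i)) = L"
  proof -
    obtain m where m: "n = Suc m" using n by (cases n) auto
    have "real n * real (m choose i) = real (Suc i) * real (n choose Suc i)" for i
    proof -
      have "Suc i * (n choose Suc i) = n * (m choose i)" unfolding m by (metis Suc_times_binomial_eq mult.commute)
      then show ?thesis by (metis of_nat_mult)
    qed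
    then have "(real n)\<^sup>2 * (real (m choose i))\<^sup>2 = (real (Suc i))\<^sup>2 * w (Suc i)" for i
      unfolding w_def power_mult_distrib[symmetric] by simp
    then have "(real n)\<^sup>2 * (\<Sum>i\<le>m. (real (m choose i))\<^sup>2 * R (Suc i)) = (\<Sum>i\<le>m. (real (Suc i))\<^sup>2 * w (Suc i) * R (Suc i))"
      by (simp add: sum_distrib_left mult.assoc[symmetric])
    also have "\<dots> = L" unfolding L_def m sum.atMost_Suc_shift by simp
    finally show ?thesis by (simp add: m)
  qed
  have rev: "(\<Sum>i\<le>n. f i) = (\<Sum>i\<le>n. f (n - i))" for f :: "nat \<Rightarrow> real"
    using sum.nat_diff_reindex[of f "Suc n"] by (simp add: lessThan_Suc_atMost)
  have "L = (\<Sum>i\<le>n. - ((real n - real i)\<^sup>2 * w i * R i))"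
    unfolding L_def by (subst rev, intro sum.cong refl) (auto simp: wsym anti of_nat_diff)
  then have "2 * L = (\<Sum>i\<le>n. (real i)\<^sup>2 * w i * R i) + (\<Sum>i\<le>n. - ((real n - real i)\<^sup>2 * w i * R i))"
    unfolding L_def by simp
  also have "\<dots> = (\<Sum>i\<le>n. real n * (2 * real i - real n) * w i * R i)"
    unfolding sum.distrib[symmetric] by (intro sum.cong refl) (simp add: power2_eq_square algebra_simps)
  also have "\<dots> = (\<Sum>i\<le>n. real n * (real n - 2 * real i) * w i * R (n - i))"
    by (subst rev, intro sum.cong refl) (auto simp: wsym of_nat_diff algebra_simps)
  finally have L2: "2 * L = (\<Sum>i\<le>n. real n * (real n - 2 * real i) * w i * R (n - i))" .
  define g where "g i = real n * (real n - 2 * real i) * w i * R (n - i)" for i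
  have gsym: "g (n - i) = g i" if "i \<le> n" for i
    using that anti[OF that] by (simp add: g_def wsym of_nat_diff algebra_simps)
  let ?K = "(n - 1) div 2"
  \<comment> \<open>For even n the middle term carries the factor n - 2 * i = 0, so nothing is lost
    by leaving it out.\<close>
  have "(\<Sum>i\<le>n. g i) = (\<Sum>i | i \<le> n \<and> 2 * i < n. g i) + (\<Sum>i | i \<le> n \<and> 2 * i > n. g i)"
  proof -
    have "(\<Sum>i\<le>n. g i) = (\<Sum>i\<in>{i. i \<le> n \<and> 2 * i < n} \<union> {i. i \<le> n \<and> 2 * i > n}. g i)"
    proof (rule sum.mono_neutral_right)
      show "\<forall>i\<in>{..n} - ({i. i \<le> n \<and> 2 * i < n} \<union> {i. i \<le> n \<and> 2 * i > n}). g i = 0"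
      proof
        fix i assume "i \<in> {..n} - ({i. i \<le> n \<and> 2 * i < n} \<union> {i. i \<le> n \<and> 2 * i > n})"
        then have "n = 2 * i" by auto
        then show "g i = 0" by (simp add: g_def)
      qed
    qed auto
    also have "\<dots> = (\<Sum>i | i \<le> n \<and> 2 * i < n. g i) + (\<Sum>i | i \<le> n \<and> 2 * i > n. g i)"
      by (intro sum.union_disjoint) auto
    finally show ?thesis .
  qed
  also have "(\<Sum>i | i \<le> n \<and> 2 * i > n. g i) = (\<Sum>i | i \<le> n \<and> 2 * i < n. g i)"
    by (rule sum.reindex_bij_witness[of _ "\<lambda>i. n - i" "\<lambda>i. n - i"]) (auto simp: gsym)
  also have "{i. i \<le> n \<and> 2 * i < n} = {..?K}" using n by auto
  finally have "2 * L = 2 * (\<Sum>i\<le>?K. g i)" using L2 by (simp add: g_def)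
  then show ?thesis unfolding lhs by (simp add: g_def w_def)
qed

context isonormal_gaussian_process
begin

lemma finite_combination_inequality:
  fixes S :: "'h set" and c d :: "'h \<Rightarrow> real"
  assumes S: "unit_set S" and n: "n \<ge> 2"
  defines "E s \<equiv> expectation (\<lambda>\<omega>. gram (basis_lists s) (chaos_deriv W n s S c \<omega>) (chaos_deriv W n s S d \<omega>))"
  shows "(real n)\<^sup>2 * ((fact n)\<^sup>2 * (pow_ip n S c c * pow_ip n S d d - (pow_ip n S c d)\<^sup>2))
    \<le> (\<Sum>s = 2..(n - 1) div 2. real n * (real n - 2 * real s) / (fact s)\<^sup>2 * E s) + (real n - 1)\<^sup>2 * E 1"
proof -
  define Q where "Q i j k = quad S (alt_coeff c d) i j k" for i j k
  define R where "R i = Q i (n - i) 0" for i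
  let ?K = "(n - 1) div 2"
  let ?w = "\<lambda>b. real n * (real n - 2 * real b) * (real (n choose b))\<^sup>2"
  let ?e = "\<lambda>b. real n * (real n - 2 * real b) / (fact b)\<^sup>2 * E b"
  have fin: "finite S" using S by (simp add: unit_set_def)
  have Kb: "2 * b < n" if "b \<le> ?K" for b using that n by auto
  \<comment> \<open>Division by (b!)^2 turns (n!)^4 / ((n - b)!)^2 into (n!)^2 * (n choose b)^2, the
    coefficient occurring in the highest part; this explains the weights 1 / (s!)^2 of the
    theorem.\<close>
  have low: "(fact n)\<^sup>2 * (real (n choose b))\<^sup>2 / 2 * Q b 0 (n - b) \<le> E b / (fact b)\<^sup>2" if "b \<le> n" for b
  proof -
    have "real (n choose b) = fact n / (fact b * fact (n - b))" using that by (rule binomial_fact)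
    then have "(fact n)\<^sup>2 * (real (n choose b))\<^sup>2 / 2 = (fact n) ^ 4 / (fact (n - b))\<^sup>2 / 2 / (fact b)\<^sup>2"
      by (simp add: power4_eq_xxxx power2_eq_square mult_ac)
    then have "(fact n)\<^sup>2 * (real (n choose b))\<^sup>2 / 2 * Q b 0 (n - b) = ((fact n) ^ 4 / (fact (n - b))\<^sup>2 / 2 * Q b 0 (n - b)) / (fact b)\<^sup>2"
      by simp
    also have "\<dots> \<le> E b / (fact b)\<^sup>2"
      unfolding Q_def E_def by (intro divide_right_mono gram_ge_constant_part[OF S]) simp
    finally show ?thesis .
  qed
  \<comment> \<open>Of the difference given by \<open>quad_alt_relation\<close> the nonnegative
    first form is thrown away; only the negative one has to be compensated.\<close>
  have Rlow: "- Q b 0 (n - b) \<le> R (n - b)" if "b \<le> n" for b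
  proof -
    have "R (n - b) = Q (n - b) 0 b - Q b 0 (n - b)"
      unfolding R_def Q_def using that quad_alt_relation[of S c d "n - b" b] by simp
    then show ?thesis using quad_X_nonneg[OF fin, of "alt_coeff c d" "n - b" b] by (simp add: Q_def)
  qed
  have bd: "- (?e b) \<le> (fact n)\<^sup>2 / 2 * (?w b * R (n - b))" if "b \<le> ?K" for b
  proof -
    define v where "v = real n * (real n - 2 * real b)"
    define N where "N = (fact n)\<^sup>2 * (real (n choose b))\<^sup>2 / 2"
    have b: "b \<le> n" "0 \<le> v" "0 \<le> N" using Kb[OF that] by (auto simp: v_def N_def)
    have "v * (N * Q b 0 (n - b)) \<le> v * (E b / (fact b)\<^sup>2)"
      unfolding N_def by (intro mult_left_mono low b)
    moreover have "v * (N * (- Q b 0 (n - b))) \<le> v * (N * R (n - b))"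
      by (intro mult_left_mono Rlow b)
    ultimately have "- (v * (E b / (fact b)\<^sup>2)) \<le> v * (N * R (n - b))" by simp
    then show ?thesis by (simp add: v_def N_def mult_ac)
  qed
  \<comment> \<open>The highest part of a single copy of \<open>E 1\<close>, reordered so that the
    index 0 carries the determinant of the covariance matrix.\<close>
  have X: "(fact n)\<^sup>2 / 2 * (\<Sum>b\<le>?K. ?w b * R (n - b)) \<le> E 1"
  proof -
    have "R (n - i) = - R i" if "i \<le> n" for i
      unfolding R_def Q_def using that quad_alt_swap[of S c d "n - i" i 0] by simp
    from binomial_antisymmetric_sum[of n R, OF _ this]
    have eq: "(\<Sum>b\<le>?K. ?w b * R (n - b)) = (real n)\<^sup>2 * (\<Sum>i\<le>n - 1. (real ((n - 1) choose i))\<^sup>2 * R (Suc i))"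
      using n by simp
    have Rs: "R (Suc i) = Q (Suc i) (n - 1 - i) 0" for i by (simp add: R_def)
    have "(fact n)\<^sup>2 / 2 * (\<Sum>b\<le>?K. ?w b * R (n - b)) = (real n)\<^sup>2 * (fact n)\<^sup>2 / 2 * (\<Sum>i\<le>n - 1. (real ((n - 1) choose i))\<^sup>2 * Q (Suc i) (n - 1 - i) 0)"
      unfolding eq Rs by simp
    also have "\<dots> \<le> E 1"
      unfolding E_def Q_def by (rule gram_ge_top_part[OF S]) (use n in simp)
    finally show ?thesis .
  qed
  have split: "(\<Sum>b\<le>?K. ?w b * R (n - b)) = ?w 0 * R n + (\<Sum>b = 1..?K. ?w b * R (n - b))"
    by (simp add: atMost_atLeast0 sum.atLeast_Suc_atMost)
  have "(fact n)\<^sup>2 / 2 * (?w 0 * R n) \<le> E 1 - (fact n)\<^sup>2 / 2 * (\<Sum>b = 1..?K. ?w b * R (n - b))"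
    using X unfolding split distrib_left by linarith
  also have "\<dots> = E 1 - (\<Sum>b = 1..?K. (fact n)\<^sup>2 / 2 * (?w b * R (n - b)))"
    unfolding sum_distrib_left ..
  also have "\<dots> \<le> E 1 + (\<Sum>b = 1..?K. ?e b)"
    using sum_mono[of "{1..?K}" "\<lambda>b. - (?e b)" "\<lambda>b. (fact n)\<^sup>2 / 2 * (?w b * R (n - b))"] bd
    by (simp add: sum_negf)
  \<comment> \<open>The compensation at b = 1 costs n * (n - 2) copies of \<open>E 1\<close>; with
    the copy already used this makes (n - 1)^2. For n = 2 the sum is empty and one copy is
    enough.\<close>
  also have "\<dots> = (\<Sum>s = 2..?K. ?e s) + (real n - 1)\<^sup>2 * E 1"
  proof (cases "n = 2")
    case True
    then show ?thesis by simp
  next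
    case False
    then have "1 \<le> ?K" using n by auto
    then have "(\<Sum>b = 1..?K. ?e b) = ?e 1 + (\<Sum>b = 2..?K. ?e b)"
      by (simp add: sum.atLeast_Suc_atMost numeral_2_eq_2)
    then show ?thesis by (simp add: power2_eq_square algebra_simps)
  qed
  also have "(fact n)\<^sup>2 / 2 * (?w 0 * R n) = (real n)\<^sup>2 * ((fact n)\<^sup>2 * (pow_ip n S c c * pow_ip n S d d - (pow_ip n S c d)\<^sup>2))"
    unfolding R_def Q_def diff_self_eq_0 quad_alt_top by (simp add: power2_eq_square)
  finally show ?thesis .
qed

end

subsection \<open>Limits in the mean square\<close>

text \<open>Square integrability is asked of the approximants; the limit inherits it.\<close>

definition L2_tendsto :: "'a measure \<Rightarrow> (nat \<Rightarrow> 'a \<Rightarrow> real) \<Rightarrow> ('a \<Rightarrow> real) \<Rightarrow> bool" where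
  "L2_tendsto M a b \<longleftrightarrow> (\<forall>j. a j \<in> borel_measurable M \<and> integrable M (\<lambda>x. (a j x)\<^sup>2)) \<and> b \<in> borel_measurable M \<and>
     (\<lambda>j. \<integral>\<^sup>+x. ennreal ((a j x - b x)\<^sup>2) \<partial>M) \<longlonglongrightarrow> 0"

lemma integrable_mult_of_squares:
  fixes f g :: "'a \<Rightarrow> real"
  assumes "f \<in> borel_measurable M" "g \<in> borel_measurable M" "integrable M (\<lambda>x. (f x)\<^sup>2)" "integrable M (\<lambda>x. (g x)\<^sup>2)"
  shows "integrable M (\<lambda>x. f x * g x)"
proof (rule Bochner_Integration.integrable_bound)
  show "integrable M (\<lambda>x. (f x)\<^sup>2 + (g x)\<^sup>2)" using assms by simp
  show "AE x in M. norm (f x * g x) \<le> norm ((f x)\<^sup>2 + (g x)\<^sup>2)"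
  proof (rule AE_I2)
    fix x
    have "2 * \<bar>f x\<bar> * \<bar>g x\<bar> \<le> (f x)\<^sup>2 + (g x)\<^sup>2" using sum_squares_bound[of "\<bar>f x\<bar>" "\<bar>g x\<bar>"] by simp
    moreover have "0 \<le> \<bar>f x\<bar> * \<bar>g x\<bar>" by simp
    ultimately have "\<bar>f x\<bar> * \<bar>g x\<bar> \<le> (f x)\<^sup>2 + (g x)\<^sup>2" by linarith
    then show "norm (f x * g x) \<le> norm ((f x)\<^sup>2 + (g x)\<^sup>2)"
      by (simp add: abs_mult)
  qed
qed (use assms in measurable)

lemma L2_tendsto_square_integrable:
  assumes "L2_tendsto M a b"
  shows "integrable M (\<lambda>x. (b x)\<^sup>2)"
proof -
  have [measurable]: "a j \<in> borel_measurable M" "b \<in> borel_measurable M" for j using assms by (auto simp: L2_tendsto_def)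
  have "eventually (\<lambda>j. (\<integral>\<^sup>+x. ennreal ((a j x - b x)\<^sup>2) \<partial>M) < 1) sequentially"
    using assms by (intro order_tendstoD) (auto simp: L2_tendsto_def)
  then obtain j where j: "(\<integral>\<^sup>+x. ennreal ((a j x - b x)\<^sup>2) \<partial>M) < 1"
    using eventually_happens[of _ sequentially] by auto
  have "(\<integral>\<^sup>+x. ennreal ((a j x - b x)\<^sup>2) \<partial>M) < \<infinity>"
    using order.strict_trans[OF j, of top] by simp
  then have i: "integrable M (\<lambda>x. (a j x - b x)\<^sup>2)"
    by (intro integrableI_nonneg) auto
  show ?thesis
  proof (rule Bochner_Integration.integrable_bound)
    show "integrable M (\<lambda>x. 2 * (a j x - b x)\<^sup>2 + 2 * (a j x)\<^sup>2)"
      using i assms by (auto simp: L2_tendsto_def)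
    have "(b x)\<^sup>2 \<le> 2 * (a j x - b x)\<^sup>2 + 2 * (a j x)\<^sup>2" for x
      using zero_le_power2[of "2 * a j x - b x"] by (simp add: power2_eq_square algebra_simps)
    then show "AE x in M. norm ((b x)\<^sup>2) \<le> norm (2 * (a j x - b x)\<^sup>2 + 2 * (a j x)\<^sup>2)"
      by (intro AE_I2) simp
  qed measurable
qed

text \<open>Convergence in mean square implies weak convergence: the squared error is at most the
  second moment of \<open>g\<close> times the mean square distance, by Cauchy-Schwarz.\<close>

lemma L2_tendsto_integral_mult:
  assumes a: "L2_tendsto M a b" and [measurable]: "g \<in> borel_measurable M" and g2: "integrable M (\<lambda>x. (g x)\<^sup>2)"
  shows "(\<lambda>j. \<integral>x. a j x * g x \<partial>M) \<longlonglongrightarrow> (\<integral>x. b x * g x \<partial>M)"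
proof -
  have [measurable]: "a j \<in> borel_measurable M" "b \<in> borel_measurable M" for j using a by (auto simp: L2_tendsto_def)
  have ia: "integrable M (\<lambda>x. a j x * g x)" for j
    using a g2 by (intro integrable_mult_of_squares) (auto simp: L2_tendsto_def)
  have ib: "integrable M (\<lambda>x. b x * g x)"
    using g2 L2_tendsto_square_integrable[OF a] by (intro integrable_mult_of_squares) auto
  define G where "G = (\<integral>x. (g x)\<^sup>2 \<partial>M)"
  define D where "D j = (\<integral>\<^sup>+x. ennreal ((a j x - b x)\<^sup>2) \<partial>M)" for j
  have G: "0 \<le> G" by (simp add: G_def)
  have le: "ennreal (((\<integral>x. a j x * g x \<partial>M) - (\<integral>x. b x * g x \<partial>M))\<^sup>2) \<le> ennreal G * D j" for j
  proof -
    have "\<bar>(\<integral>x. a j x * g x \<partial>M) - (\<integral>x. b x * g x \<partial>M)\<bar> = \<bar>\<integral>x. (a j x - b x) * g x \<partial>M\<bar>"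
      using ia[of j] ib by (simp add: left_diff_distrib)
    also have "\<dots> \<le> (\<integral>x. \<bar>a j x - b x\<bar> * \<bar>g x\<bar> \<partial>M)"
      unfolding abs_mult[symmetric] by (rule integral_abs_bound)
    finally have 1: "\<bar>(\<integral>x. a j x * g x \<partial>M) - (\<integral>x. b x * g x \<partial>M)\<bar> \<le> (\<integral>x. \<bar>a j x - b x\<bar> * \<bar>g x\<bar> \<partial>M)" .
    have int: "integrable M (\<lambda>x. \<bar>a j x - b x\<bar> * \<bar>g x\<bar>)"
      using Bochner_Integration.integrable_diff[OF ia[of j] ib] unfolding abs_mult[symmetric]
      by (simp add: left_diff_distrib)
    have "ennreal \<bar>(\<integral>x. a j x * g x \<partial>M) - (\<integral>x. b x * g x \<partial>M)\<bar> \<le> (\<integral>\<^sup>+x. ennreal \<bar>a j x - b x\<bar> * ennreal \<bar>g x\<bar> \<partial>M)"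
      using 1 int by (subst ennreal_mult[symmetric]) (auto simp: nn_integral_eq_integral ennreal_leI)
    then have "(ennreal \<bar>(\<integral>x. a j x * g x \<partial>M) - (\<integral>x. b x * g x \<partial>M)\<bar>)\<^sup>2 \<le> (\<integral>\<^sup>+x. ennreal \<bar>a j x - b x\<bar> * ennreal \<bar>g x\<bar> \<partial>M)\<^sup>2"
      by (rule power_mono) simp
    also have "\<dots> \<le> (\<integral>\<^sup>+x. (ennreal \<bar>a j x - b x\<bar>)\<^sup>2 \<partial>M) * (\<integral>\<^sup>+x. (ennreal \<bar>g x\<bar>)\<^sup>2 \<partial>M)"
      by (rule Cauchy_Schwarz_nn_integral) auto
    also have "\<dots> = ennreal G * D j"
      unfolding D_def G_def using g2 by (simp add: ennreal_power nn_integral_eq_integral mult.commute)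
    finally have 2: "(ennreal \<bar>(\<integral>x. a j x * g x \<partial>M) - (\<integral>x. b x * g x \<partial>M)\<bar>)\<^sup>2 \<le> ennreal G * D j" .
    then show ?thesis by (simp add: ennreal_power)
  qed
  have "(\<lambda>j. ennreal G * D j) \<longlonglongrightarrow> ennreal G * 0"
    using a unfolding D_def L2_tendsto_def by (intro ennreal_tendsto_cmult) auto
  have "(\<lambda>j. ennreal (((\<integral>x. a j x * g x \<partial>M) - (\<integral>x. b x * g x \<partial>M))\<^sup>2)) \<longlonglongrightarrow> 0"
  proof (rule tendsto_sandwich[where f = "\<lambda>_. 0" and h = "\<lambda>j. ennreal G * D j"])
    show "(\<lambda>j. ennreal G * D j) \<longlonglongrightarrow> 0" using \<open>(\<lambda>j. ennreal G * D j) \<longlonglongrightarrow> ennreal G * 0\<close> by simp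
  qed (use le in auto)
  then have "(\<lambda>j. ennreal (((\<integral>x. a j x * g x \<partial>M) - (\<integral>x. b x * g x \<partial>M))\<^sup>2)) \<longlonglongrightarrow> ennreal 0" by simp
  then have "(\<lambda>j. ((\<integral>x. a j x * g x \<partial>M) - (\<integral>x. b x * g x \<partial>M))\<^sup>2) \<longlonglongrightarrow> 0"
    by (rule tendsto_ennreal_iff[THEN iffD1, rotated -1]) auto
  then have "(\<lambda>j. sqrt (((\<integral>x. a j x * g x \<partial>M) - (\<integral>x. b x * g x \<partial>M))\<^sup>2)) \<longlonglongrightarrow> sqrt 0"
    by (intro tendsto_real_sqrt)
  then have "(\<lambda>j. (\<integral>x. a j x * g x \<partial>M) - (\<integral>x. b x * g x \<partial>M)) \<longlonglongrightarrow> 0"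
    by (simp add: tendsto_rabs_zero_iff)
  then show ?thesis by (simp add: LIM_zero_iff)
qed

lemma abs_summable_on_iff_summable_on:
  fixes f :: "'b \<Rightarrow> real"
  shows "Infinite_Set_Sum.abs_summable_on f A \<longleftrightarrow> f summable_on A"
  using summable_on_iff_abs_summable_on_real abs_summable_equivalent by blast

subsection \<open>Finite combinations of Hermite polynomials\<close>

text \<open>Coefficients vanish off \<open>S\<close>, so two combinations can be put on the union of
  their supports and subtracted there.\<close>

definition finite_coeff :: "'h::real_inner set \<Rightarrow> ('h \<Rightarrow> real) \<Rightarrow> bool" where
  "finite_coeff S c \<longleftrightarrow> unit_set S \<and> (\<forall>h. h \<notin> S \<longrightarrow> c h = 0)"

lemma chaos_deriv_superset:
  assumes "finite_coeff S c" "S \<subseteq> T" "finite T"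
  shows "chaos_deriv W n s S c \<omega> us = chaos_deriv W n s T c \<omega> us"
  unfolding chaos_deriv_def using assms
  by (intro sum.mono_neutral_left) (auto simp: finite_coeff_def)

lemma chaos_deriv_diff:
  "chaos_deriv W n s S (\<lambda>h. c h - d h) \<omega> us = chaos_deriv W n s S c \<omega> us - chaos_deriv W n s S d \<omega> us"
  unfolding chaos_deriv_def sum_subtractf[symmetric] by (simp add: algebra_simps diff_divide_distrib)

lemma chaos_deriv_diff_union:
  assumes "finite_coeff S c" "finite_coeff T d"
  shows "chaos_deriv W n s (S \<union> T) (\<lambda>h. c h - d h) \<omega> us = chaos_deriv W n s S c \<omega> us - chaos_deriv W n s T d \<omega> us"
proof -
  have "finite (S \<union> T)" using assms by (auto simp: finite_coeff_def unit_set_def)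
  then show ?thesis unfolding chaos_deriv_diff
    using chaos_deriv_superset[OF assms(1), of "S \<union> T" W n s \<omega> us] chaos_deriv_superset[OF assms(2), of "S \<union> T" W n s \<omega> us] by simp
qed

context isonormal_gaussian_process
begin

lemma chaos_deriv_measurable[measurable]: "(\<lambda>\<omega>. chaos_deriv W n s S c \<omega> us) \<in> borel_measurable M"
proof -
  have h: "hermite k \<in> borel_measurable borel" for k
  proof (induction k rule: less_induct)
    case (less k)
    consider "k = 0" | "k = 1" | k' where "k = Suc (Suc k')" by (metis One_nat_def not0_implies_Suc)
    then show ?case
    proof cases
      case 1 then show ?thesis by simp
    next
      case 2
      then have "hermite k = (\<lambda>x. x)" by auto
      then show ?thesis by simp
    next
      case 3
      then have e: "hermite k = (\<lambda>x. x * hermite (Suc k') x - real (Suc k') * hermite k' x)" by auto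
      have [measurable]: "hermite (Suc k') \<in> borel_measurable borel" "hermite k' \<in> borel_measurable borel"
        using less 3 by auto
      show ?thesis unfolding e by measurable
    qed
  qed
  have [measurable]: "(\<lambda>\<omega>. hermite k (W h \<omega>)) \<in> borel_measurable M" for k h
    using measurable_compose[OF W_measurable h] .
  show ?thesis unfolding chaos_deriv_def by measurable
qed

lemma integrable_ip_chaos_deriv:
  "finite S \<Longrightarrow> integrable M (\<lambda>\<omega>. ip (basis_lists s) (chaos_deriv W n s S c \<omega>) (chaos_deriv W n s S d \<omega>))"
proof -
  assume fin: "finite S"
  have "ip (basis_lists s) (chaos_deriv W n s S c \<omega>) (chaos_deriv W n s S d \<omega>) =
    (fact n / fact (n - s))\<^sup>2 * (\<Sum>h\<in>S. \<Sum>k\<in>S. (c h * d k * (h \<bullet> k) ^ s) * (hermite (n - s) (W h \<omega>) * hermite (n - s) (W k \<omega>)))" for \<omega>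
    unfolding ip_chaos_deriv[OF fin] by (simp add: mult_ac)
  then show ?thesis by (simp add: integrable_hermite_prod2)
qed

text \<open>The s contractions of the derivative and the n - s of the Hermite covariance add up to
  n, so for every s one gets the same tensor inner product up to a constant. Hence approximants that
  are Cauchy at order 0 are Cauchy for all orders up to n.\<close>

lemma expectation_ip_chaos_deriv:
  assumes S: "unit_set S" and s: "s \<le> n"
  shows "expectation (\<lambda>\<omega>. ip (basis_lists s) (chaos_deriv W n s S c \<omega>) (chaos_deriv W n s S d \<omega>)) =
    (fact n)\<^sup>2 / fact (n - s) * pow_ip n S c d"
proof -
  have fin: "finite S" using S by (simp add: unit_set_def)
  have "expectation (\<lambda>\<omega>. ip (basis_lists s) (chaos_deriv W n s S c \<omega>) (chaos_deriv W n s S d \<omega>)) =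
    expectation (\<lambda>\<omega>. (fact n / fact (n - s))\<^sup>2 * (\<Sum>h\<in>S. \<Sum>k\<in>S. (c h * d k * (h \<bullet> k) ^ s) * (hermite (n - s) (W h \<omega>) * hermite (n - s) (W k \<omega>))))"
    unfolding ip_chaos_deriv[OF fin] by (simp add: mult_ac)
  also have "\<dots> = (fact n / fact (n - s))\<^sup>2 * (\<Sum>h\<in>S. \<Sum>k\<in>S. (c h * d k * (h \<bullet> k) ^ s) * expectation (\<lambda>\<omega>. hermite (n - s) (W h \<omega>) * hermite (n - s) (W k \<omega>)))"
    by (simp add: integrable_hermite_prod2)
  also have "\<dots> = (fact n / fact (n - s))\<^sup>2 * (\<Sum>h\<in>S. \<Sum>k\<in>S. fact (n - s) * (c h * d k * (h \<bullet> k) ^ n))"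
  proof -
    have "(h \<bullet> k) ^ s * (h \<bullet> k) ^ (n - s) = (h \<bullet> k) ^ n" for h k :: 'h
      using s by (simp add: power_add[symmetric])
    then show ?thesis using S
      by (intro arg_cong[where f = "(*) _"] sum.cong refl) (auto simp: unit_set_def expectation_hermite_hermite mult_ac)
  qed
  also have "\<dots> = (fact n)\<^sup>2 / fact (n - s) * pow_ip n S c d"
    unfolding pow_ip_def by (simp add: sum_distrib_left[symmetric] power2_eq_square)
  finally show ?thesis .
qed

lemma nn_integral_chaos_deriv:
  assumes S: "unit_set S" and s: "s \<le> n"
  shows "(\<integral>\<^sup>+\<omega>. ennreal ((nrm (basis_lists s) (chaos_deriv W n s S c \<omega>))\<^sup>2) \<partial>M) = ennreal ((fact n)\<^sup>2 / fact (n - s) * pow_ip n S c c)"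
proof -
  have fin: "finite S" using S by (simp add: unit_set_def)
  show ?thesis
    unfolding nrm_sq expectation_ip_chaos_deriv[OF S s, symmetric]
    by (intro nn_integral_eq_integral integrable_ip_chaos_deriv fin AE_I2 ip_nonneg)
qed

lemma pow_ip_nonneg:
  fixes S :: "'h set"
  assumes "unit_set S" shows "0 \<le> pow_ip n S c c"
proof -
  have "0 \<le> (fact n)\<^sup>2 / fact (n - n) * pow_ip n S c c"
    unfolding expectation_ip_chaos_deriv[OF assms order_refl, symmetric] by (intro integral_nonneg_AE AE_I2 ip_nonneg)
  then show ?thesis by (simp add: zero_le_mult_iff)
qed

text \<open>Completeness is used for real functions on the product of the basis lists with \<open>\<Omega>\<close>.\<close>

lemma chaos_deriv_limit:
  fixes S :: "nat \<Rightarrow> 'h set" and c :: "nat \<Rightarrow> 'h \<Rightarrow> real"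
  assumes fc: "\<And>j. finite_coeff (S j) (c j)" and s: "s \<le> n"
    and cauchy: "\<And>e. e > 0 \<Longrightarrow> \<exists>n0. \<forall>i\<ge>n0. \<forall>j\<ge>n0. pow_ip n (S i \<union> S j) (\<lambda>h. c i h - c j h) (\<lambda>h. c i h - c j h) \<le> e"
  shows "\<exists>V. tensor_random_element M s V \<and>
    (\<lambda>j. \<integral>\<^sup>+\<omega>. ennreal ((tensor_norm s (\<lambda>us. chaos_deriv W n s (S j) (c j) \<omega> us - V \<omega> us))\<^sup>2) \<partial>M) \<longlonglongrightarrow> 0"
proof -
  let ?B = "basis_lists s :: 'h list set"
  let ?C = "count_space ?B"
  interpret C: sigma_finite_measure ?C
    by (intro sigma_finite_measure_count_space_countable countable_basis_lists)
  interpret P: pair_sigma_finite ?C M ..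
  have us: "unit_set (S i)" "unit_set (S i \<union> S j)" "finite (S i)" for i j
    using fc[of i] fc[of j] by (auto simp: finite_coeff_def unit_set_def)
  \<comment> \<open>A derivative as a real function of basis list and sample point; its mean square
    norm on the product space is the expected squared tensor norm.\<close>
  define u where "u j = (\<lambda>(es, \<omega>). chaos_deriv W n s (S j) (c j) \<omega> es)" for j
  have um[measurable]: "u j \<in> borel_measurable (?C \<Otimes>\<^sub>M M)" for j
    unfolding u_def by (intro measurable_pair_measure_countable1 countable_basis_lists) simp_all
  have "\<exists>v\<in>borel_measurable (?C \<Otimes>\<^sub>M M). (\<lambda>j. \<integral>\<^sup>+z. ennreal ((u j z - v z)\<^sup>2) \<partial>(?C \<Otimes>\<^sub>M M)) \<longlonglongrightarrow> 0"
  proof (rule L2_complete[OF um])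
    fix e :: real assume e: "e > 0"
    define K where "K = (fact n)\<^sup>2 / (fact (n - s) :: real)"
    have K: "K > 0" by (simp add: K_def)
    obtain n0 where n0: "\<forall>i\<ge>n0. \<forall>j\<ge>n0. pow_ip n (S i \<union> S j) (\<lambda>h. c i h - c j h) (\<lambda>h. c i h - c j h) \<le> e / K"
      using cauchy[of "e / K"] e K by auto
    have "(\<integral>\<^sup>+z. ennreal ((u i z - u j z)\<^sup>2) \<partial>(?C \<Otimes>\<^sub>M M)) \<le> ennreal e" if "i \<ge> n0" "j \<ge> n0" for i j
    proof -
      have "(\<integral>\<^sup>+z. ennreal ((u i z - u j z)\<^sup>2) \<partial>(?C \<Otimes>\<^sub>M M)) = (\<integral>\<^sup>+\<omega>. (\<integral>\<^sup>+es. ennreal ((u i (es, \<omega>) - u j (es, \<omega>))\<^sup>2) \<partial>?C) \<partial>M)"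
        by (subst P.nn_integral_snd[symmetric]) auto
      also have "\<dots> = (\<integral>\<^sup>+\<omega>. ennreal ((nrm ?B (chaos_deriv W n s (S i \<union> S j) (\<lambda>h. c i h - c j h) \<omega>))\<^sup>2) \<partial>M)"
        unfolding u_def by (simp add: chaos_deriv_diff_union[OF fc fc, symmetric] nn_integral_l2 chaos_deriv_l2 us)
      also have "\<dots> = ennreal (K * pow_ip n (S i \<union> S j) (\<lambda>h. c i h - c j h) (\<lambda>h. c i h - c j h))"
        unfolding nn_integral_chaos_deriv[OF us(2) s] K_def ..
      also have "\<dots> \<le> ennreal e"
        using n0 that K by (intro ennreal_leI) (auto simp: pos_le_divide_eq mult.commute)
      finally show ?thesis .
    qed
    then show "\<exists>n0. \<forall>m\<ge>n0. \<forall>n\<ge>n0. (\<integral>\<^sup>+z. ennreal ((u m z - u n z)\<^sup>2) \<partial>(?C \<Otimes>\<^sub>M M)) \<le> ennreal e" by blast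
  qed
  then obtain v where v[measurable]: "v \<in> borel_measurable (?C \<Otimes>\<^sub>M M)"
    and lim: "(\<lambda>j. \<integral>\<^sup>+z. ennreal ((u j z - v z)\<^sup>2) \<partial>(?C \<Otimes>\<^sub>M M)) \<longlonglongrightarrow> 0" by blast
  \<comment> \<open>Sample points at which the limit has square summable coefficients. Elsewhere, on
    a null set, \<open>V\<close> is set to 0, because a tensor-valued random element must lie in the
    tensor power at every point.\<close>
  define good where "good \<omega> \<longleftrightarrow> (\<integral>\<^sup>+es. ennreal ((v (es, \<omega>))\<^sup>2) \<partial>?C) \<noteq> \<infinity>" for \<omega>
  have good_l2: "(\<lambda>es. v (es, \<omega>)) \<in> l2 ?B" if "good \<omega>" for \<omega>
    using that unfolding good_def l2_def by (auto intro!: summable_on_if_nn_integral_count_space)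
  have good_m: "Measurable.pred M good"
    unfolding good_def by measurable
  define V where "V \<omega> = (if good \<omega> then tensor_of s (\<lambda>es. v (es, \<omega>)) else (\<lambda>_. 0))" for \<omega>
  \<comment> \<open>Writing the extension as an integral over basis lists makes its measurability in
    the sample point a part of Fubini's theorem.\<close>
  have Vint: "V \<omega> x = (if good \<omega> then (\<integral>es. v (es, \<omega>) * elem_tensor x es \<partial>?C) else 0)" if x: "length x = s" for \<omega> x
  proof (cases "good \<omega>")
    case True
    have "(\<lambda>es. v (es, \<omega>) * elem_tensor x es) summable_on ?B"
      using good_l2[OF True] elem_tensor_l2[OF x] unfolding l2_def by (auto intro: l2_mult_summable)
    then have "Infinite_Set_Sum.abs_summable_on (\<lambda>es. v (es, \<omega>) * elem_tensor x es) ?B"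
      by (simp only: abs_summable_on_iff_summable_on)
    then show ?thesis using True infsetsum_infsum[of "\<lambda>es. v (es, \<omega>) * elem_tensor x es" ?B]
      by (simp add: V_def tensor_of_def ip_def infsetsum_def)
  qed (simp add: V_def)
  have zero_in: "(\<lambda>_. 0) \<in> (tensor_power s :: 'h tensor set)"
    by (simp add: tensor_power_def)
  have Vin: "V \<omega> \<in> tensor_power s" for \<omega>
    using tensor_of_in[OF good_l2, of \<omega>] zero_in by (simp add: V_def)
  have tre: "tensor_random_element M s V"
    unfolding tensor_random_element_def
  proof (intro conjI ballI allI)
    fix x :: "'h list"
    show "(\<lambda>\<omega>. V \<omega> x) \<in> borel_measurable M"
    proof (cases "length x = s")
      case True
      have [measurable]: "(\<lambda>z. elem_tensor x (snd z)) \<in> borel_measurable (M \<Otimes>\<^sub>M ?C)"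
        by (rule measurable_compose[OF measurable_snd]) simp
      have m: "(\<lambda>\<omega>. \<integral>es. v (es, \<omega>) * elem_tensor x es \<partial>?C) \<in> borel_measurable M"
        by (rule C.borel_measurable_lebesgue_integral) (use measurable_pair_swap in measurable)
      note [measurable] = m good_m
      show ?thesis unfolding Vint[OF True] by measurable
    next
      case False
      then have "V \<omega> x = 0" for \<omega> using Vin[of \<omega>] by (simp add: tensor_power_def)
      then show ?thesis by simp
    qed
  qed (rule Vin)
  have fub: "(\<integral>\<^sup>+z. ennreal ((u j z - v z)\<^sup>2) \<partial>(?C \<Otimes>\<^sub>M M)) = (\<integral>\<^sup>+\<omega>. (\<integral>\<^sup>+es. ennreal ((u j (es, \<omega>) - v (es, \<omega>))\<^sup>2) \<partial>?C) \<partial>M)" for j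
    by (subst P.nn_integral_snd[symmetric]) auto
  have AEgood: "AE \<omega> in M. good \<omega>"
  proof -
    have "eventually (\<lambda>j. (\<integral>\<^sup>+z. ennreal ((u j z - v z)\<^sup>2) \<partial>(?C \<Otimes>\<^sub>M M)) < 1) sequentially"
      using lim by (intro order_tendstoD) auto
    then obtain j where "(\<integral>\<^sup>+z. ennreal ((u j z - v z)\<^sup>2) \<partial>(?C \<Otimes>\<^sub>M M)) < 1"
      using eventually_happens[of _ sequentially] by auto
    then have "(\<integral>\<^sup>+\<omega>. (\<integral>\<^sup>+es. ennreal ((u j (es, \<omega>) - v (es, \<omega>))\<^sup>2) \<partial>?C) \<partial>M) \<noteq> \<infinity>"
      unfolding fub by (auto simp: top_unique)
    then have "AE \<omega> in M. (\<integral>\<^sup>+es. ennreal ((u j (es, \<omega>) - v (es, \<omega>))\<^sup>2) \<partial>?C) \<noteq> \<infinity>"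
      by (intro nn_integral_PInf_AE) measurable
    then show ?thesis
    proof eventually_elim
      case (elim \<omega>)
      then have "(\<lambda>es. u j (es, \<omega>) - v (es, \<omega>)) \<in> l2 ?B"
        unfolding l2_def by (auto intro!: summable_on_if_nn_integral_count_space)
      moreover have "(\<lambda>es. u j (es, \<omega>)) \<in> l2 ?B"
        unfolding u_def using chaos_deriv_l2[OF us(3)] by simp
      ultimately have "(\<lambda>es. v (es, \<omega>)) \<in> l2 ?B"
        using l2_diff[of "\<lambda>es. u j (es, \<omega>)" ?B "\<lambda>es. u j (es, \<omega>) - v (es, \<omega>)"] by simp
      then show ?case unfolding good_def by (simp add: nn_integral_l2)
    qed
  qed
  have "(\<integral>\<^sup>+\<omega>. ennreal ((tensor_norm s (\<lambda>us. chaos_deriv W n s (S j) (c j) \<omega> us - V \<omega> us))\<^sup>2) \<partial>M) = (\<integral>\<^sup>+z. ennreal ((u j z - v z)\<^sup>2) \<partial>(?C \<Otimes>\<^sub>M M))" for j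
    unfolding fub
  proof (rule nn_integral_cong_AE)
    show "AE \<omega> in M. ennreal ((tensor_norm s (\<lambda>us. chaos_deriv W n s (S j) (c j) \<omega> us - V \<omega> us))\<^sup>2) = (\<integral>\<^sup>+es. ennreal ((u j (es, \<omega>) - v (es, \<omega>))\<^sup>2) \<partial>?C)"
      using AEgood
    proof eventually_elim
      case (elim \<omega>)
      have l: "(\<lambda>es. u j (es, \<omega>)) \<in> l2 ?B"
        unfolding u_def using chaos_deriv_l2[OF us(3)] by simp
      have "nrm ?B (\<lambda>us. chaos_deriv W n s (S j) (c j) \<omega> us - V \<omega> us) = nrm ?B (\<lambda>es. u j (es, \<omega>) - v (es, \<omega>))"
        by (intro nrm_cong) (simp add: u_def V_def elim tensor_of_basis)
      then show ?case
        unfolding tensor_norm_nrm nn_integral_l2[OF l2_diff[OF l good_l2[OF elim]]] by simp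
    qed
  qed
  then show ?thesis using lim tre by auto
qed

end

subsection \<open>Existence of the multiple integrals\<close>

lemma nrm_basis_lists_0: "nrm (basis_lists 0) f = \<bar>f []\<bar>"
  unfolding nrm_def ip_def basis_lists_0 by simp

lemma chaos_deriv_0: "chaos_deriv W n 0 S c \<omega> [] = (\<Sum>h\<in>S. c h * hermite n (W h \<omega>))"
  by (simp add: chaos_deriv_def elem_tensor_def)

lemma nrm_power_tensor:
  assumes "finite S"
  shows "(nrm (basis_lists n) (\<lambda>us. \<Sum>h\<in>S. c h * elem_tensor (replicate n h) us))\<^sup>2 = pow_ip n S c c"
  unfolding nrm_sq pow_ip_def using assms
  by (subst ip_sum_sum) (auto simp: elem_tensor_l2 ip_elem_tensor elem_tensor_replicate_self)

context isonormal_gaussian_process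
begin

lemma nn_integral_chaos_diff:
  fixes S T :: "'h set"
  assumes "finite_coeff S c" "finite_coeff T d"
  shows "(\<integral>\<^sup>+\<omega>. ennreal ((chaos_deriv W n 0 S c \<omega> [] - chaos_deriv W n 0 T d \<omega> [])\<^sup>2) \<partial>M) =
    ennreal (fact n * pow_ip n (S \<union> T) (\<lambda>h. c h - d h) (\<lambda>h. c h - d h))"
proof -
  have u: "unit_set (S \<union> T)" using assms by (auto simp: finite_coeff_def unit_set_def)
  have "(\<integral>\<^sup>+\<omega>. ennreal ((chaos_deriv W n 0 S c \<omega> [] - chaos_deriv W n 0 T d \<omega> [])\<^sup>2) \<partial>M) =
    (\<integral>\<^sup>+\<omega>. ennreal ((nrm (basis_lists 0) (chaos_deriv W n 0 (S \<union> T) (\<lambda>h. c h - d h) \<omega>))\<^sup>2) \<partial>M)"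
    unfolding nrm_basis_lists_0 chaos_deriv_diff_union[OF assms] by simp
  also have "\<dots> = ennreal (fact n * pow_ip n (S \<union> T) (\<lambda>h. c h - d h) (\<lambda>h. c h - d h))"
    by (subst nn_integral_chaos_deriv[OF u]) (simp_all add: power2_eq_square)
  finally show ?thesis .
qed

text \<open>The isometry, with factor n!, between tensors and Hermite sums makes the sums attached
  to approximating tensors Cauchy in mean square; completeness provides the limit. This licenses the
  choice in \<open>wiener_integral\<close>.\<close>

lemma wiener_integral_exists:
  fixes f :: "'h tensor"
  assumes f: "f \<in> sym_tensor_power n" and n: "n > 0"
  shows "\<exists>X. is_wiener_integral M W n f X"
proof -
  define P where "P j S c \<longleftrightarrow> finite S \<and> (\<forall>h\<in>S. norm h = 1) \<and>
    tensor_norm n (\<lambda>us. (\<Sum>h\<in>S. c h * elem_tensor (replicate n h) us) - f us) \<le> 1 / real (Suc j)" for j S c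
  have "\<forall>j. \<exists>S c. P j S c" unfolding P_def using power_tensor_approx[OF f n] by simp
  then obtain S c0 where P: "\<And>j. P j (S j) (c0 j)" by metis
  have S: "\<And>j. finite (S j)" "\<And>j. \<forall>h\<in>S j. norm h = 1"
    and c0: "\<And>j. tensor_norm n (\<lambda>us. (\<Sum>h\<in>S j. c0 j h * elem_tensor (replicate n h) us) - f us) \<le> 1 / real (Suc j)"
    using P by (simp_all add: P_def)
  \<comment> \<open>Coefficients are cut off outside \<open>S j\<close>, so that differences live on
    unions of supports.\<close>
  define c where "c j h = (if h \<in> S j then c0 j h else 0)" for j h
  define t where "t j us = (\<Sum>h\<in>S j. c j h * elem_tensor (replicate n h) us)" for j us
  have fc: "finite_coeff (S j) (c j)" for j using S by (auto simp: finite_coeff_def unit_set_def c_def)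
  have tf: "nrm (basis_lists n) (\<lambda>us. t j us - f us) \<le> 1 / real (Suc j)" for j
    using c0[of j] unfolding tensor_norm_nrm t_def c_def by (simp cong: sum.cong)
  have fl: "f \<in> l2 (basis_lists n)" using f by (intro tensor_power_l2) (simp add: sym_tensor_power_def)
  have tl: "t j \<in> l2 (basis_lists n)" for j
    unfolding t_def[abs_def] by (intro l2_sum elem_tensor_l2) simp
  have pij: "pow_ip n (S i \<union> S j) (\<lambda>h. c i h - c j h) (\<lambda>h. c i h - c j h) = (nrm (basis_lists n) (\<lambda>us. t i us - t j us))\<^sup>2" for i j
  proof -
    have "t k us = (\<Sum>h\<in>S i \<union> S j. c k h * elem_tensor (replicate n h) us)" if "k = i \<or> k = j" for k us
      unfolding t_def using S that by (intro sum.mono_neutral_left) (auto simp: c_def)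
    then have "(\<Sum>h\<in>S i \<union> S j. (c i h - c j h) * elem_tensor (replicate n h) us) = t i us - t j us" for us
      by (simp add: sum_subtractf left_diff_distrib)
    then show ?thesis using nrm_power_tensor[of "S i \<union> S j" n "\<lambda>h. c i h - c j h"] S by simp
  qed
  define u where "u j \<omega> = chaos_deriv W n 0 (S j) (c j) \<omega> []" for j \<omega>
  have um[measurable]: "u j \<in> borel_measurable M" for j unfolding u_def by measurable
  have "\<exists>v\<in>borel_measurable M. (\<lambda>j. \<integral>\<^sup>+\<omega>. ennreal ((u j \<omega> - v \<omega>)\<^sup>2) \<partial>M) \<longlonglongrightarrow> 0"
  proof (rule L2_complete[OF um])
    fix e :: real assume e: "e > 0"
    obtain n0 where n0: "n0 > 0" "inverse (real n0) < sqrt (e / fact n) / 2"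
      using ex_inverse_of_nat_less[of "sqrt (e / fact n) / 2"] e by auto
    have "(\<integral>\<^sup>+\<omega>. ennreal ((u i \<omega> - u j \<omega>)\<^sup>2) \<partial>M) \<le> ennreal e" if "i \<ge> n0" "j \<ge> n0" for i j
    proof -
      have b: "nrm (basis_lists n) (\<lambda>us. t k us - f us) \<le> sqrt (e / fact n) / 2" if "k \<ge> n0" for k
      proof -
        have "1 / real (Suc k) \<le> inverse (real n0)" using that n0(1) by (simp add: field_simps)
        then show ?thesis using tf[of k] n0(2) by linarith
      qed
      have "nrm (basis_lists n) (\<lambda>us. t i us - t j us) \<le> nrm (basis_lists n) (\<lambda>us. t i us - f us) + nrm (basis_lists n) (\<lambda>us. f us - t j us)"
        by (rule nrm_triangle_diff[OF tl fl tl])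
      also have "\<dots> \<le> sqrt (e / fact n)"
        using b[OF that(1)] b[OF that(2)] nrm_diff_commute[of "basis_lists n" f "t j"] by simp
      finally have "(nrm (basis_lists n) (\<lambda>us. t i us - t j us))\<^sup>2 \<le> (sqrt (e / fact n))\<^sup>2"
        by (rule power_mono) simp
      then have "fact n * (nrm (basis_lists n) (\<lambda>us. t i us - t j us))\<^sup>2 \<le> e"
        using e by (simp add: field_simps)
      then show ?thesis
        unfolding u_def nn_integral_chaos_diff[OF fc fc] pij by (rule ennreal_leI)
    qed
    then show "\<exists>n0. \<forall>m\<ge>n0. \<forall>n\<ge>n0. (\<integral>\<^sup>+x. ennreal ((u m x - u n x)\<^sup>2) \<partial>M) \<le> ennreal e" by blast
  qed
  then obtain X where X: "X \<in> borel_measurable M" "(\<lambda>j. \<integral>\<^sup>+\<omega>. ennreal ((u j \<omega> - X \<omega>)\<^sup>2) \<partial>M) \<longlonglongrightarrow> 0" by blast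
  have "(\<lambda>j. nrm (basis_lists n) (\<lambda>us. t j us - f us)) \<longlonglongrightarrow> 0"
  proof (rule tendsto_sandwich[where f = "\<lambda>_. 0" and h = "\<lambda>j. 1 / real (Suc j)"])
    show "(\<lambda>j. 1 / real (Suc j)) \<longlonglongrightarrow> 0" using LIMSEQ_inverse_real_of_nat by (simp add: inverse_eq_divide)
  qed (use tf in auto)
  then have "is_wiener_integral M W n f X"
    unfolding is_wiener_integral_def using X S
    by (intro conjI exI[of _ S] exI[of _ c]) (simp_all add: u_def chaos_deriv_0 tensor_norm_nrm t_def)
  then show ?thesis by blast
qed

lemma wiener_integral_approx:
  fixes f :: "'h tensor"
  assumes f: "f \<in> sym_tensor_power n" and n: "n > 0"
  shows "\<exists>S c. (\<forall>j. finite_coeff (S j) (c j)) \<and> wiener_integral M W n f \<in> borel_measurable M \<and>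
    (\<lambda>j. \<integral>\<^sup>+\<omega>. ennreal ((chaos_deriv W n 0 (S j) (c j) \<omega> [] - wiener_integral M W n f \<omega>)\<^sup>2) \<partial>M) \<longlonglongrightarrow> 0"
proof -
  have "is_wiener_integral M W n f (wiener_integral M W n f)"
    unfolding wiener_integral_def using someI_ex[OF wiener_integral_exists[OF f n]] .
  then obtain S c where *: "wiener_integral M W n f \<in> borel_measurable M" "\<And>j. finite (S j)" "\<And>j h. h \<in> S j \<Longrightarrow> norm h = 1"
    "(\<lambda>j. \<integral>\<^sup>+\<omega>. ennreal (((\<Sum>h\<in>S j. c j h * hermite n (W h \<omega>)) - wiener_integral M W n f \<omega>)\<^sup>2) \<partial>M) \<longlonglongrightarrow> 0"
    unfolding is_wiener_integral_def by blast
  define c' where "c' j h = (if h \<in> S j then c j h else 0)" for j h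
  have "chaos_deriv W n 0 (S j) (c' j) \<omega> [] = (\<Sum>h\<in>S j. c j h * hermite n (W h \<omega>))" for j \<omega>
    unfolding chaos_deriv_0 by (intro sum.cong) (auto simp: c'_def)
  then show ?thesis using *
    by (intro exI[of _ S] exI[of _ c']) (auto simp: finite_coeff_def unit_set_def c'_def)
qed

text \<open>The isometry read backwards: convergence of the variables makes the tensors Cauchy. The
  threshold fact n * e / 4 fits (x - y)^2 \<le> 2 * (x - z)^2 + 2 * (y - z)^2.\<close>

lemma chaos_cauchy:
  fixes S :: "nat \<Rightarrow> 'h set"
  assumes fc: "\<And>j. finite_coeff (S j) (c j)" and [measurable]: "F \<in> borel_measurable M"
    and lim: "(\<lambda>j. \<integral>\<^sup>+\<omega>. ennreal ((chaos_deriv W n 0 (S j) (c j) \<omega> [] - F \<omega>)\<^sup>2) \<partial>M) \<longlonglongrightarrow> 0"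
    and e: "e > 0"
  shows "\<exists>n0. \<forall>i\<ge>n0. \<forall>j\<ge>n0. pow_ip n (S i \<union> S j) (\<lambda>h. c i h - c j h) (\<lambda>h. c i h - c j h) \<le> e"
proof -
  let ?X = "\<lambda>j \<omega>. chaos_deriv W n 0 (S j) (c j) \<omega> []"
  have "eventually (\<lambda>j. (\<integral>\<^sup>+\<omega>. ennreal ((?X j \<omega> - F \<omega>)\<^sup>2) \<partial>M) < ennreal (fact n * e / 4)) sequentially"
    using lim e by (intro order_tendstoD) auto
  then obtain n0 where n0: "\<And>j. j \<ge> n0 \<Longrightarrow> (\<integral>\<^sup>+\<omega>. ennreal ((?X j \<omega> - F \<omega>)\<^sup>2) \<partial>M) < ennreal (fact n * e / 4)"
    unfolding eventually_sequentially by blast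
  have "pow_ip n (S i \<union> S j) (\<lambda>h. c i h - c j h) (\<lambda>h. c i h - c j h) \<le> e" if "i \<ge> n0" "j \<ge> n0" for i j
  proof -
    have "(x - y)\<^sup>2 \<le> 2 * (x - z)\<^sup>2 + 2 * (y - z)\<^sup>2" for x y z :: real
      using zero_le_power2[of "x + y - 2 * z"] by (simp add: power2_eq_square algebra_simps)
    then have "(\<integral>\<^sup>+\<omega>. ennreal ((?X i \<omega> - ?X j \<omega>)\<^sup>2) \<partial>M) \<le> (\<integral>\<^sup>+\<omega>. ennreal (2 * (?X i \<omega> - F \<omega>)\<^sup>2 + 2 * (?X j \<omega> - F \<omega>)\<^sup>2) \<partial>M)"
      by (intro nn_integral_mono ennreal_leI)
    also have "\<dots> = 2 * (\<integral>\<^sup>+\<omega>. ennreal ((?X i \<omega> - F \<omega>)\<^sup>2) \<partial>M) + 2 * (\<integral>\<^sup>+\<omega>. ennreal ((?X j \<omega> - F \<omega>)\<^sup>2) \<partial>M)"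
      by (simp add: ennreal_mult nn_integral_add nn_integral_cmult)
    also have "\<dots> \<le> 2 * ennreal (fact n * e / 4) + 2 * ennreal (fact n * e / 4)"
      by (intro add_mono mult_left_mono less_imp_le n0 that) auto
    also have "\<dots> = ennreal (fact n * e)"
      using e by (simp add: ennreal_plus[symmetric] ennreal_mult''[of "_ / _" 2, symmetric] flip: ennreal_numeral ennreal_mult)
    finally have "ennreal (fact n * pow_ip n (S i \<union> S j) (\<lambda>h. c i h - c j h) (\<lambda>h. c i h - c j h)) \<le> ennreal (fact n * e)"
      unfolding nn_integral_chaos_diff[OF fc fc] .
    then show ?thesis using e by (simp add: ennreal_le_iff)
  qed
  then show ?thesis by blast
qed

end

subsection \<open>Cylindrical representation of finite combinations\<close>

lemma hermite_has_derivative: "(hermite n has_real_derivative real n * hermite (n - 1) x) (at x)"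
proof (induction n rule: less_induct)
  case (less n)
  consider "n = 0" | "n = 1" | k where "n = Suc (Suc k)" by (metis One_nat_def not0_implies_Suc)
  then show ?case
  proof cases
    case 1
    then have "hermite n = (\<lambda>_. 1)" by auto
    then show ?thesis using 1 by simp
  next
    case 2
    then have "hermite n = (\<lambda>x. x)" by auto
    then show ?thesis using 2 by simp
  next
    case 3
    have a: "(hermite (Suc k) has_real_derivative real (Suc k) * hermite k x) (at x)"
      and b: "(hermite k has_real_derivative real k * hermite (k - 1) x) (at x)"
      using less[of "Suc k"] less[of k] 3 by simp_all
    have e: "hermite n = (\<lambda>x. x * hermite (Suc k) x - real (Suc k) * hermite k x)" using 3 by auto
    show ?thesis unfolding e
      by (rule DERIV_cong[OF DERIV_diff[OF DERIV_mult[OF DERIV_ident a] DERIV_cmult[OF b]]])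
         (simp add: 3 hermite_Suc[of k] algebra_simps)
  qed
qed

text \<open>Falling factorial with truncated subtraction: it is 0 for k > n, as the derivatives of
  that order are.\<close>

definition falling :: "nat \<Rightarrow> nat \<Rightarrow> real" where "falling n k = (\<Prod>i<k. real (n - i))"

lemma falling_eq: "k \<le> n \<Longrightarrow> falling n k = fact n / fact (n - k)"
proof (induction k)
  case (Suc k)
  have "fact (n - k) = real (n - k) * fact (n - Suc k)"
    using Suc by (metis Suc_diff_Suc Suc_le_lessD fact_Suc of_nat_fact of_nat_mult)
  then show ?case using Suc by (simp add: falling_def)
qed (simp add: falling_def)

definition hermite_sum :: "nat \<Rightarrow> nat \<Rightarrow> (nat \<Rightarrow> real) \<Rightarrow> (nat \<Rightarrow> real) \<Rightarrow> real" where
  "hermite_sum n m c x = (\<Sum>i<m. c i * hermite n (x i))"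

lemma iter_partial_hermite_sum_deriv:
  fixes c a :: "nat \<Rightarrow> real"
  assumes "j < m"
  shows "((\<lambda>t. \<Sum>i<m. c i * (if P i then a i * hermite k ((x(j := t)) i) else 0)) has_real_derivative
    (c j * (if P j then a j * (real k * hermite (k - 1) (x j)) else 0))) (at (x j))"
proof -
  have "((\<lambda>t. \<Sum>i<m. c i * (if P i then a i * hermite k ((x(j := t)) i) else 0)) has_real_derivative
    (\<Sum>i<m. if i = j then c j * (if P j then a j * (real k * hermite (k - 1) (x j)) else 0) else 0)) (at (x j))"
  proof (rule DERIV_sum)
    fix i
    show "((\<lambda>t. c i * (if P i then a i * hermite k ((x(j := t)) i) else 0)) has_real_derivative
       (if i = j then c j * (if P j then a j * (real k * hermite (k - 1) (x j)) else 0) else 0)) (at (x j))"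
    proof (cases "i = j")
      case True
      then show ?thesis using DERIV_cmult[OF DERIV_cmult[OF hermite_has_derivative[of k "x j"], of "a j"], of "c j"]
        by (cases "P j") simp_all
    next
      case False
      then show ?thesis by (cases "P i") simp_all
    qed
  qed
  then show ?thesis using assms by simp
qed

text \<open>The variables are separated, so genuinely mixed partial derivatives vanish and a list of
  indices contributes only through one repeated index; the empty list keeps every summand.\<close>

lemma iter_partial_hermite_sum:
  "set is \<subseteq> {..<m} \<Longrightarrow> iter_partial is (hermite_sum n m c) x =
     (\<Sum>i<m. c i * (if set is \<subseteq> {i} then falling n (length is) * hermite (n - length is) (x i) else 0))"
proof (induction "is" arbitrary: x)
  case Nil
  then show ?case by (simp add: iter_partial_def hermite_sum_def falling_def)
next
  case (Cons j "is")
  let ?k = "length is"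
  have j: "j < m" and sub: "set is \<subseteq> {..<m}" using Cons.prems by auto
  have "iter_partial (j # is) (hermite_sum n m c) x =
    deriv (\<lambda>t. \<Sum>i<m. c i * (if set is \<subseteq> {i} then falling n ?k * hermite (n - ?k) ((x(j := t)) i) else 0)) (x j)"
    unfolding iter_partial_Cons partial_deriv_def Cons.IH[OF sub] ..
  also have "\<dots> = c j * (if set is \<subseteq> {j} then falling n ?k * (real (n - ?k) * hermite (n - ?k - 1) (x j)) else 0)"
    by (rule DERIV_imp_deriv[OF iter_partial_hermite_sum_deriv[OF j]])
  also have "\<dots> = (\<Sum>i<m. if i = j then c j * (if set is \<subseteq> {j} then falling n ?k * (real (n - ?k) * hermite (n - ?k - 1) (x j)) else 0) else 0)"
    using j by simp
  also have "\<dots> = (\<Sum>i<m. c i * (if set (j # is) \<subseteq> {i} then falling n (length (j # is)) * hermite (n - length (j # is)) (x i) else 0))"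
    by (intro sum.cong refl) (auto simp: falling_def)
  finally show ?case .
qed

lemma smooth_poly_growth_hermite_sum: "smooth_poly_growth m (hermite_sum n m c)"
  unfolding smooth_poly_growth_def
proof (intro conjI allI impI)
  fix x y :: "nat \<Rightarrow> real" assume "\<forall>i<m. x i = y i"
  then show "hermite_sum n m c x = hermite_sum n m c y" by (simp add: hermite_sum_def)
next
  fix "is" :: "nat list" assume s: "set is \<subseteq> {..<m}"
  have "poly_growth m (\<lambda>x. \<Sum>i<m. c i * (if set is \<subseteq> {i} then falling n (length is) * hermite (n - length is) (x i) else 0))"
  proof (intro poly_growth_sum poly_growth_mult poly_growth_const)
    fix i assume "i \<in> {..<m}"
    then have "poly_growth m (\<lambda>x. hermite (n - length is) (x i))"
      using dir_deriv_hermite[of i m "\<lambda>_. 0"] by (simp add: dir_deriv_def)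
    then show "poly_growth m (\<lambda>x. if set is \<subseteq> {i} then falling n (length is) * hermite (n - length is) (x i) else 0)"
      by (cases "set is \<subseteq> {i}") (auto intro: poly_growth_mult poly_growth_const)
  qed
  then have pg: "poly_growth m (iter_partial is (hermite_sum n m c))"
    using iter_partial_hermite_sum[OF s, of n c] by presburger
  then show "continuous_on UNIV (iter_partial is (hermite_sum n m c))"
    "\<exists>K N. \<forall>x. \<bar>iter_partial is (hermite_sum n m c) x\<bar> \<le> K * (1 + (\<Sum>i<m. \<bar>x i\<bar>)) ^ N"
    by (auto simp: poly_growth_def)
  fix x i assume "i < m"
  from iter_partial_hermite_sum_deriv[OF this, of c "\<lambda>i. set is \<subseteq> {i}" "\<lambda>_. falling n (length is)" "n - length is" x]
  show "(\<lambda>t. iter_partial is (hermite_sum n m c) (x(i := t))) differentiable (at (x i))"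
    unfolding iter_partial_hermite_sum[OF s] real_differentiable_def by blast
qed

text \<open>Only constant index lists survive, and the list of s copies of i contributes the s-th
  power of \<open>h i\<close>. This identifies \<open>chaos_deriv\<close> with the derivative of the
  definition.\<close>

lemma cylinder_deriv_hermite_sum:
  assumes "s \<le> n" and h: "bij_betw h {..<m} S"
  shows "cylinder_deriv W s m (hermite_sum n m (\<lambda>i. c (h i))) h \<omega> us = chaos_deriv W n s S c \<omega> us"
proof -
  let ?L = "{is. length is = s \<and> set is \<subseteq> {..<m}}"
  let ?H = "\<lambda>i. falling n s * hermite (n - s) (W (h i) \<omega>)"
  have fin: "finite ?L" using finite_lists_length_eq[of "{..<m}" s] by (simp add: conj_commute)
  have "cylinder_deriv W s m (hermite_sum n m (\<lambda>i. c (h i))) h \<omega> us =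
    (\<Sum>is\<in>?L. \<Sum>i<m. c (h i) * (if set is \<subseteq> {i} then ?H i else 0) * elem_tensor (map h is) us)"
    unfolding cylinder_deriv_def by (intro sum.cong refl) (auto simp: iter_partial_hermite_sum sum_distrib_right)
  also have "\<dots> = (\<Sum>i<m. \<Sum>is\<in>?L. c (h i) * (if set is \<subseteq> {i} then ?H i else 0) * elem_tensor (map h is) us)"
    by (rule sum.swap)
  also have "\<dots> = (\<Sum>i<m. \<Sum>is\<in>?L. if is = replicate s i then c (h i) * ?H i * elem_tensor (replicate s (h i)) us else 0)"
  proof (intro sum.cong refl, goal_cases)
    case (1 i "is")
    have "set is \<subseteq> {i} \<longleftrightarrow> is = replicate s i"
    proof
      assume "set is \<subseteq> {i}"
      then show "is = replicate s i" using 1 by (intro replicate_eqI) auto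
    qed auto
    then show ?case by auto
  qed
  also have "\<dots> = (\<Sum>i<m. c (h i) * ?H i * elem_tensor (replicate s (h i)) us)"
    using fin by (intro sum.cong refl) (auto simp: set_replicate_conv_if)
  also have "\<dots> = (\<Sum>k\<in>S. c k * (falling n s * hermite (n - s) (W k \<omega>)) * elem_tensor (replicate s k) us)"
    by (rule sum.reindex_bij_betw[OF h])
  finally show ?thesis unfolding chaos_deriv_def falling_eq[OF assms(1)] by (simp add: mult_ac)
qed

section \<open>Existence and closability of iterated derivatives\<close>

context isonormal_gaussian_process
begin

text \<open>One sequence of Hermite sums has to converge at all orders up to \<open>k\<close>
  simultaneously; this holds because all these norms are multiples of one tensor norm.\<close>

lemma malliavin_deriv_exists:
  fixes S :: "nat \<Rightarrow> 'h set"
  assumes fc: "\<And>j. finite_coeff (S j) (c j)" and F[measurable]: "F \<in> borel_measurable M"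
    and lim: "(\<lambda>j. \<integral>\<^sup>+\<omega>. ennreal ((chaos_deriv W n 0 (S j) (c j) \<omega> [] - F \<omega>)\<^sup>2) \<partial>M) \<longlonglongrightarrow> 0"
    and k: "k \<le> n"
  shows "\<exists>U. is_malliavin_deriv M W k F U \<and> tensor_random_element M k U \<and>
    (\<lambda>j. \<integral>\<^sup>+\<omega>. ennreal ((tensor_norm k (\<lambda>us. chaos_deriv W n k (S j) (c j) \<omega> us - U \<omega> us))\<^sup>2) \<partial>M) \<longlonglongrightarrow> 0"
proof -
  define V0 where "V0 \<omega> us = (if us = [] then F \<omega> else 0)" for \<omega> and us :: "'h list"
  \<comment> \<open>The definition prescribes the member of order 0 as a function, not up to null
    sets, so order 0 takes \<open>V0\<close> itself instead of a limit supplied by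
    completeness.\<close>
  define Q where "Q i V \<longleftrightarrow> tensor_random_element M i V \<and>
    (\<lambda>j. \<integral>\<^sup>+\<omega>. ennreal ((tensor_norm i (\<lambda>us. chaos_deriv W n i (S j) (c j) \<omega> us - V \<omega> us))\<^sup>2) \<partial>M) \<longlonglongrightarrow> 0 \<and> (i = 0 \<longrightarrow> V = V0)"
    for i V
  have "\<exists>V. Q i V" if i: "i \<le> n" for i
  proof (cases "i = 0")
    case False
    then show ?thesis using chaos_deriv_limit[OF fc i chaos_cauchy[OF fc F lim]] unfolding Q_def by simp
  next
    case True
    have "tensor_random_element M 0 V0"
      by (auto simp: tensor_random_element_def tensor_power_def V0_def basis_lists_0)
    moreover have "(\<lambda>j. \<integral>\<^sup>+\<omega>. ennreal ((tensor_norm 0 (\<lambda>us. chaos_deriv W n 0 (S j) (c j) \<omega> us - V0 \<omega> us))\<^sup>2) \<partial>M) \<longlonglongrightarrow> 0"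
      using lim by (simp add: tensor_norm_nrm nrm_basis_lists_0 V0_def)
    ultimately show ?thesis using True unfolding Q_def by blast
  qed
  then have "\<forall>i. \<exists>V. i \<le> n \<longrightarrow> Q i V" by blast
  then obtain V where VQ: "\<And>i. i \<le> n \<Longrightarrow> Q i (V i)" by metis
  have V: "\<And>i. i \<le> n \<Longrightarrow> tensor_random_element M i (V i)"
    "\<And>i. i \<le> n \<Longrightarrow> (\<lambda>j. \<integral>\<^sup>+\<omega>. ennreal ((tensor_norm i (\<lambda>us. chaos_deriv W n i (S j) (c j) \<omega> us - V i \<omega> us))\<^sup>2) \<partial>M) \<longlonglongrightarrow> 0"
    "V 0 = V0"
    using VQ unfolding Q_def by blast+
  have "\<forall>j. \<exists>h. bij_betw h {..<card (S j)} (S j)"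
  proof
    fix j
    have "finite (S j)" using fc[of j] by (simp add: finite_coeff_def unit_set_def)
    from ex_bij_betw_nat_finite[OF this] show "\<exists>h. bij_betw h {..<card (S j)} (S j)" unfolding atLeast0LessThan .
  qed
  then obtain h where h: "\<And>j. bij_betw (h j) {..<card (S j)} (S j)" by metis
  have "is_malliavin_deriv M W k F (V k)"
    unfolding is_malliavin_deriv_def
  proof (intro exI conjI allI impI)
    show "smooth_poly_growth (card (S j)) (hermite_sum n (card (S j)) (\<lambda>i. c j (h j i)))" for j
      by (rule smooth_poly_growth_hermite_sum)
    show "V 0 = (\<lambda>\<omega> us. if us = [] then F \<omega> else 0)" unfolding V(3) V0_def[abs_def] ..
    show "V k = V k" ..
    fix i assume "i \<le> k"
    then have i: "i \<le> n" using k by simp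
    show "tensor_random_element M i (V i)" by (rule V(1)[OF i])
    show "(\<lambda>j. \<integral>\<^sup>+\<omega>. ennreal ((tensor_norm i (\<lambda>us. cylinder_deriv W i (card (S j)) (hermite_sum n (card (S j)) (\<lambda>i. c j (h j i))) (h j) \<omega> us - V i \<omega> us))\<^sup>2) \<partial>M) \<longlonglongrightarrow> 0"
      unfolding cylinder_deriv_hermite_sum[OF i h] by (rule V(2)[OF i])
  qed
  then show ?thesis using V(1,2)[OF k] by blast
qed

lemma cylinder_deriv_poly_growth:
  fixes h :: "nat \<Rightarrow> 'h"
  assumes s: "smooth_poly_growth m \<phi>"
  shows "(\<lambda>\<omega>. cylinder_deriv W k m \<phi> h \<omega> us) \<in> borel_measurable M"
    and "integrable M (\<lambda>\<omega>. (cylinder_deriv W k m \<phi> h \<omega> us)\<^sup>2)"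
proof -
  define g where "g x = (\<Sum>is | length is = k \<and> set is \<subseteq> {..<m}. iter_partial is \<phi> x * elem_tensor (map h is) us)" for x
  have "poly_growth m g"
    unfolding g_def using s
    by (intro poly_growth_sum poly_growth_mult poly_growth_const) (auto simp: poly_growth_def smooth_poly_growth_def)
  then have "integrable M (\<lambda>\<omega>. g (\<lambda>i. W (h i) \<omega>))" "integrable M (\<lambda>\<omega>. g (\<lambda>i. W (h i) \<omega>) * g (\<lambda>i. W (h i) \<omega>))"
    by (auto intro!: integrable_poly_growth integrable_poly_growth[of m "\<lambda>x. g x * g x"] poly_growth_mult)
  moreover have "cylinder_deriv W k m \<phi> h \<omega> us = g (\<lambda>i. W (h i) \<omega>)" for \<omega> by (simp add: cylinder_deriv_def g_def)
  ultimately show "(\<lambda>\<omega>. cylinder_deriv W k m \<phi> h \<omega> us) \<in> borel_measurable M"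
    "integrable M (\<lambda>\<omega>. (cylinder_deriv W k m \<phi> h \<omega> us)\<^sup>2)" by (auto simp: power2_eq_square)
qed

lemma cylinder_coordinate_limit:
  assumes s: "\<And>j. smooth_poly_growth (m j) (\<phi> j)"
    and V: "tensor_random_element M i V"
    and lim: "(\<lambda>j. \<integral>\<^sup>+\<omega>. ennreal ((tensor_norm i (\<lambda>us. cylinder_deriv W i (m j) (\<phi> j) (h j) \<omega> us - V \<omega> us))\<^sup>2) \<partial>M) \<longlonglongrightarrow> 0"
    and es: "es \<in> basis_lists i"
  shows "L2_tendsto M (\<lambda>j \<omega>. cylinder_deriv W i (m j) (\<phi> j) (h j) \<omega> es) (\<lambda>\<omega>. V \<omega> es)"
  unfolding L2_tendsto_def
proof (intro conjI allI)
  show "(\<lambda>\<omega>. V \<omega> es) \<in> borel_measurable M" using V by (simp add: tensor_random_element_def)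
  show "(\<lambda>j. \<integral>\<^sup>+\<omega>. ennreal ((cylinder_deriv W i (m j) (\<phi> j) (h j) \<omega> es - V \<omega> es)\<^sup>2) \<partial>M) \<longlonglongrightarrow> 0"
  proof (rule tendsto_sandwich[OF _ _ tendsto_const lim])
    show "\<forall>\<^sub>F j in sequentially. (\<integral>\<^sup>+\<omega>. ennreal ((cylinder_deriv W i (m j) (\<phi> j) (h j) \<omega> es - V \<omega> es)\<^sup>2) \<partial>M)
      \<le> (\<integral>\<^sup>+\<omega>. ennreal ((tensor_norm i (\<lambda>us. cylinder_deriv W i (m j) (\<phi> j) (h j) \<omega> us - V \<omega> us))\<^sup>2) \<partial>M)"
    proof (intro always_eventually allI nn_integral_mono ennreal_leI)
      fix j \<omega> assume \<omega>: "\<omega> \<in> space M"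
      have "(\<lambda>us. cylinder_deriv W i (m j) (\<phi> j) (h j) \<omega> us) \<in> l2 (basis_lists i)"
        unfolding cylinder_deriv_def by (intro l2_sum elem_tensor_l2) auto
      moreover have "V \<omega> \<in> l2 (basis_lists i)" using V \<omega> by (intro tensor_power_l2) (auto simp: tensor_random_element_def)
      ultimately have "\<bar>cylinder_deriv W i (m j) (\<phi> j) (h j) \<omega> es - V \<omega> es\<bar> \<le> nrm (basis_lists i) (\<lambda>us. cylinder_deriv W i (m j) (\<phi> j) (h j) \<omega> us - V \<omega> us)"
        using abs_le_nrm[OF l2_diff es] by blast
      then show "(cylinder_deriv W i (m j) (\<phi> j) (h j) \<omega> es - V \<omega> es)\<^sup>2 \<le> (tensor_norm i (\<lambda>us. cylinder_deriv W i (m j) (\<phi> j) (h j) \<omega> us - V \<omega> us))\<^sup>2"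
        unfolding tensor_norm_nrm by (simp add: abs_le_square_iff[symmetric])
    qed
  qed auto
qed (use cylinder_deriv_poly_growth[OF s] in auto)

text \<open>Each side of the duality is a pairing of a mean square convergent coordinate with a
  fixed square integrable factor, so the identity passes to the limit.\<close>

lemma malliavin_limit_by_parts:
  fixes T T' :: "real \<Rightarrow> real"
  assumes s: "\<And>j. smooth_poly_growth (m j) (\<phi> j)"
    and V: "tensor_random_element M i V" "tensor_random_element M (Suc i) V'"
    and lim: "(\<lambda>j. \<integral>\<^sup>+\<omega>. ennreal ((tensor_norm i (\<lambda>us. cylinder_deriv W i (m j) (\<phi> j) (h j) \<omega> us - V \<omega> us))\<^sup>2) \<partial>M) \<longlonglongrightarrow> 0"
      "(\<lambda>j. \<integral>\<^sup>+\<omega>. ennreal ((tensor_norm (Suc i) (\<lambda>us. cylinder_deriv W (Suc i) (m j) (\<phi> j) (h j) \<omega> us - V' \<omega> us))\<^sup>2) \<partial>M) \<longlonglongrightarrow> 0"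
    and es: "e # es \<in> basis_lists (Suc i)"
    and T: "\<And>m f f' v. dir_deriv m v f f' \<Longrightarrow> dir_deriv m v (\<lambda>x. T (f x)) (\<lambda>x. T' (f x) * f' x)"
    and b: "\<And>x. \<bar>T x\<bar> \<le> 1" "\<And>x. \<bar>T' x\<bar> \<le> 1" and Tm[measurable]: "T \<in> borel_measurable borel" "T' \<in> borel_measurable borel"
  shows "expectation (\<lambda>\<omega>. V' \<omega> (e # es) * T (W g \<omega>)) = expectation (\<lambda>\<omega>. V \<omega> es * (W e \<omega> * T (W g \<omega>) - (g \<bullet> e) * T' (W g \<omega>)))"
proof -
  let ?D = "\<lambda>k j \<omega>. cylinder_deriv W k (m j) (\<phi> j) (h j) \<omega>"
  have es': "es \<in> basis_lists i" using es by (auto simp: basis_lists_def)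
  have sq1: "integrable M (\<lambda>\<omega>. (T (W g \<omega>))\<^sup>2)"
    using b(1) by (intro integrable_const_bound[where B=1]) (auto simp: abs_square_le_1)
  have sq2: "integrable M (\<lambda>\<omega>. (W e \<omega> * T (W g \<omega>) - (g \<bullet> e) * T' (W g \<omega>))\<^sup>2)"
  proof (rule Bochner_Integration.integrable_bound)
    show "integrable M (\<lambda>\<omega>. 2 * (W e \<omega> * W e \<omega>) + 2 * (g \<bullet> e)\<^sup>2)" by (simp add: integrable_W_mult)
    have "(w * t - c * t')\<^sup>2 \<le> 2 * (w * w) + 2 * c\<^sup>2" if "\<bar>t\<bar> \<le> 1" "\<bar>t'\<bar> \<le> 1" for w t c t' :: real
    proof -
      have "(w * t - c * t')\<^sup>2 \<le> 2 * (w * t)\<^sup>2 + 2 * (c * t')\<^sup>2"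
        using zero_le_power2[of "w * t + c * t'"] by (simp add: power2_eq_square algebra_simps)
      also have "\<dots> \<le> 2 * (w\<^sup>2 * 1) + 2 * (c\<^sup>2 * 1)"
        unfolding power_mult_distrib using that
        by (intro add_mono mult_left_mono) (auto simp: abs_square_le_1)
      finally show ?thesis by (simp add: power2_eq_square)
    qed
    then show "AE \<omega> in M. norm ((W e \<omega> * T (W g \<omega>) - (g \<bullet> e) * T' (W g \<omega>))\<^sup>2) \<le> norm (2 * (W e \<omega> * W e \<omega>) + 2 * (g \<bullet> e)\<^sup>2)"
      using b by (intro AE_I2) (simp add: abs_le_iff order_trans[OF _ abs_ge_self])
  qed measurable
  have "(\<lambda>j. expectation (\<lambda>\<omega>. ?D (Suc i) j \<omega> (e # es) * T (W g \<omega>))) \<longlonglongrightarrow> expectation (\<lambda>\<omega>. V' \<omega> (e # es) * T (W g \<omega>))"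
    by (rule L2_tendsto_integral_mult[OF cylinder_coordinate_limit[OF s V(2) lim(2) es] _ sq1]) measurable
  moreover have "(\<lambda>j. expectation (\<lambda>\<omega>. ?D i j \<omega> es * (W e \<omega> * T (W g \<omega>) - (g \<bullet> e) * T' (W g \<omega>)))) \<longlonglongrightarrow>
     expectation (\<lambda>\<omega>. V \<omega> es * (W e \<omega> * T (W g \<omega>) - (g \<bullet> e) * T' (W g \<omega>)))"
    by (rule L2_tendsto_integral_mult[OF cylinder_coordinate_limit[OF s V(1) lim(1) es'] _ sq2]) measurable
  moreover have "expectation (\<lambda>\<omega>. ?D (Suc i) j \<omega> (e # es) * T (W g \<omega>)) = expectation (\<lambda>\<omega>. ?D i j \<omega> es * (W e \<omega> * T (W g \<omega>) - (g \<bullet> e) * T' (W g \<omega>)))" for j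
    by (rule cylinder_deriv_integration_by_parts[OF s T b Tm])
  ultimately show ?thesis using LIMSEQ_unique by simp
qed

text \<open>The derivative is closable: order by order, integration by parts against \<open>cos (W g)\<close> and
  \<open>sin (W g)\<close> determines the limit.\<close>

lemma malliavin_deriv_unique:
  assumes "is_malliavin_deriv M W k F U" "is_malliavin_deriv M W k F U'"
    and "es \<in> basis_lists k"
  shows "AE \<omega> in M. U \<omega> es = U' \<omega> es"
proof -
  obtain m \<phi> h V where 1: "\<And>j. smooth_poly_growth (m j) (\<phi> j)" "V 0 = (\<lambda>\<omega> us. if us = [] then F \<omega> else 0)" "V k = U"
    "\<And>i. i \<le> k \<Longrightarrow> tensor_random_element M i (V i)"
    "\<And>i. i \<le> k \<Longrightarrow> (\<lambda>j. \<integral>\<^sup>+\<omega>. ennreal ((tensor_norm i (\<lambda>us. cylinder_deriv W i (m j) (\<phi> j) (h j) \<omega> us - V i \<omega> us))\<^sup>2) \<partial>M) \<longlonglongrightarrow> 0"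
    using assms(1) unfolding is_malliavin_deriv_def by blast
  obtain m' \<phi>' h' V' where 2: "\<And>j. smooth_poly_growth (m' j) (\<phi>' j)" "V' 0 = (\<lambda>\<omega> us. if us = [] then F \<omega> else 0)" "V' k = U'"
    "\<And>i. i \<le> k \<Longrightarrow> tensor_random_element M i (V' i)"
    "\<And>i. i \<le> k \<Longrightarrow> (\<lambda>j. \<integral>\<^sup>+\<omega>. ennreal ((tensor_norm i (\<lambda>us. cylinder_deriv W i (m' j) (\<phi>' j) (h' j) \<omega> us - V' i \<omega> us))\<^sup>2) \<partial>M) \<longlonglongrightarrow> 0"
    using assms(2) unfolding is_malliavin_deriv_def by blast
  \<comment> \<open>Both sequences have the same order 0. At the next order the first basis vector
    is peeled off: duality expresses the trigonometric tests by order i, where the limits already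
    agree.\<close>
  have "AE \<omega> in M. V i \<omega> es = V' i \<omega> es" if "i \<le> k" "es \<in> basis_lists i" for i es
    using that
  proof (induction i arbitrary: es)
    case 0
    then show ?case using 1(2) 2(2) by simp
  next
    case (Suc i)
    then obtain e fs where es: "es = e # fs" "e # fs \<in> basis_lists (Suc i)" "fs \<in> basis_lists i"
      by (cases es) (auto simp: basis_lists_def)
    have i: "i \<le> k" "Suc i \<le> k" using Suc.prems by auto
    have IH: "AE \<omega> in M. V i \<omega> fs = V' i \<omega> fs" using Suc.IH i es by blast
    have Lim: "L2_tendsto M (\<lambda>j \<omega>. cylinder_deriv W (Suc i) (m j) (\<phi> j) (h j) \<omega> es) (\<lambda>\<omega>. V (Suc i) \<omega> es)"
      "L2_tendsto M (\<lambda>j \<omega>. cylinder_deriv W (Suc i) (m' j) (\<phi>' j) (h' j) \<omega> es) (\<lambda>\<omega>. V' (Suc i) \<omega> es)"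
      using Suc.prems by (auto intro!: cylinder_coordinate_limit 1 2)
    have mV[measurable]: "(\<lambda>\<omega>. V (Suc i) \<omega> es) \<in> borel_measurable M" "(\<lambda>\<omega>. V' (Suc i) \<omega> es) \<in> borel_measurable M"
      "(\<lambda>\<omega>. V i \<omega> fs) \<in> borel_measurable M" "(\<lambda>\<omega>. V' i \<omega> fs) \<in> borel_measurable M"
      using 1(4)[OF i(2)] 2(4)[OF i(2)] 1(4)[OF i(1)] 2(4)[OF i(1)] by (auto simp: tensor_random_element_def)
    note sqi = Lim[THEN L2_tendsto_square_integrable]
    have intV: "integrable M (\<lambda>\<omega>. V (Suc i) \<omega> es * t \<omega>)" "integrable M (\<lambda>\<omega>. V' (Suc i) \<omega> es * t \<omega>)"
      if [measurable]: "t \<in> borel_measurable M" and "\<And>\<omega>. \<bar>t \<omega>\<bar> \<le> 1" for t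
    proof -
      have "integrable M (\<lambda>\<omega>. (t \<omega>)\<^sup>2)"
        using that by (intro integrable_const_bound[where B=1]) (auto simp: abs_square_le_1)
      then show "integrable M (\<lambda>\<omega>. V (Suc i) \<omega> es * t \<omega>)" "integrable M (\<lambda>\<omega>. V' (Suc i) \<omega> es * t \<omega>)"
        using sqi by (auto intro!: integrable_mult_of_squares)
    qed
    have orth: "expectation (\<lambda>\<omega>. (V (Suc i) \<omega> es - V' (Suc i) \<omega> es) * T (W g \<omega>)) = 0"
      if T: "\<And>m f f' v. dir_deriv m v f f' \<Longrightarrow> dir_deriv m v (\<lambda>x. T (f x)) (\<lambda>x. T' (f x) * f' x)"
        and b: "\<And>x. \<bar>T x\<bar> \<le> 1" "\<And>x. \<bar>T' x\<bar> \<le> 1" and Tm[measurable]: "T \<in> borel_measurable borel" "T' \<in> borel_measurable borel"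
      for T T' g
    proof -
      have "expectation (\<lambda>\<omega>. V i \<omega> fs * (W e \<omega> * T (W g \<omega>) - (g \<bullet> e) * T' (W g \<omega>))) = expectation (\<lambda>\<omega>. V' i \<omega> fs * (W e \<omega> * T (W g \<omega>) - (g \<bullet> e) * T' (W g \<omega>)))"
        using IH by (intro integral_cong_AE) (auto elim!: eventually_mono)
      moreover have "expectation (\<lambda>\<omega>. V (Suc i) \<omega> (e # fs) * T (W g \<omega>)) = expectation (\<lambda>\<omega>. V i \<omega> fs * (W e \<omega> * T (W g \<omega>) - (g \<bullet> e) * T' (W g \<omega>)))"
        by (rule malliavin_limit_by_parts[OF 1(1) 1(4)[OF i(1)] 1(4)[OF i(2)] 1(5)[OF i(1)] 1(5)[OF i(2)] es(2)]) (fact T b Tm)+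
      moreover have "expectation (\<lambda>\<omega>. V' (Suc i) \<omega> (e # fs) * T (W g \<omega>)) = expectation (\<lambda>\<omega>. V' i \<omega> fs * (W e \<omega> * T (W g \<omega>) - (g \<bullet> e) * T' (W g \<omega>)))"
        by (rule malliavin_limit_by_parts[OF 2(1) 2(4)[OF i(1)] 2(4)[OF i(2)] 2(5)[OF i(1)] 2(5)[OF i(2)] es(2)]) (fact T b Tm)+
      ultimately have "expectation (\<lambda>\<omega>. V (Suc i) \<omega> es * T (W g \<omega>)) = expectation (\<lambda>\<omega>. V' (Suc i) \<omega> es * T (W g \<omega>))"
        unfolding es(1) by simp
      moreover have "integrable M (\<lambda>\<omega>. V (Suc i) \<omega> es * T (W g \<omega>))" "integrable M (\<lambda>\<omega>. V' (Suc i) \<omega> es * T (W g \<omega>))"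
        using b by (auto intro!: intV)
      ultimately show ?thesis by (simp add: left_diff_distrib)
    qed
    have "AE \<omega> in M. V (Suc i) \<omega> es - V' (Suc i) \<omega> es = 0"
    proof (rule AE_zero_if_trig_orthogonal)
      show "integrable M (\<lambda>\<omega>. V (Suc i) \<omega> es - V' (Suc i) \<omega> es)"
        using intV[of "\<lambda>_. 1"] by simp
      show "expectation (\<lambda>\<omega>. (V (Suc i) \<omega> es - V' (Suc i) \<omega> es) * cos (W g \<omega>)) = 0" for g
        by (rule orth[of cos "\<lambda>x. - sin x"], erule dir_deriv_cos) auto
      show "expectation (\<lambda>\<omega>. (V (Suc i) \<omega> es - V' (Suc i) \<omega> es) * sin (W g \<omega>)) = 0" for g
        by (rule orth[of sin cos], erule dir_deriv_sin) auto
    qed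
    then show ?case by eventually_elim simp
  qed
  then show ?thesis using assms(3) 1(3) 2(3) by auto
qed

text \<open>The chosen derivative may come from some other approximating sequence; uniqueness
  transfers to it the convergence of the Hermite sums under consideration.\<close>

lemma malliavin_deriv_limit:
  fixes S :: "nat \<Rightarrow> 'h set"
  assumes fc: "\<And>j. finite_coeff (S j) (c j)" and F: "F \<in> borel_measurable M"
    and lim: "(\<lambda>j. \<integral>\<^sup>+\<omega>. ennreal ((chaos_deriv W n 0 (S j) (c j) \<omega> [] - F \<omega>)\<^sup>2) \<partial>M) \<longlonglongrightarrow> 0"
    and k: "k \<le> n"
  shows "tensor_random_element M k (malliavin_deriv M W k F)"
    and "(\<lambda>j. \<integral>\<^sup>+\<omega>. ennreal ((tensor_norm k (\<lambda>us. chaos_deriv W n k (S j) (c j) \<omega> us - malliavin_deriv M W k F \<omega> us))\<^sup>2) \<partial>M) \<longlonglongrightarrow> 0"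
proof -
  let ?U = "malliavin_deriv M W k F"
  obtain U where U: "is_malliavin_deriv M W k F U"
    "(\<lambda>j. \<integral>\<^sup>+\<omega>. ennreal ((tensor_norm k (\<lambda>us. chaos_deriv W n k (S j) (c j) \<omega> us - U \<omega> us))\<^sup>2) \<partial>M) \<longlonglongrightarrow> 0"
    using malliavin_deriv_exists[OF assms] by blast
  have mall: "is_malliavin_deriv M W k F ?U" unfolding malliavin_deriv_def by (rule someI[of "is_malliavin_deriv M W k F", OF U(1)])
  have "tensor_random_element M k Y" if Y: "is_malliavin_deriv M W k F Y" for Y
  proof -
    obtain m \<phi> h V where "\<And>j. smooth_poly_growth (m j) (\<phi> j)" "V 0 = (\<lambda>\<omega> us. if us = [] then F \<omega> else 0)"
      and V: "V k = Y" "\<And>i. i \<le> k \<Longrightarrow> tensor_random_element M i (V i)"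
      and "\<And>i. i \<le> k \<Longrightarrow> (\<lambda>j. \<integral>\<^sup>+\<omega>. ennreal ((tensor_norm i (\<lambda>us. cylinder_deriv W i (m j) (\<phi> j) (h j) \<omega> us - V i \<omega> us))\<^sup>2) \<partial>M) \<longlonglongrightarrow> 0"
      using Y unfolding is_malliavin_deriv_def by blast
    from V(2)[of k] V(1) show ?thesis by simp
  qed
  from this[OF mall] show "tensor_random_element M k ?U" .
  \<comment> \<open>Uniqueness holds for each basis list off a null set; there are countably many
    lists, so one null set serves for all and the norms agree.\<close>
  have "AE \<omega> in M. \<forall>es\<in>basis_lists k. ?U \<omega> es = U \<omega> es"
    using malliavin_deriv_unique[OF mall U(1)] by (subst AE_ball_countable) (auto intro: countable_basis_lists)
  then have "(\<integral>\<^sup>+\<omega>. ennreal ((tensor_norm k (\<lambda>us. chaos_deriv W n k (S j) (c j) \<omega> us - ?U \<omega> us))\<^sup>2) \<partial>M) =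
    (\<integral>\<^sup>+\<omega>. ennreal ((tensor_norm k (\<lambda>us. chaos_deriv W n k (S j) (c j) \<omega> us - U \<omega> us))\<^sup>2) \<partial>M)" for j
    unfolding tensor_norm_nrm
  proof (intro nn_integral_cong_AE, eventually_elim)
    case (elim \<omega>)
    then have "nrm (basis_lists k) (\<lambda>us. chaos_deriv W n k (S j) (c j) \<omega> us - ?U \<omega> us) = nrm (basis_lists k) (\<lambda>us. chaos_deriv W n k (S j) (c j) \<omega> us - U \<omega> us)"
      by (intro nrm_cong) simp
    then show ?case by simp
  qed
  then show "(\<lambda>j. \<integral>\<^sup>+\<omega>. ennreal ((tensor_norm k (\<lambda>us. chaos_deriv W n k (S j) (c j) \<omega> us - ?U \<omega> us))\<^sup>2) \<partial>M) \<longlonglongrightarrow> 0"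
    using U(2) by simp
qed

end

subsection \<open>Passage to the limit\<close>

text \<open>As an integral over the counting measure of a countable set the sum is measurable in the
  parameter, since coordinatewise measurability is joint measurability there.\<close>

lemma measurable_ip:
  assumes B: "countable B"
    and l: "\<And>\<omega>. \<omega> \<in> space M \<Longrightarrow> u \<omega> \<in> l2 B" "\<And>\<omega>. \<omega> \<in> space M \<Longrightarrow> v \<omega> \<in> l2 B"
    and m: "\<And>b. b \<in> B \<Longrightarrow> (\<lambda>\<omega>. u \<omega> b) \<in> borel_measurable M" "\<And>b. b \<in> B \<Longrightarrow> (\<lambda>\<omega>. v \<omega> b) \<in> borel_measurable M"
  shows "(\<lambda>\<omega>. ip B (u \<omega>) (v \<omega>)) \<in> borel_measurable M"
proof -
  let ?C = "count_space B"
  interpret C: sigma_finite_measure ?C by (rule sigma_finite_measure_count_space_countable[OF B])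
  have "(\<lambda>(b, \<omega>). u \<omega> b * v \<omega> b) \<in> borel_measurable (?C \<Otimes>\<^sub>M M)"
    using m by (intro measurable_pair_measure_countable1 B) auto
  from measurable_pair_swap[OF this]
  have "(\<lambda>(\<omega>, b). u \<omega> b * v \<omega> b) \<in> borel_measurable (M \<Otimes>\<^sub>M ?C)" by (simp add: case_prod_unfold)
  then have "(\<lambda>\<omega>. \<integral>b. u \<omega> b * v \<omega> b \<partial>?C) \<in> borel_measurable M"
    by (rule C.borel_measurable_lebesgue_integral)
  moreover have "(\<integral>b. u \<omega> b * v \<omega> b \<partial>?C) = ip B (u \<omega>) (v \<omega>)" if "\<omega> \<in> space M" for \<omega>
  proof -
    have "(\<lambda>b. u \<omega> b * v \<omega> b) summable_on B"
      using l[OF that] unfolding l2_def mem_Collect_eq by (rule l2_mult_summable)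
    then show ?thesis
      using infsetsum_infsum[of "\<lambda>b. u \<omega> b * v \<omega> b" B] unfolding abs_summable_on_iff_summable_on
      by (simp add: ip_def infsetsum_def)
  qed
  ultimately show ?thesis by (simp cong: measurable_cong)
qed

lemma measurable_nrm:
  assumes "countable B" "\<And>\<omega>. \<omega> \<in> space M \<Longrightarrow> u \<omega> \<in> l2 B" "\<And>b. b \<in> B \<Longrightarrow> (\<lambda>\<omega>. u \<omega> b) \<in> borel_measurable M"
  shows "(\<lambda>\<omega>. nrm B (u \<omega>)) \<in> borel_measurable M"
proof -
  have "(\<lambda>\<omega>. ip B (u \<omega>) (u \<omega>)) \<in> borel_measurable M" by (intro measurable_ip assms)
  then show ?thesis unfolding nrm_def by measurable
qed

lemma sum3_power4_le: "(x + y + z) ^ 4 \<le> 27 * (x ^ 4 + y ^ 4 + z ^ 4)" for x y z :: real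
proof -
  have sq: "(a + b + c)\<^sup>2 \<le> 3 * (a\<^sup>2 + b\<^sup>2 + c\<^sup>2)" for a b c :: real
  proof -
    have "0 \<le> (a - b)\<^sup>2 + (b - c)\<^sup>2 + (a - c)\<^sup>2" by simp
    then show ?thesis by (simp add: power2_eq_square algebra_simps)
  qed
  have "(x + y + z) ^ 4 = ((x + y + z)\<^sup>2)\<^sup>2" by (simp add: power_mult[symmetric])
  also have "\<dots> \<le> (3 * (x\<^sup>2 + y\<^sup>2 + z\<^sup>2))\<^sup>2" by (intro power_mono sq) simp
  also have "\<dots> = 9 * (x\<^sup>2 + y\<^sup>2 + z\<^sup>2)\<^sup>2" unfolding power_mult_distrib by simp
  also have "\<dots> \<le> 9 * (3 * ((x\<^sup>2)\<^sup>2 + (y\<^sup>2)\<^sup>2 + (z\<^sup>2)\<^sup>2))" by (intro mult_left_mono sq) simp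
  finally show ?thesis by (simp add: power_mult[symmetric])
qed

text \<open>If r \<le> \<open>\<epsilon>\<close> * R the first term alone is large enough, otherwise
  R < r / \<open>\<epsilon>\<close> and the second is. This separates the small quantity r from R at
  fourth power.\<close>

lemma mult_cube_le:
  fixes r R \<epsilon> :: real
  assumes "0 \<le> r" "0 \<le> R" "0 < \<epsilon>"
  shows "r * R ^ 3 \<le> \<epsilon> * R ^ 4 + r ^ 4 / \<epsilon> ^ 3"
proof (cases "r \<le> \<epsilon> * R")
  case True
  then have "r * R ^ 3 \<le> \<epsilon> * R * R ^ 3" using assms by (intro mult_right_mono) auto
  moreover have "0 \<le> r ^ 4 / \<epsilon> ^ 3" using assms by simp
  ultimately show ?thesis by (simp add: power4_eq_xxxx power3_eq_cube)
next
  case False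
  then have "R \<le> r / \<epsilon>" using assms by (simp add: field_simps)
  then have "r * R ^ 3 \<le> r * (r / \<epsilon>) ^ 3" using assms by (intro mult_left_mono power_mono) auto
  moreover have "0 \<le> \<epsilon> * R ^ 4" using assms by simp
  ultimately show ?thesis by (simp add: power4_eq_xxxx power3_eq_cube)
qed

text \<open>The determinant is a quartic expression, so convergence in the fourth mean is the
  natural hypothesis; \<open>gram_diff_le\<close> and \<open>mult_cube_le\<close> give convergence
  in the mean without Hoelder's inequality.\<close>

lemma gram_tendsto:
  assumes B: "countable B"
    and l: "\<And>j \<omega>. \<omega> \<in> space M \<Longrightarrow> uj j \<omega> \<in> l2 B" "\<And>j \<omega>. \<omega> \<in> space M \<Longrightarrow> vj j \<omega> \<in> l2 B"
      "\<And>\<omega>. \<omega> \<in> space M \<Longrightarrow> u \<omega> \<in> l2 B" "\<And>\<omega>. \<omega> \<in> space M \<Longrightarrow> v \<omega> \<in> l2 B"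
    and m: "\<And>j b. b \<in> B \<Longrightarrow> (\<lambda>\<omega>. uj j \<omega> b) \<in> borel_measurable M" "\<And>j b. b \<in> B \<Longrightarrow> (\<lambda>\<omega>. vj j \<omega> b) \<in> borel_measurable M"
      "\<And>b. b \<in> B \<Longrightarrow> (\<lambda>\<omega>. u \<omega> b) \<in> borel_measurable M" "\<And>b. b \<in> B \<Longrightarrow> (\<lambda>\<omega>. v \<omega> b) \<in> borel_measurable M"
    and u: "(\<lambda>j. \<integral>\<^sup>+\<omega>. ennreal (nrm B (\<lambda>b. uj j \<omega> b - u \<omega> b) ^ 4) \<partial>M) \<longlonglongrightarrow> 0" "(\<integral>\<^sup>+\<omega>. ennreal (nrm B (u \<omega>) ^ 4) \<partial>M) < \<infinity>"
    and v: "(\<lambda>j. \<integral>\<^sup>+\<omega>. ennreal (nrm B (\<lambda>b. vj j \<omega> b - v \<omega> b) ^ 4) \<partial>M) \<longlonglongrightarrow> 0" "(\<integral>\<^sup>+\<omega>. ennreal (nrm B (v \<omega>) ^ 4) \<partial>M) < \<infinity>"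
    and int: "\<And>j. integrable M (\<lambda>\<omega>. gram B (uj j \<omega>) (vj j \<omega>))"
  shows "(\<lambda>j. \<integral>\<omega>. gram B (uj j \<omega>) (vj j \<omega>) \<partial>M) \<longlonglongrightarrow> (\<integral>\<omega>. gram B (u \<omega>) (v \<omega>) \<partial>M)"
proof -
  define p where "p j \<omega> = nrm B (\<lambda>b. uj j \<omega> b - u \<omega> b)" for j \<omega>
  define q where "q j \<omega> = nrm B (\<lambda>b. vj j \<omega> b - v \<omega> b)" for j \<omega>
  define a where "a \<omega> = nrm B (u \<omega>)" for \<omega>
  define b where "b \<omega> = nrm B (v \<omega>)" for \<omega>
  have [measurable]: "p j \<in> borel_measurable M" "q j \<in> borel_measurable M" "a \<in> borel_measurable M" "b \<in> borel_measurable M" for j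
    unfolding p_def[abs_def] q_def[abs_def] a_def[abs_def] b_def[abs_def]
    using l m by (auto intro!: measurable_nrm B l2_diff)
  have [measurable]: "(\<lambda>\<omega>. gram B (u \<omega>) (v \<omega>)) \<in> borel_measurable M" "(\<lambda>\<omega>. gram B (uj j \<omega>) (vj j \<omega>)) \<in> borel_measurable M" for j
    unfolding gram_def using l m by (auto intro!: measurable_ip B borel_measurable_diff borel_measurable_times borel_measurable_power)
  have nn: "0 \<le> p j \<omega>" "0 \<le> q j \<omega>" "0 \<le> a \<omega>" "0 \<le> b \<omega>" for j \<omega> by (simp_all add: p_def q_def a_def b_def)
  define \<rho> where "\<rho> j = (\<integral>\<^sup>+\<omega>. ennreal ((p j \<omega> + q j \<omega>) ^ 4) \<partial>M)" for j
  define A where "A = (\<integral>\<^sup>+\<omega>. ennreal (a \<omega> ^ 4) \<partial>M) + (\<integral>\<^sup>+\<omega>. ennreal (b \<omega> ^ 4) \<partial>M)"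
  have A: "A < \<infinity>" using u(2) v(2) by (simp add: A_def a_def b_def)
  have \<rho>le: "\<rho> j \<le> 27 * ((\<integral>\<^sup>+\<omega>. ennreal (p j \<omega> ^ 4) \<partial>M) + (\<integral>\<^sup>+\<omega>. ennreal (q j \<omega> ^ 4) \<partial>M))" for j
  proof -
    have "\<rho> j \<le> (\<integral>\<^sup>+\<omega>. ennreal (27 * (p j \<omega> ^ 4 + q j \<omega> ^ 4)) \<partial>M)"
      unfolding \<rho>_def using sum3_power4_le[of "p j _" "q j _" 0] by (intro nn_integral_mono ennreal_leI) simp
    also have "\<dots> = 27 * ((\<integral>\<^sup>+\<omega>. ennreal (p j \<omega> ^ 4) \<partial>M) + (\<integral>\<^sup>+\<omega>. ennreal (q j \<omega> ^ 4) \<partial>M))"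
      by (simp add: ennreal_mult nn_integral_cmult nn_integral_add)
    finally show ?thesis .
  qed
  have "(\<lambda>j. 27 * ((\<integral>\<^sup>+\<omega>. ennreal (p j \<omega> ^ 4) \<partial>M) + (\<integral>\<^sup>+\<omega>. ennreal (q j \<omega> ^ 4) \<partial>M))) \<longlonglongrightarrow> 27 * (0 + 0)"
    using u(1) v(1) unfolding p_def[symmetric] q_def[symmetric]
    by (intro ennreal_tendsto_cmult tendsto_add) auto
  then have up: "(\<lambda>j. 27 * ((\<integral>\<^sup>+\<omega>. ennreal (p j \<omega> ^ 4) \<partial>M) + (\<integral>\<^sup>+\<omega>. ennreal (q j \<omega> ^ 4) \<partial>M))) \<longlonglongrightarrow> 0" by simp
  have \<rho>: "\<rho> \<longlonglongrightarrow> 0"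
    by (rule tendsto_sandwich[OF _ _ tendsto_const up]) (use \<rho>le in auto)
  \<comment> \<open>The factor 27 is the convexity constant for the fourth power of a sum of three
    terms, here the distance r and the two norms of the limits.\<close>
  have bound: "(\<integral>\<^sup>+\<omega>. ennreal \<bar>gram B (uj j \<omega>) (vj j \<omega>) - gram B (u \<omega>) (v \<omega>)\<bar> \<partial>M) \<le>
     ennreal (4 * \<epsilon> * 27) * (\<rho> j + A) + ennreal (4 / \<epsilon> ^ 3) * \<rho> j" if \<epsilon>: "\<epsilon> > 0" for j \<epsilon>
  proof -
    have "(\<integral>\<^sup>+\<omega>. ennreal \<bar>gram B (uj j \<omega>) (vj j \<omega>) - gram B (u \<omega>) (v \<omega>)\<bar> \<partial>M) \<le>
      (\<integral>\<^sup>+\<omega>. ennreal (4 * \<epsilon> * 27 * ((p j \<omega> + q j \<omega>) ^ 4 + (a \<omega> ^ 4 + b \<omega> ^ 4)) + 4 / \<epsilon> ^ 3 * (p j \<omega> + q j \<omega>) ^ 4) \<partial>M)"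
    proof (intro nn_integral_mono ennreal_leI)
      fix \<omega> assume \<omega>: "\<omega> \<in> space M"
      let ?r = "p j \<omega> + q j \<omega>"
      let ?R = "?r + a \<omega> + b \<omega>"
      have "\<bar>gram B (uj j \<omega>) (vj j \<omega>) - gram B (u \<omega>) (v \<omega>)\<bar> \<le> 4 * ?r * ?R ^ 3"
        by (rule gram_diff_le[OF l(1)[OF \<omega>] l(2)[OF \<omega>] l(3)[OF \<omega>] l(4)[OF \<omega>]]) (simp_all add: p_def q_def a_def b_def)
      also have "\<dots> = 4 * (?r * ?R ^ 3)" by simp
      also have "\<dots> \<le> 4 * (\<epsilon> * ?R ^ 4 + ?r ^ 4 / \<epsilon> ^ 3)"
        using nn \<epsilon> by (intro mult_left_mono mult_cube_le) (auto intro: add_nonneg_nonneg)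
      also have "\<dots> \<le> 4 * (\<epsilon> * (27 * (?r ^ 4 + a \<omega> ^ 4 + b \<omega> ^ 4)) + ?r ^ 4 / \<epsilon> ^ 3)"
        using \<epsilon> by (intro mult_left_mono add_right_mono sum3_power4_le) auto
      also have "\<dots> = 4 * \<epsilon> * 27 * (?r ^ 4 + (a \<omega> ^ 4 + b \<omega> ^ 4)) + 4 / \<epsilon> ^ 3 * ?r ^ 4"
        by (simp add: algebra_simps)
      finally show "\<bar>gram B (uj j \<omega>) (vj j \<omega>) - gram B (u \<omega>) (v \<omega>)\<bar> \<le> 4 * \<epsilon> * 27 * (?r ^ 4 + (a \<omega> ^ 4 + b \<omega> ^ 4)) + 4 / \<epsilon> ^ 3 * ?r ^ 4" .
    qed
    also have "\<dots> = (\<integral>\<^sup>+\<omega>. ennreal (4 * \<epsilon> * 27) * (ennreal ((p j \<omega> + q j \<omega>) ^ 4) + (ennreal (a \<omega> ^ 4) + ennreal (b \<omega> ^ 4))) + ennreal (4 / \<epsilon> ^ 3) * ennreal ((p j \<omega> + q j \<omega>) ^ 4) \<partial>M)"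
      using \<epsilon> nn by (intro nn_integral_cong) (simp add: ennreal_mult''[symmetric] ennreal_plus[symmetric] ennreal_mult[symmetric] del: ennreal_plus)
    also have "\<dots> = ennreal (4 * \<epsilon> * 27) * (\<rho> j + A) + ennreal (4 / \<epsilon> ^ 3) * \<rho> j"
      unfolding \<rho>_def A_def by (simp add: nn_integral_add nn_integral_cmult)
    finally show ?thesis .
  qed
  have L1: "(\<lambda>j. \<integral>\<^sup>+\<omega>. ennreal \<bar>gram B (uj j \<omega>) (vj j \<omega>) - gram B (u \<omega>) (v \<omega>)\<bar> \<partial>M) \<longlonglongrightarrow> 0"
  proof (rule order_tendstoI)
    fix e :: ennreal assume e: "0 < e"
    obtain A' where A': "A = ennreal A'" "0 \<le> A'" using A by (cases A) auto
    \<comment> \<open>First \<open>\<epsilon>\<close> is made small against the fixed fourth moments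
      \<open>A\<close>; with \<open>\<epsilon>\<close> fixed, the rest tends to 0 with
      \<open>\<rho>\<close>, however large 4 / \<open>\<epsilon>\<close>^3 may be.\<close>
    obtain \<epsilon> :: real where \<epsilon>: "\<epsilon> > 0" "ennreal (4 * \<epsilon> * 27) * A < e"
    proof (cases e)
      case (real e')
      then have e': "e' > 0" using e by simp
      define \<epsilon> where "\<epsilon> = e' / (108 * (A' + 1))"
      have "\<epsilon> > 0" using e' A' by (simp add: \<epsilon>_def)
      have "4 * \<epsilon> * 27 * A' < e'" using e' A' by (simp add: \<epsilon>_def field_simps)
      then have "ennreal (4 * \<epsilon> * 27 * A') < ennreal e'" by (rule ennreal_lessI[OF e'])
      moreover have "ennreal (4 * \<epsilon> * 27) * A = ennreal (4 * \<epsilon> * 27 * A')"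
        using \<open>\<epsilon> > 0\<close> A' by (simp only: A'(1)) (rule ennreal_mult[symmetric], auto)
      ultimately show ?thesis using that[of \<epsilon>] \<open>\<epsilon> > 0\<close> real by simp
    next
      case top
      then show ?thesis using that[of 1] A' by (simp add: ennreal_mult[symmetric] del: ennreal_numeral)
    qed
    have "(\<lambda>j. ennreal (4 * \<epsilon> * 27) * (\<rho> j + A) + ennreal (4 / \<epsilon> ^ 3) * \<rho> j) \<longlonglongrightarrow> ennreal (4 * \<epsilon> * 27) * (0 + A) + ennreal (4 / \<epsilon> ^ 3) * 0"
      by (intro tendsto_add ennreal_tendsto_cmult \<rho> tendsto_const) auto
    then have "eventually (\<lambda>j. ennreal (4 * \<epsilon> * 27) * (\<rho> j + A) + ennreal (4 / \<epsilon> ^ 3) * \<rho> j < e) sequentially"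
      using \<epsilon>(2) by (intro order_tendstoD(2)) auto
    then show "eventually (\<lambda>j. (\<integral>\<^sup>+\<omega>. ennreal \<bar>gram B (uj j \<omega>) (vj j \<omega>) - gram B (u \<omega>) (v \<omega>)\<bar> \<partial>M) < e) sequentially"
      by eventually_elim (rule le_less_trans[OF bound[OF \<epsilon>(1)]])
  qed auto
  have "integrable M (\<lambda>\<omega>. gram B (u \<omega>) (v \<omega>))"
  proof -
    have "eventually (\<lambda>j. (\<integral>\<^sup>+\<omega>. ennreal \<bar>gram B (uj j \<omega>) (vj j \<omega>) - gram B (u \<omega>) (v \<omega>)\<bar> \<partial>M) < 1) sequentially"
      using L1 by (intro order_tendstoD) auto
    then obtain j where j: "(\<integral>\<^sup>+\<omega>. ennreal \<bar>gram B (uj j \<omega>) (vj j \<omega>) - gram B (u \<omega>) (v \<omega>)\<bar> \<partial>M) < 1"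
      using eventually_happens[of _ sequentially] by auto
    have "integrable M (\<lambda>\<omega>. gram B (uj j \<omega>) (vj j \<omega>) - gram B (u \<omega>) (v \<omega>))"
      using order.strict_trans[OF j, of top] by (intro integrableI_bounded) auto
    from Bochner_Integration.integrable_diff[OF int[of j] this] show ?thesis by simp
  qed
  then show ?thesis using L1 int by (intro tendsto_L1_int) auto
qed

text \<open>Expand the product of the two differences: its integral tends to 0, and the cross terms
  have one fixed factor, where weak convergence applies.\<close>

lemma L2_tendsto_integral_prod:
  assumes a: "L2_tendsto M aj a" and b: "L2_tendsto M bj b"
  shows "(\<lambda>j. \<integral>x. aj j x * bj j x \<partial>M) \<longlonglongrightarrow> (\<integral>x. a x * b x \<partial>M)"
proof -
  have [measurable]: "aj j \<in> borel_measurable M" "bj j \<in> borel_measurable M" "a \<in> borel_measurable M" "b \<in> borel_measurable M" for j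
    using a b by (auto simp: L2_tendsto_def)
  have sq: "integrable M (\<lambda>x. (aj j x)\<^sup>2)" "integrable M (\<lambda>x. (bj j x)\<^sup>2)" for j using a b by (auto simp: L2_tendsto_def)
  note sql = L2_tendsto_square_integrable[OF a] L2_tendsto_square_integrable[OF b]
  have i: "integrable M (\<lambda>x. aj j x * bj j x)" "integrable M (\<lambda>x. aj j x * b x)" "integrable M (\<lambda>x. bj j x * a x)" "integrable M (\<lambda>x. a x * b x)"
    "integrable M (\<lambda>x. aj j x * a x)" "integrable M (\<lambda>x. bj j x * b x)" for j
    using sq sql by (auto intro!: integrable_mult_of_squares)
  have D2: "integrable M (\<lambda>x. (aj j x - a x)\<^sup>2)" "integrable M (\<lambda>x. (bj j x - b x)\<^sup>2)" for j
    using sq[of j] sql i(5,6)[of j] by (simp_all add: power2_diff mult.assoc)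
  have d: "(\<lambda>j. \<integral>x. (aj j x - a x)\<^sup>2 \<partial>M) \<longlonglongrightarrow> 0" "(\<lambda>j. \<integral>x. (bj j x - b x)\<^sup>2 \<partial>M) \<longlonglongrightarrow> 0"
  proof -
    have "(\<lambda>j. ennreal (\<integral>x. (aj j x - a x)\<^sup>2 \<partial>M)) \<longlonglongrightarrow> ennreal 0" "(\<lambda>j. ennreal (\<integral>x. (bj j x - b x)\<^sup>2 \<partial>M)) \<longlonglongrightarrow> ennreal 0"
      using a b D2 by (simp_all add: L2_tendsto_def nn_integral_eq_integral)
    then show "(\<lambda>j. \<integral>x. (aj j x - a x)\<^sup>2 \<partial>M) \<longlonglongrightarrow> 0" "(\<lambda>j. \<integral>x. (bj j x - b x)\<^sup>2 \<partial>M) \<longlonglongrightarrow> 0"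
      by (auto intro: tendsto_ennreal_iff[THEN iffD1, rotated -1])
  qed
  have "(\<lambda>j. \<integral>x. (aj j x - a x) * (bj j x - b x) \<partial>M) \<longlonglongrightarrow> 0"
  proof (rule Lim_null_comparison)
    have "(\<lambda>j. (\<integral>x. (aj j x - a x)\<^sup>2 \<partial>M) + (\<integral>x. (bj j x - b x)\<^sup>2 \<partial>M)) \<longlonglongrightarrow> 0 + 0" by (intro tendsto_add d)
    then show "(\<lambda>j. (\<integral>x. (aj j x - a x)\<^sup>2 \<partial>M) + (\<integral>x. (bj j x - b x)\<^sup>2 \<partial>M)) \<longlonglongrightarrow> 0" by simp
    show "\<forall>\<^sub>F j in sequentially. norm (\<integral>x. (aj j x - a x) * (bj j x - b x) \<partial>M) \<le> (\<integral>x. (aj j x - a x)\<^sup>2 \<partial>M) + (\<integral>x. (bj j x - b x)\<^sup>2 \<partial>M)"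
    proof (intro always_eventually allI)
      fix j
      have "norm (\<integral>x. (aj j x - a x) * (bj j x - b x) \<partial>M) \<le> (\<integral>x. (aj j x - a x)\<^sup>2 + (bj j x - b x)\<^sup>2 \<partial>M)"
      proof (rule order_trans[OF integral_norm_bound integral_mono])
        show "integrable M (\<lambda>x. norm ((aj j x - a x) * (bj j x - b x)))"
          using D2[of j] by (intro integrable_norm integrable_mult_of_squares) auto
        show "integrable M (\<lambda>x. (aj j x - a x)\<^sup>2 + (bj j x - b x)\<^sup>2)" using D2[of j] by simp
        fix x
        have "2 * \<bar>aj j x - a x\<bar> * \<bar>bj j x - b x\<bar> \<le> (aj j x - a x)\<^sup>2 + (bj j x - b x)\<^sup>2"
          using sum_squares_bound[of "\<bar>aj j x - a x\<bar>" "\<bar>bj j x - b x\<bar>"] by simp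
        moreover have "0 \<le> \<bar>aj j x - a x\<bar> * \<bar>bj j x - b x\<bar>" by simp
        ultimately have "\<bar>aj j x - a x\<bar> * \<bar>bj j x - b x\<bar> \<le> (aj j x - a x)\<^sup>2 + (bj j x - b x)\<^sup>2" by linarith
        then show "norm ((aj j x - a x) * (bj j x - b x)) \<le> (aj j x - a x)\<^sup>2 + (bj j x - b x)\<^sup>2" by (simp add: abs_mult)
      qed
      then show "norm (\<integral>x. (aj j x - a x) * (bj j x - b x) \<partial>M) \<le> (\<integral>x. (aj j x - a x)\<^sup>2 \<partial>M) + (\<integral>x. (bj j x - b x)\<^sup>2 \<partial>M)"
        using D2[of j] by simp
    qed
  qed
  moreover have "(\<lambda>j. \<integral>x. aj j x * b x \<partial>M) \<longlonglongrightarrow> (\<integral>x. a x * b x \<partial>M)"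
    using L2_tendsto_integral_mult[OF a _ sql(2)] by simp
  moreover have "(\<lambda>j. \<integral>x. bj j x * a x \<partial>M) \<longlonglongrightarrow> (\<integral>x. b x * a x \<partial>M)"
    using L2_tendsto_integral_mult[OF b _ sql(1)] by simp
  ultimately have "(\<lambda>j. (\<integral>x. (aj j x - a x) * (bj j x - b x) \<partial>M) + (\<integral>x. aj j x * b x \<partial>M) + (\<integral>x. bj j x * a x \<partial>M) - (\<integral>x. a x * b x \<partial>M))
     \<longlonglongrightarrow> 0 + (\<integral>x. a x * b x \<partial>M) + (\<integral>x. b x * a x \<partial>M) - (\<integral>x. a x * b x \<partial>M)"
    by (intro tendsto_intros)
  moreover have "(\<integral>x. (aj j x - a x) * (bj j x - b x) \<partial>M) + (\<integral>x. aj j x * b x \<partial>M) + (\<integral>x. bj j x * a x \<partial>M) - (\<integral>x. a x * b x \<partial>M) = (\<integral>x. aj j x * bj j x \<partial>M)" for j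
  proof -
    have "(aj j x - a x) * (bj j x - b x) = aj j x * bj j x - aj j x * b x - bj j x * a x + a x * b x" for x
      by (simp add: algebra_simps)
    then show ?thesis using i by simp
  qed
  ultimately show ?thesis by (simp add: mult.commute)
qed

section \<open>Convergence of fourth moments and covariances\<close>

context isonormal_gaussian_process
begin

lemma nn_integral_nrm4_chaos_deriv:
  assumes S: "unit_set S" and s: "s \<le> n"
  shows "(\<integral>\<^sup>+\<omega>. ennreal (nrm (basis_lists s) (chaos_deriv W n s S c \<omega>) ^ 4) \<partial>M) \<le>
    ennreal ((fact n / fact (n - s)) ^ 4 * (\<Sum>r\<le>n - s. hermite_weight (n - s) r * ((fact (n - s - r))\<^sup>2 * (\<Sum>i\<le>n - s - r. (real ((n - s - r) choose i))\<^sup>2)))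
      * (pow_ip n S c c)\<^sup>2)"
proof -
  have fin: "finite S" using S by (simp add: unit_set_def)
  have "nrm (basis_lists s) (chaos_deriv W n s S c \<omega>) ^ 4 = (ip (basis_lists s) (chaos_deriv W n s S c \<omega>) (chaos_deriv W n s S c \<omega>))\<^sup>2" for \<omega>
    unfolding nrm_sq[symmetric] by (simp add: power_mult[symmetric])
  then show ?thesis
    using integrable_ip_square[OF fin, of s n c] expectation_ip_square_le[OF S s, of c]
    by (simp add: nn_integral_eq_integral ennreal_leI)
qed

text \<open>Fourth moments of differences of approximants are bounded by the tensor distance. The
  limit is known only in mean square, so Fatou's lemma along an almost surely convergent subsequence
  carries the bound over.\<close>

lemma malliavin_nrm4_limit:
  fixes S :: "nat \<Rightarrow> 'h set"
  assumes fc: "\<And>j. finite_coeff (S j) (c j)" and F: "F \<in> borel_measurable M"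
    and lim: "(\<lambda>j. \<integral>\<^sup>+\<omega>. ennreal ((chaos_deriv W n 0 (S j) (c j) \<omega> [] - F \<omega>)\<^sup>2) \<partial>M) \<longlonglongrightarrow> 0"
    and s: "s \<le> n"
  defines "U \<equiv> malliavin_deriv M W s F"
  shows "(\<lambda>j. \<integral>\<^sup>+\<omega>. ennreal (nrm (basis_lists s) (\<lambda>es. chaos_deriv W n s (S j) (c j) \<omega> es - U \<omega> es) ^ 4) \<partial>M) \<longlonglongrightarrow> 0"
    and "(\<integral>\<^sup>+\<omega>. ennreal (nrm (basis_lists s) (U \<omega>) ^ 4) \<partial>M) < \<infinity>"
proof -
  let ?B = "basis_lists s :: 'h list set"
  let ?u = "\<lambda>j \<omega>. chaos_deriv W n s (S j) (c j) \<omega>"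
  have us: "unit_set (S i)" "unit_set (S i \<union> S j)" "finite (S i)" for i j
    using fc[of i] fc[of j] by (auto simp: finite_coeff_def unit_set_def)
  have tU: "tensor_random_element M s U" unfolding U_def by (rule malliavin_deriv_limit(1)[OF fc F lim s])
  have limU: "(\<lambda>j. \<integral>\<^sup>+\<omega>. ennreal ((nrm ?B (\<lambda>es. ?u j \<omega> es - U \<omega> es))\<^sup>2) \<partial>M) \<longlonglongrightarrow> 0"
    using malliavin_deriv_limit(2)[OF fc F lim s] unfolding U_def tensor_norm_nrm .
  have Ul: "U \<omega> \<in> l2 ?B" if "\<omega> \<in> space M" for \<omega> using tU that by (intro tensor_power_l2) (auto simp: tensor_random_element_def)
  have Um: "(\<lambda>\<omega>. U \<omega> es) \<in> borel_measurable M" for es using tU by (simp add: tensor_random_element_def)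
  have ul: "?u j \<omega> \<in> l2 ?B" for j \<omega> by (rule chaos_deriv_l2[OF us(3)])
  have nm[measurable]: "(\<lambda>\<omega>. nrm ?B (\<lambda>es. ?u j \<omega> es - U \<omega> es)) \<in> borel_measurable M"
    "(\<lambda>\<omega>. nrm ?B (\<lambda>es. ?u i \<omega> es - ?u j \<omega> es)) \<in> borel_measurable M"
    "(\<lambda>\<omega>. nrm ?B (U \<omega>)) \<in> borel_measurable M" "(\<lambda>\<omega>. nrm ?B (?u j \<omega>)) \<in> borel_measurable M" for i j
    using Um by (auto intro!: measurable_nrm countable_basis_lists l2_diff ul Ul borel_measurable_diff chaos_deriv_measurable)
  define K where "K = (fact n / fact (n - s)) ^ 4 * (\<Sum>r\<le>n - s. hermite_weight (n - s) r * ((fact (n - s - r))\<^sup>2 * (\<Sum>i\<le>n - s - r. (real ((n - s - r) choose i))\<^sup>2)))"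
  have K: "K \<ge> 0" unfolding K_def hermite_weight_def by (intro mult_nonneg_nonneg sum_nonneg) auto
  obtain r where r: "strict_mono r" "AE \<omega> in M. (\<lambda>k. ennreal ((nrm ?B (\<lambda>es. ?u (r k) \<omega> es - U \<omega> es))\<^sup>2)) \<longlonglongrightarrow> 0"
    using AE_subseq_if_nn_integral_tendsto_0[OF _ limU] by auto
  \<comment> \<open>One approximant \<open>j\<close> is kept fixed while the other runs through the
    subsequence towards the derivative.\<close>
  have AEconv: "AE \<omega> in M. (\<lambda>k. ennreal (nrm ?B (\<lambda>es. ?u j \<omega> es - ?u (r k) \<omega> es) ^ 4)) \<longlonglongrightarrow> ennreal (nrm ?B (\<lambda>es. ?u j \<omega> es - U \<omega> es) ^ 4)" for j
    using r(2) AE_space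
  proof eventually_elim
    case (elim \<omega>)
    have "(\<lambda>k. ennreal ((nrm ?B (\<lambda>es. ?u (r k) \<omega> es - U \<omega> es))\<^sup>2)) \<longlonglongrightarrow> ennreal 0" using elim(1) by simp
    then have "(\<lambda>k. (nrm ?B (\<lambda>es. ?u (r k) \<omega> es - U \<omega> es))\<^sup>2) \<longlonglongrightarrow> 0"
      by (rule tendsto_ennreal_iff[THEN iffD1, rotated -1]) auto
    then have "(\<lambda>k. sqrt ((nrm ?B (\<lambda>es. ?u (r k) \<omega> es - U \<omega> es))\<^sup>2)) \<longlonglongrightarrow> sqrt 0" by (rule tendsto_real_sqrt)
    then have z: "(\<lambda>k. nrm ?B (\<lambda>es. ?u (r k) \<omega> es - U \<omega> es)) \<longlonglongrightarrow> 0" by simp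
    have "(\<lambda>k. nrm ?B (\<lambda>es. ?u j \<omega> es - ?u (r k) \<omega> es) - nrm ?B (\<lambda>es. ?u j \<omega> es - U \<omega> es)) \<longlonglongrightarrow> 0"
    proof (rule Lim_null_comparison[OF _ z], intro always_eventually allI)
      fix k
      have "\<bar>nrm ?B (\<lambda>es. ?u j \<omega> es - ?u (r k) \<omega> es) - nrm ?B (\<lambda>es. ?u j \<omega> es - U \<omega> es)\<bar> \<le> nrm ?B (\<lambda>es. (?u j \<omega> es - ?u (r k) \<omega> es) - (?u j \<omega> es - U \<omega> es))"
        by (intro abs_nrm_diff_le l2_diff ul Ul elim)
      also have "\<dots> = nrm ?B (\<lambda>es. U \<omega> es - ?u (r k) \<omega> es)" by (simp add: algebra_simps)
      also have "\<dots> = nrm ?B (\<lambda>es. ?u (r k) \<omega> es - U \<omega> es)" by (rule nrm_diff_commute)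
      finally show "norm (nrm ?B (\<lambda>es. ?u j \<omega> es - ?u (r k) \<omega> es) - nrm ?B (\<lambda>es. ?u j \<omega> es - U \<omega> es)) \<le> nrm ?B (\<lambda>es. ?u (r k) \<omega> es - U \<omega> es)"
        by simp
    qed
    then have "(\<lambda>k. nrm ?B (\<lambda>es. ?u j \<omega> es - ?u (r k) \<omega> es)) \<longlonglongrightarrow> nrm ?B (\<lambda>es. ?u j \<omega> es - U \<omega> es)"
      by (rule LIM_zero_cancel)
    then show ?case by (intro tendsto_ennrealI tendsto_power)
  qed
  \<comment> \<open>A tensor distance, squared, of at most e makes the fourth moment at most K *
    e^2.\<close>
  have bnd: "\<exists>n0. \<forall>j\<ge>n0. (\<integral>\<^sup>+\<omega>. ennreal (nrm ?B (\<lambda>es. ?u j \<omega> es - U \<omega> es) ^ 4) \<partial>M) \<le> ennreal (K * e\<^sup>2)" if e: "e > 0" for e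
  proof -
    obtain n0 where n0: "\<forall>i\<ge>n0. \<forall>j\<ge>n0. pow_ip n (S i \<union> S j) (\<lambda>h. c i h - c j h) (\<lambda>h. c i h - c j h) \<le> e"
      using chaos_cauchy[OF fc F lim e] by blast
    have "(\<integral>\<^sup>+\<omega>. ennreal (nrm ?B (\<lambda>es. ?u j \<omega> es - U \<omega> es) ^ 4) \<partial>M) \<le> ennreal (K * e\<^sup>2)" if j: "j \<ge> n0" for j
    proof (rule nn_integral_le_of_AE_tendsto[OF _ AEconv])
      have "(\<integral>\<^sup>+\<omega>. ennreal (nrm ?B (\<lambda>es. ?u j \<omega> es - ?u (r k) \<omega> es) ^ 4) \<partial>M) \<le> ennreal (K * e\<^sup>2)" if "k \<ge> n0" for k
      proof -
        have rk: "r k \<ge> n0" using seq_suble[OF r(1), of k] that by simp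
        have "(\<integral>\<^sup>+\<omega>. ennreal (nrm ?B (\<lambda>es. ?u j \<omega> es - ?u (r k) \<omega> es) ^ 4) \<partial>M) =
          (\<integral>\<^sup>+\<omega>. ennreal (nrm ?B (chaos_deriv W n s (S j \<union> S (r k)) (\<lambda>h. c j h - c (r k) h) \<omega>) ^ 4) \<partial>M)"
          unfolding chaos_deriv_diff_union[OF fc fc, symmetric] ..
        also have "\<dots> \<le> ennreal (K * (pow_ip n (S j \<union> S (r k)) (\<lambda>h. c j h - c (r k) h) (\<lambda>h. c j h - c (r k) h))\<^sup>2)"
          unfolding K_def by (rule nn_integral_nrm4_chaos_deriv[OF us(2) s])
        also have "\<dots> \<le> ennreal (K * e\<^sup>2)"
          using n0 j rk K by (intro ennreal_leI mult_left_mono power_mono pow_ip_nonneg us) auto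
        finally show ?thesis .
      qed
      then show "\<forall>\<^sub>F k in sequentially. (\<integral>\<^sup>+\<omega>. ennreal (nrm ?B (\<lambda>es. ?u j \<omega> es - ?u (r k) \<omega> es) ^ 4) \<partial>M) \<le> ennreal (K * e\<^sup>2)"
        by (rule eventually_sequentiallyI)
    qed measurable
    then show ?thesis by blast
  qed
  show "(\<lambda>j. \<integral>\<^sup>+\<omega>. ennreal (nrm ?B (\<lambda>es. ?u j \<omega> es - U \<omega> es) ^ 4) \<partial>M) \<longlonglongrightarrow> 0"
  proof (rule order_tendstoI)
    fix z :: ennreal assume z: "0 < z"
    obtain e where e: "e > 0" "ennreal (K * e\<^sup>2) < z"
    proof (cases z)
      case (real x)
      then have x: "x > 0" using z by simp
      define e where "e = sqrt (x / (K + 1))"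
      have "e > 0" using x K by (simp add: e_def)
      moreover have "K * e\<^sup>2 < x" using x K by (simp add: e_def field_simps)
      ultimately show ?thesis using that[of e] real x by (simp add: ennreal_lessI)
    next
      case top
      then show ?thesis using that[of 1] by simp
    qed
    obtain n0 where "\<forall>j\<ge>n0. (\<integral>\<^sup>+\<omega>. ennreal (nrm ?B (\<lambda>es. ?u j \<omega> es - U \<omega> es) ^ 4) \<partial>M) \<le> ennreal (K * e\<^sup>2)"
      using bnd[OF e(1)] by blast
    then show "\<forall>\<^sub>F j in sequentially. (\<integral>\<^sup>+\<omega>. ennreal (nrm ?B (\<lambda>es. ?u j \<omega> es - U \<omega> es) ^ 4) \<partial>M) < z"
      using e(2) by (intro eventually_sequentiallyI[of n0]) (auto intro: le_less_trans)
  qed auto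
  obtain j where j: "(\<integral>\<^sup>+\<omega>. ennreal (nrm ?B (\<lambda>es. ?u j \<omega> es - U \<omega> es) ^ 4) \<partial>M) \<le> ennreal (K * 1\<^sup>2)"
    using bnd[of 1] by auto
  have "(\<integral>\<^sup>+\<omega>. ennreal (nrm ?B (U \<omega>) ^ 4) \<partial>M) \<le> (\<integral>\<^sup>+\<omega>. ennreal (27 * (nrm ?B (\<lambda>es. ?u j \<omega> es - U \<omega> es) ^ 4 + nrm ?B (?u j \<omega>) ^ 4)) \<partial>M)"
  proof (intro nn_integral_mono ennreal_leI)
    fix \<omega> assume \<omega>: "\<omega> \<in> space M"
    have "nrm ?B (U \<omega>) \<le> nrm ?B (\<lambda>es. ?u j \<omega> es - U \<omega> es) + nrm ?B (?u j \<omega>)"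
      using abs_nrm_diff_le[OF ul Ul[OF \<omega>], of j \<omega>] by simp
    then have "nrm ?B (U \<omega>) ^ 4 \<le> (nrm ?B (\<lambda>es. ?u j \<omega> es - U \<omega> es) + nrm ?B (?u j \<omega>) + 0) ^ 4"
      by (intro power_mono) auto
    also have "\<dots> \<le> 27 * (nrm ?B (\<lambda>es. ?u j \<omega> es - U \<omega> es) ^ 4 + nrm ?B (?u j \<omega>) ^ 4 + 0 ^ 4)"
      by (rule sum3_power4_le)
    finally show "nrm ?B (U \<omega>) ^ 4 \<le> 27 * (nrm ?B (\<lambda>es. ?u j \<omega> es - U \<omega> es) ^ 4 + nrm ?B (?u j \<omega>) ^ 4)" by simp
  qed
  also have "\<dots> = 27 * ((\<integral>\<^sup>+\<omega>. ennreal (nrm ?B (\<lambda>es. ?u j \<omega> es - U \<omega> es) ^ 4) \<partial>M) + (\<integral>\<^sup>+\<omega>. ennreal (nrm ?B (?u j \<omega>) ^ 4) \<partial>M))"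
    by (simp add: ennreal_mult nn_integral_cmult nn_integral_add)
  also have "\<dots> < \<infinity>"
    using le_less_trans[OF j ennreal_less_top] le_less_trans[OF nn_integral_nrm4_chaos_deriv[OF us(1) s, of j "c j"] ennreal_less_top]
    by (simp add: ennreal_mult_less_top)
  finally show "(\<integral>\<^sup>+\<omega>. ennreal (nrm ?B (U \<omega>) ^ 4) \<partial>M) < \<infinity>" .
qed

lemma chaos_L2_tendsto:
  fixes S :: "nat \<Rightarrow> 'h set"
  assumes fc: "\<And>j. finite_coeff (S j) (c j)" and F: "F \<in> borel_measurable M"
    and lim: "(\<lambda>j. \<integral>\<^sup>+\<omega>. ennreal ((chaos_deriv W n 0 (S j) (c j) \<omega> [] - F \<omega>)\<^sup>2) \<partial>M) \<longlonglongrightarrow> 0"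
  shows "L2_tendsto M (\<lambda>j \<omega>. chaos_deriv W n 0 (S j) (c j) \<omega> []) F"
  unfolding L2_tendsto_def
proof (intro conjI allI F lim chaos_deriv_measurable)
  fix j
  have "finite (S j)" using fc[of j] by (simp add: finite_coeff_def unit_set_def)
  from integrable_ip_chaos_deriv[OF this, of 0 n "c j" "c j"]
  show "integrable M (\<lambda>\<omega>. (chaos_deriv W n 0 (S j) (c j) \<omega> [])\<^sup>2)"
    by (simp add: ip_def basis_lists_0 power2_eq_square)
qed

text \<open>Variables of order \<open>n\<close> > 0 are orthogonal to constants, so the means vanish
  and the covariance is the limit of the expected products, which the isometry evaluates.\<close>

lemma cov_limit:
  fixes S :: "nat \<Rightarrow> 'h set"
  assumes n: "n > 0" and fc: "\<And>j. finite_coeff (S j) (c j)" and F: "F \<in> borel_measurable M"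
    and limF: "(\<lambda>j. \<integral>\<^sup>+\<omega>. ennreal ((chaos_deriv W n 0 (S j) (c j) \<omega> [] - F \<omega>)\<^sup>2) \<partial>M) \<longlonglongrightarrow> 0"
    and fd: "\<And>j. finite_coeff (S j) (d j)" and G: "G \<in> borel_measurable M"
    and limG: "(\<lambda>j. \<integral>\<^sup>+\<omega>. ennreal ((chaos_deriv W n 0 (S j) (d j) \<omega> [] - G \<omega>)\<^sup>2) \<partial>M) \<longlonglongrightarrow> 0"
  shows "(\<lambda>j. fact n * pow_ip n (S j) (c j) (d j)) \<longlonglongrightarrow> cov M F G"
proof -
  note LF = chaos_L2_tendsto[OF fc F limF] and LG = chaos_L2_tendsto[OF fd G limG]
  have us: "unit_set (S i)" "finite (S i)" for i using fc[of i] by (auto simp: finite_coeff_def unit_set_def)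
  have mean: "expectation F' = 0" if fc': "\<And>j. finite_coeff (S j) (c' j)"
    and L: "L2_tendsto M (\<lambda>j \<omega>. chaos_deriv W n 0 (S j) (c' j) \<omega> []) F'" for F' c'
  proof -
    have "(\<lambda>j. expectation (\<lambda>\<omega>. chaos_deriv W n 0 (S j) (c' j) \<omega> [] * 1)) \<longlonglongrightarrow> expectation (\<lambda>\<omega>. F' \<omega> * 1)"
      by (rule L2_tendsto_integral_mult[OF L]) auto
    moreover have "expectation (\<lambda>\<omega>. chaos_deriv W n 0 (S j) (c' j) \<omega> [] * 1) = 0" for j
    proof -
      have "expectation (\<lambda>\<omega>. hermite n (W h \<omega>)) = 0" "integrable M (\<lambda>\<omega>. hermite n (W h \<omega>))" if "h \<in> S j" for h
        using expectation_hermite_hermite[of h h n 0] integrable_hermite_prod2[of n h 0 h] us(1)[of j] that n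
        by (auto simp: unit_set_def)
      then show ?thesis unfolding chaos_deriv_0 by (simp add: Bochner_Integration.integral_sum)
    qed
    ultimately show ?thesis using LIMSEQ_unique[OF _ tendsto_const] by fastforce
  qed
  have "cov M F G = expectation (\<lambda>\<omega>. F \<omega> * G \<omega>)"
    unfolding cov_def mean[OF fc LF] mean[OF fd LG] by simp
  moreover have "expectation (\<lambda>\<omega>. chaos_deriv W n 0 (S j) (c j) \<omega> [] * chaos_deriv W n 0 (S j) (d j) \<omega> []) = fact n * pow_ip n (S j) (c j) (d j)" for j
    using expectation_ip_chaos_deriv[OF us(1), of 0 n j "c j" "d j"] by (simp add: ip_def basis_lists_0 power2_eq_square)
  ultimately show ?thesis using L2_tendsto_integral_prod[OF LF LG] by simp
qed

lemma det_malliavin_matrix: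
  "det (malliavin_matrix M W s F G \<omega>) = gram (basis_lists s) (malliavin_deriv M W s F \<omega>) (malliavin_deriv M W s G \<omega>)"
  by (simp add: det_2 malliavin_matrix_def Let_def vector_2 gram_def tensor_norm_nrm tensor_inner_ip nrm_sq power2_eq_square[symmetric])

lemma det_covariance_matrix: "det (covariance_matrix M F G) = cov M F F * cov M G G - (cov M F G)\<^sup>2"
proof -
  have "cov M G F = cov M F G" by (simp add: cov_def mult.commute)
  then show ?thesis by (simp add: det_2 covariance_matrix_def vector_2 power2_eq_square)
qed

end

text \<open>\<open>(n - 1) div 2\<close> is the integer part. The weights are formed with real
  subtraction and are positive throughout the range, since 2 * s \<le> n - 1 there.\<close>

theorem theorem2:
  fixes M :: "'w measure"
    and W :: "'h::{real_inner, polish_space} \<Rightarrow> 'w \<Rightarrow> real"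
    and n :: nat and f g :: "'h tensor"
    and F G :: "'w \<Rightarrow> real"
    and \<Lambda> :: "nat \<Rightarrow> 'w \<Rightarrow> real^2^2" and C :: "real^2^2"
  assumes "isonormal_gaussian_process M W"
    and "n \<ge> 2"
    and "f \<in> sym_tensor_power n" and "g \<in> sym_tensor_power n"
  defines "F \<equiv> wiener_integral M W n f"
    and "G \<equiv> wiener_integral M W n g"
    and "\<Lambda> \<equiv> \<lambda>s. malliavin_matrix M W s F G"
    and "C \<equiv> covariance_matrix M F G"
  shows "(\<Sum>s = 2..(n - 1) div 2.
            real n * (real n - 2 * real s) / (fact s)\<^sup>2 * (\<integral>\<omega>. det (\<Lambda> s \<omega>) \<partial>M))
         + (real n - 1)\<^sup>2 * (\<integral>\<omega>. det (\<Lambda> 1 \<omega>) \<partial>M)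
         \<ge> (real n)\<^sup>2 * det C"
proof -
  interpret isonormal_gaussian_process M W by fact
  have n: "n > 0" using assms(2) by simp
  obtain S1 c where F: "\<And>j. finite_coeff (S1 j) (c j)" "F \<in> borel_measurable M"
    "(\<lambda>j. \<integral>\<^sup>+\<omega>. ennreal ((chaos_deriv W n 0 (S1 j) (c j) \<omega> [] - F \<omega>)\<^sup>2) \<partial>M) \<longlonglongrightarrow> 0"
    using wiener_integral_approx[OF assms(3) n] unfolding F_def by blast
  obtain S2 d where G: "\<And>j. finite_coeff (S2 j) (d j)" "G \<in> borel_measurable M"
    "(\<lambda>j. \<integral>\<^sup>+\<omega>. ennreal ((chaos_deriv W n 0 (S2 j) (d j) \<omega> [] - G \<omega>)\<^sup>2) \<partial>M) \<longlonglongrightarrow> 0"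
    using wiener_integral_approx[OF assms(4) n] unfolding G_def by blast
  \<comment> \<open>The approximations of \<open>F\<close> and \<open>G\<close> come with different
    supports; the alternating coefficients need a common one.\<close>
  define S where "S j = S1 j \<union> S2 j" for j
  have us: "unit_set (S j)" "finite (S j)" for j
    using F(1)[of j] G(1)[of j] by (auto simp: S_def finite_coeff_def unit_set_def)
  have fc: "finite_coeff (S j) (c j)" and fd: "finite_coeff (S j) (d j)" for j
    using F(1)[of j] G(1)[of j] by (auto simp: S_def finite_coeff_def unit_set_def)
  have "chaos_deriv W n 0 (S1 j) (c j) \<omega> [] = chaos_deriv W n 0 (S j) (c j) \<omega> []"
    "chaos_deriv W n 0 (S2 j) (d j) \<omega> [] = chaos_deriv W n 0 (S j) (d j) \<omega> []" for j \<omega>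
    using us(2) by (auto intro!: chaos_deriv_superset F G simp: S_def)
  then have limF: "(\<lambda>j. \<integral>\<^sup>+\<omega>. ennreal ((chaos_deriv W n 0 (S j) (c j) \<omega> [] - F \<omega>)\<^sup>2) \<partial>M) \<longlonglongrightarrow> 0"
    and limG: "(\<lambda>j. \<integral>\<^sup>+\<omega>. ennreal ((chaos_deriv W n 0 (S j) (d j) \<omega> [] - G \<omega>)\<^sup>2) \<partial>M) \<longlonglongrightarrow> 0"
    using F(3) G(3) by simp_all
  define E where "E s j = (\<integral>\<omega>. gram (basis_lists s) (chaos_deriv W n s (S j) (c j) \<omega>) (chaos_deriv W n s (S j) (d j) \<omega>) \<partial>M)" for s j
  \<comment> \<open>The bound s \<le> n is where the derivatives of the approximants are known in
    closed form; every order in the sum, and order 1, satisfies it.\<close>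
  have E: "E s \<longlonglongrightarrow> (\<integral>\<omega>. det (\<Lambda> s \<omega>) \<partial>M)" if s: "s \<le> n" for s
  proof -
    have t: "tensor_random_element M s (malliavin_deriv M W s F)" "tensor_random_element M s (malliavin_deriv M W s G)"
      using malliavin_deriv_limit(1)[OF fc F(2) limF s] malliavin_deriv_limit(1)[OF fd G(2) limG s] by auto
    have "(\<lambda>j. \<integral>\<omega>. gram (basis_lists s) (chaos_deriv W n s (S j) (c j) \<omega>) (chaos_deriv W n s (S j) (d j) \<omega>) \<partial>M) \<longlonglongrightarrow>
      (\<integral>\<omega>. gram (basis_lists s) (malliavin_deriv M W s F \<omega>) (malliavin_deriv M W s G \<omega>) \<partial>M)"
      using t us(2) malliavin_nrm4_limit[OF fc F(2) limF s] malliavin_nrm4_limit[OF fd G(2) limG s]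
      by (intro gram_tendsto countable_basis_lists integrable_gram_chaos_deriv chaos_deriv_l2 chaos_deriv_measurable)
         (auto simp: tensor_random_element_def tensor_power_l2)
    then show ?thesis by (simp add: E_def[abs_def] \<Lambda>_def det_malliavin_matrix)
  qed
  have L: "(\<lambda>j. (real n)\<^sup>2 * ((fact n)\<^sup>2 * (pow_ip n (S j) (c j) (c j) * pow_ip n (S j) (d j) (d j) - (pow_ip n (S j) (c j) (d j))\<^sup>2))) \<longlonglongrightarrow> (real n)\<^sup>2 * det C"
  proof -
    have "(\<lambda>j. (real n)\<^sup>2 * ((fact n * pow_ip n (S j) (c j) (c j)) * (fact n * pow_ip n (S j) (d j) (d j)) - (fact n * pow_ip n (S j) (c j) (d j))\<^sup>2)) \<longlonglongrightarrow>
      (real n)\<^sup>2 * (cov M F F * cov M G G - (cov M F G)\<^sup>2)"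
      by (intro tendsto_intros cov_limit n fc fd F(2) G(2) limF limG)
    then show ?thesis unfolding C_def det_covariance_matrix
      by (simp add: power2_eq_square algebra_simps)
  qed
  have R: "(\<lambda>j. (\<Sum>s = 2..(n - 1) div 2. real n * (real n - 2 * real s) / (fact s)\<^sup>2 * E s j) + (real n - 1)\<^sup>2 * E 1 j) \<longlonglongrightarrow>
    (\<Sum>s = 2..(n - 1) div 2. real n * (real n - 2 * real s) / (fact s)\<^sup>2 * (\<integral>\<omega>. det (\<Lambda> s \<omega>) \<partial>M)) + (real n - 1)\<^sup>2 * (\<integral>\<omega>. det (\<Lambda> 1 \<omega>) \<partial>M)"
    using assms(2) by (intro tendsto_add tendsto_sum tendsto_mult tendsto_const E) auto
  have le: "(real n)\<^sup>2 * ((fact n)\<^sup>2 * (pow_ip n (S j) (c j) (c j) * pow_ip n (S j) (d j) (d j) - (pow_ip n (S j) (c j) (d j))\<^sup>2)) \<le>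
    (\<Sum>s = 2..(n - 1) div 2. real n * (real n - 2 * real s) / (fact s)\<^sup>2 * E s j) + (real n - 1)\<^sup>2 * E 1 j" for j
    unfolding E_def by (rule finite_combination_inequality[OF us(1) assms(2)])
  show ?thesis using LIMSEQ_le[OF L R] le by blast
qed

end
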